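(* Let $n\ge d\ge1$ and let $\mu\in\mathcal P(\mathbb R^n)$, $\nu\in\mathcal P(\mathbb R^d)$ be two centered probability measures with compact supports. Suppose that $\mu\ll\mathrm{Leb}_n$. Let $\pi^\star$ be a solution of the squared distance Gromov--Wasserstein problem $$\min_{\pi\in\Pi(\mu,\nu)}\int\int\big|\|x-x'\|^2-\|y-y'\|^2\big|^2\,d\pi(x,y)\,d\pi(x',y')\qquad(\ast)$$ and let $M^\star:=\int y'x'^\top\,d\pi^\star(x',y')\in\mathbb R^{d\times n}$. Then: (i) if $\operatorname{rk}M^\star=d$, there exists an optimal correspondence plan (solution of $(\ast)$) that is a $2$-map and is also a map/anti-map; (ii) if $\operatorname{rk}M^\star=d-1$, there exists an optimal correspondence plan that is a $2$-map; (iii) if $\operatorname{rk}M^\star\le d-2$, there exists an optimal correspondence map, i.e. a map whose induced plan $(\mathrm{id},T)_\#\mu$ solves $(\ast)$, which (regarding $\nu$ as a measure on $\mathbb R^n$ supported in the $d$-dimensional subspace $\mathbb R^d\times\{0\}$) can be written as $$T:\mathbb R^n\to\mathbb R^n,\qquad T=O_{\mathcal Y}^\top\circ T_0\circ O_{\mathcal X},$$ where $O_{\mathcal X},O_{\mathcal Y}\in O_n(\mathbb R)$ and, with $h=\operatorname{rk}M^\star$, writing $x=(x_H,x_\perp)\in\mathbb R^h\times\mathbb R^{n-h}$ and $$\Phi:\mathbb R^n\to(\mathbb R^h\times\mathbb R_{\ge0})\times S^{n-h-1},\qquad x\mapsto\big(x_B,x_F\big):=\big((x_H,\|x_\perp\|^2),\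 x_\perp/\|x_\perp\|\big),$$ the map $T_0:\mathbb R^n\to\mathbb R^n$ satisfies $$\Phi\circ T_0(x)=\big(\tilde c\text{-}\exp_{x_B}(\nabla f(x_B)),\ \exp_{x_F}(\nabla g_{x_B}(x_F))\big),$$ where $f:\mathbb R^{h+1}\to\mathbb R$ is $\tilde c$-convex, all the $g_{x_B}:S^{n-h-1}\to\mathbb R$ are $d_{S^{n-h-1}}^2/2$-convex, and $\tilde c$, $\tilde c\text{-}\exp$ are the explicit cost and exponential given in the context. Therefore, regardless of the rank of $M^\star$, there always exists an optimal correspondence plan that is a $2$-map.
   Context: $\Pi(\mu,\nu)$: probability measures with marginals $\mu$ and $\nu$; $T_\#\mu$: pushforward; $O_n(\mathbb R)$: real orthogonal matrices; $S^{k}$: unit sphere of $\mathbb R^{k+1}$ with geodesic distance $d_{S^k}$ and Riemannian exponential $\exp$. Centered means of zero mean. A solution of $(\ast)$ is called an optimal correspondence plan. $2$-map: a plan $\pi\in\Pi(\mu,\nu)$ is an $m$-map if there are $k\le m$, measurable functions $\alpha_i:\mathcal X\to[0,1]$ and measurable maps $T_i:\mathcal X\to\mathcal Y$ ($1\le i\le k$), with $\mathcal X=\mathbb R^n$, $\mathcal Y=\mathbb R^d$, such that $\pi(S)=\sum_{i=1}^k\int\alpha_i(x)\,\mathbf 1_S(x,T_i(x))\,d\mu(x)$ for every Borel $S\subset\mathcal X\times\mathcal Y$. Map/anti-map: a plan of the form $\pi=(\mathrm{id},G)_\#\bar\mu+(H,\mathrm{id})_\#(\nu-G_\#\bar\mu)$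 for some measurable maps $G:\mathcal X\to\mathcal Y$, $H:\mathcal Y\to\mathcal X$ and a non-negative measure $\bar\mu\le\mu$ such that $\nu-G_\#\bar\mu$ vanishes on the range of $G$. $c$-convexity: $f$ is $c$-convex if it is not identically $+\infty$ and $f(x)=\sup_y(\zeta(y)-c(x,y))$ for some $\zeta$ with values in $\mathbb R\cup\{\pm\infty\}$. $c\text{-}\exp_x(p)$ is the point $y$ with $\nabla_xc(x,y)+p=0$, when it exists and is unique. In (iii): let $\tilde\Sigma\in\mathbb R^{h\times h}$ be the diagonal matrix of the non-zero singular values of $4M^\star$ (in non-increasing order). The cost $\tilde c:(\mathbb R^h\times\mathbb R)\times(\mathbb R^h\times\mathbb R)\to\mathbb R$ is $$\tilde c\big((u,r),(v,s)\big)=-\|u\|^2\|v\|^2-s\|u\|^2-r\|v\|^2-rs-\langle\tilde\Sigma u,v\rangle,$$ and, for base point $(u,r)$ and tangent vector $(w,t)$ in $\mathbb R^h\times\mathbb R$, $$\tilde c\text{-}\exp_{(u,r)}(w,t)=\big(\tilde\Sigma^{-1}(w-2tu),\ t-\|\tilde\Sigma^{-1}(w-2tu)\|^2\big).$$ When $h=0$ the $\mathbb R^h$ components are absent. The component $x_\perp/\|x_\perp\|$ of $\Phi$ is given an arbitrary fixed value in $S^{n-h-1}$ when $x_\perp=0$. Identities describing $T_0$ are understood almost everywhere with respect to $O_{\mathcal X\#}\mu$. *)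

theory Defs
  imports "HOL-Analysis.Analysis" "HOL-Probability.Probability"
begin

section \<open>Couplings and the squared-distance Gromov--Wasserstein problem\<close>

definition measure_support :: "'a::topological_space measure \<Rightarrow> 'a set" where
  "measure_support M = {x. \<forall>U. open U \<and> x \<in> U \<longrightarrow> emeasure M U > 0}"

definition borel_prob :: "'a::topological_space measure \<Rightarrow> bool" where
  "borel_prob M \<longleftrightarrow> prob_space M \<and> sets M = sets borel"

definition couplings ::
  "'a::euclidean_space measure \<Rightarrow> 'b::euclidean_space measure \<Rightarrow> ('a \<times> 'b) measure set" where
  "couplings \<mu> \<nu> = {\<pi>. borel_prob \<pi> \<and> distr \<pi> borel fst = \<mu> \<and> distr \<pi> borel snd = \<nu>}"

definition gw_cost :: "('a::euclidean_space \<times> 'b::euclidean_space) measure \<Rightarrow> ennreal" where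
  "gw_cost \<pi> = (\<integral>\<^sup>+ p. \<integral>\<^sup>+ q.
      ennreal (\<bar>(norm (fst p - fst q))\<^sup>2 - (norm (snd p - snd q))\<^sup>2\<bar>\<^sup>2) \<partial>\<pi> \<partial>\<pi>)"

definition gw_optimal :: "'a::euclidean_space measure \<Rightarrow> 'b::euclidean_space measure
    \<Rightarrow> ('a \<times> 'b) measure \<Rightarrow> bool" where
  "gw_optimal \<mu> \<nu> \<pi> \<longleftrightarrow>
     \<pi> \<in> couplings \<mu> \<nu> \<and> (\<forall>\<pi>' \<in> couplings \<mu> \<nu>. gw_cost \<pi> \<le> gw_cost \<pi>')"

definition graph_plan :: "'a::euclidean_space measure \<Rightarrow> ('a \<Rightarrow> 'b::euclidean_space)
    \<Rightarrow> ('a \<times> 'b) measure" where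
  "graph_plan \<mu> T = distr \<mu> borel (\<lambda>x. (x, T x))"

text \<open>The matrix \<open>\<integral> y x\<^sup>T d\<pi>(x,y)\<close>, with \<open>d\<close> rows and \<open>n\<close> columns.\<close>

definition cross_moment :: "((real^'n) \<times> (real^'d)) measure \<Rightarrow> real^'n^'d" where
  "cross_moment \<pi> = (\<integral> p. (\<chi> i j. snd p $ i * fst p $ j) \<partial>\<pi>)"

section \<open>\<open>m\<close>-maps and map/anti-maps\<close>

definition is_m_map :: "nat \<Rightarrow> 'a::euclidean_space measure \<Rightarrow> 'b::euclidean_space measure
    \<Rightarrow> ('a \<times> 'b) measure \<Rightarrow> bool" where
  "is_m_map m \<mu> \<nu> \<pi> \<longleftrightarrow> \<pi> \<in> couplings \<mu> \<nu> \<and>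
     (\<exists>k \<le> m. \<exists>(\<alpha> :: nat \<Rightarrow> 'a \<Rightarrow> real) (T :: nat \<Rightarrow> 'a \<Rightarrow> 'b).
        (\<forall>i \<in> {1..k}. \<alpha> i \<in> borel_measurable borel \<and> range (\<alpha> i) \<subseteq> {0..1}
                       \<and> T i \<in> borel_measurable borel) \<and>
        (\<forall>S \<in> sets borel. emeasure \<pi> S =
           (\<Sum>i = 1..k. \<integral>\<^sup>+ x. ennreal (\<alpha> i x) * indicator S (x, T i x) \<partial>\<mu>)))"

text \<open>
  The range of \<open>G\<close> need not be Borel (it is only analytic); that \<open>\<nu> - G\<^sub>#\<mu>'\<close> vanishes on it is
  expressed by \<open>AE\<close>, i.e. the range is contained in a Borel null set. The condition
  \<open>G\<^sub>#\<mu>' \<le> \<nu>\<close> makes the difference a genuine measure (\<^const>\<open>diff_measure\<close> truncates); it is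
  implied by the vanishing condition for the signed difference, because \<open>G\<^sub>#\<mu>'\<close> does not charge
  the complement of the range.
\<close>

definition is_map_anti_map :: "'a::euclidean_space measure \<Rightarrow> 'b::euclidean_space measure
    \<Rightarrow> ('a \<times> 'b) measure \<Rightarrow> bool" where
  "is_map_anti_map \<mu> \<nu> \<pi> \<longleftrightarrow> \<pi> \<in> couplings \<mu> \<nu> \<and>
     (\<exists>(G :: 'a \<Rightarrow> 'b) (H :: 'b \<Rightarrow> 'a) \<mu>'.
        G \<in> borel_measurable borel \<and> H \<in> borel_measurable borel \<and>
        sets \<mu>' = sets borel \<and> (\<forall>A \<in> sets borel. emeasure \<mu>' A \<le> emeasure \<mu> A) \<and>
        (\<forall>B \<in> sets borel. emeasure (distr \<mu>' borel G) B \<le> emeasure \<nu> B) \<and>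
        (AE y in diff_measure \<nu> (distr \<mu>' borel G). y \<notin> range G) \<and>
        (\<forall>S \<in> sets borel. emeasure \<pi> S =
            emeasure (distr \<mu>' borel (\<lambda>x. (x, G x))) S
          + emeasure (distr (diff_measure \<nu> (distr \<mu>' borel G)) borel (\<lambda>y. (H y, y))) S))"

section \<open>\<open>c\<close>-convexity\<close>

definition c_convex ::
  "'a set \<Rightarrow> 'b set \<Rightarrow> ('a \<Rightarrow> 'b \<Rightarrow> real) \<Rightarrow> ('a \<Rightarrow> ereal) \<Rightarrow> bool" where
  "c_convex X Y c f \<longleftrightarrow> (\<exists>x \<in> X. f x \<noteq> \<infinity>) \<and>
     (\<exists>\<zeta> :: 'b \<Rightarrow> ereal. \<forall>x \<in> X. f x = (SUP y \<in> Y. \<zeta> y - ereal (c x y)))"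

section \<open>Coordinates\<close>

text \<open>
  The coordinates of \<open>real^'n\<close> are numbered \<open>0, \<dots>, CARD('n) - 1\<close> by a fixed enumeration of the
  index type. Since the rank \<open>h\<close> is not known at the type level, \<open>\<real>\<^sup>h\<close> and \<open>\<real>\<^sup>n\<^sup>-\<^sup>h\<close> are realised as the
  subspaces of \<open>real^'n\<close> spanned by the coordinates numbered \<open>< h\<close> and \<open>\<ge> h\<close> respectively, so
  that a pair \<open>(x\<^sub>H, x\<^sub>\<bottom>)\<close> is the sum of its two components.
\<close>

definition coord_no :: "'n::finite \<Rightarrow> nat" where
  "coord_no = to_nat_on (UNIV :: 'n set)"

definition coord_embed :: "real^'d \<Rightarrow> real^'n" where
  "coord_embed y =
     (\<chi> i. if coord_no i < CARD('d) then y $ from_nat_into (UNIV :: 'd set) (coord_no i) else 0)"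

definition head_space :: "nat \<Rightarrow> (real^'n) set" where
  "head_space h = {x. \<forall>i. h \<le> coord_no i \<longrightarrow> x $ i = 0}"

definition tail_space :: "nat \<Rightarrow> (real^'n) set" where
  "tail_space h = {x. \<forall>i. coord_no i < h \<longrightarrow> x $ i = 0}"

definition head_part :: "nat \<Rightarrow> real^'n \<Rightarrow> real^'n" where
  "head_part h x = (\<chi> i. if coord_no i < h then x $ i else 0)"

definition tail_part :: "nat \<Rightarrow> real^'n \<Rightarrow> real^'n" where
  "tail_part h x = (\<chi> i. if coord_no i < h then 0 else x $ i)"

text \<open>\<open>\<real>\<^sup>h \<times> \<real>\<close> and \<open>S\<^sup>n\<^sup>-\<^sup>h\<^sup>-\<^sup>1\<close>\<close>

definition base_space :: "nat \<Rightarrow> ((real^'n) \<times> real) set" where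
  "base_space h = head_space h \<times> UNIV"

definition tail_sphere :: "nat \<Rightarrow> (real^'n) set" where
  "tail_sphere h = {x \<in> tail_space h. norm x = 1}"

text \<open>\<open>e\<close> is the value given to \<open>x\<^sub>\<bottom>/\<parallel>x\<^sub>\<bottom>\<parallel>\<close> when \<open>x\<^sub>\<bottom> = 0\<close>.\<close>

definition Phi_base :: "nat \<Rightarrow> real^'n \<Rightarrow> (real^'n) \<times> real" where
  "Phi_base h x = (head_part h x, (norm (tail_part h x))\<^sup>2)"

definition Phi_fibre :: "nat \<Rightarrow> real^'n \<Rightarrow> real^'n \<Rightarrow> real^'n" where
  "Phi_fibre h e x =
     (if tail_part h x = 0 then e else tail_part h x /\<^sub>R norm (tail_part h x))"

definition Phi :: "nat \<Rightarrow> real^'n \<Rightarrow> real^'n \<Rightarrow> ((real^'n) \<times> real) \<times> (real^'n)" where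
  "Phi h e x = (Phi_base h x, Phi_fibre h e x)"

section \<open>Singular values, the base cost and its exponential\<close>

text \<open>
  The non-zero singular values of \<open>A\<close> in non-increasing order: the square roots of the non-zero
  eigenvalues of \<open>A\<^sup>TA\<close>, each repeated according to its multiplicity.
\<close>

definition sing_eigenspace :: "real^'n^'m \<Rightarrow> real \<Rightarrow> (real^'n) set" where
  "sing_eigenspace A s = {v. (transpose A ** A) *v v = s\<^sup>2 *\<^sub>R v}"

definition nonzero_singular_values :: "real^'n^'m \<Rightarrow> real list" where
  "nonzero_singular_values A =
     concat (map (\<lambda>s. replicate (dim (sing_eigenspace A s)) s)
       (rev (sorted_list_of_set {s. s > 0 \<and> (\<exists>v. v \<noteq> 0 \<and> v \<in> sing_eigenspace A s)})))"

text \<open>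
  The action on \<open>head_space (length \<sigma>)\<close> of the diagonal matrix with diagonal \<open>\<sigma>\<close>, and of its inverse.
\<close>

definition diag_act :: "real list \<Rightarrow> real^'n \<Rightarrow> real^'n" where
  "diag_act \<sigma> u = (\<chi> i. if coord_no i < length \<sigma> then \<sigma> ! coord_no i * u $ i else 0)"

definition diag_inv_act :: "real list \<Rightarrow> real^'n \<Rightarrow> real^'n" where
  "diag_inv_act \<sigma> u = (\<chi> i. if coord_no i < length \<sigma> then u $ i / \<sigma> ! coord_no i else 0)"

definition base_cost :: "real list \<Rightarrow> (real^'n) \<times> real \<Rightarrow> (real^'n) \<times> real \<Rightarrow> real" where
  "base_cost \<sigma> = (\<lambda>(u, r) (v, s).
     - (norm u)\<^sup>2 * (norm v)\<^sup>2 - s * (norm u)\<^sup>2 - r * (norm v)\<^sup>2 - r * s - diag_act \<sigma> u \<bullet> v)"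

definition base_c_exp ::
  "real list \<Rightarrow> (real^'n) \<times> real \<Rightarrow> (real^'n) \<times> real \<Rightarrow> (real^'n) \<times> real" where
  "base_c_exp \<sigma> = (\<lambda>(u, r) (w, t).
     (let v = diag_inv_act \<sigma> (w - (2 * t) *\<^sub>R u) in (v, t - (norm v)\<^sup>2)))"

definition is_base_gradient ::
  "nat \<Rightarrow> ((real^'n) \<times> real \<Rightarrow> real) \<Rightarrow> (real^'n) \<times> real \<Rightarrow> (real^'n) \<times> real \<Rightarrow> bool" where
  "is_base_gradient h f b p \<longleftrightarrow> p \<in> base_space h \<and>
     (f has_derivative (\<lambda>v. v \<bullet> p)) (at b within base_space h)"

section \<open>The sphere\<close>

definition sphere_dist :: "'a::euclidean_space \<Rightarrow> 'a \<Rightarrow> real" where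
  "sphere_dist x y = arccos (x \<bullet> y)"

definition sphere_exp :: "'a::euclidean_space \<Rightarrow> 'a \<Rightarrow> 'a" where
  "sphere_exp x p = cos (norm p) *\<^sub>R x + (if p = 0 then 0 else (sin (norm p) / norm p) *\<^sub>R p)"

text \<open>
  The Riemannian gradient at \<open>x\<close> of a function on the sphere: the vector tangent to the sphere at \<open>x\<close>
  that represents the derivative along the sphere.
\<close>

definition is_sphere_gradient ::
  "nat \<Rightarrow> (real^'n \<Rightarrow> real) \<Rightarrow> real^'n \<Rightarrow> real^'n \<Rightarrow> bool" where
  "is_sphere_gradient h g x p \<longleftrightarrow> p \<in> tail_space h \<and> x \<bullet> p = 0 \<and>
     (g has_derivative (\<lambda>v. v \<bullet> p)) (at x within tail_sphere h)"

end

theory Submission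
  imports Defs
begin

text \<open>
  Expanding the square shows that, up to terms depending only on the marginals, the functional is
  minus a convex function of the plan, so that an optimal plan also maximizes its linearization
  \<open>\<integral> (\<parallel>x\<parallel>\<^sup>2\<parallel>y\<parallel>\<^sup>2 + 4\<langle>M\<^sup>\<star>x, y\<rangle>) d\<pi>\<close>, and every plan with the same linearized value is optimal too. The
  support of an optimal plan is therefore cyclically monotone and has a potential, which is convex
  and hence differentiable almost everywhere. If \<open>M\<^sup>\<star>\<close> has full rank, then the gradient of the
  potential at \<open>x\<close> determines \<open>y\<close> up to the root of a quadratic equation for \<open>\<parallel>y\<parallel>\<^sup>2\<close>, and of two partners of
  \<open>x\<close> the shorter one has no other partner.

  Otherwise a singular value decomposition of \<open>4M\<^sup>\<star>\<close> makes the linearized cost a function of the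
  base points \<open>(x\<^sub>H, \<parallel>x\<^sub>\<bottom>\<parallel>\<^sup>2)\<close>, and the gradient of the potential determines the base point of \<open>y\<close>. The fibre
  consists of two points if the rank is \<open>d - 1\<close>. If it is smaller, then the mass may be rearranged
  within the fibres, which are spheres, without changing the linearized value. Rearranging it optimally
  for the squared distance, with dual potentials that depend measurably on the base point, yields a
  map. The dual problem is solved for all fibres at once, by minimizing the integrated dual functional:
  its first variation at a minimizer says that the map transports the fibre measures as required.
\<close>

text \<open>The direct route to the map, disintegrating the plan over the base points and choosing
  an optimal map in each fibre, raises two questions: whether the choice is measurable and whether
  the conditional measures charge the singularities of the potentials. The first is met by working
  with admissible families, in which measurability in the base point is part of the definition. The
  second cannot be settled by differentiability of one convex function, since the potential changes
  with the base point: for each fixed base point almost every z is good, but the points of interest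
  lie on the graph of \<open>Phi_base\<close>, a null set of pairs. Fubini applies only because the
  property is invariant under the motions that move this graph through the space of pairs. Squared
  distance on the sphere is merely semiconcave. Its upper bound is however affine in the ambient
  variable, so that adding a constant and extending with homogeneity one produces a genuinely convex
  function. If d < n, the fibre spheres of the n-space are larger than those of the embedded
  d-space. That the map takes values in the smaller space is not imposed on the potentials; it is
  inherited through an equality of laws.\<close>

subsection \<open>Geometry of the sphere\<close>

text \<open>Up to the factor -2 the quotient is the derivative of arccos^2 at the cosine of its
  argument, so this monotonicity is the source of convexity in
  \<open>convex_on_arccos_sq\<close>.\<close>

lemma id_over_sin_mono:
  assumes "0 < a" "a \<le> b" "b < pi"
  shows "a / sin a \<le> b / sin b"
proof (rule DERIV_nonneg_imp_nondecreasing[OF assms(2)])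
  fix x assume x: "a \<le> x" "x \<le> b"
  then have s: "sin x > 0" using assms by (intro sin_gt_zero) auto
  have "((\<lambda>x. x / sin x) has_real_derivative (sin x - x * cos x) / (sin x)^2) (at x)"
    using s by (auto intro!: derivative_eq_intros simp: power2_eq_square divide_simps)
  moreover have "sin x - x * cos x \<ge> 0"
  proof -
    have "(\<lambda>x. sin x - x * cos x) 0 \<le> (\<lambda>x. sin x - x * cos x) x"
    proof (rule DERIV_nonneg_imp_nondecreasing[where f="\<lambda>x. sin x - x * cos x"])
      show "0 \<le> x" using assms x by simp
      fix z assume z: "0 \<le> z" "z \<le> x"
      have "((\<lambda>x. sin x - x * cos x) has_real_derivative z * sin z) (at z)"
        by (auto intro!: derivative_eq_intros)
      moreover have "z * sin z \<ge> 0" using z x assms by (intro mult_nonneg_nonneg sin_ge_zero) auto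
      ultimately show "\<exists>y. ((\<lambda>x. sin x - x * cos x) has_real_derivative y) (at z) \<and> 0 \<le> y" by blast
    qed
    then show ?thesis by simp
  qed
  ultimately show "\<exists>y. ((\<lambda>x. x / sin x) has_real_derivative y) (at x) \<and> 0 \<le> y"
    using s by (metis divide_nonneg_nonneg zero_le_power2)
qed

text \<open>The derivative is available only on the open interval, because arccos has infinite slope
  at -1 and 1. The end points are reached by multiplying all arguments by r < 1 and letting r tend
  to 1.\<close>

lemma convex_on_arccos_sq: "convex_on {-1..1} (\<lambda>s. (arccos s)\<^sup>2)"
proof -
  have op: "convex_on {-1<..<1} (\<lambda>s. (arccos s)\<^sup>2)"
  proof (rule convex_on_realI[where f' = "\<lambda>x. - 2 * (arccos x / sin (arccos x))"])
    show "connected {-1<..<1::real}" by simp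
    fix x :: real assume x: "x \<in> {-1<..<1}"
    then show "((\<lambda>s. (arccos s)\<^sup>2) has_real_derivative - 2 * (arccos x / sin (arccos x))) (at x)"
      by (auto intro!: derivative_eq_intros simp: sin_arccos field_simps)
  next
    fix x y :: real assume xy: "x \<in> {-1<..<1}" "y \<in> {-1<..<1}" "x \<le> y"
    have "arccos y / sin (arccos y) \<le> arccos x / sin (arccos x)"
      using xy arccos_lt_bounded[of x] arccos_lt_bounded[of y]
      by (intro id_over_sin_mono arccos_le_mono[THEN iffD2]) auto
    then show "- 2 * (arccos x / sin (arccos x)) \<le> - 2 * (arccos y / sin (arccos y))" by simp
  qed
  show ?thesis
  proof (rule convex_onI)
    fix t x y :: real assume t: "0 < t" "t < 1" and xy: "x \<in> {-1..1}" "y \<in> {-1..1}"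
    let ?f = "\<lambda>s. (arccos s)\<^sup>2"
    define z where "z = (1 - t) *\<^sub>R x + t *\<^sub>R y"
    have z: "z \<in> {-1..1}" unfolding z_def using xy t by (intro convexD) auto
    have lim: "((\<lambda>r. ?f (r * s)) \<longlongrightarrow> ?f s) (at_left 1)" if "s \<in> {-1..1}" for s
    proof -
      have "continuous_on {0..1} (\<lambda>r. ?f (r * s))"
      proof (intro continuous_intros ballI)
        fix r :: real assume r: "r \<in> {0..1}"
        have "\<bar>r * s\<bar> \<le> 1 * 1" using that r unfolding abs_mult by (intro mult_mono) auto
        then show "- 1 \<le> r * s \<and> r * s \<le> 1" by (auto simp: abs_le_iff)
      qed
      then have "((\<lambda>r. ?f (r * s)) \<longlongrightarrow> ?f (1 * s)) (at 1 within {0..1})"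
        unfolding continuous_on_def by (rule bspec) simp
      moreover have "at 1 within {0..1} = at_left (1::real)"
        by (intro at_within_Icc_at_left) simp
      ultimately show ?thesis by simp
    qed
    show "?f ((1 - t) *\<^sub>R x + t *\<^sub>R y) \<le> (1 - t) * ?f x + t * ?f y"
      unfolding z_def[symmetric]
    proof (rule tendsto_le[OF _ _ lim[OF z]])
      show "((\<lambda>r. (1 - t) * ?f (r * x) + t * ?f (r * y)) \<longlongrightarrow> (1 - t) * ?f x + t * ?f y) (at_left 1)"
        by (intro tendsto_intros lim xy)
      show "\<forall>\<^sub>F r in at_left 1. ?f (r * z) \<le> (1 - t) * ?f (r * x) + t * ?f (r * y)"
        unfolding eventually_at_left_field
      proof (intro exI[of _ 0] conjI allI impI)
        fix r :: real assume r: "0 < r" "r < 1"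
        have *: "r * s \<in> {-1<..<1}" if "s \<in> {-1..1}" for s
        proof -
          have "\<bar>r * s\<bar> \<le> r * 1" using that r unfolding abs_mult by (intro mult_mono) auto
          then show ?thesis using r by auto
        qed
        have "?f ((1 - t) *\<^sub>R (r * x) + t *\<^sub>R (r * y)) \<le> (1 - t) * ?f (r * x) + t * ?f (r * y)"
          using * xy t by (intro convex_onD[OF op]) auto
        then show "?f (r * z) \<le> (1 - t) * ?f (r * x) + t * ?f (r * y)"
          by (simp add: z_def algebra_simps)
      qed simp
    qed simp
  qed simp
qed

text \<open>The chord of sin over [0, pi/2] gives d / pi <= sin (d / 2), and 1 - cos d = 2 sin^2 (d
  / 2). The constant 5 is half of the bound 10 for pi^2.\<close>

lemma one_minus_cos_ge:
  assumes "0 \<le> d" "d \<le> pi" shows "d\<^sup>2 \<le> 5 * (1 - cos d)"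
proof -
  have c: "concave_on {0..pi/2} sin"
  proof -
    have "convex_on {0..pi/2} (\<lambda>x. - sin x)"
    proof (rule convex_on_realI[where f'="\<lambda>x. - cos x"])
      fix x y assume "x \<in> {0..pi/2}" "y \<in> {0..pi/2}" "x \<le> y"
      then show "- cos x \<le> - cos y" by (auto intro!: cos_monotone_0_pi_le)
    qed (auto intro!: derivative_eq_intros)
    then show ?thesis by (simp add: concave_on_def)
  qed
  define t where "t = d / pi"
  have t: "0 \<le> t" "t \<le> 1" using assms by (auto simp: t_def field_simps)
  have "(1 - t) * sin 0 + t * sin (pi/2) \<le> sin ((1 - t) *\<^sub>R 0 + t *\<^sub>R (pi/2))"
    using c t by (intro concave_onD) auto
  then have s: "d / pi \<le> sin (d / 2)" by (simp add: t_def)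
  have p: "pi^2 \<le> 10"
  proof -
    have "pi < 3.16" using pi_approx by simp
    then have "pi^2 \<le> 3.16^2" by (intro power_mono) auto
    then show ?thesis by (simp add: power2_eq_square)
  qed
  have "(d / pi)^2 \<le> (sin (d/2))^2" using s assms by (intro power_mono) auto
  moreover have "1 - cos d = 2 * (sin (d/2))^2" using cos_double_sin[of "d/2"] by simp
  ultimately have "2 * d^2 / pi^2 \<le> 1 - cos d" by (simp add: power_divide)
  moreover have "2 * d^2 / 10 \<le> 2 * d^2 / pi^2" using p by (intro divide_left_mono) auto
  ultimately show ?thesis by simp
qed

lemma sub_sin_le:
  assumes "0 \<le> (d::real)" shows "d - sin d \<le> d\<^sup>2"
proof -
  have "(\<lambda>x. x\<^sup>2 - x + sin x) 0 \<le> (\<lambda>x. x\<^sup>2 - x + sin x) d"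
  proof (rule DERIV_nonneg_imp_nondecreasing[OF assms, where f="\<lambda>x. x\<^sup>2 - x + sin x"])
    fix z :: real assume z: "0 \<le> z" "z \<le> d"
    have "((\<lambda>x. x\<^sup>2 - x + sin x) has_real_derivative 2 * z - 1 + cos z) (at z)"
      by (auto intro!: derivative_eq_intros)
    moreover have "1 - cos z \<le> 2 * z"
    proof -
      have "norm (cos z - cos 0) \<le> 1 * norm (z - 0)"
        by (rule field_differentiable_bound[where S="UNIV" and f'="\<lambda>x. - sin x"]) (auto intro!: derivative_eq_intros)
      then show ?thesis using z by auto
    qed
    ultimately show "\<exists>y. ((\<lambda>x. x\<^sup>2 - x + sin x) has_real_derivative y) (at z) \<and> 0 \<le> y" by force
  qed
  then show ?thesis by simp
qed

text \<open>
  The hinge comparison of the sphere with the plane. In terms of \<open>k\<close>, the cosine of the angle of the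
  hinge, the squared length of the third side is the convex function \<open>arccos\<^sup>2\<close> of an affine function,
  whereas its Euclidean counterpart is affine, so that it suffices to compare the two at \<open>k = 1\<close> and
  \<open>k = -1\<close>.
\<close>

lemma arccos_cos_le: assumes "0 \<le> x" shows "arccos (cos x) \<le> x"
proof (cases "x \<le> pi")
  case True then show ?thesis using assms by (simp add: arccos_cos)
next
  case False then show ?thesis using arccos_bounded[of "cos x"] by auto
qed

lemma hinge_plane:
  assumes th: "0 \<le> \<theta>" "\<theta> \<le> pi" and d: "0 \<le> \<delta>" "\<delta> \<le> pi" and k: "\<bar>k\<bar> \<le> 1"
  shows "(arccos (cos \<theta> * cos \<delta> + sin \<theta> * sin \<delta> * k))\<^sup>2 \<le> \<theta>\<^sup>2 + \<delta>\<^sup>2 - 2 * k * \<theta> * \<delta>"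
proof -
  let ?f = "\<lambda>s. (arccos s)\<^sup>2"
  \<comment> \<open>k = 1 - 2 t runs from k = 1, where the third side is the difference of the legs,
    to k = -1, where it is their sum.\<close>
  define t where "t = (1 - k) / 2"
  have t: "0 \<le> t" "t \<le> 1" and kt: "k = 1 - 2 * t" using k by (auto simp: t_def abs_le_iff field_simps)
  have "?f ((1 - t) *\<^sub>R cos (\<theta> - \<delta>) + t *\<^sub>R cos (\<theta> + \<delta>)) \<le> (1 - t) * ?f (cos (\<theta> - \<delta>)) + t * ?f (cos (\<theta> + \<delta>))"
    using t by (intro convex_onD[OF convex_on_arccos_sq]) auto
  also have "(1 - t) *\<^sub>R cos (\<theta> - \<delta>) + t *\<^sub>R cos (\<theta> + \<delta>) = cos \<theta> * cos \<delta> + sin \<theta> * sin \<delta> * k"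
    by (simp add: kt cos_diff cos_add algebra_simps)
  finally have 1: "?f (cos \<theta> * cos \<delta> + sin \<theta> * sin \<delta> * k) \<le> (1 - t) * ?f (cos (\<theta> - \<delta>)) + t * ?f (cos (\<theta> + \<delta>))" .
  have "?f (cos (\<theta> - \<delta>)) = (\<theta> - \<delta>)\<^sup>2"
  proof -
    have "arccos (cos (\<theta> - \<delta>)) = \<bar>\<theta> - \<delta>\<bar>" using th d by (cases "\<theta> \<ge> \<delta>") (auto simp: arccos_cos arccos_cos2)
    then show ?thesis by simp
  qed
  \<comment> \<open>If the sum of the legs exceeds pi, the third side is shorter than the sum; the
    inequality has the right direction.\<close>
  moreover have "?f (cos (\<theta> + \<delta>)) \<le> (\<theta> + \<delta>)\<^sup>2"
    using th d by (intro power_mono arccos_cos_le arccos_lbound) auto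
  ultimately have "(1 - t) * ?f (cos (\<theta> - \<delta>)) + t * ?f (cos (\<theta> + \<delta>)) \<le> (1 - t) * (\<theta> - \<delta>)\<^sup>2 + t * (\<theta> + \<delta>)\<^sup>2"
    using t by (auto intro: mult_left_mono)
  also have "\<dots> = \<theta>\<^sup>2 + \<delta>\<^sup>2 - 2 * k * \<theta> * \<delta>" by (simp add: kt power2_eq_square algebra_simps)
  finally show ?thesis using 1 by simp
qed

text \<open>The bound is an affine function of x' in the ambient space, with a constant that stays
  uniform up to the antipode; \<open>hext_support\<close> relies on both. In the proof \<delta> is
  the distance from x to x' and k the cosine of the angle at x.\<close>

lemma hinge_sphere:
  fixes x x' w :: "'a::euclidean_space"
  assumes th: "0 \<le> \<theta>" "\<theta> \<le> pi" and n: "norm x = 1" "norm x' = 1" "norm w = 1" and o: "x \<bullet> w = 0"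
  shows "(arccos (x' \<bullet> (cos \<theta> *\<^sub>R x + sin \<theta> *\<^sub>R w)))\<^sup>2 \<le> \<theta>\<^sup>2 - 2 * \<theta> * (w \<bullet> (x' - x)) + 40 * (1 - x \<bullet> x')"
proof -
  define \<delta> where "\<delta> = arccos (x \<bullet> x')"
  have xx': "\<bar>x \<bullet> x'\<bar> \<le> 1" using Cauchy_Schwarz_ineq2[of x x'] n by simp
  then have cd: "cos \<delta> = x \<bullet> x'" and d: "0 \<le> \<delta>" "\<delta> \<le> pi"
    using arccos_bounded[of "x \<bullet> x'"] by (auto simp: \<delta>_def abs_le_iff)
  have sd: "sin \<delta> \<ge> 0" using d by (rule sin_ge_zero)
  define v where "v = x' - cos \<delta> *\<^sub>R x"
  have xx: "x \<bullet> x = 1" "x' \<bullet> x' = 1" "w \<bullet> w = 1" using n by (auto simp: dot_square_norm)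
  have vv: "v \<bullet> v = (sin \<delta>)\<^sup>2"
    by (simp add: v_def inner_diff_left inner_diff_right xx cd inner_commute[of x' x] sin_squared_eq[of \<delta>, unfolded power2_eq_square] power2_eq_square)
  then have nv: "norm v = sin \<delta>" using sd by (metis norm_eq_sqrt_inner real_sqrt_abs abs_of_nonneg)
  have wv: "w \<bullet> v = w \<bullet> x'" using o by (simp add: v_def inner_diff_right inner_commute)
  have wv': "\<bar>w \<bullet> x'\<bar> \<le> sin \<delta>" using Cauchy_Schwarz_ineq2[of w v] n nv wv by simp
  \<comment> \<open>If sin \<delta> = 0, then x' is x or -x and w is orthogonal to it, so any value
    serves.\<close>
  define k where "k = (if sin \<delta> = 0 then 0 else (w \<bullet> x') / sin \<delta>)"
  have k: "\<bar>k\<bar> \<le> 1" and ks: "sin \<delta> * k = w \<bullet> x'" using wv' sd by (auto simp: k_def)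
  have "x' \<bullet> (cos \<theta> *\<^sub>R x + sin \<theta> *\<^sub>R w) = cos \<theta> * cos \<delta> + sin \<theta> * sin \<delta> * k"
    using ks by (simp add: inner_add_right cd inner_commute)
  then have "(arccos (x' \<bullet> (cos \<theta> *\<^sub>R x + sin \<theta> *\<^sub>R w)))\<^sup>2 \<le> \<theta>\<^sup>2 + \<delta>\<^sup>2 - 2 * k * \<theta> * \<delta>"
    using hinge_plane[OF th d k] by simp
  also have "\<dots> = \<theta>\<^sup>2 - 2 * \<theta> * (w \<bullet> x') + (\<delta>\<^sup>2 - 2 * \<theta> * k * (\<delta> - sin \<delta>))"
    by (simp add: ks[symmetric] algebra_simps)
  \<comment> \<open>Here \<theta> <= pi <= 3.5 and \<delta> - sin \<delta> <= \<delta>^2. With the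
    remaining \<delta>^2 the factor becomes 8, which \<open>one_minus_cos_ge\<close> turns into 8 *
    5 = 40.\<close>
  also have "- 2 * \<theta> * k * (\<delta> - sin \<delta>) \<le> 2 * 3.5 * 1 * \<delta>\<^sup>2"
  proof -
    have "- 2 * \<theta> * k * (\<delta> - sin \<delta>) \<le> \<bar>- 2 * \<theta> * k * (\<delta> - sin \<delta>)\<bar>" by simp
    also have "\<dots> = 2 * \<theta> * \<bar>k\<bar> * (\<delta> - sin \<delta>)" using th sin_x_le_x[OF d(1)] by (simp add: abs_mult)
    also have "\<dots> \<le> 2 * 3.5 * 1 * \<delta>\<^sup>2"
      using th k sub_sin_le[OF d(1)] sin_x_le_x[OF d(1)] pi_approx
      by (intro mult_mono) auto
    finally show ?thesis .
  qed
  then have "\<theta>\<^sup>2 - 2 * \<theta> * (w \<bullet> x') + (\<delta>\<^sup>2 - 2 * \<theta> * k * (\<delta> - sin \<delta>)) \<le> \<theta>\<^sup>2 - 2 * \<theta> * (w \<bullet> x') + 8 * \<delta>\<^sup>2" by simp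
  also have "8 * \<delta>\<^sup>2 \<le> 40 * (1 - x \<bullet> x')" using one_minus_cos_ge[OF d] cd by simp
  finally show ?thesis using o by (simp add: inner_diff_right inner_commute)
qed

text \<open>w is the initial direction of a minimal geodesic from x to y. For y = x and y = -x it is
  not determined by y, and the given tangent vector \<open>w0\<close> is taken.\<close>

lemma sphere_polar:
  fixes x y w0 :: "'a::euclidean_space"
  assumes V: "subspace V" "x \<in> V" "y \<in> V" "w0 \<in> V" and n: "norm x = 1" "norm y = 1" "norm w0 = 1" and o: "x \<bullet> w0 = 0"
  obtains w where "w \<in> V" "norm w = 1" "x \<bullet> w = 0" "y = cos (sphere_dist x y) *\<^sub>R x + sin (sphere_dist x y) *\<^sub>R w"
proof -
  define \<delta> where "\<delta> = sphere_dist x y"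
  have xx': "\<bar>x \<bullet> y\<bar> \<le> 1" using Cauchy_Schwarz_ineq2[of x y] n by simp
  then have cd: "cos \<delta> = x \<bullet> y" and d: "0 \<le> \<delta>" "\<delta> \<le> pi"
    using arccos_bounded[of "x \<bullet> y"] by (auto simp: \<delta>_def sphere_dist_def abs_le_iff)
  have sd: "sin \<delta> \<ge> 0" using d by (rule sin_ge_zero)
  define v where "v = y - cos \<delta> *\<^sub>R x"
  have xx: "x \<bullet> x = 1" "y \<bullet> y = 1" using n by (auto simp: dot_square_norm)
  have vv: "v \<bullet> v = (sin \<delta>)\<^sup>2"
    by (simp add: v_def inner_diff_left inner_diff_right xx cd inner_commute[of y x] sin_squared_eq[of \<delta>, unfolded power2_eq_square] power2_eq_square)
  then have nv: "norm v = sin \<delta>" using sd by (metis norm_eq_sqrt_inner real_sqrt_abs abs_of_nonneg)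
  have xv: "x \<bullet> v = 0" by (simp add: v_def inner_diff_right xx cd)
  have vV: "v \<in> V" unfolding v_def using V by (intro subspace_diff subspace_scale) auto
  show ?thesis
  proof (cases "sin \<delta> = 0")
    case True
    then have "v = 0" using nv by simp
    then show ?thesis using V n o True by (intro that[of w0]) (auto simp: v_def \<delta>_def)
  next
    case False
    then show ?thesis
      by (intro that[of "v /\<^sub>R sin \<delta>"]) (use V vV nv sd xv False in \<open>auto intro!: subspace_scale simp: \<delta>_def[symmetric] v_def\<close>)
  qed
qed

subsection \<open>Almost everywhere differentiability of convex functions\<close>

text \<open>Fubini along orbits: if almost every z is moved to a good point by almost every t in Q,
  then, Q having positive measure, a single t in Q moves almost every z to a good point.
  Nonsingularity of that one motion then gives the claim for z itself.\<close>

lemma AE_lborel_averaging: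
  fixes P :: "'a::euclidean_space \<Rightarrow> bool" and A :: "'p::euclidean_space \<Rightarrow> 'a \<Rightarrow> 'a"
  assumes P[measurable]: "Measurable.pred borel P"
    and A[measurable]: "(\<lambda>(t, z). A t z) \<in> borel_measurable (borel \<Otimes>\<^sub>M borel)"
    and Q[measurable]: "Q \<in> sets borel" and Q0: "emeasure lborel Q \<noteq> 0"
    and ae: "AE z in lborel. AE t in lborel. t \<in> Q \<longrightarrow> P (A t z)"
    and nonsing: "\<And>t. t \<in> Q \<Longrightarrow> AE z in lborel. P (A t z) \<Longrightarrow> AE z in lborel. P z"
  shows "AE z in lborel. P z"
proof -
  have "(\<lambda>x. (\<lambda>(t, z). A t z) (snd x, fst x)) \<in> borel_measurable (lborel \<Otimes>\<^sub>M lborel)" by measurable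
  then have [measurable]: "(\<lambda>x. A (snd x) (fst x)) \<in> borel_measurable (lborel \<Otimes>\<^sub>M lborel)" by simp
  have "AE t in lborel. AE z in lborel. t \<in> Q \<longrightarrow> P (A t z)"
    using ae by (subst (asm) lborel_pair.AE_commute) measurable
  moreover have "\<not> (AE t in lborel. t \<notin> Q)"
    using Q0 by (subst AE_iff_measurable[of Q]) auto
  moreover have "AE t in lborel. t \<notin> Q"
    if 1: "AE t in lborel. AE z in lborel. t \<in> Q \<longrightarrow> P (A t z)"
      and 2: "\<And>t. t \<in> Q \<Longrightarrow> \<not> (AE z in lborel. P (A t z))"
    using 1 by eventually_elim (use 2 in auto)
  ultimately obtain t where "t \<in> Q" "AE z in lborel. P (A t z)" by blast
  then show ?thesis by (rule nonsing)
qed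

lemma AE_lborel_diagonal:
  fixes P :: "'a::euclidean_space \<Rightarrow> bool"
  assumes P[measurable]: "Measurable.pred borel P" and c: "\<And>j. j \<in> Basis \<Longrightarrow> c j \<noteq> 0"
    and ae: "AE z in lborel. P (t + (\<Sum>j\<in>Basis. (c j * (z \<bullet> j)) *\<^sub>R j))"
  shows "AE z in lborel. P z"
proof -
  let ?T = "\<lambda>z. t + (\<Sum>j\<in>Basis. (c j * (z \<bullet> j)) *\<^sub>R j)"
  have "AE z in density (distr lborel borel ?T) (\<lambda>_. \<Prod>j\<in>Basis. \<bar>c j\<bar>). P z"
    using ae by (subst AE_density) (auto simp: AE_distr_iff)
  with c show ?thesis by (subst lborel_affine_euclidean[of c t])
qed

lemma AE_lborel_translation:
  fixes P :: "'a::euclidean_space \<Rightarrow> bool"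
  assumes P[measurable]: "Measurable.pred borel P" and ae: "AE z in lborel. P (z + a)"
  shows "AE z in lborel. P z"
  using AE_lborel_diagonal[OF P, of "\<lambda>_. 1" a] ae by (simp add: euclidean_representation add.commute)

text \<open>For convex \<open>F\<close> the difference quotients are monotone, so that this is the one-sided derivative.\<close>

definition dirD :: "('a::real_vector \<Rightarrow> real) \<Rightarrow> 'a \<Rightarrow> 'a \<Rightarrow> real" where
  "dirD F e z = (INF n. (F (z + inverse (real (Suc n)) *\<^sub>R e) - F z) / inverse (real (Suc n)))"

lemma convex_slope_mono:
  assumes F: "convex_on UNIV F" and st: "0 < s" "s \<le> t"
  shows "(F (z + s *\<^sub>R e) - F z) / s \<le> (F (z + t *\<^sub>R e) - F z) / t"
proof -
  have "F ((1 - s / t) *\<^sub>R z + (s / t) *\<^sub>R (z + t *\<^sub>R e)) \<le> (1 - s / t) * F z + (s / t) * F (z + t *\<^sub>R e)"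
    using st by (intro convex_onD[OF F]) (auto simp: field_simps)
  also have "(1 - s / t) *\<^sub>R z + (s / t) *\<^sub>R (z + t *\<^sub>R e) = z + s *\<^sub>R e"
    using st by (simp add: algebra_simps)
  finally show ?thesis using st by (simp add: field_simps)
qed

lemma convex_slope_opposite:
  assumes F: "convex_on UNIV F" and st: "0 < s" "0 < t"
  shows "- ((F (z + s *\<^sub>R (- e)) - F z) / s) \<le> (F (z + t *\<^sub>R e) - F z) / t"
proof -
  have st1: "1 - s / (s + t) = t / (s + t)" using st by (simp add: field_simps)
  have "F ((1 - s / (s + t)) *\<^sub>R (z + s *\<^sub>R (- e)) + (s / (s + t)) *\<^sub>R (z + t *\<^sub>R e))
     \<le> (1 - s / (s + t)) * F (z + s *\<^sub>R (- e)) + (s / (s + t)) * F (z + t *\<^sub>R e)"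
    using st by (intro convex_onD[OF F]) (auto simp: field_simps)
  also have "(1 - s / (s + t)) *\<^sub>R (z + s *\<^sub>R (- e)) + (s / (s + t)) *\<^sub>R (z + t *\<^sub>R e)
      = z + ((s / (s + t)) * t - (1 - s / (s + t)) * s) *\<^sub>R e"
    by (simp add: algebra_simps)
  also have "(s / (s + t)) * t - (1 - s / (s + t)) * s = 0" using st by (simp add: st1)
  also have "(1 - s / (s + t)) * F (z + s *\<^sub>R (- e)) + (s / (s + t)) * F (z + t *\<^sub>R e)
    = (t * F (z + s *\<^sub>R (- e)) + s * F (z + t *\<^sub>R e)) / (s + t)"
    by (simp add: st1 add_divide_distrib)
  finally have "F z \<le> (t * F (z + s *\<^sub>R (- e)) + s * F (z + t *\<^sub>R e)) / (s + t)" by simp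
  then have "(s + t) * F z \<le> t * F (z + s *\<^sub>R (- e)) + s * F (z + t *\<^sub>R e)"
    using st by (simp add: pos_le_divide_eq mult.commute)
  then show ?thesis using st by (simp add: field_simps)
qed

lemma dirD_bdd_below:
  assumes F: "convex_on UNIV F"
  shows "bdd_below (range (\<lambda>n. (F (z + inverse (real (Suc n)) *\<^sub>R e) - F z) / inverse (real (Suc n))))"
  by (rule bdd_belowI2[of _ "- ((F (z + 1 *\<^sub>R (- e)) - F z) / 1)"], rule convex_slope_opposite[OF F]) auto

lemma dirD_le:
  assumes F: "convex_on UNIV F" and t: "0 < t"
  shows "dirD F e z \<le> (F (z + t *\<^sub>R e) - F z) / t"
proof -
  obtain n where n: "inverse (real (Suc n)) < t" using reals_Archimedean[OF t] by blast
  have "dirD F e z \<le> (F (z + inverse (real (Suc n)) *\<^sub>R e) - F z) / inverse (real (Suc n))"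
    unfolding dirD_def by (rule cINF_lower[OF dirD_bdd_below[OF F]]) simp
  also have "\<dots> \<le> (F (z + t *\<^sub>R e) - F z) / t" using n by (intro convex_slope_mono[OF F]) auto
  finally show ?thesis .
qed

lemma dirD_ge:
  assumes "\<And>t. 0 < t \<Longrightarrow> c \<le> (F (z + t *\<^sub>R e) - F z) / t"
  shows "c \<le> dirD F e z"
  unfolding dirD_def by (rule cINF_greatest) (use assms in auto)

lemma dirD_opposite:
  assumes F: "convex_on UNIV F"
  shows "- dirD F (- e) z \<le> dirD F e z"
proof (rule dirD_ge)
  fix t :: real assume t: "0 < t"
  have "- ((F (z + t *\<^sub>R e) - F z) / t) \<le> dirD F (- e) z"
  proof (rule dirD_ge)
    fix s :: real assume s: "0 < s"
    show "- ((F (z + t *\<^sub>R e) - F z) / t) \<le> (F (z + s *\<^sub>R (- e)) - F z) / s"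
      using convex_slope_opposite[OF F s t, of z e] by linarith
  qed
  then show "- dirD F (- e) z \<le> (F (z + t *\<^sub>R e) - F z) / t" by linarith
qed

lemma dirD_approx:
  assumes F: "convex_on UNIV F" and e: "0 < \<epsilon>"
  obtains \<delta> where "0 < \<delta>" "\<And>t. 0 < t \<Longrightarrow> t \<le> \<delta> \<Longrightarrow> (F (z + t *\<^sub>R e) - F z) / t \<le> dirD F e z + \<epsilon>"
proof -
  have "\<exists>n\<in>UNIV. (F (z + inverse (real (Suc n)) *\<^sub>R e) - F z) / inverse (real (Suc n)) < dirD F e z + \<epsilon>"
    using cINF_less_iff[OF _ dirD_bdd_below[OF F, of z e], of "dirD F e z + \<epsilon>"] e by (simp add: dirD_def)
  then obtain n where n: "(F (z + inverse (real (Suc n)) *\<^sub>R e) - F z) / inverse (real (Suc n)) < dirD F e z + \<epsilon>" by blast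
  show ?thesis
  proof (rule that[of "inverse (real (Suc n))"])
    fix t assume "0 < t" "t \<le> inverse (real (Suc n))"
    then have "(F (z + t *\<^sub>R e) - F z) / t \<le> (F (z + inverse (real (Suc n)) *\<^sub>R e) - F z) / inverse (real (Suc n))"
      by (intro convex_slope_mono[OF F])
    then show "(F (z + t *\<^sub>R e) - F z) / t \<le> dirD F e z + \<epsilon>" using n by linarith
  qed simp
qed

lemma dirD_eq_derivative:
  assumes F: "convex_on UNIV F" and D: "(F has_derivative D) (at z)"
  shows "dirD F e z = D e"
proof -
  have "((\<lambda>t. F (z + t *\<^sub>R e)) has_derivative (\<lambda>t. D (t *\<^sub>R e))) (at 0)"
    using D by (intro has_derivative_compose[of "\<lambda>t. z + t *\<^sub>R e" _ 0 UNIV F]) (auto intro!: derivative_eq_intros)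
  moreover have "(\<lambda>t. D (t *\<^sub>R e)) = (*) (D e)"
    using D by (auto simp: has_derivative_linear linear_scale)
  ultimately have "((\<lambda>t. F (z + t *\<^sub>R e)) has_real_derivative D e) (at 0)"
    by (simp add: has_field_derivative_def)
  then have lim: "((\<lambda>t. (F (z + t *\<^sub>R e) - F z) / t) \<longlongrightarrow> D e) (at 0)"
    by (simp add: has_field_derivative_iff)
  have lim': "((\<lambda>t. (F (z + t *\<^sub>R e) - F z) / t) \<longlongrightarrow> D e) (at_right 0)"
    using lim by (simp add: filterlim_at_split)
  show ?thesis
  proof (rule antisym)
    have "\<forall>\<^sub>F t in at_right 0. dirD F e z \<le> (F (z + t *\<^sub>R e) - F z) / t"
      using eventually_at_right_less[of 0] by eventually_elim (rule dirD_le[OF F])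
    then show "dirD F e z \<le> D e" by (rule tendsto_lowerbound[OF lim']) simp
    show "D e \<le> dirD F e z"
    proof (rule field_le_epsilon)
      fix \<epsilon> :: real assume "0 < \<epsilon>"
      then obtain \<delta> where d: "0 < \<delta>" "\<And>t. 0 < t \<Longrightarrow> t \<le> \<delta> \<Longrightarrow> (F (z + t *\<^sub>R e) - F z) / t \<le> dirD F e z + \<epsilon>"
        using dirD_approx[OF F] by blast
      have "\<forall>\<^sub>F t in at_right 0. (F (z + t *\<^sub>R e) - F z) / t \<le> dirD F e z + \<epsilon>"
        unfolding eventually_at_right_field using d by (intro exI[of _ \<delta>]) simp
      then show "D e \<le> dirD F e z + \<epsilon>" by (rule tendsto_upperbound[OF lim']) simp
    qed
  qed
qed

text \<open>For convex functions two-sided derivatives along the axes already give total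
  differentiability. After subtraction of the candidate tangent, G is convex with G 0 = 0. Writing v
  as the mean of N points on the axes bounds G v from above by the values there, and - G (- v) <= G
  v bounds it from below.\<close>

lemma convex_has_derivative:
  fixes F :: "'a::euclidean_space \<Rightarrow> real"
  assumes F: "convex_on UNIV F" and two: "\<And>e. e \<in> Basis \<Longrightarrow> dirD F e z + dirD F (- e) z = 0"
  shows "(F has_derivative (\<lambda>v. v \<bullet> (\<Sum>e\<in>Basis. dirD F e z *\<^sub>R e))) (at z)"
proof -
  define q where "q = (\<Sum>e\<in>Basis. dirD F e z *\<^sub>R e)"
  have qe: "e \<bullet> q = dirD F e z" if "e \<in> Basis" for e
    using that by (simp add: q_def inner_sum_right inner_Basis if_distrib cong: if_cong)
  define G where "G v = F (z + v) - F z - v \<bullet> q" for v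
  have G0: "G 0 = 0" by (simp add: G_def)
  have G: "convex_on UNIV G"
  proof -
    have "convex_on UNIV (\<lambda>v. F (z + v))"
    proof (rule convex_onI)
      fix t :: real and x y assume "0 < t" "t < 1"
      then show "F (z + ((1 - t) *\<^sub>R x + t *\<^sub>R y)) \<le> (1 - t) * F (z + x) + t * F (z + y)"
        using convex_onD[OF F, of t "z + x" "z + y"] by (simp add: algebra_simps)
    qed simp
    moreover have "convex_on UNIV (\<lambda>v. - F z - v \<bullet> q)"
      by (intro convex_onI) (auto simp: algebra_simps)
    ultimately have "convex_on UNIV (\<lambda>v. F (z + v) + (- F z - v \<bullet> q))" by (rule convex_on_add)
    then show ?thesis by (simp add: G_def[abs_def] algebra_simps)
  qed
  have Gneg: "- G (- v) \<le> G v" for v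
    using convex_onD[OF G, of "1/2" v "- v"] G0 by simp
  let ?N = "real DIM('a)"
  have up: "G v \<le> (\<Sum>e\<in>Basis. G ((?N * (v \<bullet> e)) *\<^sub>R e)) / ?N" for v
  proof -
    have "G (\<Sum>e\<in>Basis. (1 / ?N) *\<^sub>R ((?N * (v \<bullet> e)) *\<^sub>R e)) \<le> (\<Sum>e\<in>Basis. (1 / ?N) * G ((?N * (v \<bullet> e)) *\<^sub>R e))"
      by (intro convex_on_sum[OF _ _ G]) auto
    then show ?thesis by (simp add: euclidean_representation sum_divide_distrib)
  qed
  have small: "\<exists>\<delta>>0. \<forall>e\<in>Basis. \<forall>t. \<bar>t\<bar> \<le> \<delta> \<longrightarrow> G (t *\<^sub>R e) \<le> \<epsilon> * \<bar>t\<bar>" if eps: "0 < \<epsilon>" for \<epsilon>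
  proof -
    have "\<exists>\<delta>>0. \<forall>t. \<bar>t\<bar> \<le> \<delta> \<longrightarrow> G (t *\<^sub>R e) \<le> \<epsilon> * \<bar>t\<bar>" if e: "e \<in> Basis" for e
    proof -
      obtain d1 where d1: "0 < d1" "\<And>t. 0 < t \<Longrightarrow> t \<le> d1 \<Longrightarrow> (F (z + t *\<^sub>R e) - F z) / t \<le> dirD F e z + \<epsilon>"
        using dirD_approx[OF F eps] by blast
      obtain d2 where d2: "0 < d2" "\<And>t. 0 < t \<Longrightarrow> t \<le> d2 \<Longrightarrow> (F (z + t *\<^sub>R (- e)) - F z) / t \<le> dirD F (- e) z + \<epsilon>"
        using dirD_approx[OF F eps] by blast
      show ?thesis
      proof (intro exI[of _ "min d1 d2"] conjI allI impI)
        fix t assume t: "\<bar>t\<bar> \<le> min d1 d2"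
        consider "t > 0" | "t = 0" | "t < 0" by linarith
        then show "G (t *\<^sub>R e) \<le> \<epsilon> * \<bar>t\<bar>"
        proof cases
          case 1
          then show ?thesis using d1(2)[of t] t by (simp add: G_def qe[OF e] field_simps)
        next
          case 2 then show ?thesis using G0 by simp
        next
          case 3
          then show ?thesis using d2(2)[of "- t"] t eq_neg_iff_add_eq_0[THEN iffD2, OF two[OF e]] by (simp add: G_def qe[OF e] field_simps)
        qed
      qed (use d1 d2 in auto)
    qed
    then obtain d where d: "\<And>e. e \<in> Basis \<Longrightarrow> d e > 0" "\<And>e t. e \<in> Basis \<Longrightarrow> \<bar>t\<bar> \<le> d e \<Longrightarrow> G (t *\<^sub>R e) \<le> \<epsilon> * \<bar>t\<bar>"
      by metis
    show ?thesis
    proof (intro exI[of _ "Min (d ` Basis)"] conjI ballI allI impI)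
      show "Min (d ` Basis) > 0" using d by simp
      fix e :: 'a and t :: real assume e: "e \<in> Basis" and "\<bar>t\<bar> \<le> Min (d ` Basis)"
      moreover have "Min (d ` Basis) \<le> d e" using e by (intro Min_le) auto
      ultimately show "G (t *\<^sub>R e) \<le> \<epsilon> * \<bar>t\<bar>" using d by simp
    qed
  qed
  have "\<exists>\<delta>>0. \<forall>v. norm v < \<delta> \<longrightarrow> \<bar>G v\<bar> \<le> \<epsilon> * norm v" if eps: "0 < \<epsilon>" for \<epsilon>
  proof -
    have N: "?N > 0" by simp
    obtain \<delta> where d: "\<delta> > 0" "\<And>e t. e \<in> Basis \<Longrightarrow> \<bar>t\<bar> \<le> \<delta> \<Longrightarrow> G (t *\<^sub>R e) \<le> (\<epsilon> / ?N) * \<bar>t\<bar>"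
      using small[of "\<epsilon> / ?N"] eps N by (metis divide_pos_pos)
    have *: "G v \<le> \<epsilon> * norm v" if v: "norm v < \<delta> / ?N" for v
    proof -
      have "G ((?N * (v \<bullet> e)) *\<^sub>R e) \<le> \<epsilon> * norm v" if e: "e \<in> Basis" for e
      proof -
        have b: "\<bar>v \<bullet> e\<bar> \<le> norm v" using e by (rule Basis_le_norm)
        have "?N * \<bar>v \<bullet> e\<bar> \<le> ?N * norm v" using b by (intro mult_left_mono) auto
        also have "\<dots> \<le> \<delta>" using v N by (simp add: field_simps)
        finally have "G ((?N * (v \<bullet> e)) *\<^sub>R e) \<le> (\<epsilon> / ?N) * \<bar>?N * (v \<bullet> e)\<bar>" using e by (intro d) (auto simp: abs_mult)
        also have "\<dots> = \<epsilon> * \<bar>v \<bullet> e\<bar>" using N by (simp add: abs_mult)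
        also have "\<dots> \<le> \<epsilon> * norm v" using b eps by simp
        finally show ?thesis .
      qed
      then have "(\<Sum>e\<in>Basis. G ((?N * (v \<bullet> e)) *\<^sub>R e)) \<le> ?N * (\<epsilon> * norm v)"
        using sum_bounded_above[of Basis "\<lambda>e. G ((?N * (v \<bullet> e)) *\<^sub>R e)" "\<epsilon> * norm v"] by simp
      then have "(\<Sum>e\<in>Basis. G ((?N * (v \<bullet> e)) *\<^sub>R e)) / ?N \<le> \<epsilon> * norm v" using N by (simp add: field_simps)
      then show ?thesis using up[of v] by linarith
    qed
    have "\<bar>G v\<bar> \<le> \<epsilon> * norm v" if v: "norm v < \<delta> / ?N" for v
      using *[OF v] *[of "- v"] v Gneg[of v] by simp
    then show ?thesis using d N by (intro exI[of _ "\<delta> / ?N"]) auto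
  qed
  note * = this
  show ?thesis
    unfolding has_derivative_at_alt q_def[symmetric]
  proof (intro conjI allI impI)
    fix \<epsilon> :: real assume "0 < \<epsilon>"
    then obtain \<delta> where \<delta>: "\<delta> > 0" "\<And>v. norm v < \<delta> \<Longrightarrow> \<bar>G v\<bar> \<le> \<epsilon> * norm v" using * by blast
    have "norm (F y - F z - (y - z) \<bullet> q) \<le> \<epsilon> * norm (y - z)" if "norm (y - z) < \<delta>" for y
      using \<delta>(2)[OF that] by (simp add: G_def)
    then show "\<exists>d>0. \<forall>y. norm (y - z) < d \<longrightarrow> norm (F y - F z - (y - z) \<bullet> q) \<le> \<epsilon> * norm (y - z)"
      using \<delta>(1) by blast
  qed (rule bounded_linear_inner_left)
qed

text \<open>On a line the right derivative D is monotone, and the left derivative at t dominates D s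
  for every s < t. At a continuity point of D the two therefore agree, and a monotone function has
  only countably many discontinuities.\<close>

lemma dirD_line:
  assumes F: "convex_on UNIV F"
  shows "countable {t. dirD F e (z + t *\<^sub>R e) + dirD F (- e) (z + t *\<^sub>R e) \<noteq> 0}"
proof -
  define D where "D t = dirD F e (z + t *\<^sub>R e)" for t
  have left: "D s \<le> - dirD F (- e) (z + t *\<^sub>R e)" if st: "s < t" for s t
  proof -
    have "D s \<le> (F (z + s *\<^sub>R e + (t - s) *\<^sub>R e) - F (z + s *\<^sub>R e)) / (t - s)"
      unfolding D_def using st by (intro dirD_le[OF F]) auto
    moreover have "dirD F (- e) (z + t *\<^sub>R e) \<le> (F (z + t *\<^sub>R e + (t - s) *\<^sub>R (- e)) - F (z + t *\<^sub>R e)) / (t - s)"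
      using st by (intro dirD_le[OF F]) auto
    moreover have "z + s *\<^sub>R e + (t - s) *\<^sub>R e = z + t *\<^sub>R e" "z + t *\<^sub>R e + (t - s) *\<^sub>R (- e) = z + s *\<^sub>R e"
      by (auto simp: algebra_simps)
    ultimately show ?thesis
      using minus_divide_left[of "F (z + t *\<^sub>R e) - F (z + s *\<^sub>R e)" "t - s"] by (simp only: minus_diff_eq)
  qed
  have "mono D"
  proof (rule monoI)
    fix s t :: real assume "s \<le> t"
    then show "D s \<le> D t" using left[of s t] dirD_opposite[OF F, of e "z + t *\<^sub>R e"]
      by (cases "s = t") (auto simp: D_def)
  qed
  then have "countable {t. \<not> isCont D t}" using mono_on_ctble_discont[of UNIV D] by simp
  moreover have "dirD F e (z + t *\<^sub>R e) + dirD F (- e) (z + t *\<^sub>R e) = 0" if t: "isCont D t" for t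
  proof -
    have "(D \<longlongrightarrow> D t) (at_left t)" using t by (simp add: isCont_def filterlim_at_split)
    then have "D t \<le> - dirD F (- e) (z + t *\<^sub>R e)"
      by (rule tendsto_upperbound) (auto simp: eventually_at_left_field intro!: exI[of _ "t - 1"] left)
    then show ?thesis using dirD_opposite[OF F, of e "z + t *\<^sub>R e"] by (simp add: D_def)
  qed
  ultimately show ?thesis by (elim countable_subset[rotated]) auto
qed

lemma borel_measurable_dirD:
  fixes F :: "'b \<Rightarrow> 'a::euclidean_space \<Rightarrow> real"
  assumes F: "\<And>b. convex_on UNIV (F b)" and [measurable]: "(\<lambda>(b, z). F b z) \<in> borel_measurable (M \<Otimes>\<^sub>M borel)"
  shows "(\<lambda>(b, z). dirD (F b) e z) \<in> borel_measurable (M \<Otimes>\<^sub>M borel)"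
proof -
  have [measurable]: "(\<lambda>p. F (fst p) (snd p + c)) \<in> borel_measurable (M \<Otimes>\<^sub>M borel)" for c
  proof -
    have "(\<lambda>p. (\<lambda>(b, z). F b z) (fst p, snd p + c)) \<in> borel_measurable (M \<Otimes>\<^sub>M borel)" by measurable
    then show ?thesis by simp
  qed
  have [measurable]: "(\<lambda>p. F (fst p) (snd p)) \<in> borel_measurable (M \<Otimes>\<^sub>M borel)"
    using assms(2) by (simp add: case_prod_beta')
  show ?thesis
    unfolding dirD_def case_prod_beta'
    by (intro borel_measurable_cINF dirD_bdd_below F) auto
qed

lemma borel_measurable_dirD':
  fixes F :: "'a::euclidean_space \<Rightarrow> real"
  assumes F: "convex_on UNIV F"
  shows "dirD F e \<in> borel_measurable borel"
proof -
  have [measurable]: "F \<in> borel_measurable borel"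
    using F by (intro borel_measurable_continuous_onI convex_on_continuous) auto
  have "(\<lambda>(b::unit, z). dirD F e z) \<in> borel_measurable (count_space UNIV \<Otimes>\<^sub>M borel)"
    by (intro borel_measurable_dirD F) measurable
  then have "(\<lambda>z. (\<lambda>(b::unit, z). dirD F e z) ((), z)) \<in> borel_measurable borel"
    by measurable
  then show ?thesis by simp
qed

text \<open>Averaging over translations in direction e reduces the claim to lines parallel to e,
  each of which contains only countably many bad points by \<open>dirD_line\<close>.\<close>

lemma AE_convex_dirD:
  fixes F :: "'a::euclidean_space \<Rightarrow> real"
  assumes F: "convex_on UNIV F"
  shows "AE z in lborel. \<forall>e\<in>Basis. dirD F e z + dirD F (- e) z = 0"
proof -
  have "AE z in lborel. dirD F e z + dirD F (- e) z = 0" if "e \<in> Basis" for e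
  proof (rule AE_lborel_averaging[where A="\<lambda>t z. z + t *\<^sub>R e" and Q="UNIV::real set"])
    note [measurable] = borel_measurable_dirD'[OF F]
    show "Measurable.pred borel (\<lambda>z. dirD F e z + dirD F (- e) z = 0)" by measurable
    show "AE z in lborel. AE t::real in lborel. t \<in> UNIV \<longrightarrow> dirD F e (z + t *\<^sub>R e) + dirD F (- e) (z + t *\<^sub>R e) = 0"
      using countable_imp_null_set_lborel[OF dirD_line[OF F, of e]]
      by (intro AE_I2 AE_I'[of "{t. dirD F e (_ + t *\<^sub>R e) + dirD F (- e) (_ + t *\<^sub>R e) \<noteq> 0}"]) auto
    show "AE z in lborel. dirD F e z + dirD F (- e) z = 0"
      if "AE z in lborel. dirD F e (z + t *\<^sub>R e) + dirD F (- e) (z + t *\<^sub>R e) = 0" for t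
      using that by (rule AE_lborel_translation[rotated]) measurable
  qed (auto simp: emeasure_lborel_UNIV)
  then show ?thesis by (simp add: AE_finite_allI)
qed

subsection \<open>Measurable families of Kantorovich potentials\<close>

text \<open>The test functions decrease to the indicator of F as n grows, so their integrals
  determine the mass of closed sets, which form an intersection-stable generator. Testing with
  continuous functions is what the first variation in \<open>fibre_potentials\<close>
  allows.\<close>

lemma borel_measure_eqI_infdist:
  fixes M N :: "'a::metric_space measure"
  assumes fin: "finite_measure M" "finite_measure N" and sets: "sets M = sets borel" "sets N = sets borel"
    and eq: "\<And>F (n::nat). closed F \<Longrightarrow> F \<noteq> {} \<Longrightarrow>
      (\<integral>z. max 0 (1 - real n * infdist z F) \<partial>M) = (\<integral>z. max 0 (1 - real n * infdist z F) \<partial>N)"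
  shows "M = N"
proof -
  have spc: "space M = UNIV" "space N = UNIV" using sets by (auto dest: sets_eq_imp_space_eq)
  have lim: "(\<lambda>n. \<integral>z. max 0 (1 - real n * infdist z F) \<partial>M) \<longlonglongrightarrow> measure M F"
    if F: "closed F" "F \<noteq> {}" and M: "finite_measure M" "sets M = sets borel" for F and M :: "'a measure"
  proof -
    interpret finite_measure M by fact
    have [measurable]: "F \<in> sets M" using F M by auto
    have "(\<lambda>n. \<integral>z. max 0 (1 - real n * infdist z F) \<partial>M) \<longlonglongrightarrow> (\<integral>z. indicator F z \<partial>M)"
    proof (rule integral_dominated_convergence[where w="\<lambda>_. 1"])
      show "AE z in M. (\<lambda>n. max 0 (1 - real n * infdist z F)) \<longlonglongrightarrow> indicator F z"
      proof (rule AE_I2)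
        fix z
        show "(\<lambda>n. max 0 (1 - real n * infdist z F)) \<longlonglongrightarrow> indicator F z"
        proof (cases "z \<in> F")
          case True then show ?thesis by simp
        next
          case False
          then have p: "infdist z F > 0" using F by (simp add: infdist_pos_not_in_closed)
          obtain n0 :: nat where "1 / infdist z F < real n0" using reals_Archimedean2 by blast
          then have "\<forall>\<^sub>F n in sequentially. max 0 (1 - real n * infdist z F) = indicator F z"
            using p False unfolding eventually_sequentially
          proof (intro exI[of _ n0] allI impI)
            fix n assume "n0 \<le> n" "1 / infdist z F < real n0"
            then have "1 / infdist z F \<le> real n" by simp
            then have "1 \<le> real n * infdist z F" using p by (simp add: field_simps)
            then show "max 0 (1 - real n * infdist z F) = indicator F z" using False by simp
          qed
          then show ?thesis by (rule tendsto_eventually)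
        qed
      qed
    qed (use F in \<open>auto simp: measurable_cong_sets[OF M(2) refl] infdist_nonneg intro!: borel_measurable_continuous_onI continuous_intros\<close>)
    then show ?thesis by (simp add: sets_eq_imp_space_eq[OF M(2)])
  qed
  have E: "emeasure M F = emeasure N F" if "closed F" for F
  proof (cases "F = {}")
    case False
    have "measure M F = measure N F"
      using LIMSEQ_unique[OF lim[OF that False fin(1) sets(1)]] lim[OF that False fin(2) sets(2)] eq[OF that False] by simp
    then show ?thesis using fin by (simp add: finite_measure.emeasure_eq_measure)
  qed simp
  show ?thesis
  proof (rule measure_eqI_generator_eq[where E="Collect closed" and \<Omega>=UNIV and A="\<lambda>_. UNIV"])
    show "sets M = sigma_sets UNIV (Collect closed)" "sets N = sigma_sets UNIV (Collect closed)"
      unfolding sets borel_eq_closed by auto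
    show "emeasure M UNIV \<noteq> \<infinity>" using finite_measure.emeasure_finite[OF fin(1)] by simp
  qed (auto simp: Int_stable_def E)
qed

section \<open>The c-transform for a symmetric Lipschitz cost on a compact set\<close>

locale fibre_cost =
  fixes S :: "'a::euclidean_space set" and c :: "'a \<Rightarrow> 'a \<Rightarrow> real" and L K :: real and d :: "nat \<Rightarrow> 'a"
  assumes S: "compact S" and d: "range d \<subseteq> S" "S \<subseteq> closure (range d)"
    and c_sym: "\<And>x y. c x y = c y x"
    and c_lip: "\<And>x x' y. x \<in> S \<Longrightarrow> x' \<in> S \<Longrightarrow> y \<in> S \<Longrightarrow> \<bar>c x y - c x' y\<bar> \<le> L * dist x x'"
    and c_bd: "\<And>x y. x \<in> S \<Longrightarrow> y \<in> S \<Longrightarrow> \<bar>c x y\<bar> \<le> K"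
    and L0: "0 \<le> L"
begin

definition lip :: "('a \<Rightarrow> real) \<Rightarrow> bool" where
  "lip f \<longleftrightarrow> (\<forall>x\<in>S. \<forall>x'\<in>S. \<bar>f x - f x'\<bar> \<le> L * dist x x')"

text \<open>The c-transform. As the cost is symmetric, one operator serves for both variables, and
  \<open>tr f\<close> is c-convex with \<zeta> = - f.\<close>

definition tr :: "('a \<Rightarrow> real) \<Rightarrow> 'a \<Rightarrow> real" where
  "tr f x = (SUP y\<in>S. - c x y - f y)"

lemma dS: "d k \<in> S" using d by auto

lemma S_ne: "S \<noteq> {}" using dS by auto

lemma lip_continuous:
  assumes "lip f" shows "continuous_on S f"
proof -
  have "L-lipschitz_on S f"
    using assms L0 by (intro lipschitz_onI) (auto simp: lip_def dist_real_def)
  then show ?thesis by (rule lipschitz_on_continuous_on)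
qed

lemma lip_c: "y \<in> S \<Longrightarrow> lip (\<lambda>x. c x y)" "y \<in> S \<Longrightarrow> lip (\<lambda>x. c y x)"
  using c_lip by (auto simp: lip_def c_sym[of y])

text \<open>Turning suprema over S into countable ones is what keeps transforms measurable in a
  parameter.\<close>

lemma SUP_dense:
  assumes f: "continuous_on S f"
  shows "(SUP x\<in>S. f x) = (SUP k. f (d k) :: real)"
proof -
  have bd: "bdd_above (f ` S)" using compact_imp_bounded[OF compact_continuous_image[OF f S]] by (rule bounded_imp_bdd_above)
  have bd': "bdd_above (range (\<lambda>k. f (d k)))" using bd dS by (auto simp: bdd_above_def)
  show ?thesis
  proof (rule antisym)
    show "(SUP x\<in>S. f x) \<le> (SUP k. f (d k))"
    proof (rule cSUP_least[OF S_ne])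
      fix x assume x: "x \<in> S"
      then have "x \<in> closure (range d)" using d(2) by auto
      then obtain s where s: "\<And>n. s n \<in> range d" "s \<longlonglongrightarrow> x" unfolding closure_sequential by auto
      have "(\<lambda>n. f (s n)) \<longlonglongrightarrow> f x"
        using s(1) d(1) by (intro continuous_on_tendsto_compose[OF f s(2) x] always_eventually allI) auto
      then show "f x \<le> (SUP k. f (d k))"
      proof (rule tendsto_upperbound)
        have "f (s n) \<le> (SUP k. f (d k))" for n
          using s(1)[of n] cSUP_upper[OF UNIV_I bd'] by auto
        then show "\<forall>\<^sub>F n in sequentially. f (s n) \<le> (SUP k. f (d k))" by simp
      qed simp
    qed
    show "(SUP k. f (d k)) \<le> (SUP x\<in>S. f x)"
      by (rule cSUP_least) (auto intro!: cSUP_upper bd dS)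
  qed
qed

context
  fixes f :: "'a \<Rightarrow> real" and R :: real
  assumes R: "\<And>y. y \<in> S \<Longrightarrow> \<bar>f y\<bar> \<le> R"
begin

lemma tr_bdd: "x \<in> S \<Longrightarrow> bdd_above ((\<lambda>y. - c x y - f y) ` S)"
  using R c_bd by (intro bdd_aboveI2[of _ _ "K + R"]) (force simp: abs_le_iff)

lemma tr_upper: "x \<in> S \<Longrightarrow> y \<in> S \<Longrightarrow> - c x y - f y \<le> tr f x"
  unfolding tr_def by (rule cSUP_upper) (auto intro: tr_bdd)

lemma tr_least: "(\<And>y. y \<in> S \<Longrightarrow> - c x y - f y \<le> u) \<Longrightarrow> tr f x \<le> u"
  unfolding tr_def by (rule cSUP_least[OF S_ne])

lemma lip_tr: "lip (tr f)"
proof -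
  have *: "tr f x \<le> tr f x' + L * dist x x'" if "x \<in> S" "x' \<in> S" for x x'
  proof (rule tr_least)
    fix y assume y: "y \<in> S"
    show "- c x y - f y \<le> tr f x' + L * dist x x'"
      using tr_upper[OF that(2) y] c_lip[OF that y] by linarith
  qed
  show ?thesis unfolding lip_def
  proof (intro ballI)
    fix x x' assume "x \<in> S" "x' \<in> S"
    then show "\<bar>tr f x - tr f x'\<bar> \<le> L * dist x x'" using *[of x x'] *[of x' x] by (simp add: dist_commute abs_le_iff)
  qed
qed

lemma tr_abs: assumes x: "x \<in> S" shows "\<bar>tr f x\<bar> \<le> R + K"
proof -
  have "tr f x \<le> R + K" by (rule tr_least) (use R c_bd x in \<open>force simp: abs_le_iff\<close>)
  moreover have "- (R + K) \<le> - c x (d 0) - f (d 0)" using R[OF dS[of 0]] c_bd[OF x dS[of 0]] by linarith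
  ultimately show ?thesis using tr_upper[OF x dS[of 0]] by linarith
qed

end

lemma tr_tr_le:
  assumes R: "\<And>y. y \<in> S \<Longrightarrow> \<bar>f y\<bar> \<le> R" and y: "y \<in> S"
  shows "tr (tr f) y \<le> f y"
proof (rule tr_least[OF tr_abs[of f R, OF R]])
  fix x assume x: "x \<in> S"
  show "- c y x - tr f x \<le> f y" using tr_upper[of f R, OF R x y] c_sym[of x y] by simp
qed

lemma tr_antimono:
  assumes R: "\<And>y. y \<in> S \<Longrightarrow> \<bar>f y\<bar> \<le> R" and x: "x \<in> S" and le: "\<And>y. y \<in> S \<Longrightarrow> f y \<le> g y"
  shows "tr g x \<le> tr f x"
  unfolding tr_def[of g]
proof (rule cSUP_least[OF S_ne])
  fix y assume y: "y \<in> S"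
  show "- c x y - g y \<le> tr f x" using tr_upper[of f R, OF R x y] le[OF y] by simp
qed

lemma tr_tr_tr:
  assumes R: "\<And>y. y \<in> S \<Longrightarrow> \<bar>f y\<bar> \<le> R" and x: "x \<in> S"
  shows "tr (tr (tr f)) x = tr f x"
proof (rule antisym)
  show "tr (tr (tr f)) x \<le> tr f x"
    by (rule tr_tr_le[of "tr f" "R + K"]) (use tr_abs[of f R] R x in auto)
  show "tr f x \<le> tr (tr (tr f)) x"
  proof (rule tr_antimono[of "tr (tr f)" "R + K + K"])
    show "\<bar>tr (tr f) y\<bar> \<le> R + K + K" if "y \<in> S" for y
      by (rule tr_abs[of "tr f" "R + K"]) (use tr_abs[of f R] R that in auto)
  qed (use tr_tr_le R x in auto)
qed

lemma continuous_bounded: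
  assumes "continuous_on S (f :: 'a \<Rightarrow> real)" obtains R where "\<And>y. y \<in> S \<Longrightarrow> \<bar>f y\<bar> \<le> R"
  using compact_imp_bounded[OF compact_continuous_image[OF assms S]] unfolding bounded_iff by auto

lemma continuous_c: "x \<in> S \<Longrightarrow> continuous_on S (\<lambda>y. c x y)"
  using lip_c(2) lip_continuous by blast

lemma tr_attained:
  assumes f: "continuous_on S f" and x: "x \<in> S"
  obtains y where "y \<in> S" "tr f x = - c x y - f y"
proof -
  have "continuous_on S (\<lambda>y. - c x y - f y)" by (intro continuous_intros f continuous_c x)
  then obtain y where y: "y \<in> S" "\<And>z. z \<in> S \<Longrightarrow> - c x z - f z \<le> - c x y - f y"
    using continuous_attains_sup[OF S S_ne] by blast
  obtain R where R: "\<And>y. y \<in> S \<Longrightarrow> \<bar>f y\<bar> \<le> R" using continuous_bounded[OF f] by blast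
  show ?thesis
  proof (rule that[OF y(1)])
    show "tr f x = - c x y - f y"
      by (rule antisym[OF tr_least tr_upper]) (use y R x in auto)
  qed
qed

lemma tr_upper_lip:
  assumes f: "lip f" and xy: "x \<in> S" "y \<in> S" shows "- c x y - f y \<le> tr f x"
proof -
  obtain R where "\<And>y. y \<in> S \<Longrightarrow> \<bar>f y\<bar> \<le> R" using continuous_bounded[OF lip_continuous[OF f]] by blast
  then show ?thesis using xy by (rule tr_upper)
qed

lemma tr_measurable:
  assumes f: "\<And>b. continuous_on S (f b)" and m: "\<And>y. y \<in> S \<Longrightarrow> (\<lambda>b. f b y) \<in> borel_measurable M" and x: "x \<in> S"
  shows "(\<lambda>b. tr (f b) x) \<in> borel_measurable M"
proof -
  have "tr (f b) x = (SUP k. - c x (d k) - f b (d k))" for b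
    unfolding tr_def by (rule SUP_dense) (intro continuous_intros f continuous_c x)
  moreover have "(\<lambda>b. SUP k. - c x (d k) - f b (d k)) \<in> borel_measurable M"
  proof (rule borel_measurable_cSUP)
    fix b
    obtain R where "\<And>y. y \<in> S \<Longrightarrow> \<bar>f b y\<bar> \<le> R" using continuous_bounded[OF f] by blast
    then have "bdd_above ((\<lambda>y. - c x y - f b y) ` S)" by (rule tr_bdd[OF _ x])
    then show "bdd_above (range (\<lambda>k. - c x (d k) - f b (d k)))"
      by (rule bdd_above_mono) (use dS in auto)
  qed (auto intro!: borel_measurable_diff m dS)
  ultimately show ?thesis by simp
qed

text \<open>McShane's formula: a Lipschitz function is the upper envelope of the cones hung at its
  values on the dense sequence. Measurability in a parameter at each \<open>d k\<close> thus yields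
  joint measurability in parameter and point, see \<open>lip_joint_measurable\<close>.\<close>

lemma lip_eq_SUP:
  assumes f: "lip f" and x: "x \<in> S"
  shows "f x = (SUP k. f (d k) - L * dist x (d k))" "bdd_above (range (\<lambda>k. f (d k) - L * dist x' (d k)))"
proof -
  have c: "continuous_on S (\<lambda>y. f y - L * dist x y)" by (intro continuous_intros lip_continuous f)
  have "(SUP y\<in>S. f y - L * dist x y) = f x"
  proof (rule antisym)
    show "(SUP y\<in>S. f y - L * dist x y) \<le> f x"
    proof (rule cSUP_least[OF S_ne])
      fix y assume "y \<in> S" then have "\<bar>f y - f x\<bar> \<le> L * dist y x" using f x by (auto simp: lip_def)
      then show "f y - L * dist x y \<le> f x" by (simp add: dist_commute)
    qed
    have "f x - L * dist x x \<le> (SUP y\<in>S. f y - L * dist x y)"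
      by (rule cSUP_upper[OF x bounded_imp_bdd_above[OF compact_imp_bounded[OF compact_continuous_image[OF c S]]]])
    then show "f x \<le> (SUP y\<in>S. f y - L * dist x y)" by simp
  qed
  then show "f x = (SUP k. f (d k) - L * dist x (d k))" using SUP_dense[OF c] by simp
  obtain R where "\<And>y. y \<in> S \<Longrightarrow> \<bar>f y\<bar> \<le> R" using continuous_bounded[OF lip_continuous[OF f]] by blast
  then show "bdd_above (range (\<lambda>k. f (d k) - L * dist x' (d k)))"
    using dS L0 by (intro bdd_aboveI2[of _ _ R]) (smt (verit) mult_nonneg_nonneg zero_le_dist)
qed

lemma lip_joint_measurable:
  assumes f: "\<And>b. lip (f b)" and m: "\<And>y. y \<in> S \<Longrightarrow> (\<lambda>b. f b y) \<in> borel_measurable M"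
    and [measurable]: "B \<in> measurable N M" "X \<in> borel_measurable N" and X: "\<And>\<omega>. \<omega> \<in> space N \<Longrightarrow> X \<omega> \<in> S"
  shows "(\<lambda>\<omega>. f (B \<omega>) (X \<omega>)) \<in> borel_measurable N"
proof -
  have [measurable]: "(\<lambda>b. f b (d k)) \<in> borel_measurable M" for k by (rule m[OF dS])
  have "(\<lambda>\<omega>. SUP k. f (B \<omega>) (d k) - L * dist (X \<omega>) (d k)) \<in> borel_measurable N"
    by (rule borel_measurable_cSUP) (auto intro!: lip_eq_SUP(2)[OF f dS])
  then show ?thesis
    by (subst measurable_cong[where g="\<lambda>\<omega>. SUP k. f (B \<omega>) (d k) - L * dist (X \<omega>) (d k)"]) (auto intro: lip_eq_SUP(1) f X)
qed

lemma lip_uniform_limit: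
  assumes f: "\<And>j. lip (f j)" and g: "lip g" and lim: "\<And>k. (\<lambda>j. f j (d k)) \<longlonglongrightarrow> g (d k)" and e: "0 < \<epsilon>"
  shows "\<forall>\<^sub>F j in sequentially. \<forall>x\<in>S. \<bar>f j x - g x\<bar> \<le> \<epsilon>"
proof -
  \<comment> \<open>A third of \<epsilon> goes to each of three errors; L + 1 in place of L keeps
    the quotient defined for L = 0.\<close>
  define \<eta> where "\<eta> = \<epsilon> / (3 * (L + 1))"
  have \<eta>: "\<eta> > 0" "L * \<eta> \<le> \<epsilon> / 3" using e L0 by (auto simp: \<eta>_def field_simps)
  have "S \<subseteq> (\<Union>k\<in>UNIV. ball (d k) \<eta>)"
  proof
    fix x assume "x \<in> S"
    then have "x \<in> closure (range d)" using d by auto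
    then show "x \<in> (\<Union>k\<in>UNIV. ball (d k) \<eta>)" using \<eta> by (auto simp: closure_approachable)
  qed
  then obtain F where F: "finite F" "S \<subseteq> (\<Union>k\<in>F. ball (d k) \<eta>)"
    using compactE_image[OF S, of UNIV "\<lambda>k. ball (d k) \<eta>"] by (metis open_ball)
  have "\<forall>\<^sub>F j in sequentially. \<forall>k\<in>F. \<bar>f j (d k) - g (d k)\<bar> < \<epsilon> / 3"
    using F(1)
  proof (rule eventually_ball_finite, intro ballI)
    fix k show "\<forall>\<^sub>F j in sequentially. \<bar>f j (d k) - g (d k)\<bar> < \<epsilon> / 3"
      using tendstoD[OF lim[of k], of "\<epsilon> / 3"] e by (simp add: dist_real_def)
  qed
  then show ?thesis
  proof eventually_elim
    case (elim j)
    show ?case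
    proof
      fix x assume x: "x \<in> S"
      then obtain k where k: "k \<in> F" "dist (d k) x < \<eta>" using F by auto
      have 1: "L * dist x (d k) \<le> \<epsilon> / 3" using k(2) \<eta>(2) L0
        by (smt (verit) dist_commute mult_left_mono)
      have "\<bar>f j x - f j (d k)\<bar> \<le> \<epsilon> / 3" "\<bar>g x - g (d k)\<bar> \<le> \<epsilon> / 3"
        using f[of j] g x dS[of k] 1 unfolding lip_def by (meson order_trans)+
      then show "\<bar>f j x - g x\<bar> \<le> \<epsilon>" using bspec[OF elim k(1)] by linarith
    qed
  qed
qed

lemma tr_uniform:
  assumes f: "lip f" and g: "lip g" and u: "\<And>x. x \<in> S \<Longrightarrow> \<bar>f x - g x\<bar> \<le> \<epsilon>" and y: "y \<in> S"
  shows "\<bar>tr f y - tr g y\<bar> \<le> \<epsilon>"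
proof -
  have *: "tr f y \<le> tr g y + \<epsilon>" if f: "lip f" and g: "lip g" and u: "\<And>x. x \<in> S \<Longrightarrow> \<bar>f x - g x\<bar> \<le> \<epsilon>" for f g
  proof -
    obtain R where R: "\<And>y. y \<in> S \<Longrightarrow> \<bar>g y\<bar> \<le> R" using continuous_bounded[OF lip_continuous[OF g]] by blast
    show ?thesis
      unfolding tr_def[of f]
    proof (rule cSUP_least[OF S_ne])
      fix x assume x: "x \<in> S"
      show "- c y x - f x \<le> tr g y + \<epsilon>" using tr_upper[of g R, OF R y x] u[OF x] by simp
    qed
  qed
  show ?thesis using *[OF f g u] *[OF g f] u by (simp add: abs_le_iff abs_minus_commute)
qed

end

section \<open>The integrated dual problem and its minimizer\<close>

locale fibre_problem = fibre_cost S c L K d + prob_space P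
  for S :: "'a::euclidean_space set" and c L K d and P :: "'p measure" +
  fixes B :: "'p \<Rightarrow> 'b::euclidean_space" and X Y :: "'p \<Rightarrow> 'a"
  assumes B[measurable]: "B \<in> borel_measurable P"
    and X[measurable]: "X \<in> borel_measurable P" and XS: "\<And>\<omega>. \<omega> \<in> space P \<Longrightarrow> X \<omega> \<in> S"
    and Y[measurable]: "Y \<in> borel_measurable P" and YS: "\<And>\<omega>. \<omega> \<in> space P \<Longrightarrow> Y \<omega> \<in> S"
begin

text \<open>Measurability is required only in b for each fixed point of S; the Lipschitz condition
  upgrades it to joint measurability. This form is preserved by \<open>tr\<close> and by pointwise
  limits.\<close>

definition adm :: "('b \<Rightarrow> 'a \<Rightarrow> real) \<Rightarrow> bool" where
  "adm \<phi> \<longleftrightarrow> (\<forall>b. lip (\<phi> b)) \<and> (\<forall>y\<in>S. (\<lambda>b. \<phi> b y) \<in> borel_measurable borel) \<and>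
     (\<exists>R. \<forall>b. \<forall>y\<in>S. \<bar>\<phi> b y\<bar> \<le> R)"

definition J :: "('b \<Rightarrow> 'a \<Rightarrow> real) \<Rightarrow> real" where
  "J \<phi> = expectation (\<lambda>\<omega>. \<phi> (B \<omega>) (X \<omega>) + tr (\<phi> (B \<omega>)) (Y \<omega>))"

lemma adm_lip: "adm \<phi> \<Longrightarrow> lip (\<phi> b)" by (simp add: adm_def)

lemma adm_bound: assumes "adm \<phi>" obtains R where "\<And>b y. y \<in> S \<Longrightarrow> \<bar>\<phi> b y\<bar> \<le> R"
  using assms unfolding adm_def by blast

lemma adm_tr:
  assumes "\<And>b. continuous_on S (f b)" "\<And>y. y \<in> S \<Longrightarrow> (\<lambda>b. f b y) \<in> borel_measurable borel"
    and R: "\<And>b y. y \<in> S \<Longrightarrow> \<bar>f b y\<bar> \<le> R"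
  shows "adm (\<lambda>b. tr (f b))"
  unfolding adm_def
proof (intro conjI allI ballI exI[of _ "R + K"])
  show "lip (tr (f b))" for b using R by (rule lip_tr)
  show "\<bar>tr (f b) y\<bar> \<le> R + K" if "y \<in> S" for b y using R that by (rule tr_abs)
qed (rule tr_measurable[OF assms(1,2)])

lemma adm_tr': assumes "adm \<phi>" shows "adm (\<lambda>b. tr (\<phi> b))"
proof -
  obtain R where "\<And>b y. y \<in> S \<Longrightarrow> \<bar>\<phi> b y\<bar> \<le> R" using adm_bound[OF assms] by blast
  then show ?thesis using assms by (intro adm_tr lip_continuous) (auto simp: adm_def)
qed

lemma adm_measurable:
  assumes "adm \<phi>" "Z \<in> borel_measurable P" "\<And>\<omega>. \<omega> \<in> space P \<Longrightarrow> Z \<omega> \<in> S"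
  shows "(\<lambda>\<omega>. \<phi> (B \<omega>) (Z \<omega>)) \<in> borel_measurable P"
proof (rule lip_joint_measurable[where f=\<phi> and M=borel and B=B and X=Z])
  show "lip (\<phi> b)" for b using assms(1) by (rule adm_lip)
  show "(\<lambda>b. \<phi> b y) \<in> borel_measurable borel" if "y \<in> S" for y using assms(1) that by (simp add: adm_def)
qed (use B assms(2,3) in auto)

lemma adm_integrable:
  assumes "adm \<phi>" "Z \<in> borel_measurable P" "\<And>\<omega>. \<omega> \<in> space P \<Longrightarrow> Z \<omega> \<in> S"
  shows "integrable P (\<lambda>\<omega>. \<phi> (B \<omega>) (Z \<omega>))"
proof -
  obtain R where "\<And>b y. y \<in> S \<Longrightarrow> \<bar>\<phi> b y\<bar> \<le> R" using adm_bound[OF assms(1)] by blast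
  then show ?thesis using assms(3) by (intro integrable_const_bound[of _ R] adm_measurable assms) auto
qed

lemmas adm_int_X = adm_integrable[OF _ X XS] and adm_int_Y = adm_integrable[OF _ Y YS]

lemma J_split: assumes "adm \<phi>"
  shows "J \<phi> = expectation (\<lambda>\<omega>. \<phi> (B \<omega>) (X \<omega>)) + expectation (\<lambda>\<omega>. tr (\<phi> (B \<omega>)) (Y \<omega>))"
  unfolding J_def using assms by (intro Bochner_Integration.integral_add adm_int_X adm_int_Y[OF adm_tr'])

lemma J_ge: assumes "adm \<phi>" shows "- K \<le> J \<phi>"
proof -
  obtain R where R: "\<And>b y. y \<in> S \<Longrightarrow> \<bar>\<phi> b y\<bar> \<le> R" using adm_bound[OF assms(1)] by blast
  have "expectation (\<lambda>\<omega>. - K) \<le> J \<phi>" unfolding J_def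
  proof (rule integral_mono)
    show "integrable P (\<lambda>\<omega>. \<phi> (B \<omega>) (X \<omega>) + tr (\<phi> (B \<omega>)) (Y \<omega>))"
      using assms by (intro Bochner_Integration.integrable_add adm_int_X adm_int_Y[OF adm_tr'])
    fix \<omega> assume "\<omega> \<in> space P"
    then show "- K \<le> \<phi> (B \<omega>) (X \<omega>) + tr (\<phi> (B \<omega>)) (Y \<omega>)"
      using tr_upper_lip[OF adm_lip[OF assms] YS XS, of \<omega> \<omega> "B \<omega>"] c_bd[OF YS XS, of \<omega> \<omega>] by simp
  qed simp
  then show ?thesis by (simp add: prob_space)
qed

text \<open>Subtracting a function of b from \<phi> adds it to the transform, hence leaves J
  unchanged. Vanishing at \<open>d 0\<close> converts the common Lipschitz constant into a common
  bound.\<close>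

definition nrm :: "('b \<Rightarrow> 'a \<Rightarrow> real) \<Rightarrow> 'b \<Rightarrow> 'a \<Rightarrow> real" where
  "nrm \<phi> b x = \<phi> b x - \<phi> b (d 0)"

lemma tr_shift:
  assumes R: "\<And>y. y \<in> S \<Longrightarrow> \<bar>f y\<bar> \<le> R" and x: "x \<in> S"
  shows "tr (\<lambda>y. f y - k) x = tr f x + k"
proof (rule antisym)
  have R': "\<bar>f y - k\<bar> \<le> R + \<bar>k\<bar>" if "y \<in> S" for y using R[OF that] by linarith
  show "tr (\<lambda>y. f y - k) x \<le> tr f x + k"
  proof (rule tr_least[of "\<lambda>y. f y - k", OF R'])
    fix y assume "y \<in> S" then show "- c x y - (f y - k) \<le> tr f x + k" using tr_upper[of f R, OF R x, of y] by simp
  qed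
  have "tr f x \<le> tr (\<lambda>y. f y - k) x - k"
  proof (rule tr_least[of f, OF R])
    fix y assume "y \<in> S" then show "- c x y - f y \<le> tr (\<lambda>y. f y - k) x - k" using tr_upper[of "\<lambda>y. f y - k", OF R' x, of y] by simp
  qed
  then show "tr f x + k \<le> tr (\<lambda>y. f y - k) x" by simp
qed

lemma adm_nrm: assumes "adm \<phi>" shows "adm (nrm \<phi>)" "J (nrm \<phi>) = J \<phi>"
proof -
  obtain R where R: "\<And>b y. y \<in> S \<Longrightarrow> \<bar>\<phi> b y\<bar> \<le> R" using adm_bound[OF assms(1)] by blast
  have "\<bar>nrm \<phi> b y\<bar> \<le> R + R" if "y \<in> S" for b y
    using R[OF that, of b] R[OF dS[of 0], of b] unfolding nrm_def by linarith
  then show "adm (nrm \<phi>)" using assms dS[of 0] unfolding adm_def nrm_def lip_def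
    by (intro conjI exI[of _ "R + R"] ballI allI borel_measurable_diff) auto
  show "J (nrm \<phi>) = J \<phi>" unfolding J_def
  proof (rule Bochner_Integration.integral_cong[OF refl])
    fix \<omega> assume w: "\<omega> \<in> space P"
    have "tr (nrm \<phi> (B \<omega>)) (Y \<omega>) = tr (\<phi> (B \<omega>)) (Y \<omega>) + \<phi> (B \<omega>) (d 0)"
      unfolding nrm_def by (rule tr_shift[of "\<phi> (B \<omega>)" R, OF R YS]) (use w in auto)
    then show "nrm \<phi> (B \<omega>) (X \<omega>) + tr (nrm \<phi> (B \<omega>)) (Y \<omega>) = \<phi> (B \<omega>) (X \<omega>) + tr (\<phi> (B \<omega>)) (Y \<omega>)"
      by (simp add: nrm_def)
  qed
qed

text \<open>As a supremum of affine functionals of f, \<open>tr f\<close> is convex in f. Midpoints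
  are all that the parallelogram law asks for.\<close>

lemma adm_mid:
  assumes "adm \<phi>" "adm \<psi>"
  shows "adm (\<lambda>b x. (\<phi> b x + \<psi> b x) / 2)" "J (\<lambda>b x. (\<phi> b x + \<psi> b x) / 2) \<le> (J \<phi> + J \<psi>) / 2"
proof -
  obtain R where R: "\<And>b y. y \<in> S \<Longrightarrow> \<bar>\<phi> b y\<bar> \<le> R" using adm_bound[OF assms(1)] by blast
  obtain R' where R': "\<And>b y. y \<in> S \<Longrightarrow> \<bar>\<psi> b y\<bar> \<le> R'" using adm_bound[OF assms(2)] by blast
  have RR: "\<bar>(\<phi> b y + \<psi> b y) / 2\<bar> \<le> R + R'" if "y \<in> S" for b y
    using R[OF that, of b] R'[OF that, of b] by (simp add: abs_le_iff)
  show adm: "adm (\<lambda>b x. (\<phi> b x + \<psi> b x) / 2)" unfolding adm_def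
  proof (intro conjI allI ballI)
    fix b show "lip (\<lambda>x. (\<phi> b x + \<psi> b x) / 2)" unfolding lip_def
    proof (intro ballI)
      fix x x' assume "x \<in> S" "x' \<in> S"
      then have "\<bar>\<phi> b x - \<phi> b x'\<bar> \<le> L * dist x x'" "\<bar>\<psi> b x - \<psi> b x'\<bar> \<le> L * dist x x'"
        using assms by (auto simp: adm_def lip_def)
      then show "\<bar>(\<phi> b x + \<psi> b x) / 2 - (\<phi> b x' + \<psi> b x') / 2\<bar> \<le> L * dist x x'"
        by (simp add: abs_le_iff field_simps)
    qed
  next
    show "\<exists>R. \<forall>b. \<forall>y\<in>S. \<bar>(\<phi> b y + \<psi> b y) / 2\<bar> \<le> R" using RR by blast
  qed (use assms in \<open>auto simp: adm_def intro!: borel_measurable_divide borel_measurable_add\<close>)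
  have *: "(\<phi> b x + \<psi> b x) / 2 + tr (\<lambda>x. (\<phi> b x + \<psi> b x) / 2) y \<le> (\<phi> b x + tr (\<phi> b) y) / 2 + (\<psi> b x + tr (\<psi> b) y) / 2"
    if "y \<in> S" for b x y
  proof -
    have "tr (\<lambda>x. (\<phi> b x + \<psi> b x) / 2) y \<le> (tr (\<phi> b) y + tr (\<psi> b) y) / 2"
    proof (rule tr_least[of "\<lambda>x. (\<phi> b x + \<psi> b x) / 2", OF RR])
      fix x assume "x \<in> S"
      then show "- c y x - (\<phi> b x + \<psi> b x) / 2 \<le> (tr (\<phi> b) y + tr (\<psi> b) y) / 2"
        using tr_upper_lip[OF adm_lip[OF assms(1)] that, of x b] tr_upper_lip[OF adm_lip[OF assms(2)] that, of x b]
        by (simp add: field_simps)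
    qed
    then show ?thesis by (simp add: field_simps)
  qed
  define u where "u \<omega> = \<phi> (B \<omega>) (X \<omega>) + tr (\<phi> (B \<omega>)) (Y \<omega>)" for \<omega>
  define v where "v \<omega> = \<psi> (B \<omega>) (X \<omega>) + tr (\<psi> (B \<omega>)) (Y \<omega>)" for \<omega>
  have uv: "integrable P u" "integrable P v"
    unfolding u_def[abs_def] v_def[abs_def]
    using Bochner_Integration.integrable_add[OF adm_int_X[OF assms(1)] adm_int_Y[OF adm_tr'[OF assms(1)]]]
      Bochner_Integration.integrable_add[OF adm_int_X[OF assms(2)] adm_int_Y[OF adm_tr'[OF assms(2)]]] by simp_all
  have "J (\<lambda>b x. (\<phi> b x + \<psi> b x) / 2) \<le> expectation (\<lambda>\<omega>. u \<omega> / 2 + v \<omega> / 2)"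
    unfolding J_def
  proof (rule integral_mono)
    show "integrable P (\<lambda>\<omega>. (\<phi> (B \<omega>) (X \<omega>) + \<psi> (B \<omega>) (X \<omega>)) / 2 + tr (\<lambda>x. (\<phi> (B \<omega>) x + \<psi> (B \<omega>) x) / 2) (Y \<omega>))"
      by (rule Bochner_Integration.integrable_add[OF adm_int_X[OF adm] adm_int_Y[OF adm_tr'[OF adm]]])
    show "integrable P (\<lambda>\<omega>. u \<omega> / 2 + v \<omega> / 2)" using uv by simp
  qed (use * YS in \<open>simp add: u_def v_def\<close>)
  also have "\<dots> = (J \<phi> + J \<psi>) / 2"
    using uv by (simp add: J_def u_def[symmetric] v_def[symmetric] add_divide_distrib)
  finally show "J (\<lambda>b x. (\<phi> b x + \<psi> b x) / 2) \<le> (J \<phi> + J \<psi>) / 2" .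
qed

abbreviation "Q \<equiv> P \<Otimes>\<^sub>M measure_pmf (geometric_pmf (1/2))"

lemma prob_space_Q: "prob_space Q"
  by (rule prob_space_pair[OF prob_space_axioms prob_space_measure_pmf])

lemma lip_bound': "\<exists>\<Delta>. 0 \<le> \<Delta> \<and> (\<forall>f. lip f \<longrightarrow> (\<forall>x\<in>S. \<forall>y\<in>S. \<bar>f x - f y\<bar> \<le> \<Delta>))"
proof -
  obtain e where e: "\<And>x y. x \<in> S \<Longrightarrow> y \<in> S \<Longrightarrow> dist x y \<le> e"
    using compact_imp_bounded[OF S] unfolding bounded_two_points by blast
  have "\<bar>f x - f y\<bar> \<le> L * e" if f: "lip f" and xy: "x \<in> S" "y \<in> S" for f x y
  proof -
    have "\<bar>f x - f y\<bar> \<le> L * dist x y" using f xy by (simp add: lip_def)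
    also have "\<dots> \<le> L * e" using e[OF xy] L0 by (rule mult_left_mono)
    finally show ?thesis .
  qed
  moreover have "0 \<le> e" using e[OF dS dS, of 0 0] by simp
  ultimately show ?thesis using L0 by (intro exI[of _ "L * e"]) simp
qed

lemma adm_measurable_Q:
  assumes "adm \<phi>" shows "(\<lambda>q. \<phi> (B (fst q)) (d (snd q))) \<in> borel_measurable Q"
proof (rule lip_joint_measurable[where f=\<phi> and M=borel and B="\<lambda>q. B (fst q)" and X="\<lambda>q. d (snd q)"])
  show "lip (\<phi> b)" for b using assms(1) by (rule adm_lip)
  show "(\<lambda>b. \<phi> b y) \<in> borel_measurable borel" if "y \<in> S" for y using assms(1) that by (simp add: adm_def)
  show "(\<lambda>q. B (fst q)) \<in> borel_measurable Q" by measurable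
  have "(\<lambda>k. d k) \<in> borel_measurable (measure_pmf (geometric_pmf (1/2)))" by simp
  from measurable_compose[OF measurable_snd this]
  show "(\<lambda>q. d (snd q)) \<in> borel_measurable Q" .
qed (rule dS)

text \<open>
  Near-minimizers of \<open>J\<close> form decreasing convex sets; elements of almost minimal \<open>L\<^sup>2\<close>-norm in these sets
  form a Cauchy sequence by the parallelogram law. The geometric distribution serves as a measure
  charging all points of the dense sequence \<open>d\<close>.
\<close>

lemma minimizing_sequence:
  obtains \<phi> :: "nat \<Rightarrow> 'b \<Rightarrow> 'a \<Rightarrow> real" where
    "\<And>j. adm (\<phi> j)" "\<And>j b. \<phi> j b (d 0) = 0"
    "\<And>\<psi> \<epsilon>. adm \<psi> \<Longrightarrow> 0 < \<epsilon> \<Longrightarrow> \<forall>\<^sub>F j in sequentially. J (\<phi> j) \<le> J \<psi> + \<epsilon>"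
    "AE \<omega> in P. \<forall>k. convergent (\<lambda>j. \<phi> j (B \<omega>) (d k))"
proof -
  interpret Q: prob_space Q by (rule prob_space_Q)
  define N where "N = {\<phi>. adm \<phi> \<and> (\<forall>b. \<phi> b (d 0) = 0)}"
  obtain \<Delta> where \<Delta>': "0 \<le> \<Delta> \<and> (\<forall>f. lip f \<longrightarrow> (\<forall>x\<in>S. \<forall>y\<in>S. \<bar>f x - f y\<bar> \<le> \<Delta>))"
    using lip_bound' ..
  have \<Delta>: "0 \<le> \<Delta>" "lip f \<Longrightarrow> x \<in> S \<Longrightarrow> y \<in> S \<Longrightarrow> \<bar>f x - f y\<bar> \<le> \<Delta>" for f x y
    using \<Delta>' by simp_all
  have Nbd: "\<bar>\<phi> b x\<bar> \<le> \<Delta>" if "\<phi> \<in> N" "x \<in> S" for \<phi> b x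
  proof -
    have "lip (\<phi> b)" "\<phi> b (d 0) = 0" using that(1) by (simp_all add: N_def adm_lip)
    then show ?thesis using \<Delta>(2)[OF _ that(2) dS[of 0], of "\<phi> b"] by simp
  qed
  have zero: "(\<lambda>_ _. 0) \<in> N" using L0 by (auto simp: N_def adm_def lip_def intro!: exI[of _ 0])
  define m where "m = (INF \<phi>\<in>N. J \<phi>)"
  have bdd: "bdd_below (J ` N)" using J_ge by (intro bdd_belowI2[of _ "-K"]) (auto simp: N_def)
  have m_le: "m \<le> J \<psi>" if "adm \<psi>" for \<psi>
  proof -
    have "nrm \<psi> \<in> N" using adm_nrm(1)[OF that] by (auto simp: N_def nrm_def)
    then have "m \<le> J (nrm \<psi>)" unfolding m_def by (rule cINF_lower[OF bdd])
    then show ?thesis using adm_nrm(2)[OF that] by simp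
  qed
  \<comment> \<open>The sets of near-minimizers. They shrink with n and are stable under midpoints
    by \<open>adm_mid\<close>.\<close>
  define Kn where "Kn n = {\<phi> \<in> N. J \<phi> \<le> m + inverse (real (Suc n))}" for n :: nat
  have Kn_ne: "Kn n \<noteq> {}" for n
  proof -
    have "\<exists>\<phi>\<in>N. J \<phi> < m + inverse (real (Suc n))"
      using cINF_less_iff[OF _ bdd, of "m + inverse (real (Suc n))"] zero by (auto simp: m_def)
    then show ?thesis by (auto simp: Kn_def intro: less_imp_le)
  qed
  have Kn_anti: "Kn l \<subseteq> Kn n" if "n \<le> l" for n l
  proof -
    have "inverse (real (Suc l)) \<le> inverse (real (Suc n))" using that by (intro le_imp_inverse_le) auto
    then have "J x \<le> m + inverse (real (Suc n))" if "J x \<le> m + inverse (real (Suc l))" for x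
      using that by linarith
    then show ?thesis unfolding Kn_def by blast
  qed
  define W where "W \<phi> = (\<lambda>q. \<phi> (B (fst q)) (d (snd q)))" for \<phi> :: "'b \<Rightarrow> 'a \<Rightarrow> real"
  have W_meas: "W \<phi> \<in> borel_measurable Q" if "\<phi> \<in> N" for \<phi>
    using adm_measurable_Q[of \<phi>] that by (simp add: W_def N_def)
  have W_bd: "\<bar>W \<phi> q\<bar> \<le> \<Delta>" if "\<phi> \<in> N" for \<phi> q using Nbd[OF that dS] by (simp add: W_def)
  have W_bd2: "(W \<phi> q)\<^sup>2 \<le> \<Delta>\<^sup>2" if "\<phi> \<in> N" for \<phi> q
    using W_bd[OF that, of q] power_mono[of "\<bar>W \<phi> q\<bar>" \<Delta> 2] by simp
  have W_int: "integrable Q (\<lambda>q. (W \<phi> q)\<^sup>2)" if "\<phi> \<in> N" for \<phi>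
    using W_bd2[OF that] W_meas[OF that] by (intro Q.integrable_const_bound[of _ "\<Delta>\<^sup>2"]) auto
  define NN where "NN \<phi> = (\<integral>q. (W \<phi> q)\<^sup>2 \<partial>Q)" for \<phi>
  have NN0: "0 \<le> NN \<phi>" for \<phi> unfolding NN_def by simp
  have NN1: "NN \<phi> \<le> \<Delta>\<^sup>2" if "\<phi> \<in> N" for \<phi>
    using integral_mono[OF W_int[OF that], of "\<lambda>_. \<Delta>\<^sup>2"] W_bd2[OF that] by (simp add: NN_def Q.prob_space)
  \<comment> \<open>The least squared norm over \<open>Kn n\<close> increases with n and is bounded,
    so it converges; its increments control the distance between almost norm-minimal
    elements.\<close>
  define I where "I n = (INF \<phi>\<in>Kn n. NN \<phi>)" for n
  have I_bdd: "bdd_below (NN ` Kn n)" for n using NN0 by (intro bdd_belowI2[of _ 0]) auto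
  have I_le: "I n \<le> NN \<phi>" if "\<phi> \<in> Kn n" for n \<phi> unfolding I_def using that by (rule cINF_lower[OF I_bdd])
  have I_bound: "I n \<le> \<Delta>\<^sup>2" for n
  proof -
    obtain \<phi> where "\<phi> \<in> Kn n" using Kn_ne by blast
    then show ?thesis using I_le[of \<phi> n] NN1[of \<phi>] by (simp add: Kn_def)
  qed
  have I_mono: "I n \<le> I l" if "n \<le> l" for n l
    unfolding I_def by (rule cINF_superset_mono) (use Kn_ne I_bdd Kn_anti[OF that] in auto)
  define Is where "Is = (SUP n. I n)"
  have Ibd: "bdd_above (range I)" using I_bound by (intro bdd_aboveI2)
  have I_Is: "I n \<le> Is" for n unfolding Is_def by (rule cSUP_upper[OF _ Ibd]) simp
  have I_lim: "I \<longlonglongrightarrow> Is" unfolding Is_def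
    by (rule LIMSEQ_incseq_SUP[OF Ibd]) (use I_mono in \<open>auto simp: incseq_def\<close>)
  have "\<exists>\<phi>. \<phi> \<in> Kn n \<and> NN \<phi> \<le> I n + inverse (real (Suc n))" for n
  proof -
    have "\<exists>\<phi>\<in>Kn n. NN \<phi> < I n + inverse (real (Suc n))"
      using cINF_less_iff[OF Kn_ne I_bdd, of n "I n + inverse (real (Suc n))"] by (auto simp: I_def)
    then show ?thesis by (auto intro: less_imp_le)
  qed
  then obtain p where p: "\<And>n. p n \<in> Kn n" "\<And>n. NN (p n) \<le> I n + inverse (real (Suc n))" by metis
  have pN: "p n \<in> N" for n using p(1)[of n] by (simp add: Kn_def)
  define e where "e n = 2 * (Is - I n) + 4 * inverse (real (Suc n))" for n
  have dist: "(\<integral>q. (W (p l) q - W (p n) q)\<^sup>2 \<partial>Q) \<le> e n" if nl: "n \<le> l" for n l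
  proof -
    \<comment> \<open>The midpoint lies in \<open>Kn n\<close>, so its squared norm is at least
      \<open>I n\<close>. Inserted into the parallelogram law this bounds the distance of its end
      points.\<close>
    let ?m = "\<lambda>b x. (p n b x + p l b x) / 2"
    have pl: "p l \<in> Kn n" using Kn_anti[OF nl] p(1)[of l] by auto
    have "?m \<in> Kn n" using adm_mid[of "p n" "p l"] p(1)[of n] pl by (auto simp: Kn_def N_def)
    then have 1: "I n \<le> NN ?m" and mN: "?m \<in> N" using I_le by (auto simp: Kn_def)
    have "(W (p l) q - W (p n) q)\<^sup>2 = 2 * (W (p n) q)\<^sup>2 + 2 * (W (p l) q)\<^sup>2 - 4 * (W ?m q)\<^sup>2" for q
      by (simp add: W_def power2_eq_square field_simps)
    then have "(\<integral>q. (W (p l) q - W (p n) q)\<^sup>2 \<partial>Q) = 2 * NN (p n) + 2 * NN (p l) - 4 * NN ?m"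
      unfolding NN_def using W_int[OF pN] W_int[OF mN] by simp
    also have "\<dots> \<le> 2 * (I n + inverse (real (Suc n))) + 2 * (I l + inverse (real (Suc l))) - 4 * I n"
      using mult_left_mono[OF p(2)[of n], of 2] mult_left_mono[OF p(2)[of l], of 2] mult_left_mono[OF 1, of 4]
      by simp
    also have "\<dots> \<le> 2 * (I n + inverse (real (Suc n))) + 2 * (Is + inverse (real (Suc n))) - 4 * I n"
    proof -
      have "inverse (real (Suc l)) \<le> inverse (real (Suc n))" using nl by (intro le_imp_inverse_le) auto
      then show ?thesis using I_Is[of l] by argo
    qed
    also have "\<dots> = e n" by (simp add: e_def)
    finally show ?thesis .
  qed
  have e_lim: "e \<longlonglongrightarrow> 0"
  proof -
    have "e \<longlonglongrightarrow> 2 * (Is - Is) + 4 * 0"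
      unfolding e_def divide_inverse by (intro tendsto_intros I_lim LIMSEQ_inverse_real_of_nat)
    then show ?thesis by simp
  qed
  have "\<exists>n0. \<forall>n\<ge>n0. e n \<le> (1/4)^j" for j
  proof -
    have "\<forall>\<^sub>F n in sequentially. e n < (1/4)^j" using order_tendstoD(2)[OF e_lim, of "(1/4)^j"] by simp
    then show ?thesis unfolding eventually_sequentially by (meson less_imp_le)
  qed
  then obtain n0 where n0: "\<And>j n. n0 j \<le> n \<Longrightarrow> e n \<le> (1/4)^j" by metis
  \<comment> \<open>The sum dominates \<open>n0 j\<close>, and the summand j makes r strictly
    increasing.\<close>
  define r where "r j = (\<Sum>i\<le>j. n0 i) + j" for j
  have r: "strict_mono r" by (auto simp: strict_mono_Suc_iff r_def)
  have rn: "n0 j \<le> r j" for j unfolding r_def by (simp add: member_le_sum trans_le_add1)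
  define \<delta> where "\<delta> j q = \<bar>W (p (r (Suc j))) q - W (p (r j)) q\<bar>" for j q
  have \<delta>_meas[measurable]: "\<delta> j \<in> borel_measurable Q" for j
    unfolding \<delta>_def using W_meas[OF pN] by measurable
  have \<delta>2: "(\<integral>q. (\<delta> j q)\<^sup>2 \<partial>Q) \<le> (1/4)^j" for j
    using dist[of "r j" "r (Suc j)"] n0[OF rn[of j]] strict_mono_less_eq[OF r, of j "Suc j"] by (simp add: \<delta>_def)
  have \<delta>_bd: "0 \<le> \<delta> j q" "\<delta> j q \<le> 2 * \<Delta>" for j q
    using W_bd[OF pN, of "r j" q] W_bd[OF pN, of "r (Suc j)" q] by (auto simp: \<delta>_def)
  have \<delta>_int: "integrable Q (\<delta> j)" "integrable Q (\<lambda>q. (\<delta> j q)\<^sup>2)" for j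
  proof -
    show "integrable Q (\<delta> j)" using \<delta>_bd by (intro Q.integrable_const_bound[of _ "2 * \<Delta>"]) auto
    have "norm ((\<delta> j q)\<^sup>2) \<le> (2 * \<Delta>)\<^sup>2" for q using \<delta>_bd[of j q] power_mono[of "\<delta> j q" "2 * \<Delta>" 2] by simp
    then show "integrable Q (\<lambda>q. (\<delta> j q)\<^sup>2)" by (intro Q.integrable_const_bound[of _ "(2 * \<Delta>)\<^sup>2"] AE_I2) auto
  qed
  have \<delta>1: "(\<integral>q. \<delta> j q \<partial>Q) \<le> (1/2)^j" for j
  proof -
    \<comment> \<open>The inequality of arithmetic and geometric means with weights 2^(-j) and 2^j
      turns the bound 4^(-j) on the square into the bound 2^(-j) on the integral, which is summable
      over j.\<close>
    have "\<delta> j q \<le> ((1/2)^j + 2^j * (\<delta> j q)\<^sup>2) / 2" for q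
    proof -
      define a b where "a = (1/2 :: real)^j" and "b = (2 :: real)^j"
      have ab: "a * b = 1" "b > 0" by (auto simp: a_def b_def power_mult_distrib[symmetric])
      have "0 \<le> (a - \<delta> j q)\<^sup>2 * b" using ab(2) by (intro mult_nonneg_nonneg) auto
      also have "\<dots> = a * (a * b) - 2 * \<delta> j q * (a * b) + b * (\<delta> j q)\<^sup>2"
        by (simp add: power2_eq_square algebra_simps)
      finally have "2 * \<delta> j q \<le> a + b * (\<delta> j q)\<^sup>2" by (simp add: ab(1))
      then show ?thesis unfolding a_def b_def by simp
    qed
    then have "(\<integral>q. \<delta> j q \<partial>Q) \<le> (\<integral>q. ((1/2)^j + 2^j * (\<delta> j q)\<^sup>2) / 2 \<partial>Q)"
    proof (intro integral_mono \<delta>_int)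
      show "integrable Q (\<lambda>q. ((1/2)^j + 2^j * (\<delta> j q)\<^sup>2) / 2)" using \<delta>_int(2)[of j]
        by (intro integrable_divide Bochner_Integration.integrable_add integrable_mult_right Q.integrable_const)
    qed
    also have "\<dots> = ((1/2)^j + 2^j * (\<integral>q. (\<delta> j q)\<^sup>2 \<partial>Q)) / 2"
      using \<delta>_int by (simp add: Q.prob_space)
    also have "\<dots> \<le> ((1/2)^j + 2^j * (1/4)^j) / 2" using \<delta>2[of j] by simp
    also have "\<dots> = (1/2)^j" by (simp add: power_mult_distrib[symmetric])
    finally show ?thesis .
  qed
  have "AE q in Q. (\<Sum>j. ennreal (\<delta> j q)) \<noteq> \<infinity>"
  proof (rule nn_integral_PInf_AE)
    have "(\<integral>\<^sup>+ q. (\<Sum>j. ennreal (\<delta> j q)) \<partial>Q) = (\<Sum>j. \<integral>\<^sup>+ q. ennreal (\<delta> j q) \<partial>Q)"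
      by (rule nn_integral_suminf) simp
    also have "\<dots> \<le> (\<Sum>j. ennreal ((1/2)^j))"
      using \<delta>1 \<delta>_bd \<delta>_int by (intro suminf_le) (auto simp: nn_integral_eq_integral intro!: ennreal_leI)
    also have "\<dots> < \<infinity>" by (simp add: suminf_ennreal2 summable_geometric)
    finally show "(\<integral>\<^sup>+ q. (\<Sum>j. ennreal (\<delta> j q)) \<partial>Q) \<noteq> \<infinity>" by simp
  qed simp
  then have Q_conv: "AE q in Q. convergent (\<lambda>j. W (p (r j)) q)"
  proof eventually_elim
    case (elim q)
    then have "summable (\<lambda>j. \<delta> j q)" using \<delta>_bd by (intro summable_suminf_not_top) auto
    then have "summable (\<lambda>j. W (p (r (Suc j))) q - W (p (r j)) q)"
      unfolding \<delta>_def by (rule summable_rabs_cancel)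
    then have "convergent (\<lambda>n. (\<Sum>j<n. W (p (r (Suc j))) q - W (p (r j)) q) + W (p (r 0)) q)"
      by (intro convergent_add convergent_const) (simp add: summable_iff_convergent)
    then show ?case unfolding sum_lessThan_telescope[of "\<lambda>j. W (p (r j)) q"] by simp
  qed
  interpret PQ: pair_sigma_finite P "measure_pmf (geometric_pmf (1/2))" ..
  have "AE \<omega> in P. AE k in measure_pmf (geometric_pmf (1/2)). convergent (\<lambda>j. W (p (r j)) (\<omega>, k))"
    by (rule PQ.AE_pair[OF Q_conv])
  \<comment> \<open>The geometric distribution charges every natural number, so almost every k means
    every k.\<close>
  then have conv: "AE \<omega> in P. \<forall>k. convergent (\<lambda>j. p (r j) (B \<omega>) (d k))"
    by eventually_elim (simp add: AE_measure_pmf_iff W_def set_pmf_geometric)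
  show ?thesis
  proof (rule that[of "\<lambda>j. p (r j)"])
    show "adm (p (r j))" "p (r j) b (d 0) = 0" for j b using pN by (auto simp: N_def)
    fix \<psi> \<epsilon> assume "adm \<psi>" and eps: "0 < (\<epsilon>::real)"
    obtain n1 where n1: "inverse (real (Suc n1)) < \<epsilon>" using reals_Archimedean[OF eps] by blast
    show "\<forall>\<^sub>F j in sequentially. J (p (r j)) \<le> J \<psi> + \<epsilon>" unfolding eventually_sequentially
    proof (intro exI[of _ n1] allI impI)
      fix j assume "n1 \<le> j"
      then have "n1 \<le> r j" using seq_suble[OF r, of j] by linarith
      then have "inverse (real (Suc (r j))) \<le> inverse (real (Suc n1))" by (intro le_imp_inverse_le) auto
      moreover have "J (p (r j)) \<le> m + inverse (real (Suc (r j)))" using p(1)[of "r j"] by (simp add: Kn_def)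
      ultimately show "J (p (r j)) \<le> J \<psi> + \<epsilon>" using m_le[OF \<open>adm \<psi>\<close>] n1 by linarith
    qed
  qed (rule conv)
qed

text \<open>Convergence at the points of the dense sequence spreads to all of S, uniformly for each
  base point, because the Lipschitz constant is common. Uniform convergence passes through
  \<open>tr\<close>, and dominated convergence carries J to the limit.\<close>

lemma minimizer:
  obtains \<phi> where "adm \<phi>" "\<And>b. \<phi> b (d 0) = 0" "\<And>\<psi>. adm \<psi> \<Longrightarrow> J \<phi> \<le> J \<psi>"
proof -
  obtain p where adm: "\<And>j. adm (p j)" and p0: "\<And>j b. p j b (d 0) = 0"
    and min: "\<And>\<psi> \<epsilon>. adm \<psi> \<Longrightarrow> 0 < \<epsilon> \<Longrightarrow> \<forall>\<^sub>F j in sequentially. J (p j) \<le> J \<psi> + \<epsilon>"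
    and conv: "AE \<omega> in P. \<forall>k. convergent (\<lambda>j. p j (B \<omega>) (d k))"
    by (rule minimizing_sequence) (rule that)
  obtain \<Delta> where \<Delta>': "0 \<le> \<Delta> \<and> (\<forall>f. lip f \<longrightarrow> (\<forall>x\<in>S. \<forall>y\<in>S. \<bar>f x - f y\<bar> \<le> \<Delta>))"
    using lip_bound' ..
  have \<Delta>: "0 \<le> \<Delta>" "lip f \<Longrightarrow> x \<in> S \<Longrightarrow> y \<in> S \<Longrightarrow> \<bar>f x - f y\<bar> \<le> \<Delta>" for f x y
    using \<Delta>' by simp_all
  have plip: "lip (p j b)" for j b using adm by (simp add: adm_def)
  have pbd: "\<bar>p j b x\<bar> \<le> \<Delta>" if "x \<in> S" for j b x
    using \<Delta>(2)[OF plip that dS[of 0], of j b] p0 by simp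
  define C where "C = {b. \<forall>k. convergent (\<lambda>j. p j b (d k))}"
  have pm[measurable]: "(\<lambda>b. p j b (d k)) \<in> borel_measurable borel" for j k using adm[of j] dS by (simp add: adm_def)
  have C[measurable]: "C \<in> sets borel" unfolding C_def convergent_def Cauchy_convergent_iff[symmetric]
  proof -
    have "{b \<in> space borel. \<forall>k. Cauchy (\<lambda>j. p j b (d k))} \<in> sets borel" by measurable
    then show "{b. \<forall>k. \<exists>L. (\<lambda>j. p j b (d k)) \<longlonglongrightarrow> L} \<in> sets borel"
      by (simp add: Cauchy_convergent_iff convergent_def)
  qed
  have convS: "convergent (\<lambda>j. p j b x)" if b: "b \<in> C" and x: "x \<in> S" for b x
    unfolding Cauchy_convergent_iff[symmetric]
  proof (rule metric_CauchyI)
    fix \<epsilon> :: real assume e: "0 < \<epsilon>"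
    define \<eta> where "\<eta> = \<epsilon> / (3 * (L + 1))"
    have \<eta>: "\<eta> > 0" "L * \<eta> \<le> \<epsilon> / 3" using e L0 by (auto simp: \<eta>_def field_simps)
    have "x \<in> closure (range d)" using x d by auto
    then obtain k where k: "dist (d k) x < \<eta>" using \<eta> by (auto simp: closure_approachable)
    have 1: "L * dist x (d k) \<le> \<epsilon> / 3" using k \<eta>(2) L0 by (smt (verit) dist_commute mult_left_mono)
    have 2: "\<bar>p j b x - p j b (d k)\<bar> \<le> \<epsilon> / 3" for j
      using plip[of j b] x dS[of k] 1 unfolding lip_def by (meson order_trans)
    have "Cauchy (\<lambda>j. p j b (d k))" using b by (simp add: C_def Cauchy_convergent_iff)
    then obtain M where M: "\<And>i j. i \<ge> M \<Longrightarrow> j \<ge> M \<Longrightarrow> dist (p i b (d k)) (p j b (d k)) < \<epsilon> / 3"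
      using metric_CauchyD[of _ "\<epsilon> / 3"] e by (metis divide_pos_pos zero_less_numeral)
    show "\<exists>M. \<forall>m\<ge>M. \<forall>n\<ge>M. dist (p m b x) (p n b x) < \<epsilon>"
    proof (intro exI[of _ M] allI impI)
      fix i j assume "i \<ge> M" "j \<ge> M"
      then show "dist (p i b x) (p j b x) < \<epsilon>" using M[of i j] 2[of i] 2[of j] unfolding dist_real_def by linarith
    qed
  qed
  \<comment> \<open>Off C, which the base variable avoids almost surely, the value 0 keeps the
    family Lipschitz, normalized and measurable.\<close>
  define \<phi> where "\<phi> b x = (if b \<in> C then lim (\<lambda>j. p j b x) else 0)" for b x
  have lim: "(\<lambda>j. p j b x) \<longlonglongrightarrow> \<phi> b x" if "b \<in> C" "x \<in> S" for b x
    using convS[OF that] that by (simp add: \<phi>_def convergent_LIMSEQ_iff)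
  have \<phi>lip: "lip (\<phi> b)" for b
  proof (cases "b \<in> C")
    case True
    show ?thesis unfolding lip_def
    proof (intro ballI)
      fix x x' assume x: "x \<in> S" "x' \<in> S"
      have "(\<lambda>j. \<bar>p j b x - p j b x'\<bar>) \<longlonglongrightarrow> \<bar>\<phi> b x - \<phi> b x'\<bar>"
        by (intro tendsto_intros lim x True)
      then show "\<bar>\<phi> b x - \<phi> b x'\<bar> \<le> L * dist x x'"
        by (rule tendsto_upperbound) (use plip x in \<open>auto simp: lip_def\<close>)
    qed
  qed (use L0 in \<open>auto simp: \<phi>_def lip_def\<close>)
  have \<phi>0: "\<phi> b (d 0) = 0" for b by (simp add: \<phi>_def p0)
  have \<phi>bd: "\<bar>\<phi> b x\<bar> \<le> \<Delta>" if "x \<in> S" for b x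
    using \<Delta>(2)[OF \<phi>lip that dS[of 0], of b] \<phi>0 by simp
  have \<phi>m: "(\<lambda>b. \<phi> b x) \<in> borel_measurable borel" if "x \<in> S" for x
  proof -
    have [measurable]: "(\<lambda>b. p j b x) \<in> borel_measurable borel" for j using adm[of j] that by (simp add: adm_def)
    have [measurable]: "(\<lambda>b. lim (\<lambda>j. p j b x)) \<in> borel_measurable borel" by (rule borel_measurable_lim_metric) measurable
    show ?thesis unfolding \<phi>_def by measurable
  qed
  have adm\<phi>: "adm \<phi>" using \<phi>lip \<phi>bd \<phi>m by (auto simp: adm_def)
  have Jlim: "(\<lambda>j. J (p j)) \<longlonglongrightarrow> J \<phi>"
    unfolding J_def
  proof (rule integral_dominated_convergence[where w="\<lambda>_. \<Delta> + (\<Delta> + K)"])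
    show "(\<lambda>\<omega>. \<phi> (B \<omega>) (X \<omega>) + tr (\<phi> (B \<omega>)) (Y \<omega>)) \<in> borel_measurable P"
      "(\<lambda>\<omega>. p j (B \<omega>) (X \<omega>) + tr (p j (B \<omega>)) (Y \<omega>)) \<in> borel_measurable P" for j
      using adm adm\<phi> by (intro borel_measurable_add adm_measurable[OF _ X XS] adm_measurable[OF adm_tr' Y YS]; simp)+
    show "AE \<omega> in P. norm (p j (B \<omega>) (X \<omega>) + tr (p j (B \<omega>)) (Y \<omega>)) \<le> \<Delta> + (\<Delta> + K)" for j
    proof (rule AE_I2)
      fix \<omega> assume "\<omega> \<in> space P"
      then show "norm (p j (B \<omega>) (X \<omega>) + tr (p j (B \<omega>)) (Y \<omega>)) \<le> \<Delta> + (\<Delta> + K)"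
        using pbd[OF XS, of \<omega> j "B \<omega>"] tr_abs[of "p j (B \<omega>)" \<Delta>, OF pbd YS, of \<omega>] by simp
    qed
    show "AE \<omega> in P. (\<lambda>j. p j (B \<omega>) (X \<omega>) + tr (p j (B \<omega>)) (Y \<omega>)) \<longlonglongrightarrow> \<phi> (B \<omega>) (X \<omega>) + tr (\<phi> (B \<omega>)) (Y \<omega>)"
      using conv AE_space
    proof eventually_elim
      case (elim \<omega>)
      then have b: "B \<omega> \<in> C" by (simp add: C_def)
      have "(\<lambda>j. tr (p j (B \<omega>)) (Y \<omega>)) \<longlonglongrightarrow> tr (\<phi> (B \<omega>)) (Y \<omega>)"
      proof (rule tendstoI)
        fix \<epsilon> :: real assume e: "0 < \<epsilon>"
        have "\<forall>\<^sub>F j in sequentially. \<forall>x\<in>S. \<bar>p j (B \<omega>) x - \<phi> (B \<omega>) x\<bar> \<le> \<epsilon> / 2"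
          by (rule lip_uniform_limit[OF plip \<phi>lip]) (use lim[OF b dS] e in auto)
        then show "\<forall>\<^sub>F j in sequentially. dist (tr (p j (B \<omega>)) (Y \<omega>)) (tr (\<phi> (B \<omega>)) (Y \<omega>)) < \<epsilon>"
        proof eventually_elim
          case (elim j)
          then show ?case using tr_uniform[OF plip[of j] \<phi>lip[of "B \<omega>"], of "B \<omega>" "\<epsilon>/2" "Y \<omega>"] YS \<open>\<omega> \<in> space P\<close> e
            by (simp add: dist_real_def)
        qed
      qed
      then show ?case by (intro tendsto_intros lim b XS elim)
    qed
  qed auto
  show ?thesis
  proof (rule that[OF adm\<phi> \<phi>0])
    fix \<psi> assume psi: "adm \<psi>"
    show "J \<phi> \<le> J \<psi>"
    proof (rule field_le_epsilon)
      fix \<epsilon> :: real assume "0 < \<epsilon>"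
      from min[OF psi this] show "J \<phi> \<le> J \<psi> + \<epsilon>" by (rule tendsto_upperbound[OF Jlim]) simp
    qed
  qed
qed

text \<open>
  First variation: replacing \<open>\<psi>\<close> by \<open>\<psi> + \<epsilon> h\<close> changes \<open>tr \<psi>\<close> at rate \<open>- h (T x)\<close>, where \<open>T x\<close> is the
  point at which the supremum defining \<open>tr \<psi> x\<close> is attained.
\<close>

lemma tr_perturb_tendsto:
  assumes psi: "lip \<psi>" and h: "continuous_on S h" and H: "\<And>y. y \<in> S \<Longrightarrow> \<bar>h y\<bar> \<le> H"
    and x: "x \<in> S" and T: "T \<in> S" and contact: "tr \<psi> x = - c x T - \<psi> T"
    and uniq: "\<And>y. y \<in> S \<Longrightarrow> tr \<psi> x = - c x y - \<psi> y \<Longrightarrow> y = T"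
  shows "(\<lambda>n. (tr (\<lambda>y. \<psi> y + inverse (real (Suc n)) * h y) x - tr \<psi> x) / inverse (real (Suc n))) \<longlonglongrightarrow> - h T"
    and "\<bar>(tr (\<lambda>y. \<psi> y + inverse (real (Suc n)) * h y) x - tr \<psi> x) / inverse (real (Suc n))\<bar> \<le> H"
proof -
  define \<epsilon> where "\<epsilon> n = inverse (real (Suc n))" for n
  have e0: "\<epsilon> n > 0" for n by (simp add: \<epsilon>_def)
  have elim: "\<epsilon> \<longlonglongrightarrow> 0" unfolding \<epsilon>_def by (rule LIMSEQ_inverse_real_of_nat)
  have cont: "continuous_on S (\<lambda>y. \<psi> y + \<epsilon> n * h y)" for n by (intro continuous_intros lip_continuous psi h)
  have "\<exists>y. y \<in> S \<and> tr (\<lambda>y. \<psi> y + \<epsilon> n * h y) x = - c x y - (\<psi> y + \<epsilon> n * h y)" for n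
    using tr_attained[OF cont[of n] x] by metis
  then obtain y where y: "\<And>n. y n \<in> S" "\<And>n. tr (\<lambda>y. \<psi> y + \<epsilon> n * h y) x = - c x (y n) - (\<psi> (y n) + \<epsilon> n * h (y n))"
    by metis
  define q where "q n = (tr (\<lambda>y. \<psi> y + \<epsilon> n * h y) x - tr \<psi> x) / \<epsilon> n" for n
  have up: "q n \<le> - h (y n)" for n
  proof -
    have "tr (\<lambda>y. \<psi> y + \<epsilon> n * h y) x - tr \<psi> x \<le> - h (y n) * \<epsilon> n"
      using tr_upper_lip[OF psi x y(1)[of n]] y(2)[of n] by (simp add: algebra_simps)
    then show ?thesis using e0[of n] by (simp add: q_def pos_divide_le_eq)
  qed
  have lo: "- h T \<le> q n" for n
  proof -
    obtain R where R: "\<And>y. y \<in> S \<Longrightarrow> \<bar>\<psi> y + \<epsilon> n * h y\<bar> \<le> R" using continuous_bounded[OF cont[of n]] by blast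
    have "- c x T - (\<psi> T + \<epsilon> n * h T) \<le> tr (\<lambda>y. \<psi> y + \<epsilon> n * h y) x" using R x T by (rule tr_upper)
    then have "- h T * \<epsilon> n \<le> tr (\<lambda>y. \<psi> y + \<epsilon> n * h y) x - tr \<psi> x" using contact by (simp add: algebra_simps)
    then show ?thesis using e0[of n] by (simp add: q_def pos_le_divide_eq)
  qed
  show "\<bar>(tr (\<lambda>y. \<psi> y + inverse (real (Suc n)) * h y) x - tr \<psi> x) / inverse (real (Suc n))\<bar> \<le> H"
    using up[of n] lo[of n] H[OF T] H[OF y(1)[of n]] unfolding q_def \<epsilon>_def by linarith
  have ylim: "y \<longlonglongrightarrow> T"
  proof (rule tendstoI)
    fix \<eta> :: real assume eta: "0 < \<eta>"
    \<comment> \<open>On the compact set U the slack in the contact relation has a positive minimum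
      \<kappa>. The perturbed maximizer \<open>y n\<close> has slack at most 2 H times the step
      size, so it eventually leaves U.\<close>
    define U where "U = S - ball T \<eta>"
    have U: "compact U" unfolding U_def by (intro compact_diff S open_ball)
    show "\<forall>\<^sub>F n in sequentially. dist (y n) T < \<eta>"
    proof (cases "U = {}")
      case True
      then have "y n \<in> ball T \<eta>" for n using y(1)[of n] unfolding U_def by auto
      then show ?thesis by (intro always_eventually allI) (simp add: dist_commute)
    next
      case False
      have "continuous_on U (\<lambda>y. tr \<psi> x + c x y + \<psi> y)"
      proof (rule continuous_on_subset[of S])
        show "continuous_on S (\<lambda>y. tr \<psi> x + c x y + \<psi> y)"
          by (intro continuous_on_add continuous_on_const continuous_c[OF x] lip_continuous[OF psi])
      qed (simp add: U_def)
      then obtain z where z: "z \<in> U" "\<And>w. w \<in> U \<Longrightarrow> tr \<psi> x + c x z + \<psi> z \<le> tr \<psi> x + c x w + \<psi> w"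
        using continuous_attains_inf[OF U False] by blast
      define \<kappa> where "\<kappa> = tr \<psi> x + c x z + \<psi> z"
      have zS: "z \<in> S" "z \<noteq> T" using z(1) eta by (auto simp: U_def)
      have "\<kappa> \<noteq> 0" using uniq[OF zS(1)] zS(2) by (auto simp: \<kappa>_def)
      moreover have "\<kappa> \<ge> 0" using tr_upper_lip[OF psi x zS(1)] by (simp add: \<kappa>_def)
      ultimately have k: "\<kappa> > 0" by simp
      have "(\<lambda>n. \<epsilon> n * (2 * H)) \<longlonglongrightarrow> 0 * (2 * H)" by (intro tendsto_intros elim)
      then have "\<forall>\<^sub>F n in sequentially. \<epsilon> n * (2 * H) < \<kappa>" using k by (intro order_tendstoD(2)[of _ "0 * (2*H)"]) auto
      then show ?thesis
      proof eventually_elim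
        case (elim n)
        have "- h T * \<epsilon> n \<le> tr (\<lambda>y. \<psi> y + \<epsilon> n * h y) x - tr \<psi> x"
          using lo[of n] e0[of n] by (simp add: q_def pos_le_divide_eq)
        then have "tr \<psi> x + c x (y n) + \<psi> (y n) \<le> \<epsilon> n * (h T - h (y n))"
          using y(2)[of n] by (simp add: algebra_simps)
        also have "\<dots> \<le> \<epsilon> n * (2 * H)" using e0[of n] H[OF T] H[OF y(1)[of n]] by (intro mult_left_mono) auto
        also note elim
        finally have "y n \<notin> U" using z(2)[of "y n"] by (auto simp: \<kappa>_def)
        then show "dist (y n) T < \<eta>" using y(1) by (simp add: U_def dist_commute)
      qed
    qed
  qed
  have "(\<lambda>n. - h (y n)) \<longlonglongrightarrow> - h T"
    by (intro tendsto_minus continuous_on_tendsto_compose[OF h ylim T]) (simp add: y)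
  then have "q \<longlonglongrightarrow> - h T"
    by (rule tendsto_sandwich[rotated 3]) (use lo up in auto)
  then show "(\<lambda>n. (tr (\<lambda>y. \<psi> y + inverse (real (Suc n)) * h y) x - tr \<psi> x) / inverse (real (Suc n))) \<longlonglongrightarrow> - h T"
    unfolding q_def \<epsilon>_def .
qed

text \<open>Equality of the two joint laws says that, given the base variable, T X-fibrewise
  reproduces the distribution of Y, without any conditional measure being constructed. It is the
  Euler equation of the dual problem: the variation in direction h compares the means of h at T and
  at Y, and h and - h together give equality.\<close>

theorem fibre_potentials:
  obtains \<psi> where "adm \<psi>" "\<And>b y. y \<in> S \<Longrightarrow> tr (tr (\<psi> b)) y = \<psi> b y"
    "\<And>T. T \<in> borel_measurable P \<Longrightarrow> (AE \<omega> in P. T \<omega> \<in> S \<and>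
       (\<forall>y\<in>S. tr (\<psi> (B \<omega>)) (X \<omega>) = - c (X \<omega>) y - \<psi> (B \<omega>) y \<longleftrightarrow> y = T \<omega>)) \<Longrightarrow>
       distr P borel (\<lambda>\<omega>. (B \<omega>, T \<omega>)) = distr P borel (\<lambda>\<omega>. (B \<omega>, Y \<omega>))"
proof -
  obtain \<phi> where phi: "adm \<phi>" and min: "\<And>\<phi>'. adm \<phi>' \<Longrightarrow> J \<phi> \<le> J \<phi>'" by (rule minimizer) (rule that)
  define \<psi> where "\<psi> b = tr (\<phi> b)" for b
  have psi: "adm \<psi>" using adm_tr'[OF phi] unfolding \<psi>_def[abs_def] .
  have g: "adm (\<lambda>b. tr (\<psi> b))" by (rule adm_tr'[OF psi])
  obtain R where R: "\<And>b y. y \<in> S \<Longrightarrow> \<bar>\<phi> b y\<bar> \<le> R" using adm_bound[OF phi] by blast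
  obtain R' where R': "\<And>b y. y \<in> S \<Longrightarrow> \<bar>\<psi> b y\<bar> \<le> R'" using adm_bound[OF psi] by blast
  have ttt: "tr (tr (\<psi> b)) y = \<psi> b y" if "y \<in> S" for b y
    unfolding \<psi>_def using tr_tr_tr[OF _ that] R by blast
  define A where "A = expectation (\<lambda>\<omega>. tr (\<psi> (B \<omega>)) (X \<omega>))"
  define C where "C = expectation (\<lambda>\<omega>. \<psi> (B \<omega>) (Y \<omega>))"
  \<comment> \<open>Replacing \<phi> by its double transform does not raise the functional, so the
    conjugate pair formed by \<open>tr \<psi>\<close> and \<psi> is minimal as well.\<close>
  have AC: "A + C \<le> J \<phi>'" if "adm \<phi>'" for \<phi>'
  proof -
    have "A \<le> expectation (\<lambda>\<omega>. \<phi> (B \<omega>) (X \<omega>))" unfolding A_def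
    proof (rule integral_mono[OF adm_int_X[OF g] adm_int_X[OF phi]])
      fix \<omega> assume "\<omega> \<in> space P"
      then show "tr (\<psi> (B \<omega>)) (X \<omega>) \<le> \<phi> (B \<omega>) (X \<omega>)"
        unfolding \<psi>_def using tr_tr_le[of "\<phi> (B \<omega>)" R "X \<omega>"] R XS by blast
    qed
    then have "A + C \<le> J \<phi>" unfolding J_split[OF phi] C_def \<psi>_def by simp
    then show ?thesis using min[OF that] by simp
  qed
  show ?thesis
  proof (rule that[OF psi ttt])
    fix T assume T[measurable]: "T \<in> borel_measurable P"
      and uq: "AE \<omega> in P. T \<omega> \<in> S \<and>
         (\<forall>y\<in>S. tr (\<psi> (B \<omega>)) (X \<omega>) = - c (X \<omega>) y - \<psi> (B \<omega>) y \<longleftrightarrow> y = T \<omega>)"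
    have var: "expectation (\<lambda>\<omega>. h (B \<omega>, T \<omega>)) \<le> expectation (\<lambda>\<omega>. h (B \<omega>, Y \<omega>))"
      if h: "continuous_on UNIV h" and H: "\<And>z. \<bar>h z\<bar> \<le> H" for h :: "'b \<times> 'a \<Rightarrow> real" and H
    proof -
      have [measurable]: "h \<in> borel_measurable borel" using h by (rule borel_measurable_continuous_onI)
      have hb: "continuous_on S (\<lambda>y. h (b, y))" for b
        by (rule continuous_on_compose2[OF h]) (auto intro!: continuous_intros)
      define \<epsilon> where "\<epsilon> n = inverse (real (Suc n))" for n
      have e0: "0 < \<epsilon> n" "\<epsilon> n \<le> 1" for n by (auto simp: \<epsilon>_def inverse_le_1_iff)
      \<comment> \<open>The perturbed potential is only continuous in y, hence not admissible. The
        competitor is its transform, and transforming once more gives at most \<open>p\<close>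
        itself, which is enough for an upper bound on J.\<close>
      define p where "p n b y = \<psi> b y + \<epsilon> n * h (b, y)" for n b y
      have pc: "continuous_on S (p n b)" for n b unfolding p_def
        by (intro continuous_intros lip_continuous adm_lip psi hb)
      have pR: "\<bar>p n b y\<bar> \<le> R' + H" if "y \<in> S" for n b y
      proof -
        have "\<bar>\<epsilon> n * h (b, y)\<bar> \<le> 1 * H" unfolding abs_mult using e0[of n] H by (intro mult_mono) auto
        then show ?thesis using R'[OF that, of b] unfolding p_def by linarith
      qed
      have padm: "adm (\<lambda>b. tr (p n b))" for n
      proof (rule adm_tr[OF pc _ pR])
        fix y assume y: "y \<in> S"
        have [measurable]: "(\<lambda>b. \<psi> b y) \<in> borel_measurable borel" using psi y by (simp add: adm_def)
        have [measurable]: "(\<lambda>b. (b, y)) \<in> borel \<rightarrow>\<^sub>M borel"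
          by (intro borel_measurable_continuous_onI continuous_intros)
        show "(\<lambda>b. p n b y) \<in> borel_measurable borel" unfolding p_def by measurable
      qed
      have bp[measurable]: "(\<lambda>\<omega>. (B \<omega>, Y \<omega>)) \<in> borel_measurable P" "(\<lambda>\<omega>. (B \<omega>, T \<omega>)) \<in> borel_measurable P"
        unfolding borel_prod[symmetric] by measurable
      have int_h: "integrable P (\<lambda>\<omega>. h (B \<omega>, Y \<omega>))" "integrable P (\<lambda>\<omega>. h (B \<omega>, T \<omega>))"
        using H by (auto intro!: integrable_const_bound[of _ H])
      define q where "q n \<omega> = (tr (p n (B \<omega>)) (X \<omega>) - tr (\<psi> (B \<omega>)) (X \<omega>)) / \<epsilon> n" for n \<omega>
      have q_int: "integrable P (q n)" for n
        unfolding q_def[abs_def] by (intro integrable_divide Bochner_Integration.integrable_diff adm_int_X padm g)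
      have qE: "- expectation (\<lambda>\<omega>. h (B \<omega>, Y \<omega>)) \<le> expectation (q n)" for n
      proof -
        have "A + C \<le> J (\<lambda>b. tr (p n b))" by (rule AC[OF padm])
        also have "\<dots> = expectation (\<lambda>\<omega>. tr (p n (B \<omega>)) (X \<omega>)) + expectation (\<lambda>\<omega>. tr (tr (p n (B \<omega>))) (Y \<omega>))"
          by (rule J_split[OF padm])
        also have "expectation (\<lambda>\<omega>. tr (tr (p n (B \<omega>))) (Y \<omega>)) \<le> expectation (\<lambda>\<omega>. \<psi> (B \<omega>) (Y \<omega>) + \<epsilon> n * h (B \<omega>, Y \<omega>))"
        proof (rule integral_mono)
          show "integrable P (\<lambda>\<omega>. tr (tr (p n (B \<omega>))) (Y \<omega>))" by (rule adm_int_Y[OF adm_tr'[OF padm]])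
          show "integrable P (\<lambda>\<omega>. \<psi> (B \<omega>) (Y \<omega>) + \<epsilon> n * h (B \<omega>, Y \<omega>))"
            by (intro Bochner_Integration.integrable_add adm_int_Y psi integrable_mult_right int_h)
          fix \<omega> assume "\<omega> \<in> space P"
          then have "tr (tr (p n (B \<omega>))) (Y \<omega>) \<le> p n (B \<omega>) (Y \<omega>)" using tr_tr_le[of "p n (B \<omega>)" "R' + H"] pR YS by blast
          then show "tr (tr (p n (B \<omega>))) (Y \<omega>) \<le> \<psi> (B \<omega>) (Y \<omega>) + \<epsilon> n * h (B \<omega>, Y \<omega>)" by (simp add: p_def)
        qed
        also have "\<dots> = C + \<epsilon> n * expectation (\<lambda>\<omega>. h (B \<omega>, Y \<omega>))"
          unfolding C_def using adm_int_Y[OF psi] int_h by simp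
        finally have "- expectation (\<lambda>\<omega>. h (B \<omega>, Y \<omega>)) * \<epsilon> n \<le> expectation (\<lambda>\<omega>. tr (p n (B \<omega>)) (X \<omega>)) - A"
          by (simp add: algebra_simps)
        then have "- expectation (\<lambda>\<omega>. h (B \<omega>, Y \<omega>)) \<le> (expectation (\<lambda>\<omega>. tr (p n (B \<omega>)) (X \<omega>)) - A) / \<epsilon> n"
          using e0(1)[of n] by (simp add: pos_le_divide_eq)
        also have "\<dots> = expectation (q n)"
          unfolding q_def[abs_def] A_def using adm_int_X[OF padm] adm_int_X[OF g] by simp
        finally show ?thesis .
      qed
      have "(\<lambda>n. expectation (q n)) \<longlonglongrightarrow> expectation (\<lambda>\<omega>. - h (B \<omega>, T \<omega>))"
      proof (rule integral_dominated_convergence[where w="\<lambda>_. H"])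
        have 1: "AE \<omega> in P. (\<lambda>n. q n \<omega>) \<longlonglongrightarrow> - h (B \<omega>, T \<omega>) \<and> (\<forall>n. \<bar>q n \<omega>\<bar> \<le> H)"
          using uq AE_space
        proof eventually_elim
          case (elim \<omega>)
          then have T: "T \<omega> \<in> S" and x: "X \<omega> \<in> S" using XS by auto
          have c1: "tr (\<psi> (B \<omega>)) (X \<omega>) = - c (X \<omega>) (T \<omega>) - \<psi> (B \<omega>) (T \<omega>)"
            and c2: "\<And>y. y \<in> S \<Longrightarrow> tr (\<psi> (B \<omega>)) (X \<omega>) = - c (X \<omega>) y - \<psi> (B \<omega>) y \<Longrightarrow> y = T \<omega>"
            using elim(1) T by auto
          note * = tr_perturb_tendsto[OF adm_lip[OF psi] hb H x T c1 c2]
          show ?case unfolding q_def p_def \<epsilon>_def using * by blast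
        qed
        then show "AE \<omega> in P. (\<lambda>n. q n \<omega>) \<longlonglongrightarrow> - h (B \<omega>, T \<omega>)" by eventually_elim simp
        show "AE \<omega> in P. norm (q n \<omega>) \<le> H" for n using 1 by eventually_elim simp
      qed (use q_int in auto)
      then have "- expectation (\<lambda>\<omega>. h (B \<omega>, Y \<omega>)) \<le> expectation (\<lambda>\<omega>. - h (B \<omega>, T \<omega>))"
        by (rule tendsto_lowerbound) (use qE in auto)
      then show ?thesis by simp
    qed
    have bp[measurable]: "(\<lambda>\<omega>. (B \<omega>, Y \<omega>)) \<in> borel_measurable P" "(\<lambda>\<omega>. (B \<omega>, T \<omega>)) \<in> borel_measurable P"
      unfolding borel_prod[symmetric] by measurable
    show "distr P borel (\<lambda>\<omega>. (B \<omega>, T \<omega>)) = distr P borel (\<lambda>\<omega>. (B \<omega>, Y \<omega>))"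
    proof (rule borel_measure_eqI_infdist)
      show "finite_measure (distr P borel (\<lambda>\<omega>. (B \<omega>, T \<omega>)))" "finite_measure (distr P borel (\<lambda>\<omega>. (B \<omega>, Y \<omega>)))"
        by (auto intro!: finite_measure_distr)
      fix F :: "('b \<times> 'a) set" and n :: nat assume F: "closed F" "F \<noteq> {}"
      let ?h = "\<lambda>z. max 0 (1 - real n * infdist z F)"
      have c: "continuous_on UNIV ?h" by (intro continuous_intros)
      have c': "continuous_on UNIV (\<lambda>z. - ?h z)" by (intro continuous_intros)
      have b: "\<bar>?h z\<bar> \<le> 1" "\<bar>- ?h z\<bar> \<le> 1" for z using infdist_nonneg[of z F] by (auto simp: max_def)
      have "expectation (\<lambda>\<omega>. ?h (B \<omega>, T \<omega>)) = expectation (\<lambda>\<omega>. ?h (B \<omega>, Y \<omega>))"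
        using var[OF c b(1)] var[OF c' b(2)] by simp
      moreover have [measurable]: "?h \<in> borel_measurable borel" using c by (rule borel_measurable_continuous_onI)
      ultimately show "(\<integral>z. ?h z \<partial>distr P borel (\<lambda>\<omega>. (B \<omega>, T \<omega>))) = (\<integral>z. ?h z \<partial>distr P borel (\<lambda>\<omega>. (B \<omega>, Y \<omega>)))"
        by (subst (1 2) integral_distr) auto
    qed simp_all
  qed
qed

end

subsection \<open>Supports and finite sums of measures\<close>

lemma AE_measure_support:
  fixes M :: "'a::second_countable_topology measure"
  assumes sets: "sets M = sets borel"
  shows "AE x in M. x \<in> measure_support M"
proof -
  obtain B :: "'a set set" where B: "countable B" "topological_basis B" using ex_countable_basis by blast
  define N where "N = \<Union>{b \<in> B. emeasure M b = 0}"
  have "N \<in> null_sets M" unfolding N_def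
  proof (rule null_sets_UN'[of _ "\<lambda>x. x", simplified])
    show "countable {b \<in> B. emeasure M b = 0}" using B(1) by (rule countable_subset[rotated]) auto
    fix b assume "b \<in> {b \<in> B. emeasure M b = 0}"
    then show "b \<in> null_sets M" using topological_basis_open[OF B(2), of b] sets by (auto simp: null_sets_def)
  qed
  then show ?thesis
  proof (rule AE_I', intro subsetI)
    fix x assume "x \<in> {x \<in> space M. x \<notin> measure_support M}"
    then obtain U where U: "open U" "x \<in> U" "emeasure M U = 0" by (auto simp: measure_support_def not_less)
    obtain b where b: "b \<in> B" "x \<in> b" "b \<subseteq> U" using topological_basisE[OF B(2) U(1,2)] by blast
    have "emeasure M b \<le> emeasure M U" using b(3) U(1) sets by (intro emeasure_mono) auto
    then show "x \<in> N" using b U(3) by (auto simp: N_def)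
  qed
qed

lemma closed_measure_support: "closed (measure_support M)"
proof -
  have "- measure_support M = \<Union>{U. open U \<and> emeasure M U = 0}"
    by (auto simp: measure_support_def not_less)
  then show ?thesis by (simp add: closed_def open_Union)
qed

text \<open>Finite sums serve to build competing plans: the rerouted plan in
  \<open>cyc_mono_of_optimal\<close> and the mixtures in \<open>lin_value_optimal\<close>.\<close>

definition msum :: "'i set \<Rightarrow> ('i \<Rightarrow> 'a::topological_space measure) \<Rightarrow> 'a measure" where
  "msum I M = measure_of UNIV (sets borel) (\<lambda>A. \<Sum>i\<in>I. emeasure (M i) A)"

lemma sets_msum[simp]: "sets (msum I M) = sets borel" and space_msum[simp]: "space (msum I M) = UNIV"
  unfolding msum_def by (simp_all add: sets.sigma_sets_eq[of borel, simplified])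

lemma emeasure_msum:
  assumes M: "\<And>i. i \<in> I \<Longrightarrow> sets (M i) = sets borel" and A: "A \<in> sets borel"
  shows "emeasure (msum I M) A = (\<Sum>i\<in>I. emeasure (M i) A)"
proof (rule emeasure_measure_of[OF msum_def])
  show "positive (sets (msum I M)) (\<lambda>A. \<Sum>i\<in>I. emeasure (M i) A)" by (simp add: positive_def)
  show "countably_additive (sets (msum I M)) (\<lambda>A. \<Sum>i\<in>I. emeasure (M i) A)"
  proof (rule countably_additiveI)
    fix A :: "nat \<Rightarrow> 'b set" assume A: "range A \<subseteq> sets (msum I M)" "disjoint_family A" "\<Union> (range A) \<in> sets (msum I M)"
    have "(\<Sum>n. \<Sum>i\<in>I. emeasure (M i) (A n)) = (\<Sum>i\<in>I. \<Sum>n. emeasure (M i) (A n))"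
      by (intro suminf_sum summableI)
    also have "\<dots> = (\<Sum>i\<in>I. emeasure (M i) (\<Union> (range A)))"
      using A M by (intro sum.cong refl suminf_emeasure) auto
    finally show "(\<Sum>n. \<Sum>i\<in>I. emeasure (M i) (A n)) = (\<Sum>i\<in>I. emeasure (M i) (\<Union> (range A)))" .
  qed
qed (use A in \<open>auto simp: sets.space_closed[of borel, simplified]\<close>)

lemma nn_integral_msum:
  assumes M: "\<And>i. i \<in> I \<Longrightarrow> sets (M i) = sets borel" and f: "f \<in> borel_measurable borel"
  shows "(\<integral>\<^sup>+ x. f x \<partial>msum I M) = (\<Sum>i\<in>I. \<integral>\<^sup>+ x. f x \<partial>M i)"
  using f
proof (induction rule: borel_measurable_induct)
  case (cong f g)
  then have "f = g" by auto
  with cong show ?case by simp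
next
  case (set A)
  then show ?case using M by (simp add: emeasure_msum)
next
  case (mult u c)
  have "u \<in> borel_measurable (M i)" if "i \<in> I" for i using mult(2) M[OF that] by (simp cong: measurable_cong_sets)
  moreover have "u \<in> borel_measurable (msum I M)" using mult(2) by (simp cong: measurable_cong_sets)
  ultimately show ?case using mult by (simp add: nn_integral_cmult sum_distrib_left)
next
  case (add u v)
  have "u \<in> borel_measurable (M i)" "v \<in> borel_measurable (M i)" if "i \<in> I" for i
    using add.hyps M[OF that] by (simp_all cong: measurable_cong_sets)
  moreover have "u \<in> borel_measurable (msum I M)" "v \<in> borel_measurable (msum I M)"
    using add.hyps by (simp_all cong: measurable_cong_sets)
  ultimately show ?case using add by (simp add: nn_integral_add sum.distrib)
next
  case (seq U)
  have m: "U n \<in> borel_measurable (M i)" if "i \<in> I" for i n using seq(1) M[OF that] by (simp cong: measurable_cong_sets)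
  have m': "U n \<in> borel_measurable (msum I M)" for n using seq(1) by (simp cong: measurable_cong_sets)
  have lim: "(\<lambda>n. \<integral>\<^sup>+ x. U n x \<partial>N) \<longlonglongrightarrow> (\<integral>\<^sup>+ x. (SUP n. U n x) \<partial>N)" if "\<And>n. U n \<in> borel_measurable N" for N
  proof -
    have "(\<lambda>n. \<integral>\<^sup>+ x. U n x \<partial>N) \<longlonglongrightarrow> (SUP n. \<integral>\<^sup>+ x. U n x \<partial>N)"
      by (intro LIMSEQ_SUP monoI nn_integral_mono) (use seq(3) in \<open>auto simp: incseq_def le_fun_def\<close>)
    then show ?thesis using nn_integral_monotone_convergence_SUP[OF seq(3) that] by simp
  qed
  have "(\<lambda>n. \<integral>\<^sup>+ x. U n x \<partial>msum I M) \<longlonglongrightarrow> (\<Sum>i\<in>I. \<integral>\<^sup>+ x. (SUP n. U n x) \<partial>M i)"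
    by (simp only: seq.IH) (intro tendsto_sum lim m)
  then show ?case using LIMSEQ_unique[OF lim[OF m']] by (simp add: image_comp)
qed

lemma integral_msum:
  fixes f :: "'a::topological_space \<Rightarrow> real"
  assumes I: "finite I" and M: "\<And>i. i \<in> I \<Longrightarrow> sets (M i) = sets borel" and f: "f \<in> borel_measurable borel"
    and int: "\<And>i. i \<in> I \<Longrightarrow> integrable (M i) f"
  shows "integrable (msum I M) f" "(\<integral>x. f x \<partial>msum I M) = (\<Sum>i\<in>I. \<integral>x. f x \<partial>M i)"
proof -
  have fin: "(\<integral>\<^sup>+ x. ennreal (norm (f x)) \<partial>M i) < \<infinity>" if "i \<in> I" for i
    using int[OF that] by (simp add: integrable_iff_bounded)
  have [measurable]: "f \<in> borel_measurable (msum I M)" using f by (simp cong: measurable_cong_sets)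
  show i: "integrable (msum I M) f"
    unfolding integrable_iff_bounded
    using fin I f by (subst nn_integral_msum[OF M]) auto
  have le: "(\<integral>\<^sup>+ x. ennreal (f x) \<partial>M i) < \<infinity>" "(\<integral>\<^sup>+ x. ennreal (- f x) \<partial>M i) < \<infinity>" if "i \<in> I" for i
    by (rule le_less_trans[OF nn_integral_mono fin[OF that]]; auto intro!: ennreal_leI)+
  have "(\<integral>x. f x \<partial>msum I M) = enn2real (\<Sum>i\<in>I. \<integral>\<^sup>+ x. ennreal (f x) \<partial>M i) - enn2real (\<Sum>i\<in>I. \<integral>\<^sup>+ x. ennreal (- f x) \<partial>M i)"
    using f by (simp add: real_lebesgue_integral_def[OF i] nn_integral_msum M)
  also have "\<dots> = (\<Sum>i\<in>I. enn2real (\<integral>\<^sup>+ x. ennreal (f x) \<partial>M i)) - (\<Sum>i\<in>I. enn2real (\<integral>\<^sup>+ x. ennreal (- f x) \<partial>M i))"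
    using le by (subst (1 2) enn2real_sum) auto
  also have "\<dots> = (\<Sum>i\<in>I. \<integral>x. f x \<partial>M i)"
    using int by (simp add: real_lebesgue_integral_def sum_subtractf)
  finally show "(\<integral>x. f x \<partial>msum I M) = (\<Sum>i\<in>I. \<integral>x. f x \<partial>M i)" .
qed

subsection \<open>Potentials of cyclically monotone sets\<close>

text \<open>Here \<kappa> is a gain to be maximized, so a cyclic shift of partners must not increase
  the sum.\<close>

definition cyc_mono :: "('x \<Rightarrow> 'y \<Rightarrow> real) \<Rightarrow> ('x \<times> 'y) set \<Rightarrow> bool" where
  "cyc_mono \<kappa> \<Gamma> \<longleftrightarrow> (\<forall>m x y. (\<forall>i<m. (x i, y i) \<in> \<Gamma>) \<longrightarrow>
     (\<Sum>i<m. \<kappa> (x (Suc i mod m)) (y i)) \<le> (\<Sum>i<m. \<kappa> (x i) (y i)))"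

lemma cyc_mono_image:
  assumes "cyc_mono \<kappa> \<Gamma>" and eq: "\<And>x y x' y'. (x, y) \<in> \<Gamma> \<Longrightarrow> (x', y') \<in> \<Gamma> \<Longrightarrow> \<kappa> x' y = \<kappa>' (p x') (q y)"
  shows "cyc_mono \<kappa>' ((\<lambda>(x, y). (p x, q y)) ` \<Gamma>)"
  unfolding cyc_mono_def
proof (intro allI impI)
  fix m :: nat and x y assume *: "\<forall>i<m. (x i, y i) \<in> (\<lambda>(x, y). (p x, q y)) ` \<Gamma>"
  have "\<exists>u v. i < m \<longrightarrow> (u, v) \<in> \<Gamma> \<and> x i = p u \<and> y i = q v" for i
  proof (cases "i < m")
    case True
    then have "(x i, y i) \<in> (\<lambda>(x, y). (p x, q y)) ` \<Gamma>" using * by blast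
    then obtain w where "w \<in> \<Gamma>" "(x i, y i) = (\<lambda>(x, y). (p x, q y)) w" by blast
    then show ?thesis by (cases w) auto
  qed simp
  then obtain u v where uv: "\<And>i. i < m \<Longrightarrow> (u i, v i) \<in> \<Gamma> \<and> x i = p (u i) \<and> y i = q (v i)" by metis
  have "(\<Sum>i<m. \<kappa> (u (Suc i mod m)) (v i)) \<le> (\<Sum>i<m. \<kappa> (u i) (v i))"
    using assms(1) uv unfolding cyc_mono_def by blast
  moreover have "(\<Sum>i<m. \<kappa> (u (Suc i mod m)) (v i)) = (\<Sum>i<m. \<kappa>' (x (Suc i mod m)) (y i))"
  proof (intro sum.cong refl)
    fix i assume "i \<in> {..<m}"
    then have "i < m" "Suc i mod m < m" by auto
    then show "\<kappa> (u (Suc i mod m)) (v i) = \<kappa>' (x (Suc i mod m)) (y i)" using uv eq by metis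
  qed
  moreover have "(\<Sum>i<m. \<kappa> (u i) (v i)) = (\<Sum>i<m. \<kappa>' (x i) (y i))"
    using uv eq by (intro sum.cong refl) (metis lessThan_iff)
  ultimately show "(\<Sum>i<m. \<kappa>' (x (Suc i mod m)) (y i)) \<le> (\<Sum>i<m. \<kappa>' (x i) (y i))" by simp
qed

text \<open>Rockafellar's construction: \<open>V z\<close> collects the gains along chains in
  \<Gamma> that lead from x0 to z, and the potential is its supremum. Closed chains have gain at
  most 0 by cyclic monotonicity; returning to x0 from a point of the projection therefore bounds the
  gains collected there.\<close>

lemma cyc_mono_potential_on:
  assumes cyc: "cyc_mono \<kappa> \<Gamma>" and xy0: "(x0, y0) \<in> \<Gamma>"
  obtains \<phi> where "\<And>x y x' y'. (x, y) \<in> \<Gamma> \<Longrightarrow> (x', y') \<in> \<Gamma> \<Longrightarrow> \<phi> x + \<kappa> x' y - \<kappa> x y \<le> (\<phi> x' :: real)"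
proof -
  define V where "V z = {v. \<exists>m x y. v = (\<Sum>i<m. \<kappa> (x (Suc i)) (y i) - \<kappa> (x i) (y i)) \<and>
    x 0 = x0 \<and> x m = z \<and> (\<forall>i<m. (x i, y i) \<in> \<Gamma>)}" for z
  have step: "v + (\<kappa> x' y - \<kappa> x y) \<in> V x'" if v: "v \<in> V x" and xy: "(x, y) \<in> \<Gamma>" for v x y x'
  proof -
    obtain m u w where m: "v = (\<Sum>i<m. \<kappa> (u (Suc i)) (w i) - \<kappa> (u i) (w i))" "u 0 = x0" "u m = x" "\<forall>i<m. (u i, w i) \<in> \<Gamma>"
      using v unfolding V_def by blast
    define u' where "u' = u(Suc m := x')"
    define w' where "w' = w(m := y)"
    have "(\<Sum>i<m. \<kappa> (u' (Suc i)) (w' i) - \<kappa> (u' i) (w' i)) = v"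
      unfolding m(1) u'_def w'_def by (intro sum.cong) auto
    then have "v + (\<kappa> x' y - \<kappa> x y) = (\<Sum>i<Suc m. \<kappa> (u' (Suc i)) (w' i) - \<kappa> (u' i) (w' i))"
      using m(3) by (simp add: u'_def w'_def)
    moreover have "u' 0 = x0" "u' (Suc m) = x'" "\<forall>i<Suc m. (u' i, w' i) \<in> \<Gamma>"
      using m xy by (auto simp: u'_def w'_def less_Suc_eq)
    ultimately show ?thesis unfolding V_def by blast
  qed
  have closed_le: "v \<le> 0" if v0: "v \<in> V x0" for v
  proof -
    obtain m x y where m: "v = (\<Sum>i<m. \<kappa> (x (Suc i)) (y i) - \<kappa> (x i) (y i))" "x 0 = x0" "x m = x0" "\<forall>i<m. (x i, y i) \<in> \<Gamma>"
      using v0 unfolding V_def by blast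
    have "x (Suc i mod m) = x (Suc i)" if "i < m" for i
      using that m(2,3) by (cases "Suc i = m") auto
    then have "(\<Sum>i<m. \<kappa> (x (Suc i)) (y i)) = (\<Sum>i<m. \<kappa> (x (Suc i mod m)) (y i))" by (intro sum.cong) auto
    also have "\<dots> \<le> (\<Sum>i<m. \<kappa> (x i) (y i))" using cyc m(4) unfolding cyc_mono_def by blast
    finally show ?thesis by (simp add: m(1) sum_subtractf)
  qed
  have zero: "0 \<in> V x0" unfolding V_def by (auto intro!: exI[of _ "0::nat"] exI[of _ "\<lambda>_. x0"])
  have ne: "V z \<noteq> {}" for z using step[OF zero xy0] by blast
  have bdd: "bdd_above (V x)" if xy: "(x, y) \<in> \<Gamma>" for x y
  proof (rule bdd_aboveI)
    fix v assume "v \<in> V x"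
    from closed_le[OF step[OF this xy, of x0]] show "v \<le> \<kappa> x y - \<kappa> x0 y" by simp
  qed
  show ?thesis
  proof (rule that[of "\<lambda>z. Sup (V z)"])
    fix x y x' y' assume xy: "(x, y) \<in> \<Gamma>" "(x', y') \<in> \<Gamma>"
    have "Sup (V x) \<le> Sup (V x') - (\<kappa> x' y - \<kappa> x y)"
    proof (rule cSup_least[OF ne])
      fix v assume "v \<in> V x"
      from cSup_upper[OF step[OF this xy(1), of x'] bdd[OF xy(2)]]
      show "v \<le> Sup (V x') - (\<kappa> x' y - \<kappa> x y)" by simp
    qed
    then show "Sup (V x) + \<kappa> x' y - \<kappa> x y \<le> Sup (V x')" by simp
  qed
qed

text \<open>The potential is continued beyond the projection of \<Gamma> by the supremum that it
  satisfies there. Having F everywhere as such a supremum is what makes it convex or c-convex in the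
  applications.\<close>

lemma cyc_mono_potential:
  fixes \<kappa> :: "'x \<Rightarrow> 'y \<Rightarrow> real"
  assumes cyc: "cyc_mono \<kappa> \<Gamma>" and ne: "\<Gamma> \<noteq> {}" and bd: "\<And>z. bounded (\<kappa> z ` snd ` \<Gamma>)"
  obtains F where "\<And>x y z. (x, y) \<in> \<Gamma> \<Longrightarrow> F x + \<kappa> z y - \<kappa> x y \<le> F z"
    "\<And>z. F z = (SUP p\<in>\<Gamma>. F (fst p) + \<kappa> z (snd p) - \<kappa> (fst p) (snd p))"
    "\<And>z. bdd_above ((\<lambda>p. F (fst p) + \<kappa> z (snd p) - \<kappa> (fst p) (snd p)) ` \<Gamma>)"
proof -
  obtain x0 y0 where xy0: "(x0, y0) \<in> \<Gamma>" using ne by auto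
  obtain \<phi> where phi: "\<And>x y x' y'. (x, y) \<in> \<Gamma> \<Longrightarrow> (x', y') \<in> \<Gamma> \<Longrightarrow> \<phi> x + \<kappa> x' y - \<kappa> x y \<le> \<phi> x'"
    using cyc_mono_potential_on[OF cyc xy0] by blast
  define F where "F z = (SUP p\<in>\<Gamma>. \<phi> (fst p) + \<kappa> z (snd p) - \<kappa> (fst p) (snd p))" for z
  have bdd: "bdd_above ((\<lambda>p. \<phi> (fst p) + \<kappa> z (snd p) - \<kappa> (fst p) (snd p)) ` \<Gamma>)" for z
  proof -
    obtain a where a: "\<And>y. y \<in> snd ` \<Gamma> \<Longrightarrow> \<bar>\<kappa> z y\<bar> \<le> a" using bd[of z] unfolding bounded_iff by auto
    obtain b where b: "\<And>y. y \<in> snd ` \<Gamma> \<Longrightarrow> \<bar>\<kappa> x0 y\<bar> \<le> b" using bd[of x0] unfolding bounded_iff by auto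
    show ?thesis
    proof (rule bdd_aboveI2)
      fix p assume p: "p \<in> \<Gamma>"
      then have s: "snd p \<in> snd ` \<Gamma>" by simp
      show "\<phi> (fst p) + \<kappa> z (snd p) - \<kappa> (fst p) (snd p) \<le> \<phi> x0 + a + b"
        using phi[of "fst p" "snd p" x0 y0] p xy0 a[OF s] b[OF s] by simp
    qed
  qed
  have F\<phi>: "F (fst p) = \<phi> (fst p)" if p: "p \<in> \<Gamma>" for p
  proof (rule antisym)
    show "F (fst p) \<le> \<phi> (fst p)" unfolding F_def
    proof (rule cSUP_least[OF ne])
      fix q assume "q \<in> \<Gamma>"
      then show "\<phi> (fst q) + \<kappa> (fst p) (snd q) - \<kappa> (fst q) (snd q) \<le> \<phi> (fst p)"
        using phi[of "fst q" "snd q" "fst p" "snd p"] p by simp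
    qed
    show "\<phi> (fst p) \<le> F (fst p)" using cSUP_upper[OF p bdd[of "fst p"]] by (simp add: F_def)
  qed
  have eq: "(\<lambda>p. F (fst p) + \<kappa> z (snd p) - \<kappa> (fst p) (snd p)) ` \<Gamma> = (\<lambda>p. \<phi> (fst p) + \<kappa> z (snd p) - \<kappa> (fst p) (snd p)) ` \<Gamma>" for z
    using F\<phi> by auto
  show ?thesis
  proof (rule that[of F])
    show bd': "bdd_above ((\<lambda>p. F (fst p) + \<kappa> z (snd p) - \<kappa> (fst p) (snd p)) ` \<Gamma>)" for z unfolding eq by (rule bdd)
    show F: "F z = (SUP p\<in>\<Gamma>. F (fst p) + \<kappa> z (snd p) - \<kappa> (fst p) (snd p))" for z
      unfolding eq by (simp add: F_def)
    show "F x + \<kappa> z y - \<kappa> x y \<le> F z" if "(x, y) \<in> \<Gamma>" for x y z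
      using cSUP_upper[OF that bd'[of z]] by (simp add: F[of z])
  qed
qed

lemma convex_on_SUP:
  fixes f :: "'i \<Rightarrow> 'a::real_vector \<Rightarrow> real"
  assumes I: "I \<noteq> {}" and f: "\<And>i. i \<in> I \<Longrightarrow> convex_on UNIV (f i)" and bdd: "\<And>z. bdd_above ((\<lambda>i. f i z) ` I)"
  shows "convex_on UNIV (\<lambda>z. SUP i\<in>I. f i z)"
proof (rule convex_onI)
  fix t :: real and x y assume t: "0 < t" "t < 1"
  show "(SUP i\<in>I. f i ((1 - t) *\<^sub>R x + t *\<^sub>R y)) \<le> (1 - t) * (SUP i\<in>I. f i x) + t * (SUP i\<in>I. f i y)"
  proof (rule cSUP_least[OF I])
    fix i assume i: "i \<in> I"
    have "f i ((1 - t) *\<^sub>R x + t *\<^sub>R y) \<le> (1 - t) * f i x + t * f i y"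
      using convex_onD[OF f[OF i], of t x y] t by simp
    also have "\<dots> \<le> (1 - t) * (SUP i\<in>I. f i x) + t * (SUP i\<in>I. f i y)"
      using t cSUP_upper[OF i bdd[of x]] cSUP_upper[OF i bdd[of y]] by (intro add_mono mult_left_mono) auto
    finally show "f i ((1 - t) *\<^sub>R x + t *\<^sub>R y) \<le> (1 - t) * (SUP i\<in>I. f i x) + t * (SUP i\<in>I. f i y)" .
  qed
qed simp

subsection \<open>Optimal couplings have cyclically monotone support\<close>

lemma couplingsD:
  assumes "\<pi> \<in> couplings \<mu> \<nu>"
  shows "prob_space \<pi>" "sets \<pi> = sets borel" "space \<pi> = UNIV" "distr \<pi> borel fst = \<mu>" "distr \<pi> borel snd = \<nu>"
    "fst \<in> borel_measurable \<pi>" "snd \<in> borel_measurable \<pi>" "sets \<mu> = sets borel" "sets \<nu> = sets borel"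
proof -
  show s: "prob_space \<pi>" "sets \<pi> = sets borel" "distr \<pi> borel fst = \<mu>" "distr \<pi> borel snd = \<nu>"
    using assms by (auto simp: couplings_def borel_prob_def)
  show "space \<pi> = UNIV" using sets_eq_imp_space_eq[OF s(2)] by simp
  have "fst \<in> borel_measurable (borel :: ('a \<times> 'b) measure)" "snd \<in> borel_measurable (borel :: ('a \<times> 'b) measure)"
    by (auto intro!: borel_measurable_continuous_onI continuous_intros)
  then show "fst \<in> borel_measurable \<pi>" "snd \<in> borel_measurable \<pi>" using measurable_cong_sets[OF s(2) refl] by auto
  show "sets \<mu> = sets borel" "sets \<nu> = sets borel" using s(3,4) by auto
qed

lemma couplingsI:
  fixes \<mu> :: "'a::euclidean_space measure" and \<nu> :: "'b::euclidean_space measure"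
  assumes mu: "borel_prob \<mu>" and nu: "borel_prob \<nu>" and sets: "sets \<sigma> = sets borel"
    and 1: "\<And>A. A \<in> sets borel \<Longrightarrow> emeasure \<sigma> (fst -` A) = emeasure \<mu> A"
    and 2: "\<And>A. A \<in> sets borel \<Longrightarrow> emeasure \<sigma> (snd -` A) = emeasure \<nu> A"
  shows "\<sigma> \<in> couplings \<mu> \<nu>"
proof -
  have sp: "space \<sigma> = UNIV" using sets_eq_imp_space_eq[OF sets] by simp
  have m: "fst \<in> borel_measurable \<sigma>" "snd \<in> borel_measurable \<sigma>"
    unfolding measurable_cong_sets[OF sets refl] by (auto intro!: borel_measurable_continuous_onI continuous_intros)
  have "emeasure \<sigma> (fst -` UNIV) = 1"
    using mu prob_space.emeasure_space_1[of \<mu>] sets_eq_imp_space_eq[of \<mu> borel] 1[of UNIV] by (simp add: borel_prob_def)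
  then have "prob_space \<sigma>" using sp by (intro prob_spaceI) simp
  moreover have "distr \<sigma> borel fst = \<mu>"
    by (rule measure_eqI) (use mu 1 m sp in \<open>auto simp: borel_prob_def emeasure_distr\<close>)
  moreover have "distr \<sigma> borel snd = \<nu>"
    by (rule measure_eqI) (use nu 2 m sp in \<open>auto simp: borel_prob_def emeasure_distr\<close>)
  ultimately show ?thesis using sets by (simp add: couplings_def borel_prob_def)
qed

lemma AE_coupling:
  assumes "\<pi> \<in> couplings \<mu> \<nu>"
  shows "AE x in \<mu>. Q x \<Longrightarrow> AE p in \<pi>. Q (fst p)" "AE y in \<nu>. R y \<Longrightarrow> AE p in \<pi>. R (snd p)"
  using AE_distrD[OF couplingsD(6)[OF assms], of Q] AE_distrD[OF couplingsD(7)[OF assms], of R]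
  unfolding couplingsD(4,5)[OF assms] by blast+

text \<open>If shifting partners along a cycle in the support were profitable, it would be so with a
  margin on small boxes around the points. A little mass is taken from \<pi> in each box and the
  first coordinates from box \<open>s i\<close> are coupled with the second coordinates from box i,
  which preserves the marginals and raises the integral.\<close>

lemma cyc_mono_of_optimal:
  fixes \<mu> :: "'a::euclidean_space measure" and \<nu> :: "'b::euclidean_space measure"
  assumes mu: "borel_prob \<mu>" and nu: "borel_prob \<nu>" and pi: "\<pi> \<in> couplings \<mu> \<nu>"
    and cont: "continuous_on UNIV \<kappa>" and bd: "\<And>p. \<bar>\<kappa> p :: real\<bar> \<le> b"
    and opt: "\<And>\<sigma>. \<sigma> \<in> couplings \<mu> \<nu> \<Longrightarrow> (\<integral>p. \<kappa> p \<partial>\<sigma>) \<le> (\<integral>p. \<kappa> p \<partial>\<pi>)"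
  shows "cyc_mono (\<lambda>x y. \<kappa> (x, y)) (measure_support \<pi>)"
  unfolding cyc_mono_def
proof (intro allI impI, rule ccontr)
  fix m :: nat and x y
  assume supp: "\<forall>i<m. (x i, y i) \<in> measure_support \<pi>"
  define s where "s i = Suc i mod m" for i
  assume "\<not> (\<Sum>i<m. \<kappa> (x (Suc i mod m), y i)) \<le> (\<Sum>i<m. \<kappa> (x i, y i))"
  then have gap: "(\<Sum>i<m. \<kappa> (x (s i), y i)) > (\<Sum>i<m. \<kappa> (x i, y i))" by (simp add: s_def)
  then have m: "m > 0" by (auto intro: gr0I)
  interpret prob_space \<pi> using couplingsD(1)[OF pi] .
  note sets_pi = couplingsD(2)[OF pi] and space_pi = couplingsD(3)[OF pi]
  note [measurable] = couplingsD(6,7)[OF pi]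
  have sm: "s i < m" for i using m by (simp add: s_def)
  have bij: "bij_betw s {..<m} {..<m}"
  proof -
    have "inj_on s {..<m}"
    proof (rule inj_onI)
      fix i j assume "i \<in> {..<m}" "j \<in> {..<m}" "s i = s j"
      then show "i = j" by (cases "Suc i = m"; cases "Suc j = m") (auto simp: s_def)
    qed
    moreover have "s ` {..<m} \<subseteq> {..<m}" using sm by auto
    ultimately show ?thesis by (simp add: bij_betw_def endo_inj_surj)
  qed
  define g where "g = (\<Sum>i<m. \<kappa> (x (s i), y i)) - (\<Sum>i<m. \<kappa> (x i, y i))"
  \<comment> \<open>There are 2 m approximations, each with error at most \<eta>, which together
    consume half of the gap g.\<close>
  define \<eta> where "\<eta> = g / (4 * real m)"
  have \<eta>: "\<eta> > 0" using gap m by (simp add: \<eta>_def g_def)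
  have "\<exists>r>0. \<forall>p. dist p q < r \<longrightarrow> \<bar>\<kappa> p - \<kappa> q\<bar> < \<eta>" for q
    using cont \<eta> unfolding continuous_on_iff dist_real_def by (metis UNIV_I)
  then obtain r where r: "\<And>q. r q > 0" "\<And>p q. dist p q < r q \<Longrightarrow> \<bar>\<kappa> p - \<kappa> q\<bar> < \<eta>" by metis
  \<comment> \<open>Half of the smallest radius, since the distance in the product is bounded by the
    sum of the two coordinate distances. Both the old pairs and the shifted pairs have to be
    controlled.\<close>
  define \<rho> where "\<rho> = Min ((\<lambda>i. r (x i, y i)) ` {..<m} \<union> (\<lambda>i. r (x (s i), y i)) ` {..<m}) / 2"
  have fin: "finite ((\<lambda>i. r (x i, y i)) ` {..<m} \<union> (\<lambda>i. r (x (s i), y i)) ` {..<m})" by simp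
  have \<rho>0: "\<rho> > 0" using r(1) m unfolding \<rho>_def by (subst zero_less_divide_iff, subst Min_gr_iff) auto
  have \<rho>: "2 * \<rho> \<le> r (x i, y i)" "2 * \<rho> \<le> r (x (s i), y i)" if "i < m" for i
    using that unfolding \<rho>_def by (auto intro!: Min_le)
  define U where "U i = ball (x i) \<rho>" for i
  define V where "V i = ball (y i) \<rho>" for i
  have near: "\<bar>\<kappa> p - \<kappa> (a, c)\<bar> < \<eta>" if "fst p \<in> ball a \<rho>" "snd p \<in> ball c \<rho>" "2 * \<rho> \<le> r (a, c)" for p a c
  proof -
    have "dist p (a, c) \<le> dist (fst p) a + dist (snd p) c"
      using sqrt_sum_squares_le_sum[of "dist (fst p) a" "dist (snd p) c"] dist_Pair_Pair[of "fst p" "snd p" a c] by simp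
    also have "\<dots> < r (a, c)" using that by (simp add: dist_commute)
    finally show ?thesis by (rule r(2))
  qed
  define W where "W i = U i \<times> V i" for i
  have W_open: "open (W i)" for i unfolding W_def U_def V_def by (intro open_Times) auto
  then have W_sets[measurable]: "W i \<in> sets \<pi>" for i using sets_pi by auto
  define w where "w i = prob (W i)" for i
  have w0: "w i > 0" if "i < m" for i
  proof -
    have "(x i, y i) \<in> W i" using \<rho>0 by (simp add: W_def U_def V_def)
    then have "emeasure \<pi> (W i) > 0" using supp that W_open[of i] unfolding measure_support_def by blast
    then show ?thesis by (simp add: w_def emeasure_eq_measure)
  qed
  \<comment> \<open>With this choice each of the m boxes removes at most the fraction 1 / m at any
    point, so the remaining density \<open>D\<close> is nonnegative even where boxes
    overlap.\<close>
  define \<epsilon> where "\<epsilon> = Min (w ` {..<m}) / real m"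
  have e0: "\<epsilon> > 0" using w0 m unfolding \<epsilon>_def by (subst zero_less_divide_iff, subst Min_gr_iff) auto
  have ew: "\<epsilon> / w i \<le> 1 / real m" if "i < m" for i
  proof -
    have "Min (w ` {..<m}) \<le> w i" using that by (intro Min_le) auto
    then show ?thesis using w0[OF that] m by (simp add: \<epsilon>_def field_simps)
  qed
  define P where "P i = density \<pi> (\<lambda>p. ennreal (indicator (W i) p / w i))" for i
  have P_int: "(\<integral>p. f p \<partial>P i) = (\<integral>p. indicator (W i) p / w i * f p \<partial>\<pi>)"
    if "f \<in> borel_measurable \<pi>" "i < m" for f :: "'a \<times> 'b \<Rightarrow> real" and i
    using that w0[OF that(2)] unfolding P_def by (subst integral_density) auto
  have sP: "sets (P i) = sets borel" "space (P i) = UNIV" for i by (simp_all add: P_def sets_pi space_pi)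
  have fP: "fst \<in> borel_measurable (P i)" "snd \<in> borel_measurable (P i)" for i by (simp_all add: P_def)
  have P_prob: "prob_space (P i)" if "i < m" for i
  proof (rule prob_spaceI)
    have "emeasure (P i) (space (P i)) = (\<integral>\<^sup>+p. ennreal (1 / w i) * indicator (W i) p \<partial>\<pi>)"
      unfolding P_def by (subst emeasure_density) (auto intro!: nn_integral_cong simp: indicator_def)
    also have "\<dots> = 1" using w0[OF that]
      by (simp add: nn_integral_cmult_indicator emeasure_eq_measure w_def[symmetric] ennreal_mult'[symmetric])
    finally show "emeasure (P i) (space (P i)) = 1" .
  qed
  have AE_W: "AE p in P i. p \<in> W i" if "i < m" for i
    unfolding P_def using w0[OF that] by (subst AE_density) (auto simp: indicator_def)
  \<comment> \<open>Independent coupling of the two marginals. Summed over i the first marginals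
    agree with those of the removed pieces, because s permutes the indices.\<close>
  define Q where "Q i = distr (P (s i)) borel fst \<Otimes>\<^sub>M distr (P i) borel snd" for i
  have sQ: "sets (Q i) = sets borel" "space (Q i) = UNIV" for i
    by (auto simp: Q_def borel_prod[symmetric] space_pair_measure intro!: sets_pair_measure_cong)
  have Qp: "prob_space (distr (P (s i)) borel fst)" "prob_space (distr (P i) borel snd)" if "i < m" for i
    using P_prob[OF that] P_prob[OF sm] fP by (auto intro!: prob_space.prob_space_distr)
  have Q_prob: "prob_space (Q i)" if "i < m" for i
    unfolding Q_def by (rule prob_space_pair[OF Qp[OF that]])
  have Q_rect: "emeasure (Q i) (A \<times> B) = emeasure (P (s i)) (fst -` A) * emeasure (P i) (snd -` B)"
    if "i < m" "A \<in> sets borel" "B \<in> sets borel" for i A B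
  proof -
    interpret p2: prob_space "distr (P i) borel snd" using Qp[OF that(1)] by simp
    have "emeasure (Q i) (A \<times> B) = emeasure (distr (P (s i)) borel fst) A * emeasure (distr (P i) borel snd) B"
      unfolding Q_def using that by (intro p2.emeasure_pair_measure_Times) auto
    then show ?thesis using that fP sP by (simp add: emeasure_distr)
  qed
  have AE_Q: "AE p in Q i. fst p \<in> U (s i) \<and> snd p \<in> V i" if i: "i < m" for i
  proof -
    interpret q: prob_space "Q i" using Q_prob[OF i] .
    interpret ps: prob_space "P (s i)" using P_prob[OF sm] .
    interpret pi: prob_space "P i" using P_prob[OF i] .
    have UV: "U (s i) \<in> sets borel" "V i \<in> sets borel" by (auto simp: U_def V_def)
    have "emeasure (P (s i)) (fst -` U (s i)) = 1"
    proof (rule ps.emeasure_eq_1_AE)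
      show "fst -` U (s i) \<in> sets (P (s i))" using measurable_sets[OF fP(1)[of "s i"] UV(1)] sP by simp
      show "AE p in P (s i). p \<in> fst -` U (s i)" using AE_W[OF sm] by eventually_elim (auto simp: W_def)
    qed
    moreover have "emeasure (P i) (snd -` V i) = 1"
    proof (rule pi.emeasure_eq_1_AE)
      show "snd -` V i \<in> sets (P i)" using measurable_sets[OF fP(2)[of i] UV(2)] sP by simp
      show "AE p in P i. p \<in> snd -` V i" using AE_W[OF i] by eventually_elim (auto simp: W_def)
    qed
    ultimately have 1: "emeasure (Q i) (U (s i) \<times> V i) = 1" using Q_rect[OF i UV] by simp
    have "U (s i) \<times> V i \<in> sets (Q i)" unfolding sQ by (intro borel_open open_Times) (auto simp: U_def V_def)
    then have "AE p in Q i. p \<in> U (s i) \<times> V i" using 1 q.AE_in_set_eq_1 by (simp add: q.emeasure_eq_measure)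
    then show ?thesis by eventually_elim auto
  qed
  define D where "D p = 1 - (\<Sum>i<m. \<epsilon> / w i * indicator (W i) p)" for p
  have D0: "0 \<le> D p" for p
  proof -
    have "(\<Sum>i<m. \<epsilon> / w i * indicator (W i) p) \<le> (\<Sum>i<m. 1 / real m)"
      using ew e0 w0 by (intro sum_mono) (auto simp: indicator_def)
    then show ?thesis using m by (simp add: D_def)
  qed
  have [measurable]: "D \<in> borel_measurable \<pi>" unfolding D_def by measurable
  \<comment> \<open>The indices below m carry the new mass, the index m what is left of
    \<pi>.\<close>
  define M where "M i = (if i < m then density (Q i) (\<lambda>_. ennreal \<epsilon>) else density \<pi> (\<lambda>p. ennreal (D p)))" for i
  have sM: "sets (M i) = sets borel" for i by (simp add: M_def sQ sets_pi)
  define \<sigma> where "\<sigma> = msum {..m} M"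
  have \<sigma>_int: "integrable \<sigma> f" "(\<integral>p. f p \<partial>\<sigma>) = \<epsilon> * (\<Sum>i<m. \<integral>p. f p \<partial>Q i) + (\<integral>p. f p \<partial>\<pi>) - \<epsilon> * (\<Sum>i<m. \<integral>p. f p \<partial>P i)"
    if f: "f \<in> borel_measurable borel" and fb: "\<And>p. \<bar>f p\<bar> \<le> b" for f :: "'a \<times> 'b \<Rightarrow> real" and b
  proof -
    have b0: "0 \<le> b" using fb[of undefined] by simp
    have f1[measurable]: "f \<in> borel_measurable \<pi>" "f \<in> borel_measurable (Q i)" for i
      using f by (simp_all add: measurable_cong_sets[OF sets_pi refl] measurable_cong_sets[OF sQ(1) refl])
    have iQ: "integrable (Q i) f" if "i < m" for i
      using fb prob_space.finite_measure[OF Q_prob[OF that]] by (intro finite_measure.integrable_const_bound[of _ _ b]) auto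
    have iW: "integrable \<pi> (\<lambda>p. indicator (W i) p / w i * f p)" if "i < m" for i
    proof -
      have "\<bar>indicator (W i) p / w i * f p\<bar> \<le> 1 / w i * b" for p
        using fb[of p] w0[OF that] b0 by (auto simp: indicator_def abs_mult divide_right_mono)
      then show ?thesis by (intro integrable_const_bound[of _ "1 / w i * b"]) auto
    qed
    have ipi: "integrable \<pi> f" using fb by (intro integrable_const_bound[of _ b]) auto
    have Df: "D p * f p = f p - (\<Sum>i<m. \<epsilon> * (indicator (W i) p / w i * f p))" for p
      by (simp add: D_def left_diff_distrib sum_distrib_right mult.assoc)
    have iD: "integrable \<pi> (\<lambda>p. D p * f p)" unfolding Df
      by (intro Bochner_Integration.integrable_diff ipi Bochner_Integration.integrable_sum integrable_mult_right iW) auto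
    have eD: "(\<integral>p. D p * f p \<partial>\<pi>) = (\<integral>p. f p \<partial>\<pi>) - \<epsilon> * (\<Sum>i<m. \<integral>p. f p \<partial>P i)"
    proof -
      have iS: "integrable \<pi> (\<lambda>p. \<epsilon> * (indicator (W i) p / w i * f p))" if "i \<in> {..<m}" for i
        using that by (intro integrable_mult_right iW) auto
      have "(\<integral>p. D p * f p \<partial>\<pi>) = (\<integral>p. f p \<partial>\<pi>) - (\<integral>p. (\<Sum>i<m. \<epsilon> * (indicator (W i) p / w i * f p)) \<partial>\<pi>)"
        unfolding Df by (rule Bochner_Integration.integral_diff[OF ipi Bochner_Integration.integrable_sum[OF iS]])
      also have "(\<integral>p. (\<Sum>i<m. \<epsilon> * (indicator (W i) p / w i * f p)) \<partial>\<pi>)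
          = (\<Sum>i<m. \<integral>p. \<epsilon> * (indicator (W i) p / w i * f p) \<partial>\<pi>)"
        by (rule Bochner_Integration.integral_sum[OF iS])
      also have "\<dots> = (\<Sum>i<m. \<epsilon> * (\<integral>p. f p \<partial>P i))"
      proof (intro sum.cong refl)
        fix i assume "i \<in> {..<m}"
        then show "(\<integral>p. \<epsilon> * (indicator (W i) p / w i * f p) \<partial>\<pi>) = \<epsilon> * (\<integral>p. f p \<partial>P i)"
          unfolding lessThan_iff by (subst P_int[OF f1(1)]) (assumption, rule integral_mult_right_zero)
      qed
      finally show ?thesis by (simp only: sum_distrib_left)
    qed
    have iM: "integrable (M i) f" for i
      unfolding M_def using iQ iD D0 e0 by (auto simp: integrable_density)
    have eM: "(\<integral>p. f p \<partial>M i) = \<epsilon> * (\<integral>p. f p \<partial>Q i)" if "i < m" for i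
      using that e0 by (simp add: M_def integral_density)
    have eM': "(\<integral>p. f p \<partial>M m) = (\<integral>p. D p * f p \<partial>\<pi>)"
      using D0 by (simp add: M_def integral_density)
    show "integrable \<sigma> f" unfolding \<sigma>_def by (rule integral_msum[OF _ sM f iM]) simp
    have "(\<integral>p. f p \<partial>\<sigma>) = (\<Sum>i\<le>m. \<integral>p. f p \<partial>M i)" unfolding \<sigma>_def by (rule integral_msum(2)[OF _ sM f iM]) simp
    also have "\<dots> = (\<Sum>i<m. \<integral>p. f p \<partial>M i) + (\<integral>p. f p \<partial>M m)" by (simp add: lessThan_Suc_atMost[symmetric])
    also have "(\<Sum>i<m. \<integral>p. f p \<partial>M i) = \<epsilon> * (\<Sum>i<m. \<integral>p. f p \<partial>Q i)" by (simp add: eM sum_distrib_left)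
    finally show "(\<integral>p. f p \<partial>\<sigma>) = \<epsilon> * (\<Sum>i<m. \<integral>p. f p \<partial>Q i) + (\<integral>p. f p \<partial>\<pi>) - \<epsilon> * (\<Sum>i<m. \<integral>p. f p \<partial>P i)"
      by (simp add: eM' eD)
  qed
  have meas_\<sigma>: "emeasure \<sigma> E = ennreal (\<epsilon> * (\<Sum>i<m. measure (Q i) E) + prob E - \<epsilon> * (\<Sum>i<m. measure (P i) E))"
    if E: "E \<in> sets borel" for E
  proof -
    have i: "integrable \<sigma> (indicat_real E)" and e: "(\<integral>p. indicat_real E p \<partial>\<sigma>) = \<epsilon> * (\<Sum>i<m. \<integral>p. indicat_real E p \<partial>Q i) + (\<integral>p. indicat_real E p \<partial>\<pi>) - \<epsilon> * (\<Sum>i<m. \<integral>p. indicat_real E p \<partial>P i)"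
      using \<sigma>_int[of "indicat_real E" 1] E by (auto simp: indicator_def)
    have "emeasure \<sigma> E = ennreal (\<integral>p. indicat_real E p \<partial>\<sigma>)"
      using i E by (simp add: \<sigma>_def integrable_indicator_iff emeasure_eq_ennreal_measure less_top)
    then show ?thesis unfolding e by (simp add: sQ(2) space_pi sP(2))
  qed
  have fsets: "fst -` A \<in> sets (borel :: ('a \<times> 'b) measure)" if "A \<in> sets borel" for A
    using measurable_sets[OF couplingsD(6)[OF pi] that] space_pi sets_pi by simp
  have ssets: "snd -` A \<in> sets (borel :: ('a \<times> 'b) measure)" if "A \<in> sets borel" for A
    using measurable_sets[OF couplingsD(7)[OF pi] that] space_pi sets_pi by simp
  have Qf: "measure (Q i) (fst -` A) = measure (P (s i)) (fst -` A)" if "i < m" "A \<in> sets borel" for i A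
  proof -
    have "emeasure (Q i) (A \<times> UNIV) = emeasure (P (s i)) (fst -` A)"
      using Q_rect[OF that(1,2), of UNIV] prob_space.emeasure_space_1[OF P_prob[OF that(1)]] sP by simp
    moreover have "A \<times> (UNIV :: 'b set) = fst -` A" by auto
    ultimately show ?thesis by (simp add: measure_def)
  qed
  have Qs: "measure (Q i) (snd -` A) = measure (P i) (snd -` A)" if "i < m" "A \<in> sets borel" for i A
  proof -
    have "emeasure (Q i) (UNIV \<times> A) = emeasure (P i) (snd -` A)"
      using Q_rect[OF that(1) _ that(2), of UNIV] prob_space.emeasure_space_1[OF P_prob[OF sm], of i] sP by simp
    moreover have "(UNIV :: 'a set) \<times> A = snd -` A" by auto
    ultimately show ?thesis by (simp add: measure_def)
  qed
  have reindex: "(\<Sum>i<m. h (s i)) = (\<Sum>i<m. h i :: real)" for h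
    by (rule sum.reindex_bij_betw[OF bij])
  have "\<sigma> \<in> couplings \<mu> \<nu>"
  proof (rule couplingsI[OF mu nu])
    show "sets \<sigma> = sets borel" by (simp add: \<sigma>_def)
    fix A :: "'a set" assume A: "A \<in> sets borel"
    have "emeasure \<sigma> (fst -` A) = ennreal (prob (fst -` A))"
      using Qf[OF _ A] reindex[of "\<lambda>i. measure (P i) (fst -` A)"] by (simp add: meas_\<sigma>[OF fsets[OF A]])
    also have "\<dots> = emeasure (distr \<pi> borel fst) A" using A by (simp add: emeasure_distr space_pi emeasure_eq_measure)
    finally show "emeasure \<sigma> (fst -` A) = emeasure \<mu> A" using couplingsD(4)[OF pi] by simp
  next
    fix A :: "'b set" assume A: "A \<in> sets borel"
    have "emeasure \<sigma> (snd -` A) = ennreal (prob (snd -` A))"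
      using Qs[OF _ A] by (simp add: meas_\<sigma>[OF ssets[OF A]])
    also have "\<dots> = emeasure (distr \<pi> borel snd) A" using A by (simp add: emeasure_distr space_pi emeasure_eq_measure)
    finally show "emeasure \<sigma> (snd -` A) = emeasure \<nu> A" using couplingsD(5)[OF pi] by simp
  qed
  from opt[OF this]
  have le: "\<epsilon> * (\<Sum>i<m. \<integral>p. \<kappa> p \<partial>Q i) \<le> \<epsilon> * (\<Sum>i<m. \<integral>p. \<kappa> p \<partial>P i)"
    using \<sigma>_int(2)[OF borel_measurable_continuous_onI[OF cont] bd] by simp
  have \<kappa>m: "\<kappa> \<in> borel_measurable \<pi>" "\<kappa> \<in> borel_measurable (P i)" "\<kappa> \<in> borel_measurable (Q i)" for i
    using borel_measurable_continuous_onI[OF cont]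
    by (simp_all add: measurable_cong_sets[OF sets_pi refl] measurable_cong_sets[OF sQ(1) refl] measurable_cong_sets[OF sP(1) refl])
  have Qge: "\<kappa> (x (s i), y i) - \<eta> \<le> (\<integral>p. \<kappa> p \<partial>Q i)" if i: "i < m" for i
  proof -
    interpret q: prob_space "Q i" using Q_prob[OF i] .
    have "(\<integral>p. \<kappa> (x (s i), y i) - \<eta> \<partial>Q i) \<le> (\<integral>p. \<kappa> p \<partial>Q i)"
    proof (rule integral_mono_AE)
      show "integrable (Q i) \<kappa>" using bd \<kappa>m by (intro q.integrable_const_bound[of _ b]) auto
      show "AE p in Q i. \<kappa> (x (s i), y i) - \<eta> \<le> \<kappa> p"
        using AE_Q[OF i]
      proof eventually_elim
        case (elim p)
        then show ?case using near[of p "x (s i)" "y i"] \<rho>(2)[OF i] by (simp add: U_def V_def)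
      qed
    qed simp
    then show ?thesis by (simp add: q.prob_space)
  qed
  have Ple: "(\<integral>p. \<kappa> p \<partial>P i) \<le> \<kappa> (x i, y i) + \<eta>" if i: "i < m" for i
  proof -
    interpret q: prob_space "P i" using P_prob[OF i] .
    have "(\<integral>p. \<kappa> p \<partial>P i) \<le> (\<integral>p. \<kappa> (x i, y i) + \<eta> \<partial>P i)"
    proof (rule integral_mono_AE)
      show "integrable (P i) \<kappa>" using bd \<kappa>m by (intro q.integrable_const_bound[of _ b]) auto
      show "AE p in P i. \<kappa> p \<le> \<kappa> (x i, y i) + \<eta>"
        using AE_W[OF i]
      proof eventually_elim
        case (elim p)
        then show ?case using near[of p "x i" "y i"] \<rho>(1)[OF i] by (auto simp: W_def U_def V_def)
      qed
    qed simp
    then show ?thesis by (simp add: q.prob_space)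
  qed
  have "(\<Sum>i<m. \<kappa> (x (s i), y i) - \<eta>) \<le> (\<Sum>i<m. \<integral>p. \<kappa> p \<partial>Q i)" using Qge by (intro sum_mono) auto
  also have "\<dots> \<le> (\<Sum>i<m. \<integral>p. \<kappa> p \<partial>P i)" using le e0 by simp
  also have "\<dots> \<le> (\<Sum>i<m. \<kappa> (x i, y i) + \<eta>)" using Ple by (intro sum_mono) auto
  finally have "g \<le> 2 * (real m * \<eta>)" by (simp add: g_def sum_subtractf sum.distrib algebra_simps)
  moreover have "2 * (real m * \<eta>) = g / 2" using m by (simp add: \<eta>_def)
  ultimately show False using gap by (simp add: g_def)
qed

subsection \<open>Linearization of the Gromov--Wasserstein functional\<close>

definition outer :: "real^'m \<Rightarrow> real^'k \<Rightarrow> real^'k^'m" where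
  "outer y x = (\<chi> i j. y $ i * x $ j)"

lemma inner_outer: "outer y x \<bullet> outer y' x' = (x \<bullet> x') * (y \<bullet> y')"
proof -
  have "outer y x \<bullet> outer y' x' = (\<Sum>i\<in>UNIV. \<Sum>j\<in>UNIV. (y $ i * y' $ i) * (x $ j * x' $ j))"
    by (simp add: outer_def inner_vec_def mult_ac)
  also have "\<dots> = (y \<bullet> y') * (x \<bullet> x')"
    by (simp add: inner_vec_def sum_product)
  finally show ?thesis by simp
qed

lemma inner_outer_matrix: "M \<bullet> outer y x = (M *v x) \<bullet> y"
  by (simp add: outer_def inner_vec_def matrix_vector_mult_def sum_distrib_left sum_distrib_right mult_ac)

lemma continuous_on_outer[continuous_intros]:
  assumes "continuous_on S f" "continuous_on S g"
  shows "continuous_on S (\<lambda>p. outer (f p) (g p))"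
  unfolding outer_def by (intro continuous_intros assms)

text \<open>The gain functional is W plus twice the squared norm of the cross moment; its
  linearization at M has this integrand, the 4 being the derivative of twice a square.\<close>

definition lin_value :: "real^'n^'d \<Rightarrow> (real^'n) \<times> (real^'d) \<Rightarrow> real" where
  "lin_value M p = (norm (fst p))\<^sup>2 * (norm (snd p))\<^sup>2 + 4 * ((M *v fst p) \<bullet> snd p)"

lemma continuous_lin_value: "continuous_on UNIV (lin_value M)"
  unfolding lin_value_def[abs_def] inner_outer_matrix[symmetric] by (intro continuous_intros)

lemma cross_moment_outer: "cross_moment \<pi> = (\<integral>p. outer (snd p) (fst p) \<partial>\<pi>)"
  by (simp add: cross_moment_def outer_def)

section \<open>Expansion of the functional for centered marginals\<close>

locale gw_marginals =
  fixes \<mu> :: "(real^'n) measure" and \<nu> :: "(real^'d) measure"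
  assumes mu: "borel_prob \<mu>" and nu: "borel_prob \<nu>"
    and cmu: "compact (measure_support \<mu>)" and cnu: "compact (measure_support \<nu>)"
    and mu0: "(\<integral>x. x \<partial>\<mu>) = 0" and nu0: "(\<integral>y. y \<partial>\<nu>) = 0"
begin

lemma AE_supp:
  assumes "\<pi> \<in> couplings \<mu> \<nu>" shows "AE p in \<pi>. p \<in> measure_support \<mu> \<times> measure_support \<nu>"
proof -
  have "AE p in \<pi>. fst p \<in> measure_support \<mu>" "AE p in \<pi>. snd p \<in> measure_support \<nu>"
    using AE_coupling[OF assms] AE_measure_support[of \<mu>] AE_measure_support[of \<nu>] couplingsD(8,9)[OF assms] by auto
  then show ?thesis by eventually_elim (simp add: mem_Times_iff)
qed

lemma measurable_coupling:
  fixes f :: "(real^'n) \<times> (real^'d) \<Rightarrow> 'e::topological_space"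
  assumes "\<pi> \<in> couplings \<mu> \<nu>" "continuous_on UNIV f"
  shows "f \<in> borel_measurable \<pi>"
  unfolding measurable_cong_sets[OF couplingsD(2)[OF assms(1)] refl]
  using assms(2) by (rule borel_measurable_continuous_onI)

lemma integrable_coupling:
  fixes f :: "(real^'n) \<times> (real^'d) \<Rightarrow> 'e::{banach, second_countable_topology}"
  assumes pi: "\<pi> \<in> couplings \<mu> \<nu>" and f: "continuous_on UNIV f"
  shows "integrable \<pi> f"
proof -
  interpret prob_space \<pi> using couplingsD(1)[OF pi] .
  have cf: "compact (f ` (measure_support \<mu> \<times> measure_support \<nu>))"
    by (intro compact_continuous_image compact_Times cmu cnu continuous_on_subset[OF f]) simp
  then obtain b where b: "\<And>p. p \<in> measure_support \<mu> \<times> measure_support \<nu> \<Longrightarrow> norm (f p) \<le> b"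
    using compact_imp_bounded[OF cf] unfolding bounded_iff by blast
  show ?thesis
  proof (rule integrable_const_bound)
    show "AE p in \<pi>. norm (f p) \<le> b" using AE_supp[OF pi] by eventually_elim (rule b)
  qed (rule measurable_coupling[OF pi f])
qed

lemma integral_fst:
  fixes f :: "real^'n \<Rightarrow> 'e::{banach, second_countable_topology}"
  assumes pi: "\<pi> \<in> couplings \<mu> \<nu>" and f: "continuous_on UNIV f"
  shows "(\<integral>p. f (fst p) \<partial>\<pi>) = (\<integral>x. f x \<partial>\<mu>)"
  unfolding couplingsD(4)[OF pi, symmetric]
  by (rule integral_distr[symmetric, OF couplingsD(6)[OF pi]]) (rule borel_measurable_continuous_onI[OF f])

lemma integral_snd:
  fixes f :: "real^'d \<Rightarrow> 'e::{banach, second_countable_topology}"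
  assumes pi: "\<pi> \<in> couplings \<mu> \<nu>" and f: "continuous_on UNIV f"
  shows "(\<integral>p. f (snd p) \<partial>\<pi>) = (\<integral>y. f y \<partial>\<nu>)"
  unfolding couplingsD(5)[OF pi, symmetric]
  by (rule integral_distr[symmetric, OF couplingsD(7)[OF pi]]) (rule borel_measurable_continuous_onI[OF f])

definition W :: "((real^'n) \<times> (real^'d)) measure \<Rightarrow> real" where
  "W \<pi> = (\<integral>p. (norm (fst p))\<^sup>2 * (norm (snd p))\<^sup>2 \<partial>\<pi>)"

definition gw_const :: real where
  "gw_const = 2 * (\<integral>x. (norm x)^4 \<partial>\<mu>) + 2 * (\<integral>y. (norm y)^4 \<partial>\<nu>)
     + 2 * ((\<integral>x. (norm x)\<^sup>2 \<partial>\<mu>) - (\<integral>y. (norm y)\<^sup>2 \<partial>\<nu>))\<^sup>2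
     + 4 * (norm (\<integral>x. outer x x \<partial>\<mu>))\<^sup>2 + 4 * (norm (\<integral>y. outer y y \<partial>\<nu>))\<^sup>2"

text \<open>Centering removes the products that are linear in one of the two points. Apart from W
  and the cross moment everything left is determined by the marginals. Nonnegativity is recorded
  because \<open>ennreal\<close> truncates, and \<open>gw_cost_le_iff\<close> compares two such
  values.\<close>

lemma gw_cost_eq:
  assumes pi: "\<pi> \<in> couplings \<mu> \<nu>"
  shows "gw_cost \<pi> = ennreal (gw_const - 4 * W \<pi> - 8 * (norm (cross_moment \<pi>))\<^sup>2)"
    "0 \<le> gw_const - 4 * W \<pi> - 8 * (norm (cross_moment \<pi>))\<^sup>2"
proof -
  interpret prob_space \<pi> using couplingsD(1)[OF pi] .
  note int = integrable_coupling[OF pi]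
  define a where "a p = (norm (fst p))\<^sup>2 - (norm (snd p))\<^sup>2" for p :: "(real^'n) \<times> (real^'d)"
  have ca: "continuous_on UNIV a" unfolding a_def[abs_def] by (intro continuous_intros)
  define D where "D p q = \<bar>(norm (fst p - fst q))\<^sup>2 - (norm (snd p - snd q))\<^sup>2\<bar>\<^sup>2" for p q :: "(real^'n) \<times> (real^'d)"
  define M where "M = cross_moment \<pi>"
  define Mmu where "Mmu = (\<integral>x. outer x x \<partial>\<mu>)"
  define Mnu where "Mnu = (\<integral>y. outer y y \<partial>\<nu>)"
  define A1 where "A1 = (\<integral>q. a q \<partial>\<pi>)"
  define A2 where "A2 = (\<integral>q. (a q)\<^sup>2 \<partial>\<pi>)"
  define w1 where "w1 = (\<integral>q. a q *\<^sub>R fst q \<partial>\<pi>)"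
  define w2 where "w2 = (\<integral>q. a q *\<^sub>R snd q \<partial>\<pi>)"
  have m0: "(\<integral>q. fst q \<partial>\<pi>) = 0" "(\<integral>q. snd q \<partial>\<pi>) = 0"
    using integral_fst[OF pi continuous_on_id] integral_snd[OF pi continuous_on_id] mu0 nu0 by simp_all
  have co: "continuous_on UNIV (\<lambda>x :: real^'n. outer x x)" "continuous_on UNIV (\<lambda>x :: real^'d. outer x x)"
    by (intro continuous_intros)+
  have cn: "continuous_on UNIV (\<lambda>x :: real^'n. (norm x)^j)" "continuous_on UNIV (\<lambda>x :: real^'d. (norm x)^j)" for j
    by (intro continuous_intros)+
  have mm: "(\<integral>q. outer (fst q) (fst q) \<partial>\<pi>) = Mmu" "(\<integral>q. outer (snd q) (snd q) \<partial>\<pi>) = Mnu"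
    using integral_fst[OF pi co(1)] integral_snd[OF pi co(2)] by (simp_all add: Mmu_def Mnu_def)
  have M: "(\<integral>q. outer (snd q) (fst q) \<partial>\<pi>) = M" by (simp add: M_def cross_moment_outer)
  have Dex: "D p q = (a p)\<^sup>2 + (a q)\<^sup>2 + 2 * a p * a q - 4 * a p * (fst p \<bullet> fst q - snd p \<bullet> snd q)
     - 4 * (fst p \<bullet> (a q *\<^sub>R fst q) - snd p \<bullet> (a q *\<^sub>R snd q))
     + 4 * (outer (fst p) (fst p) \<bullet> outer (fst q) (fst q) + outer (snd p) (snd p) \<bullet> outer (snd q) (snd q)
        - 2 * (outer (snd p) (fst p) \<bullet> outer (snd q) (fst q)))" for p q
  proof -
    define t where "t = fst p \<bullet> fst q"
    define u where "u = snd p \<bullet> snd q"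
    have n: "(norm (v - w))\<^sup>2 = (norm v)\<^sup>2 + (norm w)\<^sup>2 - 2 * (v \<bullet> w)" for v w :: "real^'k"
      by (simp add: power2_norm_eq_inner inner_diff_left inner_diff_right inner_commute)
    have d: "(norm (fst p - fst q))\<^sup>2 - (norm (snd p - snd q))\<^sup>2 = a p + a q - 2 * (t - u)"
      by (simp add: n[of "fst p" "fst q"] n[of "snd p" "snd q"] a_def t_def u_def)
    show ?thesis unfolding D_def d power2_abs inner_outer inner_scaleR_right t_def[symmetric] u_def[symmetric]
      by (simp add: power2_eq_square algebra_simps)
  qed
  define I where "I p = (a p)\<^sup>2 + A2 + 2 * a p * A1 - 4 * (fst p \<bullet> w1 - snd p \<bullet> w2)
     + 4 * (outer (fst p) (fst p) \<bullet> Mmu + outer (snd p) (snd p) \<bullet> Mnu - 2 * (outer (snd p) (fst p) \<bullet> M))" for p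
  have cI: "continuous_on UNIV I" unfolding I_def[abs_def] by (intro continuous_intros ca)
  have i: "integrable \<pi> a" "integrable \<pi> (\<lambda>q. (a q)\<^sup>2)" "integrable \<pi> (\<lambda>q. a q *\<^sub>R fst q)" "integrable \<pi> (\<lambda>q. a q *\<^sub>R snd q)"
    "integrable \<pi> (\<lambda>q. outer (fst q) (fst q))" "integrable \<pi> (\<lambda>q. outer (snd q) (snd q))"
    "integrable \<pi> (\<lambda>q. outer (snd q) (fst q))" "integrable \<pi> fst" "integrable \<pi> snd"
    by (intro int continuous_intros ca)+
  have iD: "integrable \<pi> (D p)" for p unfolding D_def[abs_def] by (intro int continuous_intros)
  have ID: "(\<integral>q. D p q \<partial>\<pi>) = I p" for p
    unfolding Dex I_def using i by (simp add: prob_space A1_def[symmetric] A2_def[symmetric] w1_def[symmetric] w2_def[symmetric] mm M m0 del: inner_scaleR_right)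
  have D0: "0 \<le> D p q" for p q by (simp add: D_def)
  have I0: "0 \<le> I p" for p unfolding ID[symmetric] by (intro integral_nonneg_AE) (simp add: D0)
  have inner: "(\<integral>\<^sup>+q. ennreal (D p q) \<partial>\<pi>) = ennreal (I p)" for p
    using nn_integral_eq_integral[OF iD] D0 by (simp add: ID)
  have "gw_cost \<pi> = (\<integral>\<^sup>+p. ennreal (I p) \<partial>\<pi>)"
    unfolding gw_cost_def D_def[symmetric] inner ..
  also have "\<dots> = ennreal (\<integral>p. I p \<partial>\<pi>)" using I0 by (intro nn_integral_eq_integral int cI) simp
  finally have gw: "gw_cost \<pi> = ennreal (\<integral>p. I p \<partial>\<pi>)" .
  have "(\<integral>p. I p \<partial>\<pi>) = 2 * A2 + 2 * A1\<^sup>2 + 4 * (Mmu \<bullet> Mmu + Mnu \<bullet> Mnu - 2 * (M \<bullet> M))"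
    unfolding I_def using i by (simp add: prob_space A1_def[symmetric] A2_def mm M m0 power2_eq_square algebra_simps)
  also have "A1 = (\<integral>x. (norm x)\<^sup>2 \<partial>\<mu>) - (\<integral>y. (norm y)\<^sup>2 \<partial>\<nu>)"
  proof -
    have "A1 = (\<integral>p. (norm (fst p))\<^sup>2 \<partial>\<pi>) - (\<integral>p. (norm (snd p))\<^sup>2 \<partial>\<pi>)"
      unfolding A1_def a_def by (intro Bochner_Integration.integral_diff int continuous_intros)
    then show ?thesis using integral_fst[OF pi cn(1)] integral_snd[OF pi cn(2)] by simp
  qed
  also have "A2 = (\<integral>x. (norm x)^4 \<partial>\<mu>) + (\<integral>y. (norm y)^4 \<partial>\<nu>) - 2 * W \<pi>"
  proof -
    have "A2 = (\<integral>p. (norm (fst p))^4 + (norm (snd p))^4 - 2 * ((norm (fst p))\<^sup>2 * (norm (snd p))\<^sup>2) \<partial>\<pi>)"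
      unfolding A2_def a_def by (intro Bochner_Integration.integral_cong refl) (simp add: power2_eq_square power4_eq_xxxx algebra_simps)
    also have "\<dots> = (\<integral>p. (norm (fst p))^4 \<partial>\<pi>) + (\<integral>p. (norm (snd p))^4 \<partial>\<pi>) - 2 * W \<pi>"
    proof -
      have "integrable \<pi> (\<lambda>p. (norm (fst p))^4)" "integrable \<pi> (\<lambda>p. (norm (snd p))^4)"
        "integrable \<pi> (\<lambda>p. (norm (fst p))\<^sup>2 * (norm (snd p))\<^sup>2)" by (intro int continuous_intros)+
      then show ?thesis by (simp add: W_def)
    qed
    finally show ?thesis using integral_fst[OF pi cn(1)] integral_snd[OF pi cn(2)] by simp
  qed
  finally have eq: "(\<integral>p. I p \<partial>\<pi>) = gw_const - 4 * W \<pi> - 8 * (norm (cross_moment \<pi>))\<^sup>2"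
    by (simp add: gw_const_def M_def Mmu_def Mnu_def power2_norm_eq_inner algebra_simps)
  then show "gw_cost \<pi> = ennreal (gw_const - 4 * W \<pi> - 8 * (norm (cross_moment \<pi>))\<^sup>2)" using gw by simp
  have "0 \<le> (\<integral>p. I p \<partial>\<pi>)" using I0 by (intro integral_nonneg_AE) simp
  then show "0 \<le> gw_const - 4 * W \<pi> - 8 * (norm (cross_moment \<pi>))\<^sup>2" using eq by simp
qed

lemma gw_cost_le_iff:
  assumes "\<pi> \<in> couplings \<mu> \<nu>" "\<sigma> \<in> couplings \<mu> \<nu>"
  shows "gw_cost \<pi> \<le> gw_cost \<sigma> \<longleftrightarrow> W \<sigma> + 2 * (norm (cross_moment \<sigma>))\<^sup>2 \<le> W \<pi> + 2 * (norm (cross_moment \<pi>))\<^sup>2"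
  unfolding gw_cost_eq(1)[OF assms(1)] gw_cost_eq(1)[OF assms(2)]
  using gw_cost_eq(2)[OF assms(2)] by (subst ennreal_le_iff) auto

lemma integral_lin_value:
  assumes pi: "\<pi> \<in> couplings \<mu> \<nu>"
  shows "(\<integral>p. lin_value M p \<partial>\<pi>) = W \<pi> + 4 * (M \<bullet> cross_moment \<pi>)"
proof -
  have "integrable \<pi> (\<lambda>p. (norm (fst p))\<^sup>2 * (norm (snd p))\<^sup>2)" "integrable \<pi> (\<lambda>p. outer (snd p) (fst p))"
    by (intro integrable_coupling[OF pi] continuous_intros)+
  then show ?thesis unfolding lin_value_def inner_outer_matrix[symmetric] W_def cross_moment_outer by simp
qed

text \<open>The squared norm lies above its tangent plane at the cross moment of \<pi>, so equal
  linearized value forces at least the same gain.\<close>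

lemma gw_optimal_of_lin_value:
  assumes opt: "gw_optimal \<mu> \<nu> \<pi>" and s: "\<sigma> \<in> couplings \<mu> \<nu>"
    and eq: "(\<integral>p. lin_value (cross_moment \<pi>) p \<partial>\<sigma>) = (\<integral>p. lin_value (cross_moment \<pi>) p \<partial>\<pi>)"
  shows "gw_optimal \<mu> \<nu> \<sigma>"
proof -
  have pi: "\<pi> \<in> couplings \<mu> \<nu>" using opt by (simp add: gw_optimal_def)
  let ?M = "cross_moment \<pi>" and ?N = "cross_moment \<sigma>"
  have "(norm (?N - ?M))\<^sup>2 = (norm ?N)\<^sup>2 - 2 * (?M \<bullet> ?N) + (norm ?M)\<^sup>2"
    by (simp add: power2_norm_eq_inner inner_diff_left inner_diff_right inner_commute)
  moreover have "0 \<le> (norm (?N - ?M))\<^sup>2" by simp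
  ultimately have "4 * (?M \<bullet> ?N) - 2 * (norm ?M)\<^sup>2 \<le> 2 * (norm ?N)\<^sup>2" by linarith
  then have "W \<pi> + 2 * (norm ?M)\<^sup>2 \<le> W \<sigma> + 2 * (norm ?N)\<^sup>2"
    using eq unfolding integral_lin_value[OF s] integral_lin_value[OF pi] by (simp add: power2_norm_eq_inner)
  then have "gw_cost \<sigma> \<le> gw_cost \<pi>" using gw_cost_le_iff[OF s pi] by simp
  then show ?thesis using opt s unfolding gw_optimal_def by (meson order_trans)
qed

text \<open>Optimality is tested on the mixtures (1 - t) \<pi> + t \<sigma>. After division by t the
  quadratic remainder is of order t and disappears as t tends to 0.\<close>

lemma lin_value_optimal:
  assumes opt: "gw_optimal \<mu> \<nu> \<pi>" and s: "\<sigma> \<in> couplings \<mu> \<nu>"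
  shows "(\<integral>p. lin_value (cross_moment \<pi>) p \<partial>\<sigma>) \<le> (\<integral>p. lin_value (cross_moment \<pi>) p \<partial>\<pi>)"
proof -
  have pi: "\<pi> \<in> couplings \<mu> \<nu>" using opt by (simp add: gw_optimal_def)
  let ?M = "cross_moment \<pi>" and ?N = "cross_moment \<sigma>"
  have key: "(W \<sigma> + 4 * (?M \<bullet> ?N)) - (W \<pi> + 4 * (?M \<bullet> ?M)) \<le> - 2 * t * (norm (?N - ?M))\<^sup>2"
    if t: "0 < t" "t < 1" for t
  proof -
    define m where "m = msum UNIV (\<lambda>b. if b then density \<pi> (\<lambda>_. ennreal (1 - t)) else density \<sigma> (\<lambda>_. ennreal t))"
    have sM: "sets (if b then density \<pi> (\<lambda>_. ennreal (1 - t)) else density \<sigma> (\<lambda>_. ennreal t)) = sets borel" for b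
      using couplingsD(2)[OF pi] couplingsD(2)[OF s] by simp
    have em: "emeasure m E = ennreal (1 - t) * emeasure \<pi> E + ennreal t * emeasure \<sigma> E" if "E \<in> sets borel" for E
      using that couplingsD(2)[OF pi] couplingsD(2)[OF s]
      by (simp add: m_def emeasure_msum sM UNIV_bool emeasure_density_const)
    have mc: "m \<in> couplings \<mu> \<nu>"
    proof (rule couplingsI[OF mu nu])
      show "sets m = sets borel" by (simp add: m_def)
      have tt: "ennreal (1 - t) * x + ennreal t * x = x" for x
        using t by (simp add: distrib_right[symmetric] ennreal_plus[symmetric] del: ennreal_plus)
      fix A :: "(real^'n) set" assume A: "A \<in> sets borel"
      have "fst -` A \<in> sets (borel :: ((real^'n) \<times> (real^'d)) measure)"
        using measurable_sets[OF couplingsD(6)[OF pi] A] couplingsD(2,3)[OF pi] by simp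
      then have "emeasure m (fst -` A) = ennreal (1 - t) * emeasure \<pi> (fst -` A) + ennreal t * emeasure \<sigma> (fst -` A)" by (rule em)
      moreover have "emeasure \<rho> (fst -` A) = emeasure \<mu> A" if "\<rho> \<in> couplings \<mu> \<nu>" for \<rho>
        using emeasure_distr[OF couplingsD(6)[OF that] A] couplingsD(3,4)[OF that] by simp
      ultimately show "emeasure m (fst -` A) = emeasure \<mu> A" using pi s tt by simp
    next
      have tt: "ennreal (1 - t) * x + ennreal t * x = x" for x
        using t by (simp add: distrib_right[symmetric] ennreal_plus[symmetric] del: ennreal_plus)
      fix A :: "(real^'d) set" assume A: "A \<in> sets borel"
      have "snd -` A \<in> sets (borel :: ((real^'n) \<times> (real^'d)) measure)"
        using measurable_sets[OF couplingsD(7)[OF pi] A] couplingsD(2,3)[OF pi] by simp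
      then have "emeasure m (snd -` A) = ennreal (1 - t) * emeasure \<pi> (snd -` A) + ennreal t * emeasure \<sigma> (snd -` A)" by (rule em)
      moreover have "emeasure \<rho> (snd -` A) = emeasure \<nu> A" if "\<rho> \<in> couplings \<mu> \<nu>" for \<rho>
        using emeasure_distr[OF couplingsD(7)[OF that] A] couplingsD(3,5)[OF that] by simp
      ultimately show "emeasure m (snd -` A) = emeasure \<nu> A" using pi s tt by simp
    qed
    have im: "(\<integral>p. f p \<partial>m) = (1 - t) * (\<integral>p. f p \<partial>\<pi>) + t * (\<integral>p. f p \<partial>\<sigma>)"
      if f: "continuous_on UNIV f" for f :: "(real^'n) \<times> (real^'d) \<Rightarrow> real"
    proof -
      have fm: "f \<in> borel_measurable \<pi>" "f \<in> borel_measurable \<sigma>" using measurable_coupling[OF pi f] measurable_coupling[OF s f] .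
      have "(\<integral>p. f p \<partial>m) = (\<Sum>b\<in>UNIV. \<integral>p. f p \<partial>(if b then density \<pi> (\<lambda>_. ennreal (1 - t)) else density \<sigma> (\<lambda>_. ennreal t)))"
        unfolding m_def
      proof (rule integral_msum(2))
        show "integrable (if b then density \<pi> (\<lambda>_. ennreal (1 - t)) else density \<sigma> (\<lambda>_. ennreal t)) f" for b
          using integrable_coupling[OF pi f] integrable_coupling[OF s f] t fm by (auto simp: integrable_density)
      qed (use sM borel_measurable_continuous_onI[OF f] in auto)
      also have "\<dots> = (1 - t) * (\<integral>p. f p \<partial>\<pi>) + t * (\<integral>p. f p \<partial>\<sigma>)"
        using t fm by (simp add: UNIV_bool integral_density)
      finally show ?thesis .
    qed
    have Wm: "W m = (1 - t) * W \<pi> + t * W \<sigma>" unfolding W_def by (intro im continuous_intros)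
    have Mm: "cross_moment m = (1 - t) *\<^sub>R ?M + t *\<^sub>R ?N"
    proof (rule euclidean_eqI)
      fix b :: "real^'n^'d"
      have c: "continuous_on UNIV (\<lambda>p. outer (snd p) (fst p) \<bullet> b)" by (intro continuous_intros)
      have "integrable \<rho> (\<lambda>p. outer (snd p) (fst p))" if "\<rho> \<in> couplings \<mu> \<nu>" for \<rho>
        by (intro integrable_coupling[OF that] continuous_intros)
      then have "cross_moment \<rho> \<bullet> b = (\<integral>p. outer (snd p) (fst p) \<bullet> b \<partial>\<rho>)" if "\<rho> \<in> couplings \<mu> \<nu>" for \<rho>
        using that by (simp add: cross_moment_outer)
      then show "cross_moment m \<bullet> b = ((1 - t) *\<^sub>R ?M + t *\<^sub>R ?N) \<bullet> b"
        using im[OF c] mc pi s by (simp add: inner_add_left)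
    qed
    have "gw_cost \<pi> \<le> gw_cost m" using opt mc by (simp add: gw_optimal_def)
    then have "W m + 2 * (norm (cross_moment m))\<^sup>2 \<le> W \<pi> + 2 * (norm ?M)\<^sup>2" using gw_cost_le_iff[OF pi mc] by simp
    moreover have "cross_moment m = ?M + t *\<^sub>R (?N - ?M)" unfolding Mm by (simp add: algebra_simps)
    moreover have "(norm (?M + t *\<^sub>R (?N - ?M)))\<^sup>2 = ?M \<bullet> ?M + 2 * t * (?M \<bullet> (?N - ?M)) + t\<^sup>2 * (norm (?N - ?M))\<^sup>2"
      unfolding power2_norm_eq_inner inner_add_left inner_add_right inner_scaleR_left inner_scaleR_right
      by (simp add: inner_commute power2_eq_square algebra_simps)
    ultimately have "t * (W \<sigma> - W \<pi>) + 4 * t * (?M \<bullet> (?N - ?M)) + 2 * t\<^sup>2 * (norm (?N - ?M))\<^sup>2 \<le> 0"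
      unfolding Wm by (simp add: power2_norm_eq_inner[of ?M] algebra_simps)
    then have "t * (W \<sigma> - W \<pi> + 4 * (?M \<bullet> (?N - ?M)) + 2 * t * (norm (?N - ?M))\<^sup>2) \<le> t * 0"
      by (simp add: power2_eq_square algebra_simps)
    then have "W \<sigma> - W \<pi> + 4 * (?M \<bullet> (?N - ?M)) + 2 * t * (norm (?N - ?M))\<^sup>2 \<le> 0"
      using t by (simp only: mult_le_cancel_left_pos)
    then show ?thesis by (simp add: inner_diff_right algebra_simps)
  qed
  have "((\<lambda>t. - 2 * t * (norm (?N - ?M))\<^sup>2) \<longlongrightarrow> - 2 * 0 * (norm (?N - ?M))\<^sup>2) (at_right 0)"
    by (intro tendsto_intros)
  moreover have "\<forall>\<^sub>F t in at_right 0. (W \<sigma> + 4 * (?M \<bullet> ?N)) - (W \<pi> + 4 * (?M \<bullet> ?M)) \<le> - 2 * t * (norm (?N - ?M))\<^sup>2"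
    unfolding eventually_at_right_field using key by (intro exI[of _ 1]) auto
  ultimately have "(W \<sigma> + 4 * (?M \<bullet> ?N)) - (W \<pi> + 4 * (?M \<bullet> ?M)) \<le> - 2 * 0 * (norm (?N - ?M))\<^sup>2"
    by (rule tendsto_lowerbound) simp
  then show ?thesis unfolding integral_lin_value[OF s] integral_lin_value[OF pi] by simp
qed

lemma measure_support_coupling:
  assumes pi: "\<pi> \<in> couplings \<mu> \<nu>"
  shows "measure_support \<pi> \<subseteq> measure_support \<mu> \<times> measure_support \<nu>" "compact (measure_support \<pi>)"
    "AE p in \<pi>. p \<in> measure_support \<pi>" "measure_support \<pi> \<noteq> {}"
proof -
  show sub: "measure_support \<pi> \<subseteq> measure_support \<mu> \<times> measure_support \<nu>"
  proof (clarify, intro conjI)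
    fix x y assume xy: "(x, y) \<in> measure_support \<pi>"
    have "0 < emeasure \<mu> U" if U: "open U" "x \<in> U" for U
    proof -
      have "open (U \<times> (UNIV :: (real^'d) set))" using U by (intro open_Times) auto
      then have "0 < emeasure \<pi> (U \<times> UNIV)" using xy U unfolding measure_support_def by blast
      moreover have "U \<times> UNIV = fst -` U \<inter> space \<pi>" using couplingsD(3)[OF pi] by auto
      ultimately show ?thesis
        using emeasure_distr[OF couplingsD(6)[OF pi], of U] U couplingsD(4)[OF pi] by simp
    qed
    then show "x \<in> measure_support \<mu>" by (auto simp: measure_support_def)
    have "0 < emeasure \<nu> U" if U: "open U" "y \<in> U" for U
    proof -
      have "open ((UNIV :: (real^'n) set) \<times> U)" using U by (intro open_Times) auto
      then have "0 < emeasure \<pi> (UNIV \<times> U)" using xy U unfolding measure_support_def by blast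
      moreover have "UNIV \<times> U = snd -` U \<inter> space \<pi>" using couplingsD(3)[OF pi] by auto
      ultimately show ?thesis
        using emeasure_distr[OF couplingsD(7)[OF pi], of U] U couplingsD(5)[OF pi] by simp
    qed
    then show "y \<in> measure_support \<nu>" by (auto simp: measure_support_def)
  qed
  show "compact (measure_support \<pi>)"
    using compact_Int_closed[OF compact_Times[OF cmu cnu] closed_measure_support[of \<pi>]] sub by (simp add: Int_absorb1)
  show ae: "AE p in \<pi>. p \<in> measure_support \<pi>" by (rule AE_measure_support[OF couplingsD(2)[OF pi]])
  interpret prob_space \<pi> using couplingsD(1)[OF pi] .
  show "measure_support \<pi> \<noteq> {}"
  proof
    assume "measure_support \<pi> = {}"
    then have "AE p in \<pi>. False" using ae by simp
    then show False by simp
  qed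
qed

text \<open>The integrand is unbounded on the whole space; it is truncated at a bound valid on the
  product of the compact supports, which changes none of the integrals involved.\<close>

lemma cyc_mono_lin_value:
  assumes opt: "gw_optimal \<mu> \<nu> \<pi>"
  shows "cyc_mono (\<lambda>x y. lin_value (cross_moment \<pi>) (x, y)) (measure_support \<pi>)"
proof -
  have pi: "\<pi> \<in> couplings \<mu> \<nu>" using opt by (simp add: gw_optimal_def)
  let ?k = "lin_value (cross_moment \<pi>)"
  have cf: "compact (?k ` (measure_support \<mu> \<times> measure_support \<nu>))"
    by (intro compact_continuous_image compact_Times cmu cnu continuous_on_subset[OF continuous_lin_value]) simp
  then obtain b where b: "\<And>p. p \<in> measure_support \<mu> \<times> measure_support \<nu> \<Longrightarrow> \<bar>?k p\<bar> \<le> b"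
    using compact_imp_bounded[OF cf] unfolding bounded_iff real_norm_def by blast
  define \<kappa> where "\<kappa> p = max (- \<bar>b\<bar>) (min \<bar>b\<bar> (?k p))" for p
  have eq: "\<kappa> p = ?k p" if "p \<in> measure_support \<mu> \<times> measure_support \<nu>" for p
    using b[OF that] by (auto simp: \<kappa>_def)
  have "cyc_mono (\<lambda>x y. \<kappa> (x, y)) (measure_support \<pi>)"
  proof (rule cyc_mono_of_optimal[OF mu nu pi])
    show c: "continuous_on UNIV \<kappa>" unfolding \<kappa>_def[abs_def] by (intro continuous_intros continuous_lin_value)
    show "\<bar>\<kappa> p\<bar> \<le> \<bar>b\<bar>" for p by (auto simp: \<kappa>_def)
    fix \<sigma> assume s: "\<sigma> \<in> couplings \<mu> \<nu>"
    have "(\<integral>p. \<kappa> p \<partial>\<rho>) = (\<integral>p. ?k p \<partial>\<rho>)" if r: "\<rho> \<in> couplings \<mu> \<nu>" for \<rho>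
      using AE_supp[OF r] by (intro integral_cong_AE measurable_coupling[OF r] c continuous_lin_value) (auto elim: eventually_mono simp: eq)
    then show "(\<integral>p. \<kappa> p \<partial>\<sigma>) \<le> (\<integral>p. \<kappa> p \<partial>\<pi>)" using lin_value_optimal[OF opt s] s pi by simp
  qed
  then have "cyc_mono (\<lambda>x y. ?k (x, y)) ((\<lambda>(x, y). (x, y)) ` measure_support \<pi>)"
    by (rule cyc_mono_image) (use measure_support_coupling(1)[OF pi] in \<open>auto intro!: eq\<close>)
  then show ?thesis by simp
qed

end

subsection \<open>Coordinates\<close>

lemma coord_no_bij: "bij_betw (coord_no :: 'n::finite \<Rightarrow> nat) UNIV {..<CARD('n)}"
  unfolding coord_no_def by (rule to_nat_on_finite) simp

lemma coord_no_less: "coord_no (i :: 'n::finite) < CARD('n)"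
  using coord_no_bij[where 'n='n] by (auto simp: bij_betw_def)

lemma coord_no_eq_iff: "coord_no (i :: 'n::finite) = coord_no j \<longleftrightarrow> i = j"
  using coord_no_bij[where 'n='n] by (auto simp: bij_betw_def inj_on_def)

lemma from_nat_into_coord_no: "from_nat_into UNIV (coord_no (j :: 'n::finite)) = j"
  unfolding coord_no_def by (simp add: countable_finite)

lemma coord_no_surj: assumes "k < CARD('n)" obtains i :: "'n::finite" where "coord_no i = k"
  using coord_no_bij[where 'n='n] assms unfolding bij_betw_def by (metis imageE lessThan_iff)

lemma coord_no_inverse: "k < CARD('n) \<Longrightarrow> coord_no (from_nat_into UNIV k :: 'n::finite) = k"
  by (metis coord_no_surj from_nat_into_coord_no)

lemma sum_coord_no: "(\<Sum>i\<in>(UNIV :: 'n::finite set). f (coord_no i)) = (\<Sum>k<CARD('n). f k)"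
  by (rule sum.reindex_bij_betw[OF coord_no_bij])

definition coord_proj :: "real^'n \<Rightarrow> real^'d" where
  "coord_proj z = (\<chi> j. z $ from_nat_into UNIV (coord_no j))"

context
  assumes nd: "CARD('d::finite) \<le> CARD('n::finite)"
begin

lemma coord_proj_embed: "coord_proj (coord_embed (y :: real^'d) :: real^'n) = y"
proof (rule vec_eq_iff[THEN iffD2], rule allI)
  fix j :: 'd
  have "coord_no j < CARD('n)" using coord_no_less[of j] nd by simp
  then show "coord_proj (coord_embed y :: real^'n) $ j = y $ j"
    using coord_no_less[of j] by (simp add: coord_proj_def coord_embed_def coord_no_inverse from_nat_into_coord_no)
qed

lemma inner_coord_embed: "(coord_embed (y :: real^'d) :: real^'n) \<bullet> coord_embed y' = y \<bullet> y'"
proof -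
  define f where "f k = (if k < CARD('d) then y $ from_nat_into UNIV k * y' $ from_nat_into UNIV k else 0)" for k
  have "(coord_embed y :: real^'n) \<bullet> coord_embed y' = (\<Sum>i\<in>(UNIV :: 'n set). f (coord_no i))"
    by (simp add: inner_vec_def coord_embed_def f_def if_distrib cong: if_cong)
  also have "\<dots> = (\<Sum>k<CARD('n). f k)" by (rule sum_coord_no)
  also have "\<dots> = (\<Sum>k<CARD('d). f k)" by (rule sum.mono_neutral_right) (use nd in \<open>auto simp: f_def\<close>)
  also have "\<dots> = (\<Sum>j\<in>(UNIV :: 'd set). f (coord_no j))" by (rule sum_coord_no[symmetric])
  also have "\<dots> = y \<bullet> y'" by (simp add: inner_vec_def f_def coord_no_less from_nat_into_coord_no)
  finally show ?thesis .
qed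

end

lemma linear_coord_embed: "linear (coord_embed :: real^'d \<Rightarrow> real^'n)"
  by (rule linearI) (auto simp: coord_embed_def vec_eq_iff)

lemma linear_coord_proj: "linear (coord_proj :: real^'n \<Rightarrow> real^'d)"
  by (rule linearI) (auto simp: coord_proj_def vec_eq_iff)

subsection \<open>Singular value decomposition\<close>

text \<open>Lists rather than sets, because the position of a vector is the number of its coordinate
  in \<open>rowmat\<close> and has to match the order of the singular values.\<close>

definition ortholist :: "'a::real_inner list \<Rightarrow> bool" where
  "ortholist us \<longleftrightarrow> (\<forall>i<length us. \<forall>j<length us. us ! i \<bullet> us ! j = (if i = j then 1 else 0))"

lemma ortholistI:
  assumes "distinct us" "\<And>u. u \<in> set us \<Longrightarrow> norm u = 1" "\<And>u v. u \<in> set us \<Longrightarrow> v \<in> set us \<Longrightarrow> u \<noteq> v \<Longrightarrow> u \<bullet> v = 0"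
  shows "ortholist us"
  unfolding ortholist_def
proof (intro allI impI)
  fix i j assume ij: "i < length us" "j < length us"
  show "us ! i \<bullet> us ! j = (if i = j then 1 else 0)"
  proof (cases "i = j")
    case True then show ?thesis using assms(2)[of "us ! i"] ij by (simp add: dot_square_norm)
  next
    case False
    then have "us ! i \<noteq> us ! j" using assms(1) ij by (simp add: nth_eq_iff_index_eq)
    then show ?thesis using False assms(3) ij by simp
  qed
qed

lemma ortholistD:
  assumes "ortholist us"
  shows "distinct us" "\<And>u. u \<in> set us \<Longrightarrow> norm u = 1" "\<And>u v. u \<in> set us \<Longrightarrow> v \<in> set us \<Longrightarrow> u \<noteq> v \<Longrightarrow> u \<bullet> v = 0"
proof -
  have ij: "us ! i \<bullet> us ! j = (if i = j then 1 else 0)" if "i < length us" "j < length us" for i j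
    using assms that by (simp add: ortholist_def)
  show "distinct us" unfolding distinct_conv_nth
  proof (intro allI impI notI)
    fix i j assume "i < length us" "j < length us" "i \<noteq> j" "us ! i = us ! j"
    then show False using ij[of i i] ij[of i j] by simp
  qed
  show "norm u = 1" if "u \<in> set us" for u
    using that ij by (auto simp: in_set_conv_nth norm_eq_1)
  show "u \<bullet> v = 0" if "u \<in> set us" "v \<in> set us" "u \<noteq> v" for u v
    using that ij by (auto simp: in_set_conv_nth)
qed

lemma ortholist_independent:
  fixes us :: "'a::euclidean_space list"
  assumes "ortholist us" shows "independent (set us)" "dim (set us) = length us"
proof -
  have "pairwise orthogonal (set us)" using ortholistD(3)[OF assms] by (auto simp: pairwise_def orthogonal_def)
  moreover have "0 \<notin> set us" using ortholistD(2)[OF assms] by force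
  ultimately show "independent (set us)" by (rule pairwise_orthogonal_independent)
  then show "dim (set us) = length us"
    using distinct_card[OF ortholistD(1)[OF assms]] by (simp add: dim_eq_card_independent)
qed

lemma orthonormal_list_subspace:
  fixes V :: "'a::euclidean_space set"
  assumes "subspace V"
  obtains us where "ortholist us" "set us \<subseteq> V" "length us = dim V" "span (set us) = V"
proof -
  obtain B where B: "B \<subseteq> V" "pairwise orthogonal B" "\<And>x. x \<in> B \<Longrightarrow> norm x = 1" "independent B" "card B = dim V" "span B = V"
    using orthonormal_basis_subspace[OF assms] by metis
  obtain us where us: "set us = B" "distinct us" using finite_distinct_list independent_imp_finite[OF B(4)] by blast
  show ?thesis
  proof (rule that)
    show "ortholist us" using us B(2,3) by (intro ortholistI) (auto simp: pairwise_def orthogonal_def)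
    show "length us = dim V" using distinct_card[OF us(2)] us B by simp
  qed (use us B in auto)
qed

lemma ortholist_append:
  assumes "ortholist us" "ortholist vs" "\<And>u v. u \<in> set us \<Longrightarrow> v \<in> set vs \<Longrightarrow> u \<bullet> v = 0"
  shows "ortholist (us @ vs)"
proof (rule ortholistI)
  have "set us \<inter> set vs = {}"
  proof (rule ccontr)
    assume "set us \<inter> set vs \<noteq> {}"
    then obtain u where "u \<in> set us" "u \<in> set vs" by blast
    then show False using assms(3)[of u u] ortholistD(2)[OF assms(1), of u] by simp
  qed
  then show "distinct (us @ vs)" using ortholistD(1) assms by auto
  show "norm u = 1" if "u \<in> set (us @ vs)" for u using that ortholistD(2) assms by auto
  show "u \<bullet> v = 0" if "u \<in> set (us @ vs)" "v \<in> set (us @ vs)" "u \<noteq> v" for u v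
    using that ortholistD(3)[OF assms(1), of u v] ortholistD(3)[OF assms(2), of u v] assms(3)[of u v] assms(3)[of v u]
    by (auto simp: inner_commute)
qed

lemma ortholist_extend:
  fixes us :: "'a::euclidean_space list"
  assumes "ortholist us"
  obtains ws where "ortholist (us @ ws)" "length (us @ ws) = DIM('a)"
proof -
  define C where "C = {y \<in> UNIV. \<forall>x\<in>span (set us). orthogonal x y}"
  have "dim C + dim (span (set us)) = dim (UNIV :: 'a set)"
    unfolding C_def by (rule dim_subspace_orthogonal_to_vectors) auto
  then have dC: "dim C + length us = DIM('a)" using ortholist_independent[OF assms] by (simp add: dim_span)
  have "subspace C" unfolding C_def using subspace_orthogonal_to_vectors[of "span (set us)"] by (simp add: orthogonal_commute)
  then obtain ws where ws: "ortholist ws" "set ws \<subseteq> C" "length ws = dim C" by (rule orthonormal_list_subspace)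
  show ?thesis
  proof (rule that[of ws])
    show "ortholist (us @ ws)"
      using assms ws(1)
    proof (rule ortholist_append)
      fix u v assume "u \<in> set us" "v \<in> set ws"
      then have "u \<in> span (set us)" "v \<in> C" using ws(2) by (auto intro: span_base)
      then show "u \<bullet> v = 0" by (simp add: C_def orthogonal_def)
    qed
  qed (use dC ws in simp)
qed

definition rowmat :: "(real^'n) list \<Rightarrow> real^'n^'n" where
  "rowmat us = (\<chi> i. us ! coord_no i)"

lemma rowmat_mult: "(rowmat us *v x) $ i = us ! coord_no i \<bullet> x"
  by (simp add: rowmat_def matrix_vector_mul_component)

lemma orthogonal_rowmat:
  fixes us :: "(real^'n) list"
  assumes "ortholist us" "length us = CARD('n)"
  shows "orthogonal_matrix (rowmat us)"
  unfolding orthogonal_matrix_orthonormal_rows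
proof (intro conjI allI impI)
  have r: "row i (rowmat us) = us ! coord_no i" for i by (simp add: row_def rowmat_def vec_lambda_eta)
  show "norm (row i (rowmat us)) = 1" for i
    using ortholistD(2)[OF assms(1)] assms(2) coord_no_less[of i] by (simp add: r)
  show "orthogonal (row i (rowmat us)) (row j (rowmat us))" if "i \<noteq> j" for i j
    using assms that coord_no_less[of i] coord_no_less[of j] coord_no_eq_iff[of i j] by (simp add: r orthogonal_def ortholist_def)
qed

lemma orthogonal_matrix_cancel:
  fixes Q :: "real^'n^'n"
  assumes "orthogonal_matrix Q"
  shows "transpose Q *v (Q *v x) = x" "Q *v (transpose Q *v x) = x"
  using assms by (metis matrix_vector_mul_assoc matrix_vector_mul_lid orthogonal_matrix_def)+

lemma rowmat_expand:
  fixes us :: "(real^'n) list"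
  assumes "ortholist us" "length us = CARD('n)"
  shows "x = (\<Sum>k<CARD('n). (us ! k \<bullet> x) *\<^sub>R (us ! k))"
proof -
  have "x = transpose (rowmat us) *v (rowmat us *v x)"
    using orthogonal_matrix_cancel(1)[OF orthogonal_rowmat[OF assms]] by simp
  also have "\<dots> = (\<Sum>i\<in>(UNIV :: 'n set). ((rowmat us *v x) $ i) *\<^sub>R column i (transpose (rowmat us)))"
    by (simp add: matrix_mult_sum scalar_mult_eq_scaleR)
  also have "\<dots> = (\<Sum>i\<in>(UNIV :: 'n set). (us ! coord_no i \<bullet> x) *\<^sub>R (us ! coord_no i))"
  proof (intro sum.cong refl)
    fix i :: 'n
    have "row i (rowmat us) = us ! coord_no i" by (simp add: row_def rowmat_def vec_lambda_eta)
    then show "(rowmat us *v x) $ i *\<^sub>R column i (transpose (rowmat us)) = (us ! coord_no i \<bullet> x) *\<^sub>R us ! coord_no i"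
      by (simp add: rowmat_mult column_transpose)
  qed
  also have "\<dots> = (\<Sum>k<CARD('n). (us ! k \<bullet> x) *\<^sub>R (us ! k))"
    by (rule sum_coord_no[of "\<lambda>k. (us ! k \<bullet> x) *\<^sub>R (us ! k)"])
  finally show ?thesis .
qed

context
  fixes A :: "real^'n^'d"
begin

private abbreviation "B \<equiv> transpose A ** A"

private lemma B_inner: "(B *v x) \<bullet> y = (A *v x) \<bullet> (A *v y)"
  by (simp add: matrix_vector_mul_assoc[symmetric] dot_lmul_matrix)

lemma subspace_sing_eigenspace: "subspace (sing_eigenspace A s)"
  by (auto simp: subspace_def sing_eigenspace_def matrix_vector_right_distrib scaleR_right_distrib matrix_vector_mult_scaleR)

private lemma eigen_orth:
  assumes "u \<in> sing_eigenspace A s" "v \<in> sing_eigenspace A t" "s \<noteq> t" "0 \<le> s" "0 \<le> t"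
  shows "u \<bullet> v = 0"
proof -
  have "s\<^sup>2 * (u \<bullet> v) = (B *v u) \<bullet> v" using assms by (simp add: sing_eigenspace_def)
  also have "\<dots> = (B *v v) \<bullet> u" unfolding B_inner by (rule inner_commute)
  also have "\<dots> = t\<^sup>2 * (u \<bullet> v)" using assms by (simp add: sing_eigenspace_def inner_commute)
  finally have "s\<^sup>2 * (u \<bullet> v) = t\<^sup>2 * (u \<bullet> v)" .
  moreover have "s\<^sup>2 \<noteq> t\<^sup>2" using assms by (simp add: power2_eq_iff_nonneg)
  ultimately show ?thesis by simp
qed

private definition "Sv = {s. s > 0 \<and> (\<exists>v. v \<noteq> 0 \<and> v \<in> sing_eigenspace A s)}"

private lemma finite_Sv: "finite Sv"
proof -
  have "\<forall>s\<in>Sv. \<exists>v. v \<noteq> 0 \<and> v \<in> sing_eigenspace A s" by (simp add: Sv_def)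
  then obtain v where v: "\<And>s. s \<in> Sv \<Longrightarrow> v s \<noteq> 0 \<and> v s \<in> sing_eigenspace A s" by metis
  have o: "v s \<bullet> v t = 0" if "s \<in> Sv" "t \<in> Sv" "s \<noteq> t" for s t
    using eigen_orth[of "v s" s "v t" t] v that by (auto simp: Sv_def)
  have inj: "inj_on v Sv"
  proof (rule inj_onI, rule ccontr)
    fix s t assume "s \<in> Sv" "t \<in> Sv" "v s = v t" "s \<noteq> t"
    then show False using o[of s t] v[of s] by simp
  qed
  have "pairwise orthogonal (v ` Sv)" using o by (force simp: pairwise_def orthogonal_def)
  moreover have "0 \<notin> v ` Sv" using v by force
  ultimately have "independent (v ` Sv)" by (rule pairwise_orthogonal_independent)
  then have "finite (v ` Sv)" by (rule independent_imp_finite)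
  then show ?thesis using inj by (rule finite_imageD)
qed

private definition "L s = (SOME us. ortholist us \<and> set us \<subseteq> sing_eigenspace A s \<and> length us = dim (sing_eigenspace A s)
   \<and> span (set us) = sing_eigenspace A s)"

private lemma L: "ortholist (L s)" "set (L s) \<subseteq> sing_eigenspace A s" "length (L s) = dim (sing_eigenspace A s)"
  "span (set (L s)) = sing_eigenspace A s"
proof -
  obtain us where "ortholist us" "set us \<subseteq> sing_eigenspace A s" "length us = dim (sing_eigenspace A s)" "span (set us) = sing_eigenspace A s"
    by (rule orthonormal_list_subspace[OF subspace_sing_eigenspace]) (rule that)
  then have "ortholist us \<and> set us \<subseteq> sing_eigenspace A s \<and> length us = dim (sing_eigenspace A s)
   \<and> span (set us) = sing_eigenspace A s" by blast
  from someI[of "\<lambda>us. ortholist us \<and> set us \<subseteq> sing_eigenspace A s \<and> length us = dim (sing_eigenspace A s)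
   \<and> span (set us) = sing_eigenspace A s", OF this]
  show "ortholist (L s)" "set (L s) \<subseteq> sing_eigenspace A s" "length (L s) = dim (sing_eigenspace A s)"
    "span (set (L s)) = sing_eigenspace A s" unfolding L_def by blast+
qed

private lemma ortholist_concat:
  assumes "distinct ss" "\<And>s. s \<in> set ss \<Longrightarrow> 0 \<le> s"
  shows "ortholist (concat (map L ss))"
  using assms
proof (induction ss)
  case (Cons s ss)
  have "ortholist (L s @ concat (map L ss))"
  proof (rule ortholist_append[OF L(1)])
    fix u v assume "u \<in> set (L s)" "v \<in> set (concat (map L ss))"
    then obtain t where t: "t \<in> set ss" "v \<in> set (L t)" "u \<in> set (L s)" by auto
    then show "u \<bullet> v = 0" using Cons.prems L(2) by (intro eigen_orth[of u s v t]) auto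
  qed (use Cons in auto)
  then show ?case by simp
qed (simp add: ortholist_def)

text \<open>
  The eigenspaces of the symmetric matrix \<open>B\<close> span: a maximizer of the Rayleigh quotient on the unit
  sphere of the orthogonal complement of their span would be an eigenvector.
\<close>

private lemma eigenspaces_span: "span (set (concat (map L ss))) = UNIV" if ss: "set ss = insert 0 Sv" for ss
proof (rule ccontr)
  define W where "W = span (set (concat (map L ss)))"
  assume "span (set (concat (map L ss))) \<noteq> UNIV"
  then have "W \<noteq> UNIV" by (simp add: W_def)
  have EW: "sing_eigenspace A s \<subseteq> W" if "s \<in> insert 0 Sv" for s
  proof -
    have "set (L s) \<subseteq> set (concat (map L ss))" using that ss by auto
    then show ?thesis unfolding W_def L(4)[of s, symmetric] by (rule span_mono)
  qed
  have BW: "B *v w \<in> W" if "w \<in> W" for w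
    using that unfolding W_def
  proof (induction rule: span_induct_alt)
    case base then show ?case by (simp add: span_0)
  next
    case (step c x y)
    then obtain s where s: "s \<in> set ss" "x \<in> set (L s)" by auto
    then have "B *v x = s\<^sup>2 *\<^sub>R x" using L(2) by (auto simp: sing_eigenspace_def)
    then have "B *v (c *\<^sub>R x + y) = (c * s\<^sup>2) *\<^sub>R x + B *v y"
      by (simp add: matrix_vector_right_distrib matrix_vector_mult_scaleR)
    then show ?case using step s by (auto intro!: span_add span_scale intro: span_base)
  qed
  define C where "C = {x. \<forall>w\<in>W. w \<bullet> x = 0}"
  have BC: "B *v x \<in> C" if "x \<in> C" for x
  proof -
    have "w \<bullet> (B *v x) = 0" if "w \<in> W" for w
    proof -
      have "w \<bullet> (B *v x) = (B *v w) \<bullet> x" unfolding B_inner inner_commute[of w] by (rule inner_commute)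
      then show ?thesis using BW[OF that] \<open>x \<in> C\<close> by (simp add: C_def)
    qed
    then show ?thesis by (simp add: C_def)
  qed
  have sC: "subspace C" by (auto simp: C_def subspace_def inner_add_right)
  have "dim W < DIM(real^'n)" using \<open>W \<noteq> UNIV\<close> unfolding W_def by (metis dim_eq_full dim_subset_UNIV le_neq_implies_less span_span)
  then obtain z where z: "z \<noteq> 0" "\<And>w. w \<in> span W \<Longrightarrow> orthogonal z w" using orthogonal_to_subspace_exists by metis
  then have "z \<in> C" by (auto simp: C_def orthogonal_def inner_commute intro: span_base)
  then have "z /\<^sub>R norm z \<in> C \<inter> sphere 0 1" using z sC by (auto intro: subspace_scale)
  then have ne: "C \<inter> sphere 0 1 \<noteq> {}" by blast
  have cp: "compact (C \<inter> sphere 0 1)" using closed_subspace[OF sC] by (intro closed_Int_compact) auto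
  have cn: "continuous_on (C \<inter> sphere 0 1) (\<lambda>x. (A *v x) \<bullet> (A *v x))"
    by (intro continuous_on_inner linear_continuous_on matrix_vector_mul_bounded_linear)
  obtain x0 where x0': "x0 \<in> C \<inter> sphere 0 1"
    and mx: "\<forall>x\<in>C \<inter> sphere 0 1. (A *v x) \<bullet> (A *v x) \<le> (A *v x0) \<bullet> (A *v x0)"
    by (rule bexE[OF continuous_attains_sup[OF cp ne cn]]) (rule that)
  have x0: "x0 \<in> C" "norm x0 = 1" using x0' by simp_all
  have max: "(A *v x) \<bullet> (A *v x) \<le> (A *v x0) \<bullet> (A *v x0)" if "x \<in> C" "norm x = 1" for x
    using bspec[OF mx, of x] that by simp
  define lam where "lam = (A *v x0) \<bullet> (A *v x0)"
  have max': "(A *v x) \<bullet> (A *v x) \<le> lam * (x \<bullet> x)" if "x \<in> C" for x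
  proof (cases "x = 0")
    case False
    have "x /\<^sub>R norm x \<in> C" using that sC by (intro subspace_scale)
    then have "(A *v (x /\<^sub>R norm x)) \<bullet> (A *v (x /\<^sub>R norm x)) \<le> lam" unfolding lam_def using False by (intro max) auto
    then have "(A *v x) \<bullet> (A *v x) / (norm x)\<^sup>2 \<le> lam"
      by (simp add: matrix_vector_mult_scaleR power2_eq_square field_simps)
    then show ?thesis using False by (simp add: power2_norm_eq_inner field_simps)
  qed simp
  have l0: "lam \<ge> 0" by (simp add: lam_def)
  define y where "y = B *v x0 - lam *\<^sub>R x0"
  have yC: "y \<in> C" unfolding y_def using BC x0 sC by (intro subspace_diff subspace_scale) auto
  have xx: "x0 \<bullet> x0 = 1" using x0 by (simp add: dot_square_norm)
  have xy: "x0 \<bullet> y = 0" using B_inner[of x0 x0] xx by (simp add: y_def inner_diff_right lam_def inner_commute)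
  have Bxy: "(A *v x0) \<bullet> (A *v y) = y \<bullet> y"
  proof -
    have "(A *v x0) \<bullet> (A *v y) = (B *v x0) \<bullet> y" by (simp add: B_inner)
    also have "B *v x0 = y + lam *\<^sub>R x0" by (simp add: y_def)
    finally show ?thesis using xy by (simp add: inner_add_left)
  qed
  \<comment> \<open>A step so short that t lam <= 1: the first-order gain 2 t |y|^2 then beats the
    term lam t^2 |y|^2 unless y = 0.\<close>
  define t where "t = 1 / (lam + 1)"
  have t: "t > 0" "t * lam \<le> 1" using l0 by (auto simp: t_def field_simps)
  have "(A *v (x0 + t *\<^sub>R y)) \<bullet> (A *v (x0 + t *\<^sub>R y)) \<le> lam * ((x0 + t *\<^sub>R y) \<bullet> (x0 + t *\<^sub>R y))"
    using x0 yC sC by (intro max' subspace_add subspace_scale) auto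
  moreover have "(A *v (x0 + t *\<^sub>R y)) \<bullet> (A *v (x0 + t *\<^sub>R y)) = lam + 2 * t * (y \<bullet> y) + t\<^sup>2 * ((A *v y) \<bullet> (A *v y))"
    by (simp add: matrix_vector_right_distrib matrix_vector_mult_scaleR inner_add_left inner_add_right Bxy inner_commute[of "A *v y" "A *v x0"] lam_def power2_eq_square distrib_left)
  moreover have "lam * ((x0 + t *\<^sub>R y) \<bullet> (x0 + t *\<^sub>R y)) = lam + lam * (t\<^sup>2 * (y \<bullet> y))"
    using xy by (simp add: inner_add_left inner_add_right xx inner_commute[of y x0] power2_eq_square distrib_left)
  moreover have "0 \<le> t\<^sup>2 * ((A *v y) \<bullet> (A *v y))" by simp
  ultimately have "2 * t * (y \<bullet> y) \<le> lam * (t\<^sup>2 * (y \<bullet> y))" by linarith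
  also have "\<dots> = (t * lam) * (t * (y \<bullet> y))" by (simp add: power2_eq_square)
  also have "\<dots> \<le> 1 * (t * (y \<bullet> y))" using t by (intro mult_right_mono) auto
  finally have "t * (y \<bullet> y) \<le> 0" by simp
  then have "y \<bullet> y \<le> 0" using t by (simp add: mult_le_0_iff)
  then have "y = 0" by (metis inner_ge_zero inner_eq_zero_iff antisym)
  then have "x0 \<in> sing_eigenspace A (sqrt lam)" using l0 by (simp add: sing_eigenspace_def y_def)
  moreover have "sqrt lam \<in> insert 0 Sv" using calculation x0 l0 by (auto simp: Sv_def intro!: exI[of _ x0])
  ultimately have "x0 \<in> W" using EW by blast
  then have "x0 \<bullet> x0 = 0" using x0 by (simp add: C_def)
  then show False using xx by simp
qed

private lemma nonzero_singular_values_eq: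
  "nonzero_singular_values A = concat (map (\<lambda>s. replicate (dim (sing_eigenspace A s)) s) (rev (sorted_list_of_set Sv)))"
  by (simp add: nonzero_singular_values_def Sv_def)

lemma right_singular_vectors:
  obtains vs where "ortholist vs" "length vs = CARD('n)" "length (nonzero_singular_values A) \<le> CARD('n)"
    "\<And>k. k < length (nonzero_singular_values A) \<Longrightarrow> B *v (vs ! k) = (nonzero_singular_values A ! k)\<^sup>2 *\<^sub>R (vs ! k)"
    "\<And>k. length (nonzero_singular_values A) \<le> k \<Longrightarrow> k < CARD('n) \<Longrightarrow> A *v (vs ! k) = 0"
    "\<And>k. k < length (nonzero_singular_values A) \<Longrightarrow> nonzero_singular_values A ! k > 0"
proof -
  define \<sigma> where "\<sigma> = nonzero_singular_values A"
  define ss where "ss = rev (sorted_list_of_set Sv)"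
  have sets: "set ss = Sv" "distinct ss" using finite_Sv by (auto simp: ss_def)
  define us where "us = concat (map L ss)"
  \<comment> \<open>\<open>L 0\<close> spans the kernel of A. Placing it last gives the kernel the
    indices from the number of singular values on.\<close>
  define vs where "vs = us @ L 0"
  have vs: "vs = concat (map L (ss @ [0]))" by (simp add: vs_def us_def)
  have ol: "ortholist vs" unfolding vs
    by (rule ortholist_concat) (use sets in \<open>auto simp: Sv_def\<close>)
  have "span (set vs) = UNIV" unfolding vs by (rule eigenspaces_span) (use sets in auto)
  then have "dim (set vs) = CARD('n)" using dim_span[of "set vs"] by simp
  then have len: "length vs = CARD('n)" using ortholist_independent[OF ol] by simp
  have la: "list_all2 (\<lambda>v s. v \<in> sing_eigenspace A s \<and> s \<in> set ss) us \<sigma>"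
  proof -
    have "list_all2 (\<lambda>v s. v \<in> sing_eigenspace A s \<and> s \<in> set ss') (concat (map L ts))
        (concat (map (\<lambda>s. replicate (dim (sing_eigenspace A s)) s) ts))" if "set ts \<subseteq> set ss'" for ts ss'
      using that
    proof (induction ts)
      case (Cons s ts)
      have "list_all2 (\<lambda>v s. v \<in> sing_eigenspace A s \<and> s \<in> set ss') (L s) (replicate (dim (sing_eigenspace A s)) s)"
        using L(2,3)[of s] Cons.prems by (auto simp: list_all2_conv_all_nth subset_iff)
      then show ?case using Cons by (simp add: list_all2_appendI)
    qed simp
    from this[of ss ss] show ?thesis by (simp add: us_def \<sigma>_def nonzero_singular_values_eq ss_def)
  qed
  then have lus: "length us = length \<sigma>" by (rule list_all2_lengthD)
  have E: "us ! k \<in> sing_eigenspace A (\<sigma> ! k)" "\<sigma> ! k \<in> Sv" if "k < length \<sigma>" for k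
    using list_all2_nthD2[OF la that] sets by auto
  show ?thesis
  proof (rule that[OF ol len], unfold \<sigma>_def[symmetric])
    show "length \<sigma> \<le> CARD('n)" using len lus by (simp add: vs_def)
    show "B *v (vs ! k) = (\<sigma> ! k)\<^sup>2 *\<^sub>R (vs ! k)" if "k < length \<sigma>" for k
      using E(1)[OF that] that lus by (simp add: vs_def nth_append sing_eigenspace_def)
    show "\<sigma> ! k > 0" if "k < length \<sigma>" for k using E(2)[OF that] by (simp add: Sv_def)
    show "A *v (vs ! k) = 0" if k: "length \<sigma> \<le> k" "k < CARD('n)" for k
    proof -
      have "vs ! k \<in> set (L 0)" using k len lus by (auto simp: vs_def nth_append)
      then have "B *v (vs ! k) = 0" using L(2)[of 0] by (auto simp: sing_eigenspace_def)
      then have "(A *v (vs ! k)) \<bullet> (A *v (vs ! k)) = 0" using B_inner[of "vs ! k" "vs ! k"] by simp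
      then show ?thesis by simp
    qed
  qed
qed

text \<open>The rows of OX are right singular vectors. The left ones live in the d-dimensional
  space, so they are embedded first and then completed to a basis of the n-dimensional space, which
  makes OY square. The last claim holds because the first rows of OY come from the
  embedding.\<close>

theorem singular_value_decomposition:
  assumes nd: "CARD('d) \<le> CARD('n)"
  obtains OX OY :: "real^'n^'n" where "orthogonal_matrix OX" "orthogonal_matrix OY"
    "\<And>x y. (A *v x) \<bullet> y = diag_act (nonzero_singular_values A) (OX *v x) \<bullet> (OY *v coord_embed y)"
    "length (nonzero_singular_values A) = rank A"
    "\<And>k. k < rank A \<Longrightarrow> nonzero_singular_values A ! k > 0"
    "\<And>u. u \<in> head_space (rank A) \<Longrightarrow> \<exists>y. OY *v coord_embed (y :: real^'d) = u"
proof -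
  define \<sigma> where "\<sigma> = nonzero_singular_values A"
  define h where "h = length \<sigma>"
  obtain vs where vs: "ortholist vs" "length vs = CARD('n)" and r: "length (nonzero_singular_values A) \<le> CARD('n)"
    "\<And>k. k < length (nonzero_singular_values A) \<Longrightarrow> B *v (vs ! k) = (nonzero_singular_values A ! k)\<^sup>2 *\<^sub>R (vs ! k)"
    "\<And>k. length (nonzero_singular_values A) \<le> k \<Longrightarrow> k < CARD('n) \<Longrightarrow> A *v (vs ! k) = 0"
    "\<And>k. k < length (nonzero_singular_values A) \<Longrightarrow> nonzero_singular_values A ! k > 0"
    by (rule right_singular_vectors) (rule that)
  note hn = r(1)[folded \<sigma>_def, folded h_def] and Bv = r(2)[folded \<sigma>_def, folded h_def]
    and Av0 = r(3)[folded \<sigma>_def, folded h_def] and pos = r(4)[folded \<sigma>_def, folded h_def]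
  have vv: "vs ! i \<bullet> vs ! j = (if i = j then 1 else 0)" if "i < CARD('n)" "j < CARD('n)" for i j
    using vs that by (simp add: ortholist_def)
  define w where "w k = (A *v (vs ! k)) /\<^sub>R (\<sigma> ! k)" for k
  have ww: "w i \<bullet> w j = (if i = j then 1 else 0)" if "i < h" "j < h" for i j
  proof -
    have "w i \<bullet> w j = ((B *v (vs ! j)) \<bullet> (vs ! i)) / (\<sigma> ! i * \<sigma> ! j)"
      unfolding B_inner by (simp add: w_def divide_inverse inner_commute[of "A *v (vs ! i)"])
    also have "\<dots> = (if i = j then 1 else 0)"
      using that vv[of j i] hn pos[of i] pos[of j] by (simp add: Bv power2_eq_square)
    finally show ?thesis .
  qed
  have wA: "A *v (vs ! k) = (\<sigma> ! k) *\<^sub>R w k" if "k < h" for k using pos[OF that] by (simp add: w_def)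
  define us where "us = map (\<lambda>k. coord_embed (w k) :: real^'n) [0..<h]"
  have "ortholist us" using ww by (simp add: ortholist_def us_def inner_coord_embed[OF nd])
  then obtain ws where bs: "ortholist (us @ ws)" "length (us @ ws) = DIM(real^'n)" by (rule ortholist_extend)
  then have bl: "length (us @ ws) = CARD('n)" by simp
  have bk: "(us @ ws) ! k = coord_embed (w k)" if "k < h" for k using that by (simp add: us_def nth_append)
  let ?OX = "rowmat vs" and ?OY = "rowmat (us @ ws)"
  have Ax: "A *v x = (\<Sum>k<h. (vs ! k \<bullet> x) *\<^sub>R (\<sigma> ! k) *\<^sub>R w k)" for x
  proof -
    have "A *v x = A *v (\<Sum>k<CARD('n). (vs ! k \<bullet> x) *\<^sub>R (vs ! k))" using rowmat_expand[OF vs, of x] by simp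
    also have "\<dots> = (\<Sum>k<CARD('n). (vs ! k \<bullet> x) *\<^sub>R (A *v (vs ! k)))"
      by (simp add: linear_sum[OF matrix_vector_mul_linear] matrix_vector_mult_scaleR)
    also have "\<dots> = (\<Sum>k<h. (vs ! k \<bullet> x) *\<^sub>R (A *v (vs ! k)))"
      by (rule sum.mono_neutral_right) (use hn Av0 in auto)
    also have "\<dots> = (\<Sum>k<h. (vs ! k \<bullet> x) *\<^sub>R (\<sigma> ! k) *\<^sub>R w k)" by (simp add: wA)
    finally show ?thesis .
  qed
  have rk: "h = rank A"
  proof -
    have ow: "ortholist (map w [0..<h])" using ww by (simp add: ortholist_def)
    have sw: "set (map w [0..<h]) = w ` {..<h}" by auto
    have "range ((*v) A) = span (w ` {..<h})"
    proof
      show "range ((*v) A) \<subseteq> span (w ` {..<h})"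
        using Ax by (auto intro!: span_sum span_scale intro: span_base)
      have "w k \<in> range ((*v) A)" if "k < h" for k
      proof
        show "w k = A *v ((vs ! k) /\<^sub>R (\<sigma> ! k))" by (simp add: w_def matrix_vector_mult_scaleR)
      qed simp
      moreover have "subspace (range ((*v) A))"
        by (rule linear_subspace_image[OF matrix_vector_mul_linear subspace_UNIV])
      ultimately show "span (w ` {..<h}) \<subseteq> range ((*v) A)" by (intro span_minimal) auto
    qed
    then have "rank A = dim (w ` {..<h})" by (simp add: rank_dim_range dim_span)
    then show ?thesis using ortholist_independent(2)[OF ow] sw by simp
  qed
  show ?thesis
  proof (rule that)
    show "orthogonal_matrix ?OX" by (rule orthogonal_rowmat[OF vs])
    show "orthogonal_matrix ?OY" by (rule orthogonal_rowmat[OF bs(1) bl])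
    show "length (nonzero_singular_values A) = rank A" using rk by (simp add: h_def \<sigma>_def)
    show "nonzero_singular_values A ! k > 0" if "k < rank A" for k using pos rk that by (simp add: \<sigma>_def)
    show "(A *v x) \<bullet> y = diag_act (nonzero_singular_values A) (?OX *v x) \<bullet> (?OY *v coord_embed y)" for x y
    proof -
      define f where "f k = (if k < h then \<sigma> ! k * (vs ! k \<bullet> x) * (w k \<bullet> y) else 0)" for k
      have "diag_act (nonzero_singular_values A) (?OX *v x) \<bullet> (?OY *v coord_embed y) = (\<Sum>i\<in>(UNIV :: 'n set). f (coord_no i))"
        unfolding inner_vec_def
        by (intro sum.cong refl) (simp add: diag_act_def \<sigma>_def[symmetric] h_def[symmetric] rowmat_mult f_def bk inner_coord_embed[OF nd])
      also have "\<dots> = (\<Sum>k<CARD('n). f k)" by (rule sum_coord_no)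
      also have "\<dots> = (\<Sum>k<h. f k)" by (rule sum.mono_neutral_right) (use hn in \<open>auto simp: f_def\<close>)
      also have "\<dots> = (A *v x) \<bullet> y" unfolding Ax inner_sum_left by (intro sum.cong refl) (simp add: f_def)
      finally show ?thesis by simp
    qed
    show "\<exists>y. ?OY *v coord_embed (y :: real^'d) = u" if u: "u \<in> head_space (rank A)" for u
    proof (intro exI vec_eq_iff[THEN iffD2] allI)
      fix i :: 'n
      define y where "y = (\<Sum>k<h. (u $ from_nat_into UNIV k) *\<^sub>R w k)"
      have ey: "(coord_embed y :: real^'n) = (\<Sum>k<h. (u $ from_nat_into UNIV k) *\<^sub>R ((us @ ws) ! k))"
        unfolding y_def by (simp add: linear_sum[OF linear_coord_embed] linear_scale[OF linear_coord_embed] bk)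
      have bb: "(us @ ws) ! i \<bullet> (us @ ws) ! j = (if i = j then 1 else 0)" if "i < CARD('n)" "j < CARD('n)" for i j
        using bs bl that by (simp add: ortholist_def)
      have "(?OY *v coord_embed y) $ i = (\<Sum>k<h. u $ from_nat_into UNIV k * (if coord_no i = k then 1 else 0))"
        unfolding rowmat_mult ey inner_sum_right using hn by (intro sum.cong refl) (simp add: bb coord_no_less)
      also have "\<dots> = (if coord_no i < h then u $ i else 0)" by (simp add: from_nat_into_coord_no if_distrib cong: if_cong)
      also have "\<dots> = u $ i" using u rk by (auto simp: head_space_def)
      finally show "(?OY *v coord_embed (\<Sum>k<h. (u $ from_nat_into UNIV k) *\<^sub>R w k)) $ i = u $ i" by (simp add: y_def)
    qed
  qed
qed

end

subsection \<open>Plans concentrated on two graphs\<close>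

text \<open>On the set where the Radon-Nikodym derivative exceeds 1 its excess integrates to 0, as
  the measure of that set may not grow. Capping the derivative at 1 therefore changes it only on a
  null set and yields bounds at every point.\<close>

lemma density_of_le:
  fixes M N :: "'a measure"
  assumes M: "finite_measure M" and sets: "sets N = sets M" and le: "\<And>A. A \<in> sets M \<Longrightarrow> emeasure N A \<le> emeasure M A"
  obtains \<alpha> :: "'a \<Rightarrow> real" where "\<alpha> \<in> borel_measurable M" "range \<alpha> \<subseteq> {0..1}" "N = density M (\<lambda>x. ennreal (\<alpha> x))"
proof -
  interpret finite_measure M by fact
  have ac: "absolutely_continuous M N"
    unfolding absolutely_continuous_def
  proof
    fix A assume A: "A \<in> null_sets M"
    then have "emeasure N A \<le> 0" using le[of A] by (auto simp: null_sets_def)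
    then show "A \<in> null_sets N" using A sets by (auto simp: null_sets_def)
  qed
  define r where "r = RN_deriv M N"
  have r[measurable]: "r \<in> borel_measurable M" by (simp add: r_def)
  have rN: "density M r = N" unfolding r_def by (rule density_RN_deriv[OF ac sets])
  define E where "E = {x \<in> space M. 1 < r x}"
  have E[measurable]: "E \<in> sets M" unfolding E_def by measurable
  have "emeasure N E = (\<integral>\<^sup>+x. r x * indicator E x \<partial>M)" unfolding rN[symmetric] by (rule emeasure_density) auto
  also have "\<dots> = (\<integral>\<^sup>+x. (r x - 1) * indicator E x + indicator E x \<partial>M)"
    by (intro nn_integral_cong) (auto simp: indicator_def E_def diff_add_cancel_ennreal)
  also have "\<dots> = (\<integral>\<^sup>+x. (r x - 1) * indicator E x \<partial>M) + emeasure M E"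
    by (subst nn_integral_add) auto
  finally have "(\<integral>\<^sup>+x. (r x - 1) * indicator E x \<partial>M) + emeasure M E \<le> 0 + emeasure M E" using le[OF E] by simp
  then have "(\<integral>\<^sup>+x. (r x - 1) * indicator E x \<partial>M) = 0"
    using emeasure_finite[of E] by (simp add: ennreal_add_left_cancel_le add.commute)
  then have "AE x in M. (r x - 1) * indicator E x = 0" by (subst (asm) nn_integral_0_iff_AE) auto
  then have r1: "AE x in M. r x \<le> 1" using AE_space
  proof eventually_elim
    case (elim x)
    show ?case
    proof (rule ccontr)
      assume "\<not> r x \<le> 1"
      then have "1 < r x" by simp
      moreover have "r x - 1 = 0" using elim \<open>1 < r x\<close> by (simp add: E_def)
      ultimately show False using \<open>\<not> r x \<le> 1\<close> by (simp add: diff_eq_0_iff_ennreal)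
    qed
  qed
  show ?thesis
  proof (rule that[of "\<lambda>x. min 1 (enn2real (r x))"])
    show "(\<lambda>x. min 1 (enn2real (r x))) \<in> borel_measurable M" by measurable
    show "range (\<lambda>x. min 1 (enn2real (r x))) \<subseteq> {0..1}" by auto
    have "AE x in M. r x = ennreal (min 1 (enn2real (r x)))" using r1
    proof eventually_elim
      case (elim x)
      then have "r x < \<infinity>" using ennreal_one_less_top le_less_trans by fastforce
      then have "ennreal (enn2real (r x)) = r x" by simp
      moreover have "enn2real (r x) \<le> 1" using elim by (metis enn2real_leI zero_le_one ennreal_1)
      ultimately show ?case by (simp add: min_def)
    qed
    then show "N = density M (\<lambda>x. ennreal (min 1 (enn2real (r x))))"
      unfolding rN[symmetric] by (intro density_cong) auto
  qed
qed

lemma measurable_graph: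
  fixes T :: "'a::euclidean_space \<Rightarrow> 'b::euclidean_space"
  assumes T[measurable]: "T \<in> borel_measurable borel"
  shows "(\<lambda>x. (x, T x)) \<in> borel_measurable borel" "{p. snd p = T (fst p)} \<in> sets borel"
proof -
  show "(\<lambda>x. (x, T x)) \<in> borel_measurable borel" unfolding borel_prod[symmetric] by measurable
  have [measurable]: "fst \<in> borel_measurable (borel :: ('a \<times> 'b) measure)" "snd \<in> borel_measurable (borel :: ('a \<times> 'b) measure)"
    by (auto intro!: borel_measurable_continuous_onI continuous_intros)
  have "{p \<in> space borel. snd p = T (fst p)} \<in> sets (borel :: ('a \<times> 'b) measure)" by measurable
  then show "{p. snd p = T (fst p)} \<in> sets borel" by simp
qed

text \<open>The plan is cut into its parts on and off the graph of T1. Each part has a first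
  marginal dominated by \<mu>, whose density provides the weight \<alpha>.\<close>

lemma is_m_map_two_graphs:
  fixes \<mu> :: "'a::euclidean_space measure" and \<nu> :: "'b::euclidean_space measure"
  assumes pi: "\<pi> \<in> couplings \<mu> \<nu>" and T1: "T1 \<in> borel_measurable borel" and T2: "T2 \<in> borel_measurable borel"
    and ae: "AE p in \<pi>. snd p = T1 (fst p) \<or> snd p = T2 (fst p)"
  shows "is_m_map 2 \<mu> \<nu> \<pi>"
proof -
  interpret prob_space \<pi> using couplingsD(1)[OF pi] .
  note sets_pi = couplingsD(2)[OF pi] and space_pi = couplingsD(3)[OF pi]
  note [measurable] = couplingsD(6,7)[OF pi] T1 T2
  have sets_mu: "sets \<mu> = sets borel" by (rule couplingsD(8)[OF pi])
  have mu: "finite_measure \<mu>" unfolding couplingsD(4)[OF pi, symmetric]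
    by (rule finite_measure_distr) simp
  \<comment> \<open>Where the two graphs meet, the mass is counted in the first piece.\<close>
  define E where "E i = (if i = (1::nat) then {p. snd p = T1 (fst p)} else - {p. snd p = T1 (fst p)})" for i
  define T where "T i = (if i = (1::nat) then T1 else T2)" for i
  have E[measurable]: "E i \<in> sets \<pi>" for i
    using measurable_graph(2)[OF T1] by (auto simp: E_def sets_pi borel_comp)
  define N where "N i = distr (density \<pi> (indicator (E i))) borel fst" for i
  have fst_d: "fst \<in> measurable (density \<pi> (indicator (E i))) borel" for i by simp
  have "\<exists>\<alpha> :: 'a \<Rightarrow> real. \<alpha> \<in> borel_measurable borel \<and> range \<alpha> \<subseteq> {0..1} \<and> N i = density \<mu> (\<lambda>x. ennreal (\<alpha> x))" for i
  proof -
    obtain \<alpha> :: "'a \<Rightarrow> real" where "\<alpha> \<in> borel_measurable \<mu>" "range \<alpha> \<subseteq> {0..1}" "N i = density \<mu> (\<lambda>x. ennreal (\<alpha> x))"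
    proof (rule density_of_le[OF mu])
      show "sets (N i) = sets \<mu>" by (simp add: N_def sets_mu)
      fix A assume "A \<in> sets \<mu>"
      then have A[measurable]: "A \<in> sets borel" by (simp add: sets_mu)
      have "emeasure (N i) A = (\<integral>\<^sup>+p. indicator (E i) p * indicator (fst -` A \<inter> space \<pi>) p \<partial>\<pi>)"
        unfolding N_def by (subst emeasure_distr[OF fst_d A], subst emeasure_density) auto
      also have "\<dots> \<le> (\<integral>\<^sup>+p. indicator (fst -` A \<inter> space \<pi>) p \<partial>\<pi>)"
        by (intro nn_integral_mono) (auto simp: indicator_def)
      also have "\<dots> = emeasure \<mu> A"
        unfolding couplingsD(4)[OF pi, symmetric] by (subst emeasure_distr) auto
      finally show "emeasure (N i) A \<le> emeasure \<mu> A" .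
    qed
    then show ?thesis using measurable_cong_sets[OF sets_mu refl] by blast
  qed
  then obtain \<alpha> :: "nat \<Rightarrow> 'a \<Rightarrow> real" where \<alpha>: "\<And>i. \<alpha> i \<in> borel_measurable borel" "\<And>i. range (\<alpha> i) \<subseteq> {0..1}"
     "\<And>i. N i = density \<mu> (\<lambda>x. ennreal (\<alpha> i x))" by metis
  have piece: "(\<integral>\<^sup>+p. indicator (E i) p * indicator S p \<partial>\<pi>) = (\<integral>\<^sup>+ x. ennreal (\<alpha> i x) * indicator S (x, T i x) \<partial>\<mu>)"
    if S: "S \<in> sets borel" and i: "i \<in> {1, 2}" for S i
  proof -
    have Ti[measurable]: "T i \<in> borel_measurable borel" by (simp add: T_def T1 T2)
    have gS[measurable]: "(\<lambda>x. indicator S (x, T i x) :: ennreal) \<in> borel_measurable borel"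
      using measurable_compose[OF measurable_graph(1)[OF Ti] borel_measurable_indicator[OF S]] .
    have a[measurable]: "\<alpha> i \<in> borel_measurable \<mu>" using \<alpha>(1) measurable_cong_sets[OF sets_mu refl] by blast
    have gS'[measurable]: "(\<lambda>x. indicator S (x, T i x) :: ennreal) \<in> borel_measurable \<mu>"
      using gS measurable_cong_sets[OF sets_mu refl] by blast
    have "AE p in \<pi>. indicator (E i) p * (indicator S p :: ennreal) = indicator (E i) p * indicator S (fst p, T i (fst p))"
      using ae
    proof eventually_elim
      case (elim p)
      then have "p \<in> E i \<Longrightarrow> snd p = T i (fst p)" using i by (auto simp: E_def T_def split: if_splits)
      then show ?case by (cases p) (auto simp: indicator_def)
    qed
    then have "(\<integral>\<^sup>+p. indicator (E i) p * indicator S p \<partial>\<pi>) = (\<integral>\<^sup>+p. indicator (E i) p * indicator S (fst p, T i (fst p)) \<partial>\<pi>)"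
      by (rule nn_integral_cong_AE)
    also have "\<dots> = (\<integral>\<^sup>+p. indicator S (fst p, T i (fst p)) \<partial>density \<pi> (indicator (E i)))"
      by (subst nn_integral_density) auto
    also have "\<dots> = (\<integral>\<^sup>+x. indicator S (x, T i x) \<partial>N i)"
      unfolding N_def by (subst nn_integral_distr[OF fst_d]) auto
    also have "\<dots> = (\<integral>\<^sup>+ x. ennreal (\<alpha> i x) * indicator S (x, T i x) \<partial>\<mu>)"
      unfolding \<alpha>(3) by (subst nn_integral_density) auto
    finally show ?thesis .
  qed
  show ?thesis unfolding is_m_map_def
  proof (intro conjI pi exI[of _ 2] exI[of _ \<alpha>] exI[of _ T] ballI)
    fix S :: "('a \<times> 'b) set" assume S: "S \<in> sets borel"
    then have S'[measurable]: "S \<in> sets \<pi>" by (simp add: sets_pi)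
    have "emeasure \<pi> S = (\<integral>\<^sup>+p. indicator (E 1) p * indicator S p + indicator (E 2) p * indicator S p \<partial>\<pi>)"
      by (subst nn_integral_indicator[OF S', symmetric]) (intro nn_integral_cong, auto simp: indicator_def E_def)
    also have "\<dots> = (\<integral>\<^sup>+p. indicator (E 1) p * indicator S p \<partial>\<pi>) + (\<integral>\<^sup>+p. indicator (E 2) p * indicator S p \<partial>\<pi>)"
      by (intro nn_integral_add) auto
    also have "\<dots> = (\<Sum>i = 1..2. \<integral>\<^sup>+ x. ennreal (\<alpha> i x) * indicator S (x, T i x) \<partial>\<mu>)"
      using piece[OF S] by (simp add: numeral_2_eq_2)
    finally show "emeasure \<pi> S = (\<Sum>i = 1..2. \<integral>\<^sup>+ x. ennreal (\<alpha> i x) * indicator S (x, T i x) \<partial>\<mu>)" .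
  qed (use \<alpha> T1 T2 in \<open>auto simp: T_def\<close>)
qed

subsection \<open>Measurable selection from compact relations\<close>

text \<open>Extreme values of continuous functions over the sections of a compact relation take the
  place of a selection theorem: where the section is nonempty, their superlevel sets are projections
  of compact sets. The value 0 is a default for empty sections.\<close>

definition sup_over :: "('a \<times> 'b) set \<Rightarrow> ('b \<Rightarrow> real) \<Rightarrow> 'a \<Rightarrow> real" where
  "sup_over \<Gamma> u x = (if x \<in> fst ` \<Gamma> then SUP y\<in>{y. (x, y) \<in> \<Gamma>}. u y else 0)"

context
  fixes \<Gamma> :: "('a::euclidean_space \<times> 'b::euclidean_space) set" and u :: "'b \<Rightarrow> real"
  assumes \<Gamma>: "compact \<Gamma>" and u: "continuous_on UNIV u"
begin

lemma sup_over_attained: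
  assumes "x \<in> fst ` \<Gamma>" obtains y where "(x, y) \<in> \<Gamma>" "sup_over \<Gamma> u x = u y" "\<And>z. (x, z) \<in> \<Gamma> \<Longrightarrow> u z \<le> u y"
proof -
  define \<Gamma>x where "\<Gamma>x = {y. (x, y) \<in> \<Gamma>}"
  have "\<Gamma>x = snd ` (\<Gamma> \<inter> ({x} \<times> UNIV))" by (force simp: \<Gamma>x_def image_iff)
  moreover have "compact (\<Gamma> \<inter> ({x} \<times> (UNIV :: 'b set)))" using \<Gamma> by (intro compact_Int_closed closed_Times) auto
  ultimately have c: "compact \<Gamma>x" by (auto intro!: compact_continuous_image continuous_intros)
  have ne: "\<Gamma>x \<noteq> {}" using assms by (auto simp: \<Gamma>x_def)
  obtain y where y: "y \<in> \<Gamma>x" "\<forall>z\<in>\<Gamma>x. u z \<le> u y"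
    using continuous_attains_sup[OF c ne continuous_on_subset[OF u]] by auto
  have "(SUP y\<in>\<Gamma>x. u y) = u y" by (rule cSup_eq_maximum) (use y in auto)
  then show ?thesis using that[of y] y assms by (auto simp: sup_over_def \<Gamma>x_def)
qed

lemma borel_measurable_sup_over: "sup_over \<Gamma> u \<in> borel_measurable borel"
  unfolding borel_measurable_iff_ge
proof
  fix a :: real
  have cl: "closed (fst ` \<Gamma>)" using \<Gamma> by (intro compact_imp_closed compact_continuous_image continuous_intros)
  have "compact (\<Gamma> \<inter> {p. a \<le> u (snd p)})"
    by (intro compact_Int_closed \<Gamma> closed_Collect_le continuous_intros continuous_on_compose2[OF u]) auto
  then have cl': "closed (fst ` (\<Gamma> \<inter> {p. a \<le> u (snd p)}))" by (intro compact_imp_closed compact_continuous_image continuous_intros)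
  have eq: "{w \<in> space borel. a \<le> sup_over \<Gamma> u w} = fst ` (\<Gamma> \<inter> {p. a \<le> u (snd p)}) \<union> (if a \<le> 0 then - fst ` \<Gamma> else {})"
  proof (intro set_eqI)
    fix w
    show "w \<in> {w \<in> space borel. a \<le> sup_over \<Gamma> u w} \<longleftrightarrow> w \<in> fst ` (\<Gamma> \<inter> {p. a \<le> u (snd p)}) \<union> (if a \<le> 0 then - fst ` \<Gamma> else {})"
    proof (cases "w \<in> fst ` \<Gamma>")
      case True
      obtain y where y: "(w, y) \<in> \<Gamma>" "sup_over \<Gamma> u w = u y" "\<And>z. (w, z) \<in> \<Gamma> \<Longrightarrow> u z \<le> u y"
        using sup_over_attained[OF True] by blast
      have "a \<le> u y \<longleftrightarrow> w \<in> fst ` (\<Gamma> \<inter> {p. a \<le> u (snd p)})"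
      proof
        assume "a \<le> u y" then show "w \<in> fst ` (\<Gamma> \<inter> {p. a \<le> u (snd p)})" using y(1) by (intro image_eqI[of _ _ "(w, y)"]) auto
      next
        assume "w \<in> fst ` (\<Gamma> \<inter> {p. a \<le> u (snd p)})"
        then obtain z where "(w, z) \<in> \<Gamma>" "a \<le> u z" by auto
        then show "a \<le> u y" using y(3) by force
      qed
      then show ?thesis using True y(2) by auto
    next
      case False
      then have "sup_over \<Gamma> u w = 0" "w \<notin> fst ` (\<Gamma> \<inter> {p. a \<le> u (snd p)})" by (auto simp: sup_over_def)
      then show ?thesis using False by auto
    qed
  qed
  show "{w \<in> space borel. a \<le> sup_over \<Gamma> u w} \<in> sets borel"
    unfolding eq using cl cl' by (auto intro!: sets.Un borel_closed borel_comp)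
qed

end

subsection \<open>The gradient of a convex function\<close>

definition grad :: "('a::euclidean_space \<Rightarrow> real) \<Rightarrow> 'a \<Rightarrow> 'a" where
  "grad F z = (\<Sum>e\<in>Basis. dirD F e z *\<^sub>R e)"

definition smooth_at :: "('a::euclidean_space \<Rightarrow> real) \<Rightarrow> 'a \<Rightarrow> bool" where
  "smooth_at F z \<longleftrightarrow> (\<forall>e\<in>Basis. dirD F e z + dirD F (- e) z = 0)"

lemma has_derivative_grad:
  assumes "convex_on UNIV F" "smooth_at F z" shows "(F has_derivative (\<lambda>v. v \<bullet> grad F z)) (at z)"
  unfolding grad_def using assms by (intro convex_has_derivative) (auto simp: smooth_at_def)

lemma smooth_at_derivative:
  assumes F: "convex_on UNIV F" and D: "(F has_derivative (\<lambda>v. v \<bullet> p)) (at z)"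
  shows "smooth_at F z" "grad F z = p"
proof -
  have d: "dirD F e z = e \<bullet> p" for e using dirD_eq_derivative[OF F D] .
  show "smooth_at F z" by (simp add: smooth_at_def d)
  show "grad F z = p" by (simp add: grad_def d inner_commute[of _ p] euclidean_representation)
qed

lemma AE_smooth_at: "convex_on UNIV F \<Longrightarrow> AE z in lborel. smooth_at F z"
  using AE_convex_dirD[of F] by (simp add: smooth_at_def)

lemma borel_measurable_grad[measurable]:
  assumes "convex_on UNIV F" shows "grad F \<in> borel_measurable borel" "Measurable.pred borel (smooth_at F)"
proof -
  note [measurable] = borel_measurable_dirD'[OF assms]
  show "grad F \<in> borel_measurable borel" unfolding grad_def[abs_def] by measurable
  show "Measurable.pred borel (smooth_at F)" unfolding smooth_at_def[abs_def] by measurable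
qed

text \<open>F - G has a minimum at z. This is how the gradient of a potential reveals the partners
  of z.\<close>

lemma grad_of_support:
  assumes F: "convex_on UNIV F" and s: "smooth_at F z" and G: "(G has_derivative (\<lambda>v. v \<bullet> p)) (at z)"
    and le: "\<And>w. F z + G w - G z \<le> F w"
  shows "grad F z = p"
proof -
  have "((\<lambda>w. F w - G w) has_derivative (\<lambda>v. v \<bullet> grad F z - v \<bullet> p)) (at z)"
    by (intro has_derivative_diff has_derivative_grad F s G)
  moreover have "\<forall>\<^sub>F w in at z. F z - G z \<le> F w - G w"
  proof (intro always_eventually allI)
    fix w show "F z - G z \<le> F w - G w" using le[of w] by linarith
  qed
  ultimately have "(\<lambda>v. v \<bullet> grad F z - v \<bullet> p) = (\<lambda>v. 0)"
    by (rule has_derivative_local_min)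
  then have "(grad F z - p) \<bullet> (grad F z - p) = 0"
    by (metis inner_diff_right)
  then show ?thesis by simp
qed

subsection \<open>Full rank\<close>

lemma convex_on_norm_power2: "convex_on UNIV (\<lambda>x::'a::real_inner. (norm x)\<^sup>2)"
proof (rule convex_onI)
  fix t :: real and x y :: 'a assume t: "0 < t" "t < 1"
  have "(1 - t) * (norm x)\<^sup>2 + t * (norm y)\<^sup>2 - (norm ((1 - t) *\<^sub>R x + t *\<^sub>R y))\<^sup>2 = t * (1 - t) * (norm (x - y))\<^sup>2"
    by (simp add: power2_norm_eq_inner inner_diff_left inner_diff_right inner_add_left inner_add_right
        inner_commute[of y x] algebra_simps)
  moreover have "0 \<le> t * (1 - t) * (norm (x - y))\<^sup>2" using t by simp
  ultimately show "(norm ((1 - t) *\<^sub>R x + t *\<^sub>R y))\<^sup>2 \<le> (1 - t) * (norm x)\<^sup>2 + t * (norm y)\<^sup>2" by linarith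
qed simp

lemma three_roots:
  fixes a b c :: real
  assumes "a * x\<^sup>2 + b * x + c = 0" "a * y\<^sup>2 + b * y + c = 0" "a * z\<^sup>2 + b * z + c = 0"
    and ne: "x \<noteq> y" "x \<noteq> z" "y \<noteq> z"
  shows "a = 0 \<and> b = 0 \<and> c = 0"
proof -
  have "(x - y) * (a * (x + y) + b) = 0" "(x - z) * (a * (x + z) + b) = 0"
    using assms(1-3) by (simp_all add: power2_eq_square algebra_simps)
  then have 1: "a * (x + y) + b = 0" "a * (x + z) + b = 0" using ne by auto
  then have "a * (y - z) = 0" unfolding right_diff_distrib distrib_left by linarith
  then have a: "a = 0" using ne by simp
  then have "b = 0" using 1 by simp
  then show ?thesis using a assms by simp
qed

context gw_marginals
begin

lemma AE_mu_of_lborel: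
  assumes "absolutely_continuous lborel \<mu>" "AE x in lborel. P x" shows "AE x in \<mu>. P x"
  using mu by (intro absolutely_continuous_AE[OF _ assms]) (simp add: borel_prob_def)

context
  fixes \<pi> :: "((real^'n) \<times> (real^'d)) measure"
  assumes opt: "gw_optimal \<mu> \<nu> \<pi>" and ac: "absolutely_continuous lborel \<mu>"
    and full: "rank (cross_moment \<pi>) = CARD('d)"
begin

private definition "M = cross_moment \<pi>"
private definition "\<Gamma> = measure_support \<pi>"
private definition "At y = 4 *\<^sub>R (transpose M *v y)"
private definition "\<kappa> x y = (norm x)\<^sup>2 * (norm y)\<^sup>2 + x \<bullet> At y"

private lemma pi: "\<pi> \<in> couplings \<mu> \<nu>" using opt by (simp add: gw_optimal_def)

private lemma kappa: "lin_value (cross_moment \<pi>) (x, y) = \<kappa> x y"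
proof -
  have "(M *v x) \<bullet> y = x \<bullet> (transpose M *v y)"
    by (simp add: inner_commute[of _ y] inner_commute[of x] dot_lmul_matrix)
  then show ?thesis by (simp add: lin_value_def \<kappa>_def At_def M_def[symmetric])
qed

private lemma linear_At: "linear At" and inj_At: "inj At"
proof -
  show l: "linear At" unfolding At_def[abs_def] by (intro linear_compose_scale_right matrix_vector_mul_linear)
  have "inj ((*v) (transpose M))"
    using full full_rank_injective[of "transpose M"] rank_transpose[of M] by (simp add: M_def)
  then show "inj At" unfolding At_def[abs_def] by (auto simp: inj_def)
qed

text \<open>In x the gain \<kappa> is a linear function plus |y|^2 times |x|^2. The coefficient is
  nonnegative, so the supremum is honestly convex.\<close>

private lemma potential:
  obtains F where "convex_on UNIV F"
    "\<And>x y z. (x, y) \<in> \<Gamma> \<Longrightarrow> F x + \<kappa> z y - \<kappa> x y \<le> F z"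
proof -
  note supp = measure_support_coupling[OF pi]
  have cyc: "cyc_mono \<kappa> \<Gamma>" using cyc_mono_lin_value[OF opt] by (simp add: kappa \<Gamma>_def)
  have bd: "bounded (\<kappa> z ` snd ` \<Gamma>)" for z
  proof -
    have "compact (snd ` \<Gamma>)" using supp(2) unfolding \<Gamma>_def by (intro compact_continuous_image continuous_intros)
    moreover have "continuous_on (snd ` \<Gamma>) (\<kappa> z)" unfolding \<kappa>_def[abs_def]
      by (intro continuous_intros linear_continuous_on linear_conv_bounded_linear[THEN iffD1] linear_At)
    ultimately show ?thesis using compact_imp_bounded compact_continuous_image by blast
  qed
  have ne: "\<Gamma> \<noteq> {}" using supp(4) by (simp add: \<Gamma>_def)
  obtain F where F: "\<And>x y z. (x, y) \<in> \<Gamma> \<Longrightarrow> F x + \<kappa> z y - \<kappa> x y \<le> F z"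
    "\<And>z. F z = (SUP p\<in>\<Gamma>. F (fst p) + \<kappa> z (snd p) - \<kappa> (fst p) (snd p))"
    "\<And>z. bdd_above ((\<lambda>p. F (fst p) + \<kappa> z (snd p) - \<kappa> (fst p) (snd p)) ` \<Gamma>)"
    by (rule cyc_mono_potential[OF cyc ne bd]) (rule that)
  have "convex_on UNIV (\<lambda>z. SUP p\<in>\<Gamma>. F (fst p) + \<kappa> z (snd p) - \<kappa> (fst p) (snd p))"
  proof (rule convex_on_SUP[OF ne _ F(3)])
    fix p assume "p \<in> \<Gamma>"
    have "convex_on UNIV (\<lambda>z::real^'n. (norm (snd p))\<^sup>2 * (norm z)\<^sup>2)"
      by (rule convex_on_cmul[OF _ convex_on_norm_power2]) simp
    moreover have "convex_on UNIV (\<lambda>z. z \<bullet> At (snd p) + (F (fst p) - \<kappa> (fst p) (snd p)))"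
      by (rule convex_onI) (simp_all add: inner_add_left algebra_simps)
    ultimately have "convex_on UNIV (\<lambda>z. (norm (snd p))\<^sup>2 * (norm z)\<^sup>2 + (z \<bullet> At (snd p) + (F (fst p) - \<kappa> (fst p) (snd p))))"
      by (rule convex_on_add)
    then show "convex_on UNIV (\<lambda>z. F (fst p) + \<kappa> z (snd p) - \<kappa> (fst p) (snd p))"
      by (simp add: \<kappa>_def algebra_simps)
  qed
  then have "convex_on UNIV F" unfolding F(2)[symmetric] .
  then show ?thesis using F(1) by (rule that)
qed

theorem full_rank_plan: "is_m_map 2 \<mu> \<nu> \<pi>" "is_map_anti_map \<mu> \<nu> \<pi>"
proof -
  obtain F where F: "convex_on UNIV F" and sub: "\<And>x y z. (x, y) \<in> \<Gamma> \<Longrightarrow> F x + \<kappa> z y - \<kappa> x y \<le> F z"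
    by (rule potential) (rule that)
  note supp = measure_support_coupling[OF pi, folded \<Gamma>_def]
  note [measurable] = borel_measurable_grad[OF F]
  \<comment> \<open>Rank d makes the transpose of M injective. The left inverse recovers y from the
    gradient as soon as |y|^2 is known.\<close>
  obtain li where li: "linear li" "li \<circ> At = id" using linear_injective_left_inverse[OF linear_At inj_At] by blast
  have liAt: "li (At y) = y" for y using li(2) by (simp add: o_def fun_eq_iff)
  have [measurable]: "li \<in> borel_measurable borel"
    using li(1) by (intro borel_measurable_continuous_onI linear_continuous_on) (simp add: linear_conv_bounded_linear)
  have gr: "grad F x = (2 * (norm y)\<^sup>2) *\<^sub>R x + At y" if xy: "(x, y) \<in> \<Gamma>" and s: "smooth_at F x" for x y
  proof (rule grad_of_support[OF F s])
    have "((\<lambda>z. (z \<bullet> z) * (norm y)\<^sup>2 + z \<bullet> At y) has_derivative (\<lambda>v. (v \<bullet> x + x \<bullet> v) * (norm y)\<^sup>2 + v \<bullet> At y)) (at x)"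
      by (auto intro!: derivative_eq_intros)
    then show "((\<lambda>z. \<kappa> z y) has_derivative (\<lambda>v. v \<bullet> ((2 * (norm y)\<^sup>2) *\<^sub>R x + At y))) (at x)"
      by (simp add: \<kappa>_def power2_norm_eq_inner inner_commute[of x] inner_add_right algebra_simps)
    show "F x + \<kappa> w y - \<kappa> x y \<le> F w" for w by (rule sub[OF xy])
  qed
  have yeq: "y = li (grad F x - (2 * (norm y)\<^sup>2) *\<^sub>R x)" if "(x, y) \<in> \<Gamma>" "smooth_at F x" for x y
    using gr[OF that] liAt[of y] by simp
  \<comment> \<open>\<open>m\<close> and \<open>- m2\<close> are the largest and the smallest
    squared norm among the partners of x. The two maps T1 and T2 will use these two values.\<close>
  define m where "m = sup_over \<Gamma> (\<lambda>y. (norm y)\<^sup>2)"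
  define m2 where "m2 = sup_over \<Gamma> (\<lambda>y. - (norm y)\<^sup>2)"
  have cn: "continuous_on UNIV (\<lambda>y::real^'d. (norm y)\<^sup>2)" "continuous_on UNIV (\<lambda>y::real^'d. - (norm y)\<^sup>2)"
    by (intro continuous_intros)+
  have [measurable]: "m \<in> borel_measurable borel" "m2 \<in> borel_measurable borel"
    unfolding m_def m2_def by (intro borel_measurable_sup_over supp cn)+
  define T1 where "T1 x = li (grad F x - (2 * m x) *\<^sub>R x)" for x
  define T2 where "T2 x = li (grad F x - (2 * (- m2 x)) *\<^sub>R x)" for x
  have [measurable]: "T1 \<in> borel_measurable borel" "T2 \<in> borel_measurable borel"
    unfolding T1_def[abs_def] T2_def[abs_def] by measurable
  have mx: "\<exists>y. (x, y) \<in> \<Gamma> \<and> m x = (norm y)\<^sup>2 \<and> (\<forall>z. (x, z) \<in> \<Gamma> \<longrightarrow> (norm z)\<^sup>2 \<le> (norm y)\<^sup>2)" if "x \<in> fst ` \<Gamma>" for x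
    unfolding m_def by (rule sup_over_attained[OF supp(2) cn(1) that]) blast
  have mn: "\<exists>y. (x, y) \<in> \<Gamma> \<and> m2 x = - (norm y)\<^sup>2 \<and> (\<forall>z. (x, z) \<in> \<Gamma> \<longrightarrow> - (norm z)\<^sup>2 \<le> - (norm y)\<^sup>2)" if "x \<in> fst ` \<Gamma>" for x
    unfolding m2_def by (rule sup_over_attained[OF supp(2) cn(2) that]) blast
  have quad: "4 * (li x \<bullet> li x) * ((norm y)\<^sup>2)\<^sup>2 + (- 4 * (li (grad F x) \<bullet> li x) - 1) * (norm y)\<^sup>2 + li (grad F x) \<bullet> li (grad F x) = 0"
    if xy: "(x, y) \<in> \<Gamma>" "smooth_at F x" for x y
  proof -
    define s where "s = (norm y)\<^sup>2"
    have "y = li (grad F x) - (2 * s) *\<^sub>R li x"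
      using yeq[OF xy] by (simp add: s_def linear_diff[OF li(1)] linear_scale[OF li(1)])
    then have "y \<bullet> y = (li (grad F x) - (2 * s) *\<^sub>R li x) \<bullet> (li (grad F x) - (2 * s) *\<^sub>R li x)" by metis
    moreover have "y \<bullet> y = s" by (simp add: s_def power2_norm_eq_inner)
    ultimately have "s = (li (grad F x) - (2 * s) *\<^sub>R li x) \<bullet> (li (grad F x) - (2 * s) *\<^sub>R li x)" by simp
    then have "s = li (grad F x) \<bullet> li (grad F x) - 4 * s * (li (grad F x) \<bullet> li x) + 4 * (s * s) * (li x \<bullet> li x)"
      by (simp add: inner_diff_left inner_diff_right inner_commute[of "li x" "li (grad F x)"] algebra_simps)
    then show ?thesis unfolding s_def[symmetric] by (simp add: power2_eq_square algebra_simps)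
  qed
  have two: "y = T1 x \<or> y = T2 x" if xy: "(x, y) \<in> \<Gamma>" "smooth_at F x" for x y
  proof -
    have "x \<in> fst ` \<Gamma>" using xy by force
    then obtain y1 y2 where y1: "(x, y1) \<in> \<Gamma>" "m x = (norm y1)\<^sup>2" and y2: "(x, y2) \<in> \<Gamma>" "m2 x = - (norm y2)\<^sup>2"
      and y12: "(norm y)\<^sup>2 \<le> (norm y1)\<^sup>2" "(norm y2)\<^sup>2 \<le> (norm y)\<^sup>2"
      using mx[of x] mn[of x] xy(1) by (metis neg_le_iff_le)
    have "(norm y)\<^sup>2 = m x \<or> (norm y)\<^sup>2 = - m2 x"
    proof (rule ccontr)
      assume "\<not> ?thesis"
      then have ne: "(norm y)\<^sup>2 \<noteq> (norm y1)\<^sup>2" "(norm y)\<^sup>2 \<noteq> (norm y2)\<^sup>2" "(norm y1)\<^sup>2 \<noteq> (norm y2)\<^sup>2" using y1 y2 y12 by auto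
      \<comment> \<open>A third root would annihilate all coefficients; but once li x = 0 the linear
        coefficient is -1.\<close>
      have "- 4 * (li (grad F x) \<bullet> li x) - 1 = 0" "4 * (li x \<bullet> li x) = 0"
        using three_roots[OF quad[OF xy] quad[OF y1(1) xy(2)] quad[OF y2(1) xy(2)] ne] by blast+
      then show False by simp
    qed
    then show ?thesis using yeq[OF xy] by (auto simp: T1_def T2_def)
  qed
  have smooth: "AE p in \<pi>. smooth_at F (fst p)"
    by (rule AE_coupling(1)[OF pi AE_mu_of_lborel[OF ac AE_smooth_at[OF F]]])
  show "is_m_map 2 \<mu> \<nu> \<pi>"
  proof (rule is_m_map_two_graphs[OF pi])
    show "AE p in \<pi>. snd p = T1 (fst p) \<or> snd p = T2 (fst p)" using smooth supp(3) by eventually_elim (metis two prod.collapse)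
  qed measurable
  text \<open>
    If \<open>x\<close> has two partners, then the difference of \<open>\<kappa>\<close> at these is a quadratic function of \<open>x\<close> with
    critical point \<open>x\<close>, which makes \<open>x\<close> the only partner of the shorter one.
  \<close>
  have uniq: "x' = x" if xy: "(x, y1) \<in> \<Gamma>" "(x, y2) \<in> \<Gamma>" "(norm y1)\<^sup>2 < (norm y2)\<^sup>2" "smooth_at F x" "(x', y1) \<in> \<Gamma>" for x x' y1 y2
  proof -
    define s where "s = (norm y2)\<^sup>2 - (norm y1)\<^sup>2"
    have s0: "s > 0" using xy by (simp add: s_def)
    have A: "At y2 - At y1 = - (2 * s) *\<^sub>R x"
      using gr[OF xy(1,4)] gr[OF xy(2,4)] by (simp add: s_def algebra_simps)
    have "\<kappa> x' y2 - \<kappa> x y2 + \<kappa> x y1 - \<kappa> x' y1 \<le> 0" using sub[OF xy(2), of x'] sub[OF xy(5), of x] by linarith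
    moreover have "\<kappa> x' y2 - \<kappa> x y2 + \<kappa> x y1 - \<kappa> x' y1 = s * ((norm x')\<^sup>2 - (norm x)\<^sup>2) + (x' - x) \<bullet> (At y2 - At y1)"
      by (simp add: \<kappa>_def s_def inner_diff_left inner_diff_right algebra_simps)
    moreover have "\<dots> = s * (norm (x' - x))\<^sup>2" unfolding A power2_norm_eq_inner
      by (simp add: inner_diff_left inner_diff_right inner_commute[of x' x] algebra_simps)
    ultimately have "s * (norm (x' - x))\<^sup>2 \<le> 0" by simp
    then show ?thesis using s0 by (simp add: mult_le_0_iff)
  qed
  define Gd where "Gd = {x. x \<in> fst ` \<Gamma> \<and> smooth_at F x}"
  have "closed (fst ` \<Gamma>)" using supp(2) by (intro compact_imp_closed compact_continuous_image continuous_intros)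
  then have [measurable]: "fst ` \<Gamma> \<in> sets borel" by auto
  have "{x \<in> space borel. x \<in> fst ` \<Gamma> \<and> smooth_at F x} \<in> sets borel" by measurable
  then have Gd[measurable]: "Gd \<in> sets borel" by (simp add: Gd_def)
  interpret prob_space \<pi> using couplingsD(1)[OF pi] .
  have aeG: "AE p in \<pi>. fst p \<in> Gd \<and> p \<in> \<Gamma>" using smooth supp(3) by eventually_elim (auto simp: Gd_def)
  have "Gd \<noteq> {}"
  proof
    assume "Gd = {}" then have "AE p in \<pi>. False" using aeG by simp
    then show False by simp
  qed
  then obtain x0 where x0: "x0 \<in> Gd" by blast
  have T1: "(x, T1 x) \<in> \<Gamma>" "(norm (T1 x))\<^sup>2 = m x" if x: "x \<in> Gd" for x
  proof -
    obtain y where y: "(x, y) \<in> \<Gamma>" "m x = (norm y)\<^sup>2" using mx[of x] x by (auto simp: Gd_def)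
    then have "y = T1 x" using yeq[of x y] x by (simp add: T1_def Gd_def)
    then show "(x, T1 x) \<in> \<Gamma>" "(norm (T1 x))\<^sup>2 = m x" using y by auto
  qed
  have short: "x' = x" if "x \<in> Gd" "(x, y) \<in> \<Gamma>" "y \<noteq> T1 x" "(x', y) \<in> \<Gamma>" for x x' y
  proof -
    have "(norm y)\<^sup>2 \<le> m x" using mx[of x] that by (force simp: Gd_def)
    moreover have "(norm y)\<^sup>2 \<noteq> m x" using yeq[of x y] that by (auto simp: T1_def Gd_def)
    ultimately have "(norm y)\<^sup>2 < (norm (T1 x))\<^sup>2" using T1[OF that(1)] by simp
    then show ?thesis using uniq[OF that(2) T1(1)[OF that(1)] _ _ that(4)] that(1) by (simp add: Gd_def)
  qed
  \<comment> \<open>Off \<open>Gd\<close> the value is again one that T1 takes on \<open>Gd\<close>,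
    so the range of G is the image of \<open>Gd\<close> under T1. The null condition on the range
    depends on this.\<close>
  define G where "G x = (if x \<in> Gd then T1 x else T1 x0)" for x
  have [measurable]: "G \<in> borel_measurable borel" unfolding G_def[abs_def] by measurable
  define \<Gamma>' where "\<Gamma>' = (\<lambda>p. (snd p, fst p)) ` \<Gamma>"
  have \<Gamma>': "compact \<Gamma>'" unfolding \<Gamma>'_def using supp(2) by (intro compact_continuous_image continuous_intros)
  have \<Gamma>'_iff: "(y, x) \<in> \<Gamma>' \<longleftrightarrow> (x, y) \<in> \<Gamma>" for x y by (force simp: \<Gamma>'_def)
  \<comment> \<open>\<open>H\<close> and \<open>H'\<close> are the componentwise largest and
    smallest partners of y. If y has one partner both return it; if they agree, y has no other. This
    expresses uniqueness by Borel functions.\<close>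
  define H where "H y = (\<chi> i. sup_over \<Gamma>' (\<lambda>x. x $ i) y)" for y
  define H' where "H' y = (\<chi> i. - sup_over \<Gamma>' (\<lambda>x. - (x $ i)) y)" for y
  have ci: "continuous_on UNIV (\<lambda>x::real^'n. x $ i)" "continuous_on UNIV (\<lambda>x::real^'n. - (x $ i))" for i
    by (intro continuous_intros)+
  have [measurable]: "H \<in> borel_measurable borel" "H' \<in> borel_measurable borel"
  proof -
    have [measurable]: "sup_over \<Gamma>' (\<lambda>x. x $ i) \<in> borel_measurable borel" "sup_over \<Gamma>' (\<lambda>x. - (x $ i)) \<in> borel_measurable borel" for i
      by (intro borel_measurable_sup_over \<Gamma>' ci)+
    show "H \<in> borel_measurable borel" "H' \<in> borel_measurable borel"
      unfolding borel_measurable_euclidean_space[where 'c="real^'n"]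
      by (auto simp: H_def H'_def Basis_vec_def inner_axis)
  qed
  have HH: "H y = x" "H' y = x" if u: "(x, y) \<in> \<Gamma>" "\<And>x'. (x', y) \<in> \<Gamma> \<Longrightarrow> x' = x" for x y
  proof -
    have yf: "y \<in> fst ` \<Gamma>'" using u \<Gamma>'_iff by force
    have "sup_over \<Gamma>' v y = v x" if "continuous_on UNIV v" for v
      using sup_over_attained[OF \<Gamma>' that yf] u(2) \<Gamma>'_iff by metis
    then show "H y = x" "H' y = x" using ci by (simp_all add: H_def H'_def vec_eq_iff)
  qed
  have HH_D: "(x', y) \<in> \<Gamma> \<Longrightarrow> x' = H y" if "H' y = H y" for x' y
  proof -
    assume x': "(x', y) \<in> \<Gamma>"
    then have yf: "y \<in> fst ` \<Gamma>'" using \<Gamma>'_iff by force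
    have le: "v x' \<le> sup_over \<Gamma>' v y" if "continuous_on UNIV v" for v
      using sup_over_attained[OF \<Gamma>' that yf] x' \<Gamma>'_iff by metis
    have "x' $ i \<le> H y $ i" "H' y $ i \<le> x' $ i" for i using le[OF ci(1), of i] le[OF ci(2), of i] by (simp_all add: H_def H'_def)
    then show "x' = H y" using that by (simp add: vec_eq_iff) (metis antisym)
  qed
  note sets_pi = couplingsD(2)[OF pi] and space_pi = couplingsD(3)[OF pi]
  note [measurable] = couplingsD(6,7)[OF pi]
  \<comment> \<open>The mass on the graph of G becomes the map part; the rest sits on pairs in which
    y is a shorter partner, and becomes the anti-map part.\<close>
  define U where "U = {p. snd p = G (fst p)}"
  have U[measurable]: "U \<in> sets \<pi>" "- U \<in> sets \<pi>" using measurable_graph(2)[of G] by (auto simp: U_def sets_pi borel_comp)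
  define \<pi>1 where "\<pi>1 = density \<pi> (indicator U)"
  define \<pi>2 where "\<pi>2 = density \<pi> (indicator (- U))"
  have e1: "emeasure \<pi>1 S = emeasure \<pi> (U \<inter> S)" and e2: "emeasure \<pi>2 S = emeasure \<pi> (- U \<inter> S)" if "S \<in> sets \<pi>" for S
    unfolding \<pi>1_def \<pi>2_def using that U
    by (simp_all add: emeasure_restricted)
  have split: "emeasure \<pi> S = emeasure \<pi>1 S + emeasure \<pi>2 S" if S: "S \<in> sets \<pi>" for S
  proof -
    have "emeasure \<pi> (U \<inter> S) + emeasure \<pi> (- U \<inter> S) = emeasure \<pi> ((U \<inter> S) \<union> (- U \<inter> S))"
      using S U by (intro plus_emeasure) auto
    moreover have "(U \<inter> S) \<union> (- U \<inter> S) = S" by auto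
    ultimately show ?thesis using e1[OF S] e2[OF S] by simp
  qed
  define \<mu>' where "\<mu>' = distr \<pi>1 borel fst"
  have m1: "fst \<in> measurable \<pi>1 borel" "snd \<in> measurable \<pi>1 borel" "fst \<in> measurable \<pi>2 borel" "snd \<in> measurable \<pi>2 borel"
    by (simp_all add: \<pi>1_def \<pi>2_def)
  have sp: "space \<pi>1 = UNIV" "space \<pi>2 = UNIV" "sets \<pi>1 = sets \<pi>" "sets \<pi>2 = sets \<pi>" by (simp_all add: \<pi>1_def \<pi>2_def space_pi)
  have fv: "fst -` A \<in> sets \<pi>" if "A \<in> sets borel" for A using measurable_sets[OF couplingsD(6)[OF pi] that] space_pi by simp
  have sv: "snd -` A \<in> sets \<pi>" if "A \<in> sets borel" for A using measurable_sets[OF couplingsD(7)[OF pi] that] space_pi by simp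
  have G1: "distr \<mu>' borel (\<lambda>x. (x, G x)) = \<pi>1"
  proof (rule measure_eqI)
    show "sets (distr \<mu>' borel (\<lambda>x. (x, G x))) = sets \<pi>1" by (simp add: sp sets_pi)
    fix S assume "S \<in> sets (distr \<mu>' borel (\<lambda>x. (x, G x)))"
    then have S: "S \<in> sets borel" by simp
    have gm: "(\<lambda>x. (x, G x)) \<in> borel_measurable borel" by (rule measurable_graph) simp
    have V: "(\<lambda>x. (x, G x)) -` S \<in> sets borel" using measurable_sets[OF gm S] by simp
    have "emeasure (distr \<mu>' borel (\<lambda>x. (x, G x))) S = emeasure \<mu>' ((\<lambda>x. (x, G x)) -` S)"
      using S gm by (subst emeasure_distr) (auto simp: \<mu>'_def measurable_distr_eq1)
    also have "\<dots> = emeasure \<pi>1 (fst -` ((\<lambda>x. (x, G x)) -` S))" unfolding \<mu>'_def using V m1 by (simp add: emeasure_distr sp)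
    also have "\<dots> = emeasure \<pi> (U \<inter> fst -` ((\<lambda>x. (x, G x)) -` S))" by (rule e1[OF fv[OF V]])
    also have "U \<inter> fst -` ((\<lambda>x. (x, G x)) -` S) = U \<inter> S" by (auto simp: U_def)
    also have "emeasure \<pi> (U \<inter> S) = emeasure \<pi>1 S" using e1[of S] S by (simp add: sets_pi)
    finally show "emeasure (distr \<mu>' borel (\<lambda>x. (x, G x))) S = emeasure \<pi>1 S" .
  qed
  have G1snd: "distr \<mu>' borel G = distr \<pi>1 borel snd"
  proof -
    have gm: "(\<lambda>x. (x, G x)) \<in> measurable \<mu>' borel" using measurable_graph(1)[of G] by (simp add: \<mu>'_def measurable_distr_eq1)
    have sm: "snd \<in> borel_measurable (borel :: ((real^'n) \<times> (real^'d)) measure)" by (intro borel_measurable_continuous_onI continuous_intros)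
    have "distr \<pi>1 borel snd = distr (distr \<mu>' borel (\<lambda>x. (x, G x))) borel snd" by (simp add: G1)
    also have "\<dots> = distr \<mu>' borel G" by (subst distr_distr[OF sm gm]) (simp add: o_def)
    finally show ?thesis by simp
  qed
  have nu_split: "emeasure \<nu> B = emeasure (distr \<pi>1 borel snd) B + emeasure (distr \<pi>2 borel snd) B" if B: "B \<in> sets borel" for B
  proof -
    have "emeasure \<nu> B = emeasure \<pi> (snd -` B)" unfolding couplingsD(5)[OF pi, symmetric] using B by (simp add: emeasure_distr space_pi)
    also have "\<dots> = emeasure \<pi>1 (snd -` B) + emeasure \<pi>2 (snd -` B)" by (rule split[OF sv[OF B]])
    finally show ?thesis using B m1 by (simp add: emeasure_distr sp)
  qed
  have nuf: "finite_measure \<nu>" using nu by (simp add: borel_prob_def prob_space.finite_measure)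
  have le: "emeasure (distr \<mu>' borel G) B \<le> emeasure \<nu> B" if "B \<in> sets borel" for B
    unfolding G1snd nu_split[OF that] by simp
  have diff: "diff_measure \<nu> (distr \<mu>' borel G) = distr \<pi>2 borel snd"
  proof (rule measure_eqI)
    show "sets (diff_measure \<nu> (distr \<mu>' borel G)) = sets (distr \<pi>2 borel snd)" using couplingsD(9)[OF pi] by simp
    fix B assume "B \<in> sets (diff_measure \<nu> (distr \<mu>' borel G))"
    then have B: "B \<in> sets borel" using couplingsD(9)[OF pi] by simp
    have fin: "finite_measure (distr \<mu>' borel G)"
    proof (rule finite_measureI)
      have "emeasure (distr \<mu>' borel G) UNIV \<le> emeasure \<nu> UNIV" by (rule le) simp
      also have "\<dots> < \<infinity>" using finite_measure.emeasure_finite[OF nuf] by (simp add: less_top)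
      finally show "emeasure (distr \<mu>' borel G) (space (distr \<mu>' borel G)) \<noteq> \<infinity>" by simp
    qed
    have "emeasure (diff_measure \<nu> (distr \<mu>' borel G)) B = emeasure \<nu> B - emeasure (distr \<mu>' borel G) B"
      by (rule emeasure_diff_measure[OF nuf fin]) (use couplingsD(9)[OF pi] B le in auto)
    also have "\<dots> = emeasure (distr \<pi>2 borel snd) B"
      unfolding nu_split[OF B] G1snd[symmetric] using finite_measure.emeasure_finite[OF fin, of B] by (simp add: ennreal_add_diff_cancel_left)
    finally show "emeasure (diff_measure \<nu> (distr \<mu>' borel G)) B = emeasure (distr \<pi>2 borel snd) B" .
  qed
  have ae2: "AE p in \<pi>2. fst p \<in> Gd \<and> p \<in> \<Gamma> \<and> snd p \<noteq> G (fst p)"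
    unfolding \<pi>2_def
  proof (subst AE_density)
    show "AE p in \<pi>. (0 :: ennreal) < indicator (- U) p \<longrightarrow> fst p \<in> Gd \<and> p \<in> \<Gamma> \<and> snd p \<noteq> G (fst p)"
      using aeG by eventually_elim (simp add: U_def indicator_def)
  qed (use U in simp)
  have ae3: "AE p in \<pi>2. fst p = H (snd p) \<and> H' (snd p) = H (snd p)"
    using ae2
  proof eventually_elim
    case (elim p)
    obtain x y where p: "p = (x, y)" by (cases p)
    have gx: "x \<in> Gd" "(x, y) \<in> \<Gamma>" and yT: "y \<noteq> T1 x" using elim by (auto simp: p G_def)
    have "x' = x" if "(x', y) \<in> \<Gamma>" for x' by (rule short[OF gx yT that])
    from HH[OF gx(2) this] show ?case by (simp add: p)
  qed
  have Hm: "(\<lambda>y. (H y, y)) \<in> borel_measurable borel" unfolding borel_prod[symmetric] by measurable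
  have "closed \<Gamma>" using supp(2) by (rule compact_imp_closed)
  then have \<Gamma>s: "\<Gamma> \<in> sets borel" by auto
  \<comment> \<open>If such a y were T1 x' with x' in \<open>Gd\<close>, then x' would be a partner
    of y, hence equal to \<open>H y\<close>; but y differs from \<open>G (H y)\<close>.\<close>
  have range: "AE y in distr \<pi>2 borel snd. y \<notin> range G"
  proof -
    have [measurable]: "Measurable.pred borel (\<lambda>y. (H y, y) \<in> \<Gamma>)" using measurable_compose[OF Hm, of "\<lambda>p. p \<in> \<Gamma>"] \<Gamma>s by simp
    have "AE y in distr \<pi>2 borel snd. (H y, y) \<in> \<Gamma> \<and> H y \<in> Gd \<and> y \<noteq> G (H y) \<and> H' y = H y"
    proof (subst AE_distr_iff[OF m1(4)])
      show "AE p in \<pi>2. (H (snd p), snd p) \<in> \<Gamma> \<and> H (snd p) \<in> Gd \<and> snd p \<noteq> G (H (snd p)) \<and> H' (snd p) = H (snd p)"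
        using ae2 ae3 by eventually_elim (metis prod.collapse)
    qed measurable
    then show ?thesis
    proof eventually_elim
      case (elim y)
      show ?case
      proof
        assume "y \<in> range G"
        then obtain x where "y = G x" by blast
        then obtain x' where x': "x' \<in> Gd" "y = T1 x'" using x0 by (cases "x \<in> Gd") (auto simp: G_def)
        then have "(x', y) \<in> \<Gamma>" using T1 by simp
        then have "x' = H y" by (rule HH_D[rotated]) (use elim in simp)
        then show False using x' elim by (simp add: G_def)
      qed
    qed
  qed
  have H2: "distr (distr \<pi>2 borel snd) borel (\<lambda>y. (H y, y)) = \<pi>2"
  proof (rule measure_eqI)
    show "sets (distr (distr \<pi>2 borel snd) borel (\<lambda>y. (H y, y))) = sets \<pi>2" by (simp add: sp sets_pi)
    fix S assume "S \<in> sets (distr (distr \<pi>2 borel snd) borel (\<lambda>y. (H y, y)))"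
    then have S: "S \<in> sets borel" by simp
    have cm: "(\<lambda>p. (H (snd p), snd p)) \<in> measurable \<pi>2 borel" using measurable_compose[OF m1(4) Hm] .
    have "emeasure (distr (distr \<pi>2 borel snd) borel (\<lambda>y. (H y, y))) S = emeasure (distr \<pi>2 borel (\<lambda>p. (H (snd p), snd p))) S"
      by (subst distr_distr[OF Hm m1(4)]) (simp add: o_def)
    also have "\<dots> = emeasure \<pi>2 ((\<lambda>p. (H (snd p), snd p)) -` S)" using cm S by (simp add: emeasure_distr sp)
    also have "\<dots> = emeasure \<pi>2 S"
    proof (rule emeasure_eq_AE)
      show "AE p in \<pi>2. p \<in> (\<lambda>p. (H (snd p), snd p)) -` S \<longleftrightarrow> p \<in> S"
        using ae3
      proof eventually_elim
        case (elim p)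
        then have "(H (snd p), snd p) = p" by (cases p) simp
        then show ?case by simp
      qed
      show "(\<lambda>p. (H (snd p), snd p)) -` S \<in> sets \<pi>2" using measurable_sets[OF cm S] by (simp add: sp)
    qed (use S in \<open>simp add: sp sets_pi\<close>)
    finally show "emeasure (distr (distr \<pi>2 borel snd) borel (\<lambda>y. (H y, y))) S = emeasure \<pi>2 S" .
  qed
  have mu'le: "emeasure \<mu>' A \<le> emeasure \<mu> A" if A: "A \<in> sets borel" for A
  proof -
    have "emeasure \<mu>' A = emeasure \<pi>1 (fst -` A)" unfolding \<mu>'_def using A m1 by (simp add: emeasure_distr sp)
    also have "\<dots> \<le> emeasure \<pi> (fst -` A)" unfolding split[OF fv[OF A]] by simp
    also have "\<dots> = emeasure \<mu> A" unfolding couplingsD(4)[OF pi, symmetric] using A by (simp add: emeasure_distr space_pi)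
    finally show ?thesis .
  qed
  show "is_map_anti_map \<mu> \<nu> \<pi>"
    unfolding is_map_anti_map_def
  proof (intro conjI pi exI[of _ G] exI[of _ H] exI[of _ \<mu>'] ballI)
    show "sets \<mu>' = sets borel" by (simp add: \<mu>'_def)
    show "AE y in diff_measure \<nu> (distr \<mu>' borel G). y \<notin> range G" unfolding diff by (rule range)
    fix S :: "((real^'n) \<times> (real^'d)) set" assume S: "S \<in> sets borel"
    show "emeasure \<pi> S = emeasure (distr \<mu>' borel (\<lambda>x. (x, G x))) S + emeasure (distr (diff_measure \<nu> (distr \<mu>' borel G)) borel (\<lambda>y. (H y, y))) S"
      unfolding diff G1 H2 using S by (intro split) (simp add: sets_pi)
  qed (use mu'le le in auto)
qed

end

end

lemma coord_no_ex: "k < CARD('n) \<Longrightarrow> \<exists>i :: 'n::finite. coord_no i = k"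
  using coord_no_inverse by blast

subsection \<open>Head and tail coordinates\<close>

lemma head_tail_component:
  "head_part h x $ i = (if coord_no i < h then x $ i else 0)" "tail_part h x $ i = (if coord_no i < h then 0 else x $ i)"
  by (simp_all add: head_part_def tail_part_def)

lemma head_tail_sum: "head_part h x + tail_part h x = x"
  by (simp add: vec_eq_iff head_tail_component)

lemma linear_head_part: "linear (head_part h :: real^'n \<Rightarrow> real^'n)" and linear_tail_part: "linear (tail_part h :: real^'n \<Rightarrow> real^'n)"
  by (auto intro!: linearI simp: vec_eq_iff head_tail_component)

lemmas head_simps = linear_add[OF linear_head_part] linear_scale[OF linear_head_part] linear_diff[OF linear_head_part] linear_0[OF linear_head_part]
lemmas tail_simps = linear_add[OF linear_tail_part] linear_scale[OF linear_tail_part] linear_diff[OF linear_tail_part] linear_0[OF linear_tail_part]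

lemma head_tail_idem[simp]: "head_part h (head_part h x) = head_part h x" "tail_part h (tail_part h x) = tail_part h x"
  "head_part h (tail_part h x) = 0" "tail_part h (head_part h x) = 0"
  by (simp_all add: vec_eq_iff head_tail_component)

lemma head_space_iff: "x \<in> head_space h \<longleftrightarrow> head_part h x = x" and tail_space_iff: "x \<in> tail_space h \<longleftrightarrow> tail_part h x = x"
  by (auto simp: head_space_def tail_space_def vec_eq_iff head_tail_component not_less)

lemma head_part_in[simp]: "head_part h x \<in> head_space h" and tail_part_in[simp]: "tail_part h x \<in> tail_space h"
  by (simp_all add: head_space_iff tail_space_iff)

lemma subspace_tail_space: "subspace (tail_space h)"
  by (auto simp: subspace_def tail_space_iff tail_simps)

lemma inner_head_tail[simp]: "head_part h x \<bullet> tail_part h y = 0" "tail_part h x \<bullet> head_part h y = 0"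
  by (auto simp: inner_vec_def head_tail_component intro!: sum.neutral)

lemma inner_tail_left: "tail_part h x \<bullet> y = tail_part h x \<bullet> tail_part h y" and inner_head_left: "head_part h x \<bullet> y = head_part h x \<bullet> head_part h y"
  using arg_cong[OF head_tail_sum[of h y], of "\<lambda>v. tail_part h x \<bullet> v"] arg_cong[OF head_tail_sum[of h y], of "\<lambda>v. head_part h x \<bullet> v"]
  by (simp_all add: inner_add_right)

lemma norm_head_tail: "(norm x)\<^sup>2 = (norm (head_part h x))\<^sup>2 + (norm (tail_part h x))\<^sup>2"
proof -
  have "x \<bullet> x = (head_part h x + tail_part h x) \<bullet> (head_part h x + tail_part h x)" by (simp add: head_tail_sum)
  also have "\<dots> = head_part h x \<bullet> head_part h x + tail_part h x \<bullet> tail_part h x"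
    by (simp add: inner_add_left inner_add_right)
  finally show ?thesis by (simp add: power2_norm_eq_inner)
qed

lemma continuous_on_head_tail[continuous_intros]:
  fixes f :: "'a::topological_space \<Rightarrow> real^'n"
  assumes "continuous_on S f" shows "continuous_on S (\<lambda>x. head_part h (f x))" "continuous_on S (\<lambda>x. tail_part h (f x))"
proof -
  have "continuous_on UNIV (head_part h :: real^'n \<Rightarrow> real^'n)" "continuous_on UNIV (tail_part h :: real^'n \<Rightarrow> real^'n)"
    using linear_head_part linear_tail_part by (auto intro: linear_continuous_on simp: linear_conv_bounded_linear)
  then show "continuous_on S (\<lambda>x. head_part h (f x))" "continuous_on S (\<lambda>x. tail_part h (f x))"
    using continuous_on_compose2[OF _ assms] by blast+
qed

lemma borel_measurable_head_tail[measurable]: "head_part h \<in> borel_measurable borel" "tail_part h \<in> borel_measurable borel"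
  by (intro borel_measurable_continuous_onI continuous_intros)+

lemma borel_measurable_Phi_base[measurable]: "Phi_base h \<in> borel_measurable borel"
  unfolding Phi_base_def[abs_def] by (intro borel_measurable_continuous_onI continuous_intros)

lemma borel_measurable_Phi_fibre[measurable]: "Phi_fibre h e \<in> borel_measurable borel"
  unfolding Phi_fibre_def[abs_def] by measurable

lemma Phi_fibre_in: "e \<in> tail_sphere h \<Longrightarrow> Phi_fibre h e x \<in> tail_sphere h"
  by (auto simp: Phi_fibre_def tail_sphere_def intro!: subspace_scale subspace_tail_space)

lemma Phi_decompose: "x = fst (Phi_base h x) + sqrt (snd (Phi_base h x)) *\<^sub>R Phi_fibre h e x"
  using head_tail_sum[of h x] by (auto simp: Phi_base_def Phi_fibre_def)

lemma AE_tail_nonzero: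
  assumes h: "h < CARD('n)" shows "AE x in lborel. tail_part h (x :: real^'n) \<noteq> 0"
proof -
  obtain i :: 'n where i: "coord_no i = h" using coord_no_ex[OF h] by blast
  have "negligible {x :: real^'n. x \<bullet> axis i 1 = 0}"
    using negligible_hyperplane[of "axis i 1 :: real^'n" 0] by (simp add: inner_commute axis_eq_0_iff)
  moreover have "{x :: real^'n. x \<bullet> axis i 1 = 0} \<in> sets lborel" by (simp add: borel_closed closed_hyperplane inner_commute)
  ultimately have "{x :: real^'n. x \<bullet> axis i 1 = 0} \<in> null_sets lborel"
    by (simp add: negligible_iff_null_sets null_sets_def)
  then show ?thesis
  proof (rule AE_I', intro subsetI)
    fix x :: "real^'n" assume "x \<in> {x \<in> space lborel. \<not> tail_part h x \<noteq> 0}"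
    then have "tail_part h x $ i = 0" by simp
    then show "x \<in> {x. x \<bullet> axis i 1 = 0}" using i by (simp add: head_tail_component inner_axis)
  qed
qed

text \<open>
  A property of pairs of base points and points that holds almost everywhere in both variables holds
  almost everywhere along the graph of \<open>Phi_base\<close>, by averaging over translations of the head and
  dilations of the tail, provided that it is insensitive to these.
\<close>

lemma AE_Phi_base:
  fixes P :: "((real^'n) \<times> real) \<Rightarrow> real^'n \<Rightarrow> bool"
  assumes h: "h < CARD('n)" and P: "Measurable.pred borel (\<lambda>(w, z). P w z)"
    and inv: "\<And>a r z z' s. 0 < s \<Longrightarrow> tail_part h z' = s *\<^sub>R tail_part h z \<Longrightarrow> P (a, r) z \<Longrightarrow> P (head_part h a, r) z'"
    and ae: "AE z in lborel. AE w in lborel. P w z"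
  shows "AE x in lborel. P (Phi_base h x) x"
proof -
  \<comment> \<open>The square root is taken because \<open>snd t\<close> scales the squared tail
    norm, which is the second base coordinate. For fixed x the base point of \<open>A t x\<close>
    comes from an affine image of t, up to discarding its tail.\<close>
  define A where "A t x = head_part h x + head_part h (fst t) + sqrt (snd t) *\<^sub>R tail_part h x" for t :: "(real^'n) \<times> real" and x :: "real^'n"
  have pm: "Measurable.pred borel (\<lambda>x. P (Phi_base h x) x)"
  proof -
    have "(\<lambda>x. (Phi_base h x, x)) \<in> borel \<rightarrow>\<^sub>M borel" by measurable
    from measurable_compose[OF this P] show ?thesis by simp
  qed
  have PA: "P (Phi_base h (A t x)) (A t x)" if t: "snd t > 0" and P: "P (x + fst t, (norm (tail_part h x))\<^sup>2 * snd t) x" for t x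
  proof -
    have tA: "tail_part h (A t x) = sqrt (snd t) *\<^sub>R tail_part h x" by (simp add: A_def tail_simps)
    have hA: "head_part h (A t x) = head_part h (x + fst t)" by (simp add: A_def head_simps)
    have "P (head_part h (x + fst t), (norm (tail_part h x))\<^sup>2 * snd t) (A t x)"
      by (rule inv[OF _ tA P]) (use t in simp)
    moreover have "(norm (tail_part h (A t x)))\<^sup>2 = (norm (tail_part h x))\<^sup>2 * snd t"
      using t by (simp add: tA power_mult_distrib)
    ultimately show ?thesis by (simp add: Phi_base_def hA)
  qed
  note tail0 = AE_tail_nonzero[OF h]
  define Q where "Q = {t :: (real^'n) \<times> real. snd t > 0}"
  show ?thesis
  proof (rule AE_lborel_averaging[OF pm, where A=A and Q=Q])
    have "(\<lambda>p. A (fst p) (snd p)) \<in> borel_measurable borel"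
      unfolding A_def by (intro borel_measurable_continuous_onI continuous_intros)
    then show "(\<lambda>(t, z). A t z) \<in> borel_measurable (borel \<Otimes>\<^sub>M borel)" by (simp add: borel_prod case_prod_beta')
    have oQ: "open Q" unfolding Q_def by (intro open_Collect_less continuous_intros)
    then show "Q \<in> sets borel" by auto
    have "(0, 1) \<in> Q" by (simp add: Q_def)
    then have "Q \<noteq> {}" by blast
    then show "emeasure lborel Q \<noteq> 0" using oQ open_not_negligible[of Q] by (auto simp: negligible_iff_null_sets null_sets_def)
    show "AE z in lborel. AE t in lborel. t \<in> Q \<longrightarrow> P (Phi_base h (A t z)) (A t z)"
      using ae tail0
    proof eventually_elim
      case (elim x)
      define r where "r = (norm (tail_part h x))\<^sup>2"
      have r: "r > 0" using elim(2) by (simp add: r_def)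
      have "AE t in lborel. P (x + fst t, r * snd t) x"
      proof (rule AE_lborel_diagonal[where c="\<lambda>j. if j = (0, 1) then 1 / r else 1" and t="(- x, 0)"])
        have "(\<lambda>t. ((x + fst t, r * snd t), x)) \<in> borel \<rightarrow>\<^sub>M borel"
          by (intro borel_measurable_continuous_onI continuous_intros)
        from measurable_compose[OF this P]
        show "Measurable.pred borel (\<lambda>t. P (x + fst t, r * snd t) x)" by simp
        have b: "(0, 1) \<in> (Basis :: ((real^'n) \<times> real) set)" by (auto simp: Basis_prod_def)
        have "(- x, 0) + (\<Sum>j\<in>Basis. ((if j = (0, 1) then 1 / r else 1) * (w \<bullet> j)) *\<^sub>R j) = (fst w - x, snd w / r)" for w :: "(real^'n) \<times> real"
        proof -
          have "(\<Sum>j\<in>Basis. ((if j = (0, 1) then 1 / r else 1) * (w \<bullet> j)) *\<^sub>R j)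
            = (\<Sum>j\<in>Basis. (w \<bullet> j) *\<^sub>R j + (if j = (0, 1) then ((1 / r - 1) * (w \<bullet> j)) *\<^sub>R j else 0))"
            by (intro sum.cong refl) (auto simp: algebra_simps)
          also have "\<dots> = w + ((1 / r - 1) * (w \<bullet> (0, 1))) *\<^sub>R (0, 1)"
            using b by (simp add: sum.distrib euclidean_representation)
          also have "\<dots> = (fst w, snd w / r)" by (cases w) (simp add: algebra_simps)
          finally show ?thesis by simp
        qed
        then show "AE w in lborel. P (x + fst ((- x, 0) + (\<Sum>j\<in>Basis. ((if j = (0, 1) then 1 / r else 1) * (w \<bullet> j)) *\<^sub>R j)),
             r * snd ((- x, 0) + (\<Sum>j\<in>Basis. ((if j = (0, 1) then 1 / r else 1) * (w \<bullet> j)) *\<^sub>R j))) x"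
          using elim(1) r by simp
      qed (use r in auto)
      then show ?case by eventually_elim (auto simp: Q_def r_def intro: PA)
    qed
    fix t :: "(real^'n) \<times> real" assume t: "t \<in> Q" and ae: "AE z in lborel. P (Phi_base h (A t z)) (A t z)"
    \<comment> \<open>For fixed t the motion is affine and diagonal with nonzero factors: 1 on the
      head axes and sqrt (snd t) on the tail axes.\<close>
    show "AE z in lborel. P (Phi_base h z) z"
    proof (rule AE_lborel_diagonal[OF pm, where t="head_part h (fst t)" and c="\<lambda>j. if tail_part h j = 0 then 1 else sqrt (snd t)"])
      have "head_part h (fst t) + (\<Sum>j\<in>Basis. ((if tail_part h j = 0 then 1 else sqrt (snd t)) * (z \<bullet> j)) *\<^sub>R j) = A t z" for z
      proof -
        have "(\<Sum>j\<in>Basis. ((if tail_part h j = 0 then 1 else sqrt (snd t)) * (z \<bullet> j)) *\<^sub>R j) = head_part h z + sqrt (snd t) *\<^sub>R tail_part h z"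
        proof (rule euclidean_eqI)
          fix b :: "real^'n" assume b: "b \<in> Basis"
          then obtain i where i: "b = axis i 1" by (auto simp: Basis_vec_def)
          have "tail_part h b = 0 \<longleftrightarrow> coord_no i < h"
            by (auto simp: i vec_eq_iff head_tail_component axis_def)
          then show "(\<Sum>j\<in>Basis. ((if tail_part h j = 0 then 1 else sqrt (snd t)) * (z \<bullet> j)) *\<^sub>R j) \<bullet> b = (head_part h z + sqrt (snd t) *\<^sub>R tail_part h z) \<bullet> b"
            unfolding inner_sum_left_Basis[OF b] by (simp add: i inner_add_left inner_axis head_tail_component)
        qed
        then show ?thesis by (simp add: A_def)
      qed
      then show "AE z in lborel. P (Phi_base h (head_part h (fst t) + (\<Sum>j\<in>Basis. ((if tail_part h j = 0 then 1 else sqrt (snd t)) * (z \<bullet> j)) *\<^sub>R j)))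
         (head_part h (fst t) + (\<Sum>j\<in>Basis. ((if tail_part h j = 0 then 1 else sqrt (snd t)) * (z \<bullet> j)) *\<^sub>R j))"
        using ae by simp
    qed (use t in \<open>auto simp: Q_def\<close>)
  qed
qed

subsection \<open>The fibres\<close>

text \<open>The bound on h makes the fibre sphere at least one-dimensional, so that unit tangent
  vectors exist everywhere; e is the default fibre coordinate.\<close>

locale tail_fibre =
  fixes h :: nat and e :: "real^'n"
  assumes h2: "h + 2 \<le> CARD('n)" and e: "e \<in> tail_sphere h"
begin

lemma tangent_exists:
  fixes x :: "real^'n"
  assumes "x \<in> tail_sphere h"
  obtains w :: "real^'n" where "w \<in> tail_space h" "norm w = 1" "x \<bullet> w = 0"
proof -
  obtain i :: 'n where i: "coord_no i = h" using coord_no_ex[where 'n='n, of h] h2 by auto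
  obtain j :: 'n where j: "coord_no j = Suc h" using coord_no_ex[where 'n='n, of "Suc h"] h2 by auto
  have ij: "i \<noteq> j" using i j by auto
  \<comment> \<open>A quarter turn of the components i and j of x; if both vanish, the axis i is
    already orthogonal to x.\<close>
  define v where "v = (if x $ i = 0 \<and> x $ j = 0 then axis i 1 else (x $ j) *\<^sub>R axis i 1 - (x $ i) *\<^sub>R axis j (1::real))"
  have vi: "v $ k = (if x $ i = 0 \<and> x $ j = 0 then (if k = i then 1 else 0) else (if k = i then x $ j else if k = j then - x $ i else 0))" for k
    using ij by (auto simp: v_def axis_def)
  have v0: "v \<noteq> 0" using ij by (auto simp: vec_eq_iff vi split: if_splits)
  have vt: "v \<in> tail_space h" using i j by (auto simp: tail_space_def vi)
  have xv: "x \<bullet> v = 0" by (auto simp: v_def inner_diff_right inner_axis)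
  show ?thesis
    by (rule that[of "v /\<^sub>R norm v"]) (use v0 vt xv in \<open>auto intro!: subspace_scale subspace_tail_space\<close>)
qed

abbreviation "c \<equiv> \<lambda>x y :: real^'n. (sphere_dist x y)\<^sup>2 / 2"

lemma sphere_dist_bounds: "x \<in> tail_sphere h \<Longrightarrow> y \<in> tail_sphere h \<Longrightarrow> 0 \<le> sphere_dist x y \<and> sphere_dist x y \<le> pi"
  using Cauchy_Schwarz_ineq2[of x y] arccos_bounded[of "x \<bullet> y"] by (simp add: sphere_dist_def tail_sphere_def abs_le_iff)

lemma hinge:
  fixes x y :: "real^'n"
  assumes x: "x \<in> tail_sphere h" and y: "y \<in> tail_sphere h"
  obtains w where "w \<in> tail_space h" "norm w = 1" "x \<bullet> w = 0" "y = cos (sphere_dist x y) *\<^sub>R x + sin (sphere_dist x y) *\<^sub>R w"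
    "\<And>x' :: real^'n. x' \<in> tail_sphere h \<Longrightarrow> c x' y \<le> c x y - sphere_dist x y * (w \<bullet> (x' - x)) + 20 * (1 - x \<bullet> x')"
proof -
  obtain w0 where w0: "w0 \<in> tail_space h" "norm w0 = 1" "x \<bullet> w0 = 0" by (rule tangent_exists[OF x]) (rule that)
  obtain w where w: "w \<in> tail_space h" "norm w = 1" "x \<bullet> w = 0" "y = cos (sphere_dist x y) *\<^sub>R x + sin (sphere_dist x y) *\<^sub>R w"
    using sphere_polar[OF subspace_tail_space, of x h y w0] w0 x y by (auto simp: tail_sphere_def)
  show ?thesis
  proof (rule that[OF w])
    fix x' :: "real^'n" assume x': "x' \<in> tail_sphere h"
    have "(arccos (x' \<bullet> (cos (sphere_dist x y) *\<^sub>R x + sin (sphere_dist x y) *\<^sub>R w)))\<^sup>2 \<le> (sphere_dist x y)\<^sup>2 - 2 * sphere_dist x y * (w \<bullet> (x' - x)) + 40 * (1 - x \<bullet> x')"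
      using hinge_sphere[of "sphere_dist x y" x x' w] sphere_dist_bounds[OF x y] x x' w by (simp add: tail_sphere_def)
    then have "(sphere_dist x' y)\<^sup>2 \<le> (sphere_dist x y)\<^sup>2 - 2 * sphere_dist x y * (w \<bullet> (x' - x)) + 40 * (1 - x \<bullet> x')"
      using w(4) by (simp add: sphere_dist_def[of x' y])
    then show "c x' y \<le> c x y - sphere_dist x y * (w \<bullet> (x' - x)) + 20 * (1 - x \<bullet> x')" by (simp add: field_simps)
  qed
qed

lemma compact_tail_sphere: "compact (tail_sphere h :: (real^'n) set)"
proof -
  have "tail_sphere h = tail_space h \<inter> sphere (0::real^'n) 1" by (auto simp: tail_sphere_def)
  then show ?thesis using closed_Int_compact[OF closed_subspace[OF subspace_tail_space] compact_sphere] by simp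
qed

lemma dense_seq: "\<exists>d :: nat \<Rightarrow> real^'n. range d \<subseteq> tail_sphere h \<and> tail_sphere h \<subseteq> closure (range d)"
proof -
  obtain T where T: "countable T" "T \<subseteq> tail_sphere h" "(tail_sphere h :: (real^'n) set) \<subseteq> closure T" using separable by blast
  have "T \<noteq> {}" using T(3) e by auto
  then have "range (from_nat_into T) = T" using T(1) by (rule range_from_nat_into)
  then show ?thesis using T by (intro exI[of _ "from_nat_into T"]) auto
qed

definition "dseq = (SOME d :: nat \<Rightarrow> real^'n. range d \<subseteq> tail_sphere h \<and> tail_sphere h \<subseteq> closure (range d))"

text \<open>The constants are generous: by \<open>hinge\<close> the slope is at most 4 + 20, where 4
  bounds pi, and the cost is at most 4^2 / 2.\<close>

sublocale fibre_cost "tail_sphere h" c 44 10 dseq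
proof
  show "range dseq \<subseteq> tail_sphere h" "tail_sphere h \<subseteq> closure (range dseq)"
    using someI_ex[OF dense_seq] by (auto simp: dseq_def)
  show "compact (tail_sphere h :: (real^'n) set)" by (rule compact_tail_sphere)
  show "c x y = c y x" for x y by (simp add: sphere_dist_def inner_commute)
  have half: "c x' y - c x y \<le> 44 * dist x x'" if x: "x \<in> tail_sphere h" "x' \<in> tail_sphere h" "y \<in> tail_sphere h" for x x' y
  proof -
    obtain w where w: "norm w = 1" "c x' y \<le> c x y - sphere_dist x y * (w \<bullet> (x' - x)) + 20 * (1 - x \<bullet> x')"
      by (rule hinge[OF x(1,3)]) (use x in blast)
    have d: "norm (x' - x) = dist x x'" by (simp add: dist_norm norm_minus_commute)
    have "- (sphere_dist x y * (w \<bullet> (x' - x))) \<le> \<bar>sphere_dist x y * (w \<bullet> (x' - x))\<bar>" by simp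
    also have "\<dots> = sphere_dist x y * \<bar>w \<bullet> (x' - x)\<bar>" using sphere_dist_bounds[OF x(1,3)] by (simp add: abs_mult)
    also have "\<dots> \<le> 4 * dist x x'"
      using sphere_dist_bounds[OF x(1,3)] Cauchy_Schwarz_ineq2[of w "x' - x"] w(1) pi_less_4 d by (intro mult_mono) auto
    finally have 1: "- (sphere_dist x y * (w \<bullet> (x' - x))) \<le> 4 * dist x x'" .
    have xx: "x \<bullet> x = 1" "norm x = 1" using x by (auto simp: tail_sphere_def dot_square_norm)
    have "1 - x \<bullet> x' = x \<bullet> (x - x')" by (simp add: inner_diff_right xx)
    also have "\<dots> \<le> norm x * norm (x - x')" by (rule norm_cauchy_schwarz)
    finally have "20 * (1 - x \<bullet> x') \<le> 20 * dist x x'" by (simp add: dist_norm xx)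
    then show ?thesis using w(2) 1 zero_le_dist[of x x'] by linarith
  qed
  show "\<bar>c x y - c x' y\<bar> \<le> 44 * dist x x'" if "x \<in> tail_sphere h" "x' \<in> tail_sphere h" "y \<in> tail_sphere h" for x x' y
    using half[OF that] half[OF that(2,1,3)] by (simp add: dist_commute abs_le_iff)
  show "\<bar>c x y\<bar> \<le> 10" if "x \<in> tail_sphere h" "y \<in> tail_sphere h" for x y
  proof -
    have "(sphere_dist x y)\<^sup>2 \<le> 4\<^sup>2" using sphere_dist_bounds[OF that] pi_less_4 by (intro power_mono) auto
    then show ?thesis by simp
  qed
qed simp

text \<open>
  The positively homogeneous extension of \<open>g + K\<close> from the sphere. By the hinge comparison it is
  supported from below by convex functions, hence convex, although \<open>g\<close> is only semiconvex.
\<close>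

definition hext :: "real \<Rightarrow> (real^'n \<Rightarrow> real) \<Rightarrow> real^'n \<Rightarrow> real" where
  "hext K g z = norm (tail_part h z) * (g (Phi_fibre h e z) + K)"

context
  fixes \<psi> g :: "real^'n \<Rightarrow> real" and K R :: real
  assumes psi: "lip \<psi>" and g: "g = tr \<psi>" and R: "\<And>x. x \<in> tail_sphere h \<Longrightarrow> \<bar>g x\<bar> \<le> R" and K: "K = R + 20"
begin

text \<open>The hinge inequality on the sphere is scaled by the norm of the tail. Its term 20 (1 - x
  . x') splits into the constant 20, absorbed into the factor of the norm, and a linear part. K = R
  + 20 keeps this factor nonnegative, so the minorant is convex; it touches along the ray through
  x.\<close>

lemma hext_support:
  assumes x: "x \<in> tail_sphere h" and y: "y \<in> tail_sphere h" and contact: "g x = - c x y - \<psi> y"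
  obtains w where "w \<in> tail_space h" "norm w = 1" "x \<bullet> w = 0" "y = cos (sphere_dist x y) *\<^sub>R x + sin (sphere_dist x y) *\<^sub>R w"
    "\<And>z. (g x + K - 20) * norm (tail_part h z) + (sphere_dist x y *\<^sub>R w + 20 *\<^sub>R x) \<bullet> tail_part h z \<le> hext K g z"
proof -
  obtain w where w: "w \<in> tail_space h" "norm w = 1" "x \<bullet> w = 0" "y = cos (sphere_dist x y) *\<^sub>R x + sin (sphere_dist x y) *\<^sub>R w"
    and hinge: "\<And>x'. x' \<in> tail_sphere h \<Longrightarrow> c x' y \<le> c x y - sphere_dist x y * (w \<bullet> (x' - x)) + 20 * (1 - x \<bullet> x')"
    by (rule hinge[OF x y]) (rule that)
  let ?q = "sphere_dist x y *\<^sub>R w + 20 *\<^sub>R x"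
  have S: "(g x + K - 20) + ?q \<bullet> x' \<le> g x' + K" if x': "x' \<in> tail_sphere h" for x'
  proof -
    have "- c x' y - \<psi> y \<le> g x'" unfolding g by (rule tr_upper_lip[OF psi x' y])
    then have "g x + sphere_dist x y * (w \<bullet> (x' - x)) - 20 * (1 - x \<bullet> x') \<le> g x'" using hinge[OF x'] contact by linarith
    then show ?thesis using w(3) by (simp add: inner_add_left inner_diff_right inner_commute[of w x])
  qed
  show ?thesis
  proof (rule that[OF w])
    fix z
    show "(g x + K - 20) * norm (tail_part h z) + ?q \<bullet> tail_part h z \<le> hext K g z"
    proof (cases "tail_part h z = 0")
      case False
      then have z: "tail_part h z = norm (tail_part h z) *\<^sub>R Phi_fibre h e z" by (simp add: Phi_fibre_def)
      have "norm (tail_part h z) * ((g x + K - 20) + ?q \<bullet> Phi_fibre h e z) \<le> hext K g z"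
        unfolding hext_def by (intro mult_left_mono S Phi_fibre_in e) simp
      moreover have "?q \<bullet> tail_part h z = norm (tail_part h z) * (?q \<bullet> Phi_fibre h e z)"
        by (subst z) simp
      ultimately show ?thesis by (simp add: distrib_left mult.commute)
    qed (simp add: hext_def)
  qed
qed

lemma convex_hext: "convex_on UNIV (hext K g)"
proof (rule convex_onI)
  fix t :: real and a b :: "real^'n" assume t: "0 < t" "t < 1"
  define z where "z = (1 - t) *\<^sub>R a + t *\<^sub>R b"
  have hnn: "0 \<le> hext K g v" for v
  proof -
    have "0 \<le> g (Phi_fibre h e v) + K" using R[OF Phi_fibre_in[OF e, of v]] K by (simp add: abs_le_iff)
    then show ?thesis by (simp add: hext_def)
  qed
  show "hext K g ((1 - t) *\<^sub>R a + t *\<^sub>R b) \<le> (1 - t) * hext K g a + t * hext K g b"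
    unfolding z_def[symmetric]
  proof (cases "tail_part h z = 0")
    \<comment> \<open>The extension vanishes where the tail does and is nonnegative everywhere,
      since K >= R.\<close>
    case True
    then show "hext K g z \<le> (1 - t) * hext K g a + t * hext K g b" using hnn[of a] hnn[of b] t by (simp add: hext_def[of _ _ z])
  next
    case False
    define x where "x = Phi_fibre h e z"
    have x: "x \<in> tail_sphere h" unfolding x_def by (rule Phi_fibre_in[OF e])
    have zx: "tail_part h z = norm (tail_part h z) *\<^sub>R x" using False by (simp add: x_def Phi_fibre_def)
    obtain y where y0: "y \<in> tail_sphere h" "tr \<psi> x = - c x y - \<psi> y"
      by (rule tr_attained[OF lip_continuous[OF psi] x]) (rule that)
    then have y: "y \<in> tail_sphere h" "g x = - c x y - \<psi> y" by (simp_all add: g)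
    obtain w where w: "x \<bullet> w = 0"
      and sup: "\<And>z. (g x + K - 20) * norm (tail_part h z) + (sphere_dist x y *\<^sub>R w + 20 *\<^sub>R x) \<bullet> tail_part h z \<le> hext K g z"
      by (rule hext_support[OF x y]) (rule that)
    let ?q = "sphere_dist x y *\<^sub>R w + 20 *\<^sub>R x" and ?\<alpha> = "g x + K - 20"
    have a0: "?\<alpha> \<ge> 0" using R[OF x] K by (simp add: abs_le_iff)
    have qx: "?q \<bullet> x = 20" using w x by (simp add: inner_add_left inner_commute[of w x] tail_sphere_def dot_square_norm)
    have "hext K g z = norm (tail_part h z) * (?\<alpha> + ?q \<bullet> x)" by (simp add: hext_def x_def[symmetric] qx)
    also have "\<dots> = ?\<alpha> * norm (tail_part h z) + ?q \<bullet> tail_part h z" by (subst (3) zx) (simp add: algebra_simps)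
    also have "\<dots> \<le> ?\<alpha> * ((1 - t) * norm (tail_part h a) + t * norm (tail_part h b)) + ((1 - t) * (?q \<bullet> tail_part h a) + t * (?q \<bullet> tail_part h b))"
    proof (intro add_mono mult_left_mono a0)
      have "norm (tail_part h z) \<le> norm ((1 - t) *\<^sub>R tail_part h a) + norm (t *\<^sub>R tail_part h b)"
        unfolding z_def tail_simps by (rule norm_triangle_ineq)
      then show "norm (tail_part h z) \<le> (1 - t) * norm (tail_part h a) + t * norm (tail_part h b)" using t by simp
      show "?q \<bullet> tail_part h z \<le> (1 - t) * (?q \<bullet> tail_part h a) + t * (?q \<bullet> tail_part h b)"
        unfolding z_def tail_simps by (simp only: inner_add_right inner_scaleR_right)
    qed
    also have "\<dots> = (1 - t) * (?\<alpha> * norm (tail_part h a) + ?q \<bullet> tail_part h a) + t * (?\<alpha> * norm (tail_part h b) + ?q \<bullet> tail_part h b)"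
      by (simp add: algebra_simps)
    also have "\<dots> \<le> (1 - t) * hext K g a + t * hext K g b"
      using t sup[of a] sup[of b] by (intro add_mono mult_left_mono) auto
    finally show "hext K g z \<le> (1 - t) * hext K g a + t * hext K g b" .
  qed
qed simp

lemma Phi_fibre_scale:
  assumes "0 < s" "tail_part h z' = s *\<^sub>R tail_part h z" shows "Phi_fibre h e z' = Phi_fibre h e z"
  using assms by (auto simp: Phi_fibre_def)

lemma hext_scale:
  assumes "0 < s" "tail_part h z' = s *\<^sub>R tail_part h z" shows "hext K g z' = s * hext K g z"
  using assms Phi_fibre_scale[OF assms] by (simp add: hext_def)

text \<open>By homogeneity of degree one, and since the head is ignored, the gradient depends only
  on the direction of the tail. This is the invariance that \<open>AE_Phi_base\<close> asks
  for.\<close>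

lemma hext_derivative_scale:
  assumes s: "0 < s" "tail_part h z' = s *\<^sub>R tail_part h z" and D: "(hext K g has_derivative (\<lambda>v. v \<bullet> p)) (at z)"
  shows "(hext K g has_derivative (\<lambda>v. v \<bullet> p)) (at z')"
proof -
  have eq: "hext K g v = s * hext K g (z + (v - z') /\<^sub>R s)" for v
    by (rule hext_scale[OF s(1)]) (use s in \<open>simp add: tail_simps algebra_simps\<close>)
  have "((\<lambda>v. z + (v - z') /\<^sub>R s) has_derivative (\<lambda>v. v /\<^sub>R s)) (at z')"
    by (auto intro!: derivative_eq_intros)
  from has_derivative_compose[OF this, of "hext K g" "\<lambda>v. v \<bullet> p"]
  have "((\<lambda>v. hext K g (z + (v - z') /\<^sub>R s)) has_derivative (\<lambda>v. (v /\<^sub>R s) \<bullet> p)) (at z')" using D by simp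
  then have "((\<lambda>v. s * hext K g (z + (v - z') /\<^sub>R s)) has_derivative (\<lambda>v. s * ((v /\<^sub>R s) \<bullet> p))) (at z')"
    by (rule has_derivative_mult_right)
  moreover have "(\<lambda>v. s * ((v /\<^sub>R s) \<bullet> p)) = (\<lambda>v. v \<bullet> p)" using s by auto
  ultimately show ?thesis by (simp add: eq[symmetric])
qed

lemma smooth_hext_scale:
  assumes s: "0 < s" "tail_part h z' = s *\<^sub>R tail_part h z" and z: "smooth_at (hext K g) z"
  shows "smooth_at (hext K g) z'" "grad (hext K g) z' = grad (hext K g) z"
  using smooth_at_derivative[OF convex_hext hext_derivative_scale[OF s has_derivative_grad[OF convex_hext z]]] by auto

text \<open>A contact point y determines the minorant of \<open>hext_support\<close> and thereby the
  gradient (g x + K) x + \<theta> w. Removing its radial part leaves \<theta> w, the initial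
  velocity of the geodesic from x to y. A contact point exists by compactness, so smoothness makes
  it unique.\<close>

lemma fibre_gradient:
  fixes z :: "real^'n"
  defines "x \<equiv> Phi_fibre h e z"
  defines "p \<equiv> grad (hext K g) z"
  defines "q \<equiv> p - (p \<bullet> x) *\<^sub>R x"
  assumes z: "tail_part h z \<noteq> 0" "smooth_at (hext K g) z"
  shows "is_sphere_gradient h g x q"
    "\<And>y. y \<in> tail_sphere h \<Longrightarrow> g x = - c x y - \<psi> y \<longleftrightarrow> y = sphere_exp x q" "sphere_exp x q \<in> tail_sphere h"
proof -
  have x: "x \<in> tail_sphere h" unfolding x_def by (rule Phi_fibre_in[OF e])
  have xt: "tail_part h x = x" and xx: "x \<bullet> x = 1" and nx: "norm x = 1" using x by (auto simp: tail_sphere_def tail_space_iff dot_square_norm)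
  have tx: "tail_part h x = (1 / norm (tail_part h z)) *\<^sub>R tail_part h z" using z(1) unfolding xt by (simp add: x_def Phi_fibre_def divide_inverse)
  have xz: "Phi_fibre h e x = x" by (subst Phi_fibre_scale[OF _ tx]) (use z(1) in \<open>auto simp: x_def\<close>)
  have D: "(hext K g has_derivative (\<lambda>v. v \<bullet> p)) (at x)"
    by (rule hext_derivative_scale[OF _ tx]) (use z in \<open>auto simp: p_def intro: has_derivative_grad convex_hext\<close>)
  have on: "hext K g v = g v + K" if "v \<in> tail_sphere h" for v
  proof -
    have v: "tail_part h v = v" "norm v = 1" using that by (auto simp: tail_sphere_def tail_space_iff)
    then show ?thesis by (auto simp: hext_def Phi_fibre_def)
  qed
  have contact: "p = (g x + K) *\<^sub>R x + sphere_dist x y *\<^sub>R w \<and> q = sphere_dist x y *\<^sub>R w \<and> y = sphere_exp x q \<and> w \<in> tail_space h"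
    if y: "y \<in> tail_sphere h" "g x = - c x y - \<psi> y"
      and w: "w \<in> tail_space h" "norm w = 1" "x \<bullet> w = 0" "y = cos (sphere_dist x y) *\<^sub>R x + sin (sphere_dist x y) *\<^sub>R w"
      and sup: "\<And>z. (g x + K - 20) * norm (tail_part h z) + (sphere_dist x y *\<^sub>R w + 20 *\<^sub>R x) \<bullet> tail_part h z \<le> hext K g z" for y w
  proof -
    let ?\<theta> = "sphere_dist x y"
    let ?q = "?\<theta> *\<^sub>R w + 20 *\<^sub>R x" and ?\<alpha> = "g x + K - 20"
    \<comment> \<open>The touching minorant. Its gradient at x is (g x + K - 20) x + 20 x + \<theta>
      w, in which the hinge constant cancels.\<close>
    define G where "G v = ?\<alpha> * norm (tail_part h v) + ?q \<bullet> tail_part h v" for v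
    have bl: "bounded_linear (tail_part h :: real^'n \<Rightarrow> real^'n)" using linear_tail_part by (simp add: linear_conv_bounded_linear)
    have tx0: "tail_part h x \<noteq> 0" using xt nx by auto
    have qt: "tail_part h ?q = ?q" using w(1) xt by (simp add: tail_simps tail_space_iff)
    have "(G has_derivative (\<lambda>v. ?\<alpha> * (tail_part h v \<bullet> sgn (tail_part h x)) + ?q \<bullet> tail_part h v)) (at x)"
      unfolding G_def
      by (intro has_derivative_add has_derivative_mult_right has_derivative_inner_right
          has_derivative_compose[OF bounded_linear_imp_has_derivative[OF bl], of norm] has_derivative_norm tx0 bounded_linear_imp_has_derivative[OF bl])
    moreover have "(\<lambda>v. ?\<alpha> * (tail_part h v \<bullet> sgn (tail_part h x)) + ?q \<bullet> tail_part h v) = (\<lambda>v. v \<bullet> (?\<alpha> *\<^sub>R x + ?q))"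
    proof
      fix v
      have "tail_part h v \<bullet> x = v \<bullet> x" using inner_tail_left[of h x v] xt by (simp add: inner_commute)
      moreover have "?q \<bullet> tail_part h v = v \<bullet> ?q" using inner_tail_left[of h ?q v] unfolding qt by (simp add: inner_commute)
      moreover have "sgn (tail_part h x) = x" using xt nx by (simp add: sgn_div_norm)
      ultimately show "?\<alpha> * (tail_part h v \<bullet> sgn (tail_part h x)) + ?q \<bullet> tail_part h v = v \<bullet> (?\<alpha> *\<^sub>R x + ?q)"
        by (simp add: inner_add_right)
    qed
    ultimately have DG: "(G has_derivative (\<lambda>v. v \<bullet> (?\<alpha> *\<^sub>R x + ?q))) (at x)" by simp
    have Gx: "G x = hext K g x" using on[OF x] w(3) by (simp add: G_def xt nx inner_add_left xx inner_commute[of w x])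
    have "grad (hext K g) x = ?\<alpha> *\<^sub>R x + ?q"
      by (rule grad_of_support[OF convex_hext smooth_at_derivative(1)[OF convex_hext D] DG]) (use sup Gx in \<open>simp add: G_def[symmetric]\<close>)
    then have p: "p = (g x + K) *\<^sub>R x + ?\<theta> *\<^sub>R w" using smooth_at_derivative(2)[OF convex_hext D] by (simp add: algebra_simps)
    then have px: "p \<bullet> x = g x + K" using w(3) by (simp add: inner_add_left xx inner_commute[of w x])
    have q: "q = ?\<theta> *\<^sub>R w" unfolding q_def px by (simp add: p)
    have t0: "0 \<le> ?\<theta>" using sphere_dist_bounds[OF x y(1)] by simp
    then have "norm q = ?\<theta>" by (simp add: q w(2))
    then have "sphere_exp x q = y" using w(2) by (subst w(4)) (auto simp: sphere_exp_def q)
    then show ?thesis using p q w(1) by simp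
  qed
  have contact': "y = sphere_exp x q \<and> q \<in> tail_space h \<and> x \<bullet> q = 0" if y: "y \<in> tail_sphere h" "g x = - c x y - \<psi> y" for y
  proof -
    obtain w where w: "w \<in> tail_space h" "norm w = 1" "x \<bullet> w = 0" "y = cos (sphere_dist x y) *\<^sub>R x + sin (sphere_dist x y) *\<^sub>R w"
      and sup: "\<And>z. (g x + K - 20) * norm (tail_part h z) + (sphere_dist x y *\<^sub>R w + 20 *\<^sub>R x) \<bullet> tail_part h z \<le> hext K g z"
      by (rule hext_support[OF x y]) (rule that)
    have q: "q = sphere_dist x y *\<^sub>R w" and yq: "y = sphere_exp x q" using contact[OF y w sup] by blast+
    have "q \<in> tail_space h" unfolding q by (rule subspace_scale[OF subspace_tail_space w(1)])
    moreover have "x \<bullet> q = 0" unfolding q using w(3) by simp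
    ultimately show ?thesis using yq by blast
  qed
  obtain y where y0: "y \<in> tail_sphere h" "tr \<psi> x = - c x y - \<psi> y"
    by (rule tr_attained[OF lip_continuous[OF psi] x]) (rule that)
  then have y: "y \<in> tail_sphere h" "g x = - c x y - \<psi> y" by (simp_all add: g)
  note yq = contact'[OF y]
  show "sphere_exp x q \<in> tail_sphere h" using y yq by simp
  show "g x = - c x y' - \<psi> y' \<longleftrightarrow> y' = sphere_exp x q" if "y' \<in> tail_sphere h" for y'
    using contact'[OF that] y yq by auto
  \<comment> \<open>On the sphere v . v = 1, so subtracting a multiple of it alters the function by
    a constant only, while the radial part of the gradient disappears.\<close>
  have "((\<lambda>v. hext K g v - (p \<bullet> x) * (v \<bullet> v) / 2) has_derivative (\<lambda>v. v \<bullet> p - (p \<bullet> x) * (v \<bullet> x + x \<bullet> v) / 2)) (at x)"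
    by (auto intro!: derivative_eq_intros D)
  moreover have "(\<lambda>v. v \<bullet> p - (p \<bullet> x) * (v \<bullet> x + x \<bullet> v) / 2) = (\<lambda>v. v \<bullet> q)"
    by (auto simp: q_def inner_diff_right inner_commute[of x])
  ultimately have "((\<lambda>v. hext K g v - (p \<bullet> x) * (v \<bullet> v) / 2 - (K - (p \<bullet> x) / 2)) has_derivative (\<lambda>v. v \<bullet> q - 0)) (at x)"
    by (intro has_derivative_diff) auto
  then have "((\<lambda>v. hext K g v - (p \<bullet> x) * (v \<bullet> v) / 2 - (K - (p \<bullet> x) / 2)) has_derivative (\<lambda>v. v \<bullet> q)) (at x within tail_sphere h)"
    by (simp add: has_derivative_at_withinI)
  then have "(g has_derivative (\<lambda>v. v \<bullet> q)) (at x within tail_sphere h)"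
  proof (rule has_derivative_transform[OF x, rotated])
    fix v :: "real^'n" assume v: "v \<in> tail_sphere h"
    then have "v \<bullet> v = 1" by (simp add: tail_sphere_def dot_square_norm)
    then show "g v = hext K g v - (p \<bullet> x) * (v \<bullet> v) / 2 - (K - (p \<bullet> x) / 2)" using on[OF v] by simp
  qed
  then show "is_sphere_gradient h g x q" using yq by (simp add: is_sphere_gradient_def)
qed

end

end

subsection \<open>Deficient rank\<close>

lemma AE_lborel_orthogonal:
  fixes Q :: "real^'n^'n"
  assumes Q: "orthogonal_matrix Q" and ae: "AE z in lborel. P z" shows "AE x in lborel. P (Q *v x)"
proof -
  from ae obtain N where N: "N \<in> null_sets lborel" "{z. \<not> P z} \<subseteq> N" by (auto simp: eventually_ae_filter)
  then have "negligible N" by (simp add: negligible_iff_null_sets null_sets_completionI)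
  then have "negligible ((*v) (transpose Q) ` N)"
    by (intro negligible_differentiable_image_negligible linear_imp_differentiable_on matrix_vector_mul_linear \<open>negligible N\<close>) simp
  then have "(*v) (transpose Q) ` N \<in> null_sets lebesgue" by (simp add: negligible_iff_null_sets)
  then have "AE x in lebesgue. P (Q *v x)"
  proof (rule AE_I', intro subsetI)
    fix x assume "x \<in> {x \<in> space lebesgue. \<not> P (Q *v x)}"
    then have "Q *v x \<in> N" using N by auto
    then show "x \<in> (*v) (transpose Q) ` N" using orthogonal_matrix_cancel(1)[OF Q, of x] by (metis imageI)
  qed
  then show ?thesis by (simp add: AE_completion_iff)
qed

lemma norm_orthogonal_matrix: "orthogonal_matrix Q \<Longrightarrow> norm (Q *v x) = norm (x :: real^'n)"
  by (metis orthogonal_transformation_matrix matrix_of_matrix_vector_mul matrix_vector_mul_linear orthogonal_transformation_norm)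

lemma Phi_base_in[simp]: "Phi_base h x \<in> base_space h"
  by (simp add: Phi_base_def base_space_def)

lemma continuous_on_Phi_base[continuous_intros]:
  "continuous_on S f \<Longrightarrow> continuous_on S (\<lambda>x. Phi_base h (f x :: real^'n))"
  unfolding Phi_base_def by (intro continuous_intros)

lemma inner_diag_act: "diag_act \<sigma> u \<bullet> v = u \<bullet> diag_act \<sigma> v"
  by (auto simp: inner_vec_def diag_act_def intro!: sum.cong)

lemma diag_act_head: "length \<sigma> = h \<Longrightarrow> diag_act \<sigma> (head_part h u) = diag_act \<sigma> u"
  "length \<sigma> = h \<Longrightarrow> head_part h (diag_act \<sigma> u) = diag_act \<sigma> u"
  by (auto simp: vec_eq_iff diag_act_def head_tail_component)

lemma diag_inv_act_diag_act:
  assumes "length \<sigma> = h" "\<And>k. k < h \<Longrightarrow> \<sigma> ! k > 0" "v \<in> head_space h"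
  shows "diag_inv_act \<sigma> (diag_act \<sigma> v) = v"
  using assms(3) unfolding vec_eq_iff head_space_def by (auto simp: diag_inv_act_def diag_act_def assms(1) not_less dest!: assms(2))

section \<open>The linearized problem in base coordinates\<close>

locale low_rank = gw_marginals \<mu> \<nu> for \<mu> :: "(real^'n) measure" and \<nu> :: "(real^'d) measure" +
  fixes \<pi> :: "((real^'n) \<times> (real^'d)) measure" and h :: nat and \<sigma> :: "real list" and OX OY :: "real^'n^'n"
  assumes opt: "gw_optimal \<mu> \<nu> \<pi>" and ac: "absolutely_continuous lborel \<mu>"
    and nd: "CARD('d) \<le> CARD('n)" and hn: "h < CARD('n)"
    and OX: "orthogonal_matrix OX" and OY: "orthogonal_matrix OY"
    and svd: "\<And>x y. 4 * ((cross_moment \<pi> *v x) \<bullet> y) = diag_act \<sigma> (OX *v x) \<bullet> (OY *v coord_embed y)"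
    and len: "length \<sigma> = h" and pos: "\<And>k. k < h \<Longrightarrow> \<sigma> ! k > 0"
begin

definition "eY y = OY *v (coord_embed (y :: real^'d) :: real^'n)"
definition "bX x = Phi_base h (OX *v x)"
definition "bY y = Phi_base h (eY y)"
definition "\<Gamma>s = measure_support \<pi>"
definition "kap b b' = - base_cost \<sigma> b (b' :: (real^'n) \<times> real)"
text \<open>Projection onto the base space. The potential is made invariant under it, so that
  convexity and almost everywhere differentiability can be used on a space whose dimension does not
  depend on h.\<close>

definition "hdb z = (head_part h (fst z), snd z :: real)"

lemma pi: "\<pi> \<in> couplings \<mu> \<nu>" using opt by (simp add: gw_optimal_def)

lemma linear_eY: "linear eY"
  unfolding eY_def[abs_def] using linear_compose[OF linear_coord_embed matrix_vector_mul_linear] by (simp add: o_def)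

lemma norm_eY: "norm (eY y) = norm y"
  unfolding eY_def norm_orthogonal_matrix[OF OY] by (simp add: norm_eq_sqrt_inner inner_coord_embed[OF nd])

lemma continuous_eY: "continuous_on S eY"
  using linear_eY by (intro linear_continuous_on) (simp add: linear_conv_bounded_linear)

lemma continuous_OX: "continuous_on S ((*v) OX)"
  by (intro linear_continuous_on) simp

lemma continuous_b: "continuous_on S bX" "continuous_on S' bY"
  unfolding bX_def[abs_def] bY_def[abs_def] by (intro continuous_intros continuous_eY continuous_OX)+

lemma borel_measurable_b[measurable]: "bX \<in> borel_measurable borel" "bY \<in> borel_measurable borel" "eY \<in> borel_measurable borel" "(*v) OX \<in> borel_measurable borel"
  by (intro borel_measurable_continuous_onI continuous_b continuous_eY continuous_OX)+

text \<open>The first four terms of the base cost factor. When r and s are the squared tail norms,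
  the factors are the full squared norms of the two points, which explains the form of the
  cost.\<close>

lemma kap_eq: "kap (u, r) (v, s) = ((norm u)\<^sup>2 + r) * ((norm v)\<^sup>2 + s) + diag_act \<sigma> u \<bullet> v"
  by (simp add: kap_def base_cost_def algebra_simps)

lemma lin_kap: "lin_value (cross_moment \<pi>) (x, y) = kap (bX x) (bY y)"
proof -
  have "diag_act \<sigma> (head_part h (OX *v x)) \<bullet> head_part h (eY y) = diag_act \<sigma> (OX *v x) \<bullet> eY y"
    using inner_head_left[of h "diag_act \<sigma> (OX *v x)" "eY y"] by (simp add: diag_act_head[OF len])
  then show ?thesis
    unfolding lin_value_def fst_conv snd_conv svd bX_def bY_def Phi_base_def kap_eq norm_head_tail[symmetric] norm_eY
      norm_orthogonal_matrix[OF OX] by (simp add: eY_def)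
qed

lemma base_head: "b \<in> base_space h \<Longrightarrow> hdb b = b"
  by (cases b) (auto simp: hdb_def base_space_def head_space_iff)

lemma b_head: "hdb (bX x) = bX x" "hdb (bY y) = bY y" "head_part h (fst (bX x)) = fst (bX x)" "head_part h (fst (bY y)) = fst (bY y)"
  unfolding bX_def bY_def by (simp_all add: base_head) (simp_all add: Phi_base_def)

text \<open>The squared norm of y read off from its base point. Being nonnegative, it makes the gain
  convex in the first argument, see \<open>kap_hd\<close>.\<close>

definition "mass y = (norm (fst (bY y)))\<^sup>2 + snd (bY y)"

lemma mass_nonneg: "0 \<le> mass y" by (simp add: mass_def bY_def Phi_base_def)

lemma kap_hd: "kap (hdb z) (bY y) = mass y * (norm (head_part h (fst z)))\<^sup>2 + (snd z * mass y + fst z \<bullet> diag_act \<sigma> (fst (bY y)))"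
proof -
  have "kap (hdb z) (bY y) = kap (head_part h (fst z), snd z) (fst (bY y), snd (bY y))" by (simp add: hdb_def)
  then show ?thesis unfolding kap_eq by (simp add: mass_def inner_diag_act[symmetric] diag_act_head[OF len] algebra_simps)
qed

lemma base_potential:
  obtains f where "convex_on UNIV f" "\<And>z. f (hdb z) = f z"
    "\<forall>(x, y)\<in>\<Gamma>s. \<forall>z. f (bX x) + kap (hdb z) (bY y) - kap (bX x) (bY y) \<le> f z"
    "c_convex (base_space h) (base_space h) (base_cost \<sigma>) (\<lambda>b. ereal (f b))"
proof -
  define \<Delta> where "\<Delta> = (\<lambda>(x, y). (bX x, bY y)) ` \<Gamma>s"
  note supp = measure_support_coupling[OF pi, folded \<Gamma>s_def]
  have cyc: "cyc_mono kap \<Delta>" unfolding \<Delta>_def \<Gamma>s_def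
    by (rule cyc_mono_image[OF cyc_mono_lin_value[OF opt]]) (rule lin_kap)
  have ne: "\<Delta> \<noteq> {}" using supp(4) by (simp add: \<Delta>_def)
  have bd: "bounded (kap z ` snd ` \<Delta>)" for z
  proof -
    have "kap z ` snd ` \<Delta> = (\<lambda>p. kap z (bY (snd p))) ` \<Gamma>s" by (force simp: \<Delta>_def)
    moreover have "continuous_on \<Gamma>s (\<lambda>p. kap z (bY (snd p)))"
    proof -
      have cb: "continuous_on \<Gamma>s (\<lambda>p. bY (snd p))"
        using continuous_on_compose2[OF continuous_b(2)[of UNIV], of \<Gamma>s snd] by (simp add: continuous_on_snd)
      have "kap z b = ((norm (fst z))\<^sup>2 + snd z) * ((norm (fst b))\<^sup>2 + snd b) + diag_act \<sigma> (fst z) \<bullet> fst b" for b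
        using kap_eq[of "fst z" "snd z" "fst b" "snd b"] by simp
      then show ?thesis by (simp only:) (intro continuous_intros cb)
    qed
    ultimately show ?thesis using supp(2) compact_imp_bounded compact_continuous_image by metis
  qed
  obtain F where F: "\<And>x y z. (x, y) \<in> \<Delta> \<Longrightarrow> F x + kap z y - kap x y \<le> F z"
    "\<And>z. F z = (SUP p\<in>\<Delta>. F (fst p) + kap z (snd p) - kap (fst p) (snd p))"
    "\<And>z. bdd_above ((\<lambda>p. F (fst p) + kap z (snd p) - kap (fst p) (snd p)) ` \<Delta>)"
    by (rule cyc_mono_potential[OF cyc ne bd]) (rule that)
  define f where "f z = F (hdb z)" for z
  have f_hdb: "f (hdb z) = f z" for z by (simp add: f_def hdb_def)
  have f_base: "f b = F b" if "b \<in> base_space h" for b by (simp add: f_def base_head[OF that])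
  have "f (bX x) + kap (hdb z) (bY y) - kap (bX x) (bY y) \<le> f z" if "(x, y) \<in> \<Gamma>s" for x y z
    unfolding f_def b_head by (rule F(1)) (use that in \<open>force simp: \<Delta>_def\<close>)
  then have sub: "\<forall>(x, y)\<in>\<Gamma>s. \<forall>z. f (bX x) + kap (hdb z) (bY y) - kap (bX x) (bY y) \<le> f z" by blast
  have "convex_on UNIV (\<lambda>z. SUP p\<in>\<Delta>. F (fst p) + kap (hdb z) (snd p) - kap (fst p) (snd p))"
  proof (rule convex_on_SUP[OF ne _ F(3)])
    fix p assume "p \<in> \<Delta>"
    then obtain x y where p: "p = (bX x, bY y)" by (auto simp: \<Delta>_def)
    have "convex_on UNIV (\<lambda>z :: (real^'n) \<times> real. (norm (head_part h (fst z)))\<^sup>2)"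
    proof (rule convex_onI)
      fix t :: real and a b :: "(real^'n) \<times> real" assume t: "0 < t" "t < 1"
      show "(norm (head_part h (fst ((1 - t) *\<^sub>R a + t *\<^sub>R b))))\<^sup>2 \<le> (1 - t) * (norm (head_part h (fst a)))\<^sup>2 + t * (norm (head_part h (fst b)))\<^sup>2"
        using convex_onD[OF convex_on_norm_power2, of t "head_part h (fst a)" "head_part h (fst b)"] t by (simp add: head_simps)
    qed simp
    then have "convex_on UNIV (\<lambda>z :: (real^'n) \<times> real. mass y * (norm (head_part h (fst z)))\<^sup>2)" by (rule convex_on_cmul[OF mass_nonneg])
    moreover have "convex_on UNIV (\<lambda>z. snd z * mass y + fst z \<bullet> diag_act \<sigma> (fst (bY y)) + (F (bX x) - kap (bX x) (bY y)))"
      by (rule convex_onI) (simp_all add: inner_add_left algebra_simps)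
    ultimately have "convex_on UNIV (\<lambda>z. mass y * (norm (head_part h (fst z)))\<^sup>2 + (snd z * mass y + fst z \<bullet> diag_act \<sigma> (fst (bY y)) + (F (bX x) - kap (bX x) (bY y))))"
      by (rule convex_on_add)
    then show "convex_on UNIV (\<lambda>z. F (fst p) + kap (hdb z) (snd p) - kap (fst p) (snd p))"
      by (simp add: p kap_hd algebra_simps)
  qed
  then have conv: "convex_on UNIV f" unfolding F(2)[symmetric] f_def .
  have "c_convex (base_space h) (base_space h) (base_cost \<sigma>) (\<lambda>b. ereal (f b))"
    unfolding c_convex_def
  proof (intro conjI)
    show "\<exists>x\<in>base_space h. ereal (f x) \<noteq> \<infinity>" by (rule bexI[OF _ Phi_base_in]) simp
    \<comment> \<open>For a base point without partner in \<Delta> the supremum is taken over the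
      empty set; \<zeta> is then minus infinity and the point does not contribute.\<close>
    define \<zeta> where "\<zeta> y = (SUP p\<in>{p \<in> \<Delta>. snd p = y}. ereal (F (fst p) + base_cost \<sigma> (fst p) y))" for y
    have "ereal (f b) = (SUP y\<in>base_space h. \<zeta> y - ereal (base_cost \<sigma> b y))" (is "_ = ?R") if b: "b \<in> base_space h" for b
    proof (rule antisym)
      have le: "ereal (F (fst p) + kap b (snd p) - kap (fst p) (snd p)) \<le> ?R" if p: "p \<in> \<Delta>" for p
      proof -
        have "snd p \<in> base_space h" using p by (auto simp: \<Delta>_def bY_def)
        then have "\<zeta> (snd p) - ereal (base_cost \<sigma> b (snd p)) \<le> ?R" by (rule SUP_upper)
        moreover have "ereal (F (fst p) + base_cost \<sigma> (fst p) (snd p)) \<le> \<zeta> (snd p)"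
          unfolding \<zeta>_def by (rule SUP_upper) (use p in simp)
        then have "ereal (F (fst p) + base_cost \<sigma> (fst p) (snd p)) - ereal (base_cost \<sigma> b (snd p)) \<le> \<zeta> (snd p) - ereal (base_cost \<sigma> b (snd p))"
          by (rule ereal_minus_mono) simp
        ultimately show ?thesis by (simp add: kap_def algebra_simps)
      qed
      show "ereal (f b) \<le> ?R"
      proof (cases ?R)
        case (real r)
        have "F b \<le> r" unfolding F(2)[of b]
          by (rule cSUP_least[OF ne]) (use le real in \<open>metis ereal_less_eq(3)\<close>)
        then show ?thesis unfolding real using f_base[OF b] by simp
      next
        case MInf
        obtain p where "p \<in> \<Delta>" using ne by blast
        from le[OF this] show ?thesis unfolding MInf by simp
      qed simp
      show "?R \<le> ereal (f b)"
      proof (rule SUP_least)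
        fix y
        have "\<zeta> y \<le> ereal (F b + base_cost \<sigma> b y)" unfolding \<zeta>_def
        proof (rule SUP_least)
          fix p assume "p \<in> {p \<in> \<Delta>. snd p = y}"
          then have "(fst p, y) \<in> \<Delta>" by auto
          from F(1)[OF this, of b] show "ereal (F (fst p) + base_cost \<sigma> (fst p) y) \<le> ereal (F b + base_cost \<sigma> b y)" by (simp add: kap_def)
        qed
        then have "\<zeta> y - ereal (base_cost \<sigma> b y) \<le> ereal (F b + base_cost \<sigma> b y) - ereal (base_cost \<sigma> b y)"
          by (rule ereal_minus_mono) simp
        then show "\<zeta> y - ereal (base_cost \<sigma> b y) \<le> ereal (f b)" by (simp add: f_base[OF b])
      qed
    qed
    then show "\<exists>\<zeta>. \<forall>x\<in>base_space h. ereal (f x) = (SUP y\<in>base_space h. \<zeta> y - ereal (base_cost \<sigma> x y))" by blast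
  qed
  from that[OF conv f_hdb sub this] show ?thesis .
qed

context
  fixes f :: "(real^'n) \<times> real \<Rightarrow> real"
  assumes conv: "convex_on UNIV f" and f_hdb: "\<And>z. f (hdb z) = f z"
    and sub: "\<forall>(x, y)\<in>\<Gamma>s. \<forall>z. f (bX x) + kap (hdb z) (bY y) - kap (bX x) (bY y) \<le> f z"
begin

lemma f_shift: "f (hdb z + w) = f (z + w)"
  using f_hdb[of "hdb z + w"] f_hdb[of "z + w"] by (simp add: hdb_def head_simps)

lemma dirD_hd: "dirD f e (hdb z) = dirD f e z"
  unfolding dirD_def f_shift f_hdb ..

lemma smooth_hd: "smooth_at f (hdb z) \<longleftrightarrow> smooth_at f z"
  by (simp add: smooth_at_def dirD_hd)

text \<open>f is constant in the tail directions, so the full gradient has no tail component and is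
  also the gradient along the base space.\<close>

lemma base_gradient:
  assumes s: "smooth_at f b" shows "is_base_gradient h f b (grad f b)"
proof -
  define p where "p = grad f b"
  have D: "(f has_derivative (\<lambda>v. v \<bullet> p)) (at b)" unfolding p_def by (rule has_derivative_grad[OF conv s])
  define w where "w = (tail_part h (fst p), 0 :: real)"
  have "f (b + t *\<^sub>R w) = f b" for t
    using f_hdb[of "b + t *\<^sub>R w"] f_hdb[of b] by (simp add: hdb_def w_def head_simps)
  then have "dirD f w b = 0" by (simp add: dirD_def)
  then have "w \<bullet> p = 0" using dirD_eq_derivative[OF conv D, of w] by simp
  then have "tail_part h (fst p) \<bullet> fst p = 0" by (cases p) (simp add: w_def)
  then have "tail_part h (fst p) = 0" using inner_tail_left[of h "fst p" "fst p"] by simp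
  then have "fst p \<in> head_space h" using head_tail_sum[of h "fst p"] by (simp add: head_space_iff)
  then have "p \<in> base_space h" by (cases p) (simp add: base_space_def)
  then show ?thesis using has_derivative_at_withinI[OF D] by (simp add: is_base_gradient_def p_def)
qed

definition "tB b = base_c_exp \<sigma> b (grad f b)"

lemma borel_measurable_tB[measurable]: "tB \<in> borel_measurable borel"
proof -
  note [measurable] = borel_measurable_grad(1)[OF conv]
  have [measurable]: "(fst :: (real^'n) \<times> real \<Rightarrow> _) \<in> borel_measurable borel" "(snd :: (real^'n) \<times> real \<Rightarrow> _) \<in> borel_measurable borel"
    by (intro borel_measurable_continuous_onI continuous_intros)+
  have "linear (diag_inv_act \<sigma> :: real^'n \<Rightarrow> real^'n)"
    by (auto intro!: linearI simp: vec_eq_iff diag_inv_act_def add_divide_distrib)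
  then have [measurable]: "(diag_inv_act \<sigma> :: real^'n \<Rightarrow> real^'n) \<in> borel_measurable borel"
    by (intro borel_measurable_continuous_onI linear_continuous_on) (simp add: linear_conv_bounded_linear)
  show ?thesis unfolding tB_def[abs_def] base_c_exp_def Let_def case_prod_beta' by measurable
qed

text \<open>The gain with fixed partner y has gradient (2 C u + \<Sigma> v, C), where C is the
  squared norm of y. \<open>base_c_exp\<close> inverts this: C is the last component, then v can be
  solved for because the singular values are positive, and C - |v|^2 remains.\<close>

lemma tB_contact:
  assumes xy: "(x, y) \<in> \<Gamma>s" and s: "smooth_at f (bX x)" shows "tB (bX x) = bY y"
proof -
  define u v where "u = fst (bX x)" and "v = fst (bY y)"
  define C where "C = mass y"
  have hu: "head_part h u = u" and hv: "head_part h v = v" by (simp_all add: u_def v_def b_head)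
  have bl: "bounded_linear (head_part h :: real^'n \<Rightarrow> real^'n)" using linear_head_part by (simp add: linear_conv_bounded_linear)
  have "grad f (bX x) = ((2 * C) *\<^sub>R u + diag_act \<sigma> v, C)"
  proof (rule grad_of_support[OF conv s])
    have "((\<lambda>z. C * (head_part h (fst z) \<bullet> head_part h (fst z)) + (snd z * C + fst z \<bullet> diag_act \<sigma> v)) has_derivative
      (\<lambda>w. C * (head_part h (fst w) \<bullet> head_part h (fst (bX x)) + head_part h (fst (bX x)) \<bullet> head_part h (fst w)) + (snd w * C + fst w \<bullet> diag_act \<sigma> v))) (at (bX x))"
      by (auto intro!: derivative_eq_intros bounded_linear.has_derivative[OF bl] simp: inner_commute)
    moreover have "head_part h (fst w) \<bullet> u = fst w \<bullet> u" for w :: "(real^'n) \<times> real" using inner_head_left[of h u "fst w"] by (simp add: hu inner_commute)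
    ultimately show "((\<lambda>z. kap (hdb z) (bY y)) has_derivative (\<lambda>w. w \<bullet> ((2 * C) *\<^sub>R u + diag_act \<sigma> v, C))) (at (bX x))"
      unfolding kap_hd power2_norm_eq_inner C_def[symmetric] v_def[symmetric]
      by (simp add: u_def[symmetric] hu inner_Pair[of "fst _" "snd _", simplified] inner_commute[of u] inner_prod_def inner_add_right algebra_simps)
    show "f (bX x) + kap (hdb w) (bY y) - kap (hdb (bX x)) (bY y) \<le> f w" for w unfolding b_head using sub xy by blast
  qed
  moreover have "bX x = (u, snd (bX x))" by (simp add: u_def)
  ultimately have "tB (bX x) = base_c_exp \<sigma> (u, snd (bX x)) ((2 * C) *\<^sub>R u + diag_act \<sigma> v, C)" by (metis tB_def)
  also have "\<dots> = (v, C - (norm v)\<^sup>2)"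
    using diag_inv_act_diag_act[OF len pos, of v] hv by (simp add: base_c_exp_def Let_def head_space_iff)
  also have "\<dots> = bY y" by (simp add: C_def mass_def v_def)
  finally show ?thesis .
qed

text \<open>Smoothness holds almost everywhere in the space of base points, whereas the claim
  concerns points x of the n-space. \<open>AE_Phi_base\<close> mediates, here with a predicate that
  ignores z.\<close>

lemma AE_smooth_base: "AE x in \<mu>. smooth_at f (bX x)"
proof -
  have "AE x in lborel. smooth_at f (Phi_base h (x :: real^'n))"
  proof (rule AE_Phi_base[OF hn, where P="\<lambda>w z. smooth_at f w"])
    have "fst \<in> borel_measurable (borel :: (((real^'n) \<times> real) \<times> (real^'n)) measure)" by (intro borel_measurable_continuous_onI continuous_intros)
    from measurable_compose[OF this borel_measurable_grad(2)[OF conv]]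
    show "Measurable.pred borel (\<lambda>(w, z :: real^'n). smooth_at f w)" by (simp add: case_prod_beta')
    show "smooth_at f (head_part h a, r)" if "smooth_at f (a, r)" for a r using smooth_hd[of "(a, r)"] that by (simp add: hdb_def)
    show "AE z::real^'n in lborel. AE w in lborel. smooth_at f w" using AE_smooth_at[OF conv] by simp
  qed
  then show ?thesis unfolding bX_def by (intro AE_mu_of_lborel[OF ac] AE_lborel_orthogonal[OF OX])
qed

lemma AE_tB: "AE p in \<pi>. tB (bX (fst p)) = bY (snd p)"
  using AE_coupling(1)[OF pi AE_smooth_base] measure_support_coupling(3)[OF pi]
  by eventually_elim (metis tB_contact \<Gamma>s_def prod.collapse)

end

end

section \<open>Plans and maps when the rank is deficient\<close>

context low_rank
begin

definition "pY z = (coord_proj (transpose OY *v z) :: real^'d)"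

lemma pY_eY: "pY (eY y) = y"
  unfolding pY_def eY_def orthogonal_matrix_cancel(1)[OF OY] by (rule coord_proj_embed[OF nd])

lemma borel_measurable_pY[measurable]: "pY \<in> borel_measurable borel"
proof -
  have "linear pY" unfolding pY_def[abs_def] by (rule linear_compose[OF matrix_vector_mul_linear linear_coord_proj, unfolded o_def])
  then show ?thesis by (intro borel_measurable_continuous_onI linear_continuous_on) (simp add: linear_conv_bounded_linear)
qed

lemma borel_measurable_base_fst_snd[measurable]:
  "(fst :: (real^'n) \<times> real \<Rightarrow> _) \<in> borel_measurable borel" "(snd :: (real^'n) \<times> real \<Rightarrow> _) \<in> borel_measurable borel"
  by (intro borel_measurable_continuous_onI continuous_intros)+

text \<open>Two points with the same head differ by an element of N, which is a line. The base point
  also fixes the length of the tail, so only a sign remains open. \<open>onto\<close> guarantees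
  that the head itself comes from a point of the d-space.\<close>

theorem corank_one_plan:
  assumes onto: "\<And>u. u \<in> head_space h \<Longrightarrow> \<exists>y. eY y = u" and rk: "rank (cross_moment \<pi>) = h" and h1: "h + 1 = CARD('d)"
  shows "is_m_map 2 \<mu> \<nu> \<pi>"
proof -
  obtain f where conv: "convex_on UNIV f" and f_hdb: "\<And>z. f (hdb z) = f z"
    and sub: "\<forall>(x, y)\<in>\<Gamma>s. \<forall>z. f (bX x) + kap (hdb z) (bY y) - kap (bX x) (bY y) \<le> f z"
    by (rule base_potential) (rule that)
  note [measurable] = borel_measurable_tB[OF conv f_hdb sub]
  define N where "N = {y. head_part h (eY y) = 0}"
  \<comment> \<open>N is the orthogonal complement of the range of the cross moment, whence its
    dimension is d - h = 1.\<close>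
  have N_eq: "N = {y \<in> UNIV. \<forall>x\<in>range ((*v) (cross_moment \<pi>)). orthogonal x y}"
  proof (intro set_eqI)
    fix y
    have "(\<forall>x\<in>range ((*v) (cross_moment \<pi>)). orthogonal x y) \<longleftrightarrow> (\<forall>x. diag_act \<sigma> (OX *v x) \<bullet> eY y = 0)"
      unfolding eY_def svd[symmetric] by (simp add: orthogonal_def)
    also have "\<dots> \<longleftrightarrow> (\<forall>x. (OX *v x) \<bullet> diag_act \<sigma> (eY y) = 0)" by (simp add: inner_diag_act)
    also have "\<dots> \<longleftrightarrow> diag_act \<sigma> (eY y) = 0"
      by (metis inner_eq_zero_iff inner_zero_right orthogonal_matrix_cancel(2)[OF OX])
    also have "\<dots> \<longleftrightarrow> head_part h (eY y) = 0"
      using less_imp_neq[OF pos, THEN not_sym] by (auto simp: vec_eq_iff diag_act_def head_tail_component len)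
    finally show "y \<in> N \<longleftrightarrow> y \<in> {y \<in> UNIV. \<forall>x\<in>range ((*v) (cross_moment \<pi>)). orthogonal x y}" by (simp add: N_def)
  qed
  have "dim N + dim (range ((*v) (cross_moment \<pi>))) = dim (UNIV :: (real^'d) set)" unfolding N_eq
    by (rule dim_subspace_orthogonal_to_vectors) (auto intro: linear_subspace_image[OF matrix_vector_mul_linear])
  then have dN: "dim N = 1" using rank_dim_range[of "cross_moment \<pi>"] rk h1 by simp
  have "subspace N" unfolding N_def subspace_def
    by (auto simp: linear_0[OF linear_eY] linear_add[OF linear_eY] linear_scale[OF linear_eY] head_simps)
  then obtain us where us: "ortholist us" "length us = dim N" "span (set us) = N" by (rule orthonormal_list_subspace) (rule that)
  then obtain b where b: "us = [b]" using dN by (metis One_nat_def length_0_conv length_Suc_conv)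
  then have Nb: "N = span {b}" and nb: "norm b = 1" using us by (auto simp: ortholist_def norm_eq_1)
  have two: "y = pY (fst (bY y)) + sqrt (snd (bY y)) *\<^sub>R b \<or> y = pY (fst (bY y)) - sqrt (snd (bY y)) *\<^sub>R b" for y
  proof -
    define v where "v = head_part h (eY y)"
    obtain y1 where y1: "eY y1 = v" using onto[of v] by (auto simp: v_def)
    have d: "eY (y - y1) = tail_part h (eY y)"
      using head_tail_sum[of h "eY y"] by (simp add: linear_diff[OF linear_eY] y1 v_def algebra_simps)
    then have "y - y1 \<in> N" by (simp add: N_def)
    then obtain t where t: "y - y1 = t *\<^sub>R b" unfolding Nb by (auto simp: span_singleton)
    have "norm (tail_part h (eY y)) = \<bar>t\<bar>" using d norm_eY[of "y - y1"] nb t by simp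
    then have s: "sqrt (snd (bY y)) = \<bar>t\<bar>" by (simp add: bY_def Phi_base_def)
    have "pY (fst (bY y)) = y1" using pY_eY[of y1] y1 by (simp add: bY_def Phi_base_def v_def)
    moreover have "y = y1 + t *\<^sub>R b" using t by (simp add: algebra_simps)
    ultimately show ?thesis unfolding s by (cases "t \<ge> 0") (auto simp: abs_if)
  qed
  define T where "T r x = pY (fst (tB f (bX x))) + (r * sqrt (snd (tB f (bX x)))) *\<^sub>R b" for r x
  have "T r \<in> borel_measurable borel" for r unfolding T_def[abs_def] by measurable
  then show ?thesis
  proof (rule is_m_map_two_graphs[OF pi])
    show "T (- 1) \<in> borel_measurable borel" by fact
    show "AE p in \<pi>. snd p = T 1 (fst p) \<or> snd p = T (- 1) (fst p)"
      using AE_tB[OF conv f_hdb sub]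
    proof eventually_elim
      case (elim p)
      show ?case using two[of "snd p"] by (simp add: T_def elim)
    qed
  qed
qed

text \<open>The base point of the image is forced to be \<open>tB\<close>; only the fibre coordinate
  is free. The map is assembled from \<open>tB\<close> and the fibre map \<open>\<Omega>\<close> and
  read back in the d-space by \<open>pY\<close>.\<close>

theorem low_rank_map:
  assumes h2: "h + 2 \<le> CARD('d)" and e: "e \<in> tail_sphere h"
  obtains S :: "real^'n \<Rightarrow> real^'d" and f :: "(real^'n) \<times> real \<Rightarrow> real" and g :: "(real^'n) \<times> real \<Rightarrow> real^'n \<Rightarrow> real"
  where "S \<in> borel_measurable borel" "gw_optimal \<mu> \<nu> (graph_plan \<mu> S)"
    "c_convex (base_space h) (base_space h) (base_cost \<sigma>) (\<lambda>b. ereal (f b))"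
    "\<And>b. c_convex (tail_sphere h) (tail_sphere h) (\<lambda>x y. (sphere_dist x y)\<^sup>2 / 2) (\<lambda>x. ereal (g b x))"
    "AE x in distr \<mu> borel ((*v) OX).
              \<exists>p q. is_base_gradient h f (Phi_base h x) p \<and>
                    is_sphere_gradient h (g (Phi_base h x)) (Phi_fibre h e x) q \<and>
                    Phi h e (eY (S (transpose OX *v x))) =
                      (base_c_exp \<sigma> (Phi_base h x) p, sphere_exp (Phi_fibre h e x) q)"
    "is_m_map 2 \<mu> \<nu> (graph_plan \<mu> S)"
proof -
  obtain f where conv: "convex_on UNIV f" and f_hdb: "\<And>z. f (hdb z) = f z"
    and sub: "\<forall>(x, y)\<in>\<Gamma>s. \<forall>z. f (bX x) + kap (hdb z) (bY y) - kap (bX x) (bY y) \<le> f z"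
    and cc: "c_convex (base_space h) (base_space h) (base_cost \<sigma>) (\<lambda>b. ereal (f b))"
    by (rule base_potential) (rule that)
  let ?tB = "tB f"
  note [measurable] = borel_measurable_tB[OF conv f_hdb sub]
  interpret tf: tail_fibre h e by unfold_locales (use h2 nd e in auto)
  interpret P: prob_space \<pi> by (rule couplingsD(1)[OF pi])
  note [measurable] = couplingsD(6,7)[OF pi]
  define B where "B p = bX (fst p)" for p :: "(real^'n) \<times> (real^'d)"
  define X where "X p = Phi_fibre h e (OX *v fst p)" for p :: "(real^'n) \<times> (real^'d)"
  define Y where "Y p = Phi_fibre h e (eY (snd p))" for p :: "(real^'n) \<times> (real^'d)"
  have [measurable]: "B \<in> borel_measurable \<pi>" "X \<in> borel_measurable \<pi>" "Y \<in> borel_measurable \<pi>"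
    unfolding B_def[abs_def] X_def[abs_def] Y_def[abs_def] by measurable
  interpret fp: fibre_problem "tail_sphere h" tf.c 44 10 tf.dseq \<pi> B X Y
    by unfold_locales (auto simp: X_def Y_def intro: Phi_fibre_in e)
  obtain \<psi> where adm: "fp.adm \<psi>"
    and law: "\<And>T. T \<in> borel_measurable \<pi> \<Longrightarrow> (AE \<omega> in \<pi>. T \<omega> \<in> tail_sphere h \<and>
       (\<forall>y\<in>tail_sphere h. tf.tr (\<psi> (B \<omega>)) (X \<omega>) = - tf.c (X \<omega>) y - \<psi> (B \<omega>) y \<longleftrightarrow> y = T \<omega>)) \<Longrightarrow>
       distr \<pi> borel (\<lambda>\<omega>. (B \<omega>, T \<omega>)) = distr \<pi> borel (\<lambda>\<omega>. (B \<omega>, Y \<omega>))"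
    by (rule fp.fibre_potentials) (rule that)
  define g where "g b = tf.tr (\<psi> b)" for b
  have psi: "tf.lip (\<psi> b)" for b using adm by (rule fp.adm_lip)
  have g_adm: "fp.adm g" unfolding g_def[abs_def] by (rule fp.adm_tr'[OF adm])
  obtain R where R: "\<And>b y. y \<in> tail_sphere h \<Longrightarrow> \<bar>g b y\<bar> \<le> R" by (rule fp.adm_bound[OF g_adm]) (rule that)
  define K where "K = R + 20"
  define H where "H b = tf.hext K (g b)" for b
  have convH: "convex_on UNIV (H b)" for b unfolding H_def by (rule tf.convex_hext[OF psi g_def R K_def])
  have ccg: "c_convex (tail_sphere h) (tail_sphere h) tf.c (\<lambda>x. ereal (g b x))" for b
    unfolding c_convex_def
  proof (intro conjI exI[of _ "\<lambda>y. ereal (- \<psi> b y)"] ballI bexI[OF _ e])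
    fix x :: "real^'n" assume x: "x \<in> tail_sphere h"
    show "ereal (g b x) = (SUP y\<in>tail_sphere h. ereal (- \<psi> b y) - ereal (tf.c x y))"
    proof (rule antisym)
      obtain y where y: "y \<in> tail_sphere h" "tf.tr (\<psi> b) x = - tf.c x y - \<psi> b y"
        by (rule tf.tr_attained[OF tf.lip_continuous[OF psi] x]) (rule that)
      have "ereal (g b x) = ereal (- \<psi> b y) - ereal (tf.c x y)" by (simp add: g_def y)
      also have "\<dots> \<le> (SUP y\<in>tail_sphere h. ereal (- \<psi> b y) - ereal (tf.c x y))" by (rule SUP_upper[OF y(1)])
      finally show "ereal (g b x) \<le> (SUP y\<in>tail_sphere h. ereal (- \<psi> b y) - ereal (tf.c x y))" .
      show "(SUP y\<in>tail_sphere h. ereal (- \<psi> b y) - ereal (tf.c x y)) \<le> ereal (g b x)"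
      proof (rule SUP_least)
        fix y :: "real^'n" assume "y \<in> tail_sphere h"
        from tf.tr_upper_lip[OF psi x this, of b] show "ereal (- \<psi> b y) - ereal (tf.c x y) \<le> ereal (g b x)"
          by (simp add: g_def)
      qed
    qed
  qed simp
  have Hm: "(\<lambda>(b, z). H b z) \<in> borel_measurable (borel \<Otimes>\<^sub>M borel)"
  proof -
    have "(\<lambda>q. g (fst q) (Phi_fibre h e (snd q))) \<in> borel_measurable (borel \<Otimes>\<^sub>M borel)"
    proof (rule tf.lip_joint_measurable[where M=borel and f=g and B=fst and X="\<lambda>q. Phi_fibre h e (snd q)"])
      show "tf.lip (g b)" for b using g_adm by (rule fp.adm_lip)
      show "(\<lambda>b. g b y) \<in> borel_measurable borel" if "y \<in> tail_sphere h" for y using g_adm that by (simp add: fp.adm_def)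
    qed (auto intro: Phi_fibre_in e)
    then show ?thesis unfolding H_def tf.hext_def case_prod_beta' by measurable
  qed
  have Dm: "(\<lambda>q. dirD (H (fst q)) v (snd q)) \<in> borel_measurable (borel \<Otimes>\<^sub>M borel)" for v
    using borel_measurable_dirD[OF convH Hm, of v] by (simp add: case_prod_beta')
  have gradm: "(\<lambda>q. grad (H (fst q)) (snd q)) \<in> borel_measurable (borel \<Otimes>\<^sub>M borel)"
    unfolding grad_def using Dm by measurable
  have smoothm: "Measurable.pred (borel \<Otimes>\<^sub>M borel) (\<lambda>q. smooth_at (H (fst q)) (snd q))"
    unfolding smooth_at_def using Dm by measurable
  \<comment> \<open>The exponential of the tangential part of the gradient, which by
    \<open>fibre_gradient\<close> is the unique contact point.\<close>
  define \<Omega> where "\<Omega> z = (let x = Phi_fibre h e z; p = grad (H (Phi_base h z)) z in sphere_exp x (p - (p \<bullet> x) *\<^sub>R x))" for z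
  have pairm: "(\<lambda>z. (Phi_base h z, z)) \<in> borel \<rightarrow>\<^sub>M (borel \<Otimes>\<^sub>M (borel :: (real^'n) measure))" by measurable
  have [measurable]: "(\<lambda>z. grad (H (Phi_base h z)) z) \<in> borel_measurable borel"
    using measurable_compose[OF pairm gradm] by simp
  have [measurable]: "Measurable.pred borel (\<lambda>z. smooth_at (H (Phi_base h z)) z)"
    using measurable_compose[OF pairm smoothm] by simp
  have [measurable]: "\<Omega> \<in> borel_measurable borel" unfolding \<Omega>_def[abs_def] Let_def sphere_exp_def by measurable
  have aeH0: "AE z in lborel. smooth_at (H (Phi_base h z)) (z :: real^'n)"
  proof -
    \<comment> \<open>For fixed w convexity gives almost every z, and Fubini exchanges the
      quantifiers. Composing with \<open>hdb\<close> makes the predicate depend on the base part of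
      w alone, as the invariance condition of \<open>AE_Phi_base\<close> requires.\<close>
    define Q where "Q w z = smooth_at (H (hdb w)) z" for w z
    have [measurable]: "(hdb :: (real^'n) \<times> real \<Rightarrow> _) \<in> borel_measurable borel" unfolding hdb_def[abs_def] by measurable
    have Qm: "Measurable.pred (borel \<Otimes>\<^sub>M borel) (\<lambda>(w, z). Q w z)"
    proof -
      have "(\<lambda>q :: ((real^'n) \<times> real) \<times> (real^'n). (hdb (fst q), snd q)) \<in> (borel \<Otimes>\<^sub>M borel) \<rightarrow>\<^sub>M (borel \<Otimes>\<^sub>M (borel :: (real^'n) measure))" by measurable
      from measurable_compose[OF this smoothm] show ?thesis by (simp add: Q_def case_prod_beta')
    qed
    have "AE z in lborel. Q (Phi_base h z) z"
    proof (rule AE_Phi_base[OF hn])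
      show "Measurable.pred borel (\<lambda>(w, z). Q w z)" using Qm by (simp add: borel_prod)
      show "Q (head_part h a, r) z'" if "0 < s" "tail_part h z' = s *\<^sub>R tail_part h z" "Q (a, r) z" for a r z z' s
        using tf.smooth_hext_scale(1)[OF psi g_def R K_def that(1,2)] that(3) by (simp add: Q_def H_def hdb_def)
      have "AE w in lborel. AE z in lborel. Q w z" unfolding Q_def by (simp add: AE_smooth_at[OF convH])
      then show "AE z in lborel. AE w in lborel. Q w z"
        by (subst (asm) lborel_pair.AE_commute) (use Qm in \<open>simp_all add: case_prod_beta' pred_def space_pair_measure\<close>)
    qed
    then show ?thesis by (simp add: Q_def base_head)
  qed
  have aeH: "AE x in \<mu>. smooth_at (H (bX x)) (OX *v x) \<and> tail_part h (OX *v x) \<noteq> 0"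
  proof (rule AE_mu_of_lborel[OF ac])
    show "AE x in lborel. smooth_at (H (bX x)) (OX *v x) \<and> tail_part h (OX *v x) \<noteq> 0"
      using AE_lborel_orthogonal[OF OX aeH0] AE_lborel_orthogonal[OF OX AE_tail_nonzero[OF hn]]
      by eventually_elim (simp add: bX_def)
  qed
  define T where "T p = \<Omega> (OX *v fst p)" for p :: "(real^'n) \<times> (real^'d)"
  have [measurable]: "T \<in> borel_measurable \<pi>" unfolding T_def[abs_def] by measurable
  have fib: "is_sphere_gradient h (g (Phi_base h z)) (Phi_fibre h e z) (grad (H (Phi_base h z)) z - (grad (H (Phi_base h z)) z \<bullet> Phi_fibre h e z) *\<^sub>R Phi_fibre h e z)"
    "\<Omega> z \<in> tail_sphere h"
    "\<And>y. y \<in> tail_sphere h \<Longrightarrow> g (Phi_base h z) (Phi_fibre h e z) = - tf.c (Phi_fibre h e z) y - \<psi> (Phi_base h z) y \<longleftrightarrow> y = \<Omega> z"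
    if "tail_part h z \<noteq> 0" "smooth_at (H (Phi_base h z)) z" for z
    using tf.fibre_gradient[OF psi[of "Phi_base h z"] g_def R K_def that(1)] that(2)
    unfolding \<Omega>_def H_def Let_def by auto
  have lawT: "distr \<pi> borel (\<lambda>p. (B p, T p)) = distr \<pi> borel (\<lambda>p. (B p, Y p))"
  proof (rule law)
    show "AE p in \<pi>. T p \<in> tail_sphere h \<and> (\<forall>y\<in>tail_sphere h. tf.tr (\<psi> (B p)) (X p) = - tf.c (X p) y - \<psi> (B p) y \<longleftrightarrow> y = T p)"
      using AE_coupling(1)[OF pi aeH]
    proof eventually_elim
      case (elim p)
      from fib(2,3)[of "OX *v fst p"] elim show ?case by (simp add: T_def B_def X_def bX_def g_def[symmetric])
    qed
  qed measurable
  define rec where "rec b \<omega> = fst (?tB b) + sqrt (snd (?tB b)) *\<^sub>R (\<omega> :: real^'n)" for b \<omega>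
  \<comment> \<open>These are the properties of the actual pairs that the new fibre coordinate has
    to share: the rebuilt point lies in the embedded d-space, the base point is a genuine one, and
    at radius 0 the fibre coordinate is the default e. They concern only the base variable and the
    fibre coordinate, so equality of laws carries them from Y to T.\<close>
  define E where "E b \<omega> \<longleftrightarrow> eY (pY (rec b \<omega>)) = rec b \<omega> \<and> head_part h (fst (?tB b)) = fst (?tB b) \<and> 0 \<le> snd (?tB b) \<and> (snd (?tB b) = 0 \<longrightarrow> \<omega> = e)" for b \<omega>
  have [measurable]: "(fst :: ((real^'n) \<times> real) \<times> (real^'n) \<Rightarrow> _) \<in> borel_measurable borel" "(snd :: ((real^'n) \<times> real) \<times> (real^'n) \<Rightarrow> _) \<in> borel_measurable borel"
    by (intro borel_measurable_continuous_onI continuous_intros)+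
  have recm[measurable]: "(\<lambda>q. rec (fst q) (snd q)) \<in> borel_measurable borel" unfolding rec_def by measurable
  have Em[measurable]: "Measurable.pred borel (\<lambda>q. E (fst q) (snd q))" unfolding E_def by measurable
  have Y_rec: "AE p in \<pi>. rec (B p) (Y p) = eY (snd p) \<and> E (B p) (Y p)"
    using AE_tB[OF conv f_hdb sub]
  proof eventually_elim
    case (elim p)
    have tb: "?tB (B p) = Phi_base h (eY (snd p))" using elim by (simp add: B_def bY_def)
    have r: "rec (B p) (Y p) = eY (snd p)" unfolding rec_def tb Y_def by (rule Phi_decompose[symmetric])
    show ?case unfolding E_def r pY_eY tb by (simp add: Phi_base_def Phi_fibre_def Y_def)
  qed
  have BTm[measurable]: "(\<lambda>p. (B p, T p)) \<in> borel_measurable \<pi>" "(\<lambda>p. (B p, Y p)) \<in> borel_measurable \<pi>" by measurable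
  have "AE q in distr \<pi> borel (\<lambda>p. (B p, Y p)). E (fst q) (snd q)"
    using Y_rec by (subst AE_distr_iff) (auto simp: pred_def[symmetric])
  then have "AE q in distr \<pi> borel (\<lambda>p. (B p, T p)). E (fst q) (snd q)" unfolding lawT .
  then have ET: "AE p in \<pi>. E (B p) (T p)"
    by (subst (asm) AE_distr_iff) (auto simp: pred_def[symmetric])
  define S where "S x = pY (rec (bX x) (\<Omega> (OX *v x)))" for x
  have Sm[measurable]: "S \<in> borel_measurable borel"
  proof -
    have "(\<lambda>x. (bX x, \<Omega> (OX *v x))) \<in> borel_measurable borel" by measurable
    from measurable_compose[OF this recm] have [measurable]: "(\<lambda>x. rec (bX x) (\<Omega> (OX *v x))) \<in> borel_measurable borel" by simp
    show ?thesis unfolding S_def[abs_def] by measurable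
  qed
  have S_pi: "S (fst p) = pY (rec (B p) (T p))" for p by (simp add: S_def B_def T_def)
  \<comment> \<open>The last condition in E matters here: at radius 0 the fibre coordinate cannot be
    recovered from the point, and \<open>Phi_fibre\<close> returns e.\<close>
  have Phi_rec: "Phi h e (rec b \<omega>) = (?tB b, \<omega>)" if E: "E b \<omega>" and w: "\<omega> \<in> tail_sphere h" for b \<omega>
  proof -
    have w': "tail_part h \<omega> = \<omega>" "norm \<omega> = 1" using w by (auto simp: tail_sphere_def tail_space_iff)
    have hw: "head_part h \<omega> = 0" using head_tail_sum[of h \<omega>] w'(1) by simp
    have tt: "tail_part h (fst (?tB b)) = 0" using head_tail_sum[of h "fst (?tB b)"] E by (simp add: E_def)
    have hd: "head_part h (rec b \<omega>) = fst (?tB b)" using E by (simp add: rec_def head_simps hw E_def)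
    have tl: "tail_part h (rec b \<omega>) = sqrt (snd (?tB b)) *\<^sub>R \<omega>" by (simp add: rec_def tail_simps tt w')
    have w0: "\<omega> \<noteq> 0" using w'(2) by auto
    show ?thesis unfolding Phi_def Phi_base_def Phi_fibre_def hd tl using E w'(2) w0
      by (auto simp: E_def prod_eq_iff)
  qed
  have good: "AE p in \<pi>. eY (S (fst p)) = rec (B p) (T p) \<and> Phi h e (eY (S (fst p))) = (?tB (B p), T p)"
    using ET AE_coupling(1)[OF pi aeH]
  proof eventually_elim
    case (elim p)
    have "T p \<in> tail_sphere h" using fib(2)[of "OX *v fst p"] elim by (simp add: T_def bX_def)
    from Phi_rec[OF elim(1) this] show ?case using elim(1) by (simp add: E_def S_pi)
  qed
  \<comment> \<open>The law of the image depends only on the joint law of base variable and fibre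
    coordinate; with Y in place of T the reconstruction returns y.\<close>
  have S_dist: "distr \<mu> borel S = \<nu>"
  proof -
    have "distr \<mu> borel S = distr \<pi> borel (\<lambda>p. S (fst p))"
      unfolding couplingsD(4)[OF pi, symmetric] by (subst distr_distr) (auto simp: o_def)
    also have "\<dots> = distr (distr \<pi> borel (\<lambda>p. (B p, T p))) borel (\<lambda>q. pY (rec (fst q) (snd q)))"
      by (subst distr_distr) (auto simp: o_def S_pi)
    also have "\<dots> = distr \<pi> borel (\<lambda>p. pY (rec (B p) (Y p)))"
      unfolding lawT by (subst distr_distr) (auto simp: o_def)
    also have "\<dots> = distr \<pi> borel snd"
    proof (rule distr_cong_AE)
      show "AE p in \<pi>. pY (rec (B p) (Y p)) = snd p" using Y_rec by eventually_elim (simp add: pY_eY)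
      have "(\<lambda>p. pY (rec (fst (B p, Y p)) (snd (B p, Y p)))) \<in> borel_measurable \<pi>"
        using measurable_compose[OF BTm(2) measurable_compose[OF recm borel_measurable_pY]] by simp
      then show "(\<lambda>p. pY (rec (B p) (Y p))) \<in> borel_measurable \<pi>" by simp
    qed simp_all
    finally show ?thesis by (simp add: couplingsD(5)[OF pi])
  qed
  have sets_mu: "sets \<mu> = sets borel" by (rule couplingsD(8)[OF pi])
  have gm: "(\<lambda>x. (x, S x)) \<in> borel_measurable borel" by (rule measurable_graph(1)[OF Sm])
  have gm': "(\<lambda>x. (x, S x)) \<in> borel_measurable \<mu>" using gm unfolding measurable_cong_sets[OF sets_mu refl] .
  have fsm: "fst \<in> borel_measurable (borel :: ((real^'n) \<times> (real^'d)) measure)" "snd \<in> borel_measurable (borel :: ((real^'n) \<times> (real^'d)) measure)"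
    by (intro borel_measurable_continuous_onI continuous_intros)+
  have gp: "graph_plan \<mu> S \<in> couplings \<mu> \<nu>"
  proof -
    have "prob_space (graph_plan \<mu> S)" unfolding graph_plan_def
      using mu by (intro prob_space.prob_space_distr gm') (simp add: borel_prob_def)
    moreover have "distr (graph_plan \<mu> S) borel fst = \<mu>"
      unfolding graph_plan_def by (subst distr_distr[OF fsm(1) gm']) (simp add: o_def distr_id2 sets_mu)
    moreover have "distr (graph_plan \<mu> S) borel snd = \<nu>"
      unfolding graph_plan_def by (subst distr_distr[OF fsm(2) gm']) (simp add: o_def S_dist)
    ultimately show ?thesis by (simp add: couplings_def borel_prob_def graph_plan_def)
  qed
  have opt': "gw_optimal \<mu> \<nu> (graph_plan \<mu> S)"
  proof (rule gw_optimal_of_lin_value[OF opt gp])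
    let ?l = "lin_value (cross_moment \<pi>)"
    have lm: "?l \<in> borel_measurable borel" by (rule borel_measurable_continuous_onI[OF continuous_lin_value])
    have glm: "(\<lambda>x. ?l (x, S x)) \<in> borel_measurable borel" by (rule measurable_compose[OF gm lm])
    have "(\<integral>q. ?l q \<partial>graph_plan \<mu> S) = (\<integral>x. ?l (x, S x) \<partial>\<mu>)"
      unfolding graph_plan_def by (rule integral_distr[OF gm' lm])
    also have "\<dots> = (\<integral>p. ?l (fst p, S (fst p)) \<partial>\<pi>)"
      unfolding couplingsD(4)[OF pi, symmetric] by (rule integral_distr[OF couplingsD(6)[OF pi] glm])
    also have "\<dots> = (\<integral>p. ?l p \<partial>\<pi>)"
    proof (rule integral_cong_AE)
      show "AE p in \<pi>. ?l (fst p, S (fst p)) = ?l p"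
        using good AE_tB[OF conv f_hdb sub]
      proof eventually_elim
        case (elim p)
        \<comment> \<open>The new partner has the same base point as the old one, and
          \<open>lin_kap\<close> sees nothing else.\<close>
        from conjunct2[OF elim(1)] elim(2) have "bY (S (fst p)) = bY (snd p)" by (simp add: Phi_def bY_def B_def)
        then have "?l (fst p, S (fst p)) = ?l (fst p, snd p)" by (simp only: lin_kap)
        then show ?case by simp
      qed
      show "(\<lambda>p. ?l (fst p, S (fst p))) \<in> borel_measurable \<pi>" by (rule measurable_compose[OF couplingsD(6)[OF pi] glm])
      show "?l \<in> borel_measurable \<pi>" by (rule measurable_coupling[OF pi continuous_lin_value])
    qed
    finally show "(\<integral>q. ?l q \<partial>graph_plan \<mu> S) = (\<integral>p. ?l p \<partial>\<pi>)" .
  qed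
  have two: "is_m_map 2 \<mu> \<nu> (graph_plan \<mu> S)"
  proof (rule is_m_map_two_graphs[OF gp Sm Sm])
    have "AE p in graph_plan \<mu> S. snd p = S (fst p)"
      unfolding graph_plan_def using measurable_graph(2)[OF Sm] by (subst AE_distr_iff[OF gm']) auto
    then show "AE p in graph_plan \<mu> S. snd p = S (fst p) \<or> snd p = S (fst p)" by simp
  qed
  have final: "AE x in distr \<mu> borel ((*v) OX).
              \<exists>p q. is_base_gradient h f (Phi_base h x) p \<and>
                    is_sphere_gradient h (g (Phi_base h x)) (Phi_fibre h e x) q \<and>
                    Phi h e (eY (S (transpose OX *v x))) =
                      (base_c_exp \<sigma> (Phi_base h x) p, sphere_exp (Phi_fibre h e x) q)"
  proof -
    note [measurable] = borel_measurable_grad(2)[OF conv]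
    \<comment> \<open>All exceptional conditions are gathered in one measurable predicate of the
      rotated point, so that they can be moved from \<pi> to the image of \<mu>.\<close>
    define G where "G z \<longleftrightarrow> smooth_at f (Phi_base h z) \<and> smooth_at (H (Phi_base h z)) z \<and> tail_part h z \<noteq> 0 \<and> E (Phi_base h z) (\<Omega> z)" for z
    have EOm: "Measurable.pred borel (\<lambda>z. E (Phi_base h z) (\<Omega> z))"
    proof -
      have "(\<lambda>z. (Phi_base h z, \<Omega> z)) \<in> borel_measurable borel" by measurable
      from measurable_compose[OF this Em] show ?thesis by simp
    qed
    have Gm: "Measurable.pred borel G" unfolding G_def[abs_def] using EOm by measurable
    have "AE p in \<pi>. G (OX *v fst p)"
      using ET AE_coupling(1)[OF pi aeH] AE_coupling(1)[OF pi AE_smooth_base[OF conv f_hdb sub]]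
      by eventually_elim (simp add: G_def B_def T_def bX_def)
    then have "AE x in distr \<pi> borel (\<lambda>p. OX *v fst p). G x"
      using Gm by (subst AE_distr_iff) (auto simp: pred_def)
    also have "distr \<pi> borel (\<lambda>p. OX *v fst p) = distr \<mu> borel ((*v) OX)"
      unfolding couplingsD(4)[OF pi, symmetric] by (subst distr_distr) (auto simp: o_def)
    finally show ?thesis
    proof eventually_elim
      case (elim z)
      then have G: "smooth_at f (Phi_base h z)" "smooth_at (H (Phi_base h z)) z" "tail_part h z \<noteq> 0" "E (Phi_base h z) (\<Omega> z)" by (simp_all add: G_def)
      have "S (transpose OX *v z) = pY (rec (Phi_base h z) (\<Omega> z))"
        unfolding S_def bX_def orthogonal_matrix_cancel(2)[OF OX] ..
      then have eS: "eY (S (transpose OX *v z)) = rec (Phi_base h z) (\<Omega> z)" using G(4) by (simp add: E_def)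
      have "Phi h e (eY (S (transpose OX *v z))) = (?tB (Phi_base h z), \<Omega> z)"
        unfolding eS by (rule Phi_rec[OF G(4) fib(2)[OF G(3,2)]])
      moreover have "?tB (Phi_base h z) = base_c_exp \<sigma> (Phi_base h z) (grad f (Phi_base h z))"
        by (rule tB_def[OF conv f_hdb sub])
      ultimately show ?case using base_gradient[OF conv f_hdb sub G(1)] fib(1)[OF G(3,2)]
        by (intro exI conjI) (auto simp: \<Omega>_def Let_def)
    qed
  qed
  show ?thesis by (rule that[OF Sm opt' cc ccg final two])
qed

end

section \<open>Combination of the three rank cases\<close>

theorem theorem3p6:
  fixes \<mu> :: "(real^'n) measure" and \<nu> :: "(real^'d) measure"
    and \<pi>star :: "((real^'n) \<times> (real^'d)) measure"
    and Mstar :: "real^'n^'d" and h :: nat and \<Sigma> :: "real list"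
  assumes "CARD('n) \<ge> CARD('d)"
    and "borel_prob \<mu>" and "borel_prob \<nu>"
    and "compact (measure_support \<mu>)" and "compact (measure_support \<nu>)"
    and "(\<integral>x. x \<partial>\<mu>) = 0" and "(\<integral>y. y \<partial>\<nu>) = 0"
    and "absolutely_continuous lborel \<mu>"
    and "gw_optimal \<mu> \<nu> \<pi>star"
    and Mstar_def: "Mstar = cross_moment \<pi>star"
    and h_def: "h = rank Mstar"
    and \<Sigma>_def: "\<Sigma> = nonzero_singular_values (4 *\<^sub>R Mstar)"
  shows
    "(h = CARD('d) \<longrightarrow>
        (\<exists>\<pi>. gw_optimal \<mu> \<nu> \<pi> \<and> is_m_map 2 \<mu> \<nu> \<pi> \<and> is_map_anti_map \<mu> \<nu> \<pi>)) \<and>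
     (h + 1 = CARD('d) \<longrightarrow>
        (\<exists>\<pi>. gw_optimal \<mu> \<nu> \<pi> \<and> is_m_map 2 \<mu> \<nu> \<pi>)) \<and>
     (h + 2 \<le> CARD('d) \<longrightarrow>
        (\<forall>e \<in> (tail_sphere h :: (real^'n) set).
         \<exists>(S :: real^'n \<Rightarrow> real^'d) (T :: real^'n \<Rightarrow> real^'n)
            (OX :: real^'n^'n) (OY :: real^'n^'n) (T0 :: real^'n \<Rightarrow> real^'n)
            (f :: (real^'n) \<times> real \<Rightarrow> real) (g :: (real^'n) \<times> real \<Rightarrow> real^'n \<Rightarrow> real).
           S \<in> borel_measurable borel \<and>
           gw_optimal \<mu> \<nu> (graph_plan \<mu> S) \<and>
           T = coord_embed \<circ> S \<and>
           orthogonal_matrix OX \<and> orthogonal_matrix OY \<and>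
           T = (*v) (transpose OY) \<circ> T0 \<circ> (*v) OX \<and>
           c_convex (base_space h) (base_space h) (base_cost \<Sigma>) (\<lambda>b. ereal (f b)) \<and>
           (\<forall>b \<in> head_space h \<times> {0..}.
              c_convex (tail_sphere h) (tail_sphere h) (\<lambda>x y. (sphere_dist x y)\<^sup>2 / 2)
                (\<lambda>x. ereal (g b x))) \<and>
           (AE x in distr \<mu> borel ((*v) OX).
              \<exists>p q. is_base_gradient h f (Phi_base h x) p \<and>
                    is_sphere_gradient h (g (Phi_base h x)) (Phi_fibre h e x) q \<and>
                    Phi h e (T0 x) =
                      (base_c_exp \<Sigma> (Phi_base h x) p, sphere_exp (Phi_fibre h e x) q)))) \<and>
     (\<exists>\<pi>. gw_optimal \<mu> \<nu> \<pi> \<and> is_m_map 2 \<mu> \<nu> \<pi>)"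
proof -
  interpret gw_marginals \<mu> \<nu> by unfold_locales (fact assms)+
  note nd = assms(1) and ac = assms(8) and opt = assms(9)
  \<comment> \<open>The decomposition is taken of the matrix with factor 4, as in the linearized
    cost, while h refers to the matrix itself.\<close>
  have rk4: "rank (4 *\<^sub>R Mstar) = h"
  proof -
    have "range ((*v) (4 *\<^sub>R Mstar)) = range ((*v) Mstar)"
    proof (intro equalityI subsetI)
      fix y assume "y \<in> range ((*v) (4 *\<^sub>R Mstar))"
      then obtain x where "y = Mstar *v (4 *\<^sub>R x)" by (auto simp: scaleR_matrix_vector_assoc matrix_vector_mult_scaleR)
      then show "y \<in> range ((*v) Mstar)" by blast
    next
      fix y assume "y \<in> range ((*v) Mstar)"
      then obtain x where x: "y = Mstar *v x" by blast
      have "y = (4 *\<^sub>R Mstar) *v ((1 / 4) *\<^sub>R x)" by (simp add: x scaleR_matrix_vector_assoc[symmetric] matrix_vector_mult_scaleR)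
      then show "y \<in> range ((*v) (4 *\<^sub>R Mstar))" by blast
    qed
    then show ?thesis by (simp add: rank_dim_range h_def)
  qed
  have full: "is_m_map 2 \<mu> \<nu> \<pi>star \<and> is_map_anti_map \<mu> \<nu> \<pi>star" if "h = CARD('d)"
    using full_rank_plan[OF opt ac] that by (simp add: h_def Mstar_def)
  obtain OX OY :: "real^'n^'n" where OX: "orthogonal_matrix OX" and OY: "orthogonal_matrix OY"
    and svd: "\<And>x y. (4 *\<^sub>R Mstar *v x) \<bullet> y = diag_act \<Sigma> (OX *v x) \<bullet> (OY *v coord_embed y)"
    and len: "length \<Sigma> = h" and pos: "\<And>k. k < h \<Longrightarrow> \<Sigma> ! k > 0"
    and onto: "\<And>u. u \<in> head_space h \<Longrightarrow> \<exists>y. OY *v coord_embed (y :: real^'d) = u"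
    using singular_value_decomposition[OF nd, of "4 *\<^sub>R Mstar", folded \<Sigma>_def, unfolded rk4] by metis
  have low: "low_rank \<mu> \<nu> \<pi>star h \<Sigma> OX OY" if "h < CARD('d)"
  proof unfold_locales
    show "4 * ((cross_moment \<pi>star *v x) \<bullet> y) = diag_act \<Sigma> (OX *v x) \<bullet> (OY *v coord_embed y)" for x y
      unfolding svd[symmetric] Mstar_def scaleR_matrix_vector_assoc[symmetric] by simp
  qed (use that nd ac opt OX OY len pos in auto)
  have corank1: "is_m_map 2 \<mu> \<nu> \<pi>star" if h1: "h + 1 = CARD('d)"
  proof -
    interpret low_rank \<mu> \<nu> \<pi>star h \<Sigma> OX OY by (rule low) (use h1 in simp)
    show ?thesis by (rule corank_one_plan) (use onto h1 in \<open>auto simp: eY_def h_def Mstar_def\<close>)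
  qed
  have map: "\<exists>(S :: real^'n \<Rightarrow> real^'d) f g. S \<in> borel_measurable borel \<and> gw_optimal \<mu> \<nu> (graph_plan \<mu> S) \<and>
      c_convex (base_space h) (base_space h) (base_cost \<Sigma>) (\<lambda>b. ereal (f b)) \<and>
      (\<forall>b. c_convex (tail_sphere h) (tail_sphere h) (\<lambda>x y. (sphere_dist x y)\<^sup>2 / 2) (\<lambda>x. ereal (g b x))) \<and>
      (AE x in distr \<mu> borel ((*v) OX).
         \<exists>p q. is_base_gradient h f (Phi_base h x) p \<and>
               is_sphere_gradient h (g (Phi_base h x)) (Phi_fibre h e x) q \<and>
               Phi h e (OY *v coord_embed (S (transpose OX *v x))) =
                 (base_c_exp \<Sigma> (Phi_base h x) p, sphere_exp (Phi_fibre h e x) q)) \<and>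
      is_m_map 2 \<mu> \<nu> (graph_plan \<mu> S)"
    if h2: "h + 2 \<le> CARD('d)" and e: "e \<in> (tail_sphere h :: (real^'n) set)" for e
  proof -
    interpret low_rank \<mu> \<nu> \<pi>star h \<Sigma> OX OY by (rule low) (use h2 in simp)
    show ?thesis by (rule low_rank_map[OF h2 e], unfold eY_def) (intro exI conjI allI; assumption)
  qed
  show ?thesis
  proof (intro conjI impI ballI)
    show "\<exists>\<pi>. gw_optimal \<mu> \<nu> \<pi> \<and> is_m_map 2 \<mu> \<nu> \<pi> \<and> is_map_anti_map \<mu> \<nu> \<pi>" if "h = CARD('d)"
      using full[OF that] opt by blast
    show "\<exists>\<pi>. gw_optimal \<mu> \<nu> \<pi> \<and> is_m_map 2 \<mu> \<nu> \<pi>" if "h + 1 = CARD('d)"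
      using corank1[OF that] opt by blast
    have "h \<le> CARD('d)" unfolding h_def using rank_bound[of Mstar] by simp
    moreover have "\<exists>\<pi>. gw_optimal \<mu> \<nu> \<pi> \<and> is_m_map 2 \<mu> \<nu> \<pi>" if h2: "h + 2 \<le> CARD('d)"
    proof -
      \<comment> \<open>Since h < n, some coordinate axis lies in the tail and supplies a default
        value e, which turns the statement for all e into existence of a plan.\<close>
      obtain i :: 'n where i: "coord_no i = h" using coord_no_ex[where 'n='n, of h] h2 nd by auto
      have "(axis i 1 :: real^'n) \<in> tail_sphere h" using i by (auto simp: tail_sphere_def tail_space_def norm_axis_1) (auto simp: axis_def)
      from map[OF h2 this] show ?thesis by blast
    qed
    ultimately show "\<exists>\<pi>. gw_optimal \<mu> \<nu> \<pi> \<and> is_m_map 2 \<mu> \<nu> \<pi>"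
      using full corank1 opt by (cases "h = CARD('d)"; cases "h + 1 = CARD('d)") (blast, blast, blast, force)
  next
    fix e :: "real^'n" assume h2: "h + 2 \<le> CARD('d)" and e: "e \<in> tail_sphere h"
    obtain S :: "real^'n \<Rightarrow> real^'d" and f g where S: "S \<in> borel_measurable borel" "gw_optimal \<mu> \<nu> (graph_plan \<mu> S)"
      "c_convex (base_space h) (base_space h) (base_cost \<Sigma>) (\<lambda>b. ereal (f b))"
      "\<And>b. c_convex (tail_sphere h) (tail_sphere h) (\<lambda>x y. (sphere_dist x y)\<^sup>2 / 2) (\<lambda>x. ereal (g b x))"
      "AE x in distr \<mu> borel ((*v) OX).
         \<exists>p q. is_base_gradient h f (Phi_base h x) p \<and>
               is_sphere_gradient h (g (Phi_base h x)) (Phi_fibre h e x) q \<and>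
               Phi h e (OY *v coord_embed (S (transpose OX *v x))) =
                 (base_c_exp \<Sigma> (Phi_base h x) p, sphere_exp (Phi_fibre h e x) q)"
      using map[OF h2 e] by blast
    have T: "coord_embed \<circ> S = (*v) (transpose OY) \<circ> (\<lambda>x. OY *v coord_embed (S (transpose OX *v x))) \<circ> (*v) OX"
      unfolding o_def orthogonal_matrix_cancel(1)[OF OX] orthogonal_matrix_cancel(1)[OF OY] ..
    show "\<exists>(S :: real^'n \<Rightarrow> real^'d) (T :: real^'n \<Rightarrow> real^'n)
            (OX :: real^'n^'n) (OY :: real^'n^'n) (T0 :: real^'n \<Rightarrow> real^'n)
            (f :: (real^'n) \<times> real \<Rightarrow> real) (g :: (real^'n) \<times> real \<Rightarrow> real^'n \<Rightarrow> real).
           S \<in> borel_measurable borel \<and>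
           gw_optimal \<mu> \<nu> (graph_plan \<mu> S) \<and>
           T = coord_embed \<circ> S \<and>
           orthogonal_matrix OX \<and> orthogonal_matrix OY \<and>
           T = (*v) (transpose OY) \<circ> T0 \<circ> (*v) OX \<and>
           c_convex (base_space h) (base_space h) (base_cost \<Sigma>) (\<lambda>b. ereal (f b)) \<and>
           (\<forall>b \<in> head_space h \<times> {0..}.
              c_convex (tail_sphere h) (tail_sphere h) (\<lambda>x y. (sphere_dist x y)\<^sup>2 / 2)
                (\<lambda>x. ereal (g b x))) \<and>
           (AE x in distr \<mu> borel ((*v) OX).
              \<exists>p q. is_base_gradient h f (Phi_base h x) p \<and>
                    is_sphere_gradient h (g (Phi_base h x)) (Phi_fibre h e x) q \<and>
                    Phi h e (T0 x) =
                      (base_c_exp \<Sigma> (Phi_base h x) p, sphere_exp (Phi_fibre h e x) q))"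
      by (intro exI[of _ S] exI[of _ "coord_embed \<circ> S"] exI[of _ OX] exI[of _ OY]
        exI[of _ "\<lambda>x. OY *v coord_embed (S (transpose OX *v x))"] exI[of _ f] exI[of _ g] conjI ballI S OX OY T refl)
  qed
qed

end
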